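(* Let $n\ge2$ and let $\Omega\subset\mathbb R^n$ be an admissible domain with $\partial\Omega=\mathcal F\cup\mathcal B$ which is a subset of the infinite cylinder $\mathcal F\times(-\infty,0]$. Let $\eta_1\le\eta_2\le\cdots$ be the mixed Steklov--Dirichlet eigenvalues of $\Omega$. Then for every integer $k\ge1$ $$\frac1k\sum_{j=1}^k\eta_j\ \ge\ \frac{n-1}{n}W_{n,k}=2\pi\left(\frac{n-1}{n}\right)\omega_{n-1}^{-\frac1{n-1}}\left(\frac{k}{|\mathcal F|}\right)^{\frac{1}{n-1}}.$$
   Context: Admissible domain in $\mathbb R^n$: a bounded domain $\Omega\subset\mathbb R^n$ with Lipschitz, piecewise smooth boundary $\partial\Omega=\mathcal F\cup\mathcal B$, $\mathcal F\subset\{x_n=0\}$, $\mathcal B\subset\{x_n<0\}$, where $\mathcal F$ has positive $(n-1)$-dimensional measure $|\mathcal F|$. $\mathcal F$ is identified with a subset of $\mathbb R^{n-1}$. Steklov--Dirichlet eigenvalues of $\Omega$: the numbers $0<\eta_1\le\eta_2\le\cdots\nearrow\infty$ (counted with multiplicity) for which $\Delta f=0$ in $\Omega$, $f=0$ on $\mathcal B$, $\partial f/\partial x_n=\eta f$ on $\mathcal F$ has a nontrivial (weak) solution; equivalently, the eigenvalues given by min-max for $\int_\Omega|\nabla f|^2dx/\int_{\mathcal F}|f|^2ds$ over $f\in H^1(\Omega)$ with $f=0$ on $\mathcal B$. $\omega_{n-1}=\pi^{\frac{n-1}2}/\Gamma(\frac{n+1}{2})$ is the volume of the unit ball in $\mathbb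 R^{n-1}$, and $W_{n,k}:=2\pi\,\omega_{n-1}^{-\frac{1}{n-1}}\left(k/|\mathcal F|\right)^{\frac1{n-1}}$. *)

theory Defs
  imports "HOL-Analysis.Analysis"
begin

section \<open>Hausdorff measure\<close>


text \<open>
  The normalisation makes the m-dimensional Hausdorff measure agree with Lebesgue measure on
  m-dimensional subspaces.  Only m \<open>\<ge>\<close> 1 is meaningful: for m = 0 empty covering sets would be
  counted.  Boundedness has to be required since the diameter of an unbounded set is a junk value.
\<close>

definition hausdorff_content :: "nat \<Rightarrow> real \<Rightarrow> 'a::metric_space set \<Rightarrow> ennreal" where
  "hausdorff_content m \<delta> A =
     (INF C \<in> {C :: nat \<Rightarrow> 'a set. A \<subseteq> (\<Union>i. C i) \<and> (\<forall>i. bounded (C i) \<and> diameter (C i) \<le> \<delta>)}.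
        \<Sum>i. ennreal (unit_ball_vol (real m) * (diameter (C i) / 2) ^ m))"

definition hausdorff_outer_measure :: "nat \<Rightarrow> 'a::metric_space set \<Rightarrow> ennreal" where
  "hausdorff_outer_measure m A = (SUP \<delta>\<in>{0<..}. hausdorff_content m \<delta> A)"

definition hausdorff_measure :: "nat \<Rightarrow> 'a::metric_space measure" where
  "hausdorff_measure m = measure_of UNIV (sets borel) (hausdorff_outer_measure m)"

text \<open>
  The total function \<open>measure_of\<close> returns the zero measure unless it is given a
  countably additive set function.  The following lemmas, ending in
  \<open>emeasure_hausdorff_measure\<close>, show that this does not happen here.
\<close>

lemma metric_outer_tail:
  fixes f :: "'a::metric_space set \<Rightarrow> ennreal"
  assumes f: "outer_measure_space UNIV f"
    and sep: "\<And>A B d. d > 0 \<Longrightarrow> (\<And>x y. x \<in> A \<Longrightarrow> y \<in> B \<Longrightarrow> d \<le> dist x y) \<Longrightarrow> f A + f B \<le> f (A \<union> B)"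
    and C: "closed C"
  shows "f (X \<inter> C) + f (X - C) \<le> f X"
proof (cases "C = {} \<or> f X = \<infinity>")
  case True
  have "f {} = 0" using f by (auto simp: outer_measure_space_def positive_def)
  with True show ?thesis by auto
next
  case False
  then have ne: "C \<noteq> {}" and fin: "f X < \<infinity>" by (auto simp: less_top)
  have mono: "A \<subseteq> B \<Longrightarrow> f A \<le> f B" for A B
    using f by (auto simp: outer_measure_space_def increasing_def)
  have f0: "f {} = 0" using f by (auto simp: outer_measure_space_def positive_def)
  have csa: "f (\<Union>i. A i) \<le> (\<Sum>i. f (A i))" if "disjoint_family A" for A :: "nat \<Rightarrow> 'a set"
    using f that by (auto simp: outer_measure_space_def countably_subadditive_def)
  define r where "r k = inverse (real (Suc k))" for k
  have rpos: "r k > 0" for k by (simp add: r_def)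
  have rdec: "k < l \<Longrightarrow> r l < r k" for k l by (simp add: r_def)
  define S where "S k = {x \<in> X. infdist x C \<ge> r k}" for k
  define R where "R k = {x \<in> X. r (Suc k) \<le> infdist x C \<and> infdist x C < r k}" for k
  have step: "f (X \<inter> C) + f (S k) \<le> f X" for k
  proof -
    have "f (X \<inter> C) + f (S k) \<le> f ((X \<inter> C) \<union> S k)"
    proof (rule sep[of "r k"])
      fix x y assume "x \<in> X \<inter> C" "y \<in> S k"
      then have "r k \<le> infdist y C" "infdist y C \<le> dist y x" by (auto simp: S_def infdist_le)
      then show "r k \<le> dist x y" by (simp add: dist_commute)
    qed (rule rpos)
    also have "\<dots> \<le> f X" by (rule mono) (auto simp: S_def)
    finally show ?thesis .
  qed
  have Rsep: "r (Suc k) - r l \<le> dist x y" if "x \<in> R k" "y \<in> R l" for x y k l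
  proof -
    have "infdist x C \<le> infdist y C + dist x y" by (rule infdist_triangle)
    then show ?thesis using that by (auto simp: R_def)
  qed
  have sums: "(\<Sum>j<N. f (R (2 * j + p))) \<le> f X" for N p
  proof -
    have "(\<Sum>j<N. f (R (2 * j + p))) \<le> f (\<Union>j<N. R (2 * j + p))"
    proof (induction N)
      case (Suc N)
      have "(\<Sum>j<Suc N. f (R (2 * j + p))) \<le> f (\<Union>j<N. R (2 * j + p)) + f (R (2 * N + p))"
        using Suc by (simp add: add_right_mono)
      also have "\<dots> \<le> f ((\<Union>j<N. R (2 * j + p)) \<union> R (2 * N + p))"
      proof (cases N)
        case 0 then show ?thesis by (simp add: f0)
      next
        case (Suc N')
        show ?thesis
        proof (rule sep[of "r (2 * N + p - 1) - r (2 * N + p)"])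
          fix x y assume "x \<in> (\<Union>j<N. R (2 * j + p))" and y: "y \<in> R (2 * N + p)"
          then obtain j where j: "j < N" "x \<in> R (2 * j + p)" by auto
          have "r (2 * N + p - 1) \<le> r (Suc (2 * j + p))"
          proof (cases "Suc (2 * j + p) = 2 * N + p - 1")
            case False
            then have "Suc (2 * j + p) < 2 * N + p - 1" using j(1) by linarith
            then show ?thesis using rdec by (simp add: order_less_imp_le)
          qed simp
          with Rsep[OF j(2) y] show "r (2 * N + p - 1) - r (2 * N + p) \<le> dist x y" by simp
        qed (use rdec[of "2 * N + p - 1" "2 * N + p"] Suc in auto)
      qed
      also have "(\<Union>j<N. R (2 * j + p)) \<union> R (2 * N + p) = (\<Union>j<Suc N. R (2 * j + p))"
        by (auto simp: less_Suc_eq)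
      finally show ?case .
    qed (simp add: f0)
    also have "\<dots> \<le> f X" by (rule mono) (auto simp: R_def)
    finally show ?thesis .
  qed
  have "(\<Sum>k<N. f (R k)) \<le> f X + f X" for N
  proof -
    have "(\<Sum>k<N. f (R k)) \<le> (\<Sum>k<2 * N. f (R k))"
      by (rule sum_mono2) auto
    also have "\<dots> = (\<Sum>j<N. f (R (2 * j + 0))) + (\<Sum>j<N. f (R (2 * j + 1)))"
      by (induction N) (auto simp: algebra_simps)
    also have "\<dots> \<le> f X + f X" by (intro add_mono sums)
    finally show ?thesis .
  qed
  then have total: "(\<Sum>k. f (R k)) \<le> f X + f X" by (intro suminf_le_const) auto
  with fin have total_fin: "(\<Sum>k. f (R k)) \<noteq> \<infinity>"
    by (metis ennreal_add_eq_top infinity_ennreal_def leD order_le_less top.not_eq_extremum)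
  have decomp: "f (X - C) \<le> f (S n) + (\<Sum>k. f (R (k + n)))" for n
  proof -
    define A where "A k = (case k of 0 \<Rightarrow> S n | Suc k \<Rightarrow> R (k + n))" for k
    have disjR: "R k \<inter> R l = {}" if "k < l" for k l
    proof -
      have "r l \<le> r (Suc k)" using rdec[of "Suc k" l] that by (cases "Suc k = l") auto
      then show ?thesis by (auto simp: R_def)
    qed
    have disjS: "S n \<inter> R (k + n) = {}" for k
    proof -
      have "r (k + n) \<le> r n" using rdec[of n "k + n"] by (cases "k = 0") auto
      then show ?thesis by (auto simp: R_def S_def)
    qed
    have "disjoint_family A"
      unfolding disjoint_family_on_def
    proof (intro ballI impI)
      fix i j :: nat assume "i \<noteq> j"
      then show "A i \<inter> A j = {}"
      proof (induction i j rule: linorder_wlog)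
        case (le i j)
        then show ?case using disjR disjS
          by (auto simp: A_def split: nat.splits)
      qed (auto simp: Int_commute)
    qed
    have "X - C \<subseteq> (\<Union>k. A k)"
    proof
      fix x assume x: "x \<in> X - C"
      then have "infdist x C > 0"
        using C ne by (metis DiffE in_closed_iff_infdist_zero infdist_nonneg order_le_less)
      then obtain m where "r m < infdist x C" unfolding r_def using reals_Archimedean by blast
      then have ex: "r m \<le> infdist x C" by simp
      define l where "l = (LEAST m. r m \<le> infdist x C)"
      have l: "r l \<le> infdist x C" unfolding l_def by (rule LeastI) (rule ex)
      show "x \<in> (\<Union>k. A k)"
      proof (cases "l \<le> n")
        case True
        then have "r n \<le> r l" using rdec[of l n] by (cases "l = n") auto
        with l x have "x \<in> A 0" by (auto simp: A_def S_def)
        then show ?thesis by blast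
      next
        case False
        then obtain k where k: "l = Suc (k + n)" by (metis add.commute less_iff_Suc_add not_le)
        have "\<not> r (k + n) \<le> infdist x C"
          using not_less_Least[of "k + n" "\<lambda>m. r m \<le> infdist x C"] k l_def by simp
        with l k x have "x \<in> A (Suc k)" by (auto simp: A_def R_def)
        then show ?thesis by blast
      qed
    qed
    then have "f (X - C) \<le> (\<Sum>k. f (A k))"
      using mono csa[OF \<open>disjoint_family A\<close>] order_trans by blast
    also have "\<dots> = (\<Sum>k. f (A (Suc k))) + f (A 0)"
      using suminf_offset[of "\<lambda>k. f (A k)" 1] by (simp add: add.commute)
    finally show ?thesis by (simp add: A_def add.commute)
  qed
  have "(\<lambda>n. \<Sum>k. f (R (k + n))) \<longlonglongrightarrow> 0"
  proof -
    define a where "a k = enn2real (f (R k))" for k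
    have Rfin: "f (R k) \<noteq> top" for k
      using ennreal_suminf_neq_top total_fin  by (metis ennreal_suminf_lessD infinity_ennreal_def top.not_eq_extremum)
    have fa: "f (R k) = ennreal (a k)" for k
      using Rfin by (simp add: a_def top.not_eq_extremum)
    have a0: "a k \<ge> 0" for k by (simp add: a_def)
    have sm: "summable a"
      using total_fin a0 by (intro summable_suminf_not_top) (auto simp: fa)
    have "(\<lambda>n. ennreal (\<Sum>k. a (k + n))) \<longlonglongrightarrow> ennreal 0"
      using suminf_exist_split2[OF sm] by (intro tendsto_ennrealI)
    moreover have "ennreal (\<Sum>k. a (k + n)) = (\<Sum>k. f (R (k + n)))" for n
      unfolding fa by (rule suminf_ennreal2[symmetric]) (auto simp: a0 sm summable_iff_shift)
    ultimately show ?thesis by simp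
  qed
  then have lim: "(\<lambda>n. f X + (\<Sum>k. f (R (k + n)))) \<longlonglongrightarrow> f X + 0"
    by (intro tendsto_add) auto
  have "f (X \<inter> C) + f (X - C) \<le> f X + (\<Sum>k. f (R (k + n)))" for n
  proof -
    have "f (X \<inter> C) + f (X - C) \<le> f (X \<inter> C) + (f (S n) + (\<Sum>k. f (R (k + n))))"
      by (intro add_left_mono decomp)
    also have "\<dots> = (f (X \<inter> C) + f (S n)) + (\<Sum>k. f (R (k + n)))" by (simp add: add.assoc)
    also have "\<dots> \<le> f X + (\<Sum>k. f (R (k + n)))" by (intro add_right_mono step)
    finally show ?thesis .
  qed
  then show ?thesis using LIMSEQ_le_const[OF lim] by auto
qed

lemma metric_outer_measure_space:
  fixes f :: "'a::metric_space set \<Rightarrow> ennreal"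
  assumes f: "outer_measure_space UNIV f"
    and sep: "\<And>A B d. d > 0 \<Longrightarrow> (\<And>x y. x \<in> A \<Longrightarrow> y \<in> B \<Longrightarrow> d \<le> dist x y) \<Longrightarrow> f A + f B \<le> f (A \<union> B)"
  shows "measure_space UNIV (sets borel) f"
proof -
  interpret sigma_algebra "UNIV :: 'a set" UNIV by (simp add: sigma_algebra_iff2)
  have ms: "measure_space UNIV (lambda_system UNIV UNIV f) f"
    by (rule caratheodory_lemma[OF f])
  then have sa: "sigma_algebra UNIV (lambda_system UNIV UNIV f)"
    by (simp add: measure_space_def)
  have sub: "f X \<le> f (X \<inter> C) + f (X - C)" for X C
  proof -
    have "subadditive UNIV f"
      using f by (intro countably_subadditive_subadditive) (auto simp: outer_measure_space_def)
    then have "f ((X \<inter> C) \<union> (X - C)) \<le> f (X \<inter> C) + f (X - C)"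
      by (rule subadditiveD) auto
    then show ?thesis by (simp add: Int_Diff_Un)
  qed
  have "C \<in> lambda_system UNIV UNIV f" if "closed C" for C
    using metric_outer_tail[OF f sep that] sub by (auto simp: lambda_system_eq intro: antisym)
  then have "sets borel \<subseteq> lambda_system UNIV UNIV f"
    unfolding borel_eq_closed
    using sigma_algebra.sigma_sets_subset[OF sa, of "Collect closed"] by (auto simp: subset_iff)
  then show ?thesis
    using measure_down[OF ms] sets.sigma_algebra_axioms[of borel] by simp
qed


lemma hausdorff_content_mono: "A \<subseteq> B \<Longrightarrow> hausdorff_content m \<delta> A \<le> hausdorff_content m \<delta> B"
  unfolding hausdorff_content_def by (rule INF_superset_mono) auto

lemma hausdorff_content_antimono: "\<delta> \<le> \<epsilon> \<Longrightarrow> hausdorff_content m \<epsilon> A \<le> hausdorff_content m \<delta> A"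
  unfolding hausdorff_content_def by (rule INF_superset_mono) (auto intro: order_trans)

lemma hausdorff_content_empty:
  assumes "m \<ge> 1" "\<delta> > 0"
  shows "hausdorff_content m \<delta> {} = 0"
proof -
  have "hausdorff_content m \<delta> {} \<le> (\<Sum>i::nat. ennreal (unit_ball_vol (real m) * (diameter ({} :: 'a set) / 2) ^ m))"
    unfolding hausdorff_content_def using assms by (intro INF_lower2[of "\<lambda>_. {}"]) auto
  then show ?thesis using assms by (simp add: power_0_left)
qed

lemma hausdorff_content_countably_subadditive:
  "hausdorff_content m \<delta> (\<Union>i. A i) \<le> (\<Sum>i. hausdorff_content m \<delta> (A i))"
proof -
  define h where "h C = ennreal (unit_ball_vol (real m) * (diameter C / 2) ^ m)" for C :: "'a set"
  define K where "K X = {C :: nat \<Rightarrow> 'a set. X \<subseteq> (\<Union>i. C i) \<and> (\<forall>i. bounded (C i) \<and> diameter (C i) \<le> \<delta>)}" for X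
  have c: "hausdorff_content m \<delta> X = (INF C\<in>K X. \<Sum>i. h (C i))" for X
    by (simp add: hausdorff_content_def h_def K_def)
  show ?thesis
  proof (rule ennreal_le_epsilon)
    fix e :: real assume e: "0 < e" and fin: "(\<Sum>i. hausdorff_content m \<delta> (A i)) < top"
    then have *: "hausdorff_content m \<delta> (A i) < hausdorff_content m \<delta> (A i) + e * (1/2) ^ Suc i" for i
      by (auto simp add: less_top dest!: ennreal_suminf_lessD)
    have "\<exists>C\<in>K (A i). (\<Sum>j. h (C j)) \<le> hausdorff_content m \<delta> (A i) + e * (1/2) ^ Suc i" for i
      using *[of i] less_imp_le unfolding c INF_less_iff by blast
    then obtain C where C: "\<And>i. C i \<in> K (A i)"
      "\<And>i. (\<Sum>j. h (C i j)) \<le> hausdorff_content m \<delta> (A i) + e * (1/2) ^ Suc i"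
      by metis
    define D where "D = case_prod C \<circ> prod_decode"
    have Dmem: "D \<in> K (\<Union>i. A i)"
    proof -
      have "(\<Union>i. A i) \<subseteq> (\<Union>n. D n)"
      proof
        fix x assume "x \<in> (\<Union>i. A i)"
        then obtain i j where "x \<in> C i j" using C(1) by (fastforce simp: K_def)
        then have "x \<in> D (prod_encode (i, j))" by (simp add: D_def)
        then show "x \<in> (\<Union>n. D n)" by blast
      qed
      then show ?thesis using C(1) by (auto simp: K_def D_def split: prod.splits)
    qed
    have "hausdorff_content m \<delta> (\<Union>i. A i) \<le> (\<Sum>n. h (D n))"
      unfolding c using Dmem by (rule INF_lower)
    also have "\<dots> = (\<Sum>i. \<Sum>j. h (C i j))"
      using suminf_ennreal_2dimen[of "\<lambda>i. \<Sum>j. h (C i j)" "\<lambda>p. h (C (fst p) (snd p))"]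
      by (simp add: D_def o_def case_prod_beta)
    also have "\<dots> \<le> (\<Sum>i. hausdorff_content m \<delta> (A i) + ennreal (e * (1/2) ^ Suc i))"
      by (intro suminf_le C) auto
    also have "\<dots> = (\<Sum>i. hausdorff_content m \<delta> (A i)) + (\<Sum>i. ennreal (e * (1/2) ^ Suc i))"
      by (rule suminf_add[symmetric]) auto
    also have "(\<Sum>i. ennreal (e * (1/2) ^ Suc i)) = ennreal e"
      using e power_half_series sums_mult[OF power_half_series, of e]
      by (subst suminf_ennreal_eq[of _ e]) auto
    finally show "hausdorff_content m \<delta> (\<Union>i. A i) \<le> (\<Sum>i. hausdorff_content m \<delta> (A i)) + ennreal e" .
  qed
qed

lemma hausdorff_content_separated:
  assumes m: "m \<ge> 1" and \<delta>: "\<delta> < d"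
    and sep: "\<And>x y. x \<in> A \<Longrightarrow> y \<in> B \<Longrightarrow> d \<le> dist x y"
  shows "hausdorff_content m \<delta> A + hausdorff_content m \<delta> B \<le> hausdorff_content m \<delta> (A \<union> B)"
proof -
  define h where "h C = ennreal (unit_ball_vol (real m) * (diameter C / 2) ^ m)" for C :: "'a set"
  define K where "K X = {C :: nat \<Rightarrow> 'a set. X \<subseteq> (\<Union>i. C i) \<and> (\<forall>i. bounded (C i) \<and> diameter (C i) \<le> \<delta>)}" for X
  have c: "hausdorff_content m \<delta> X = (INF C\<in>K X. \<Sum>i. h (C i))" for X
    by (simp add: hausdorff_content_def h_def K_def)
  have h0: "h {} = 0" using m by (simp add: h_def power_0_left)
  have "hausdorff_content m \<delta> A + hausdorff_content m \<delta> B \<le> (\<Sum>i. h (C i))" if C: "C \<in> K (A \<union> B)" for C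
  proof -
    define P where "P X i = (if C i \<inter> X = {} then {} else C i)" for X i
    have d0: "0 \<le> \<delta>" using C diameter_ge_0[of "C 0"] by (auto simp: K_def intro: order_trans)
    have P: "P X \<in> K X" if "X \<subseteq> A \<union> B" for X
      using C that d0 by (fastforce simp: K_def P_def)
    have "h (P A i) + h (P B i) \<le> h (C i)" for i
    proof (cases "C i \<inter> A = {} \<or> C i \<inter> B = {}")
      case False
      then obtain x y where xy: "x \<in> C i" "x \<in> A" "y \<in> C i" "y \<in> B" by blast
      have "dist x y \<le> diameter (C i)"
        using C xy by (intro diameter_bounded_bound) (auto simp: K_def)
      moreover have "diameter (C i) \<le> \<delta>" using C by (auto simp: K_def)
      ultimately show ?thesis using sep[OF xy(2,4)] \<delta> by linarith
    qed (auto simp: P_def h0)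
    then have "(\<Sum>i. h (P A i)) + (\<Sum>i. h (P B i)) \<le> (\<Sum>i. h (C i))"
      by (subst suminf_add) (auto intro!: suminf_le)
    moreover have "hausdorff_content m \<delta> A \<le> (\<Sum>i. h (P A i))" "hausdorff_content m \<delta> B \<le> (\<Sum>i. h (P B i))"
      unfolding c by (auto intro!: INF_lower P)
    ultimately show ?thesis by (meson add_mono order_trans)
  qed
  then show ?thesis unfolding c[of "A \<union> B"] by (rule INF_greatest)
qed

lemma measure_space_hausdorff_outer_measure:
  assumes m: "m \<ge> 1"
  shows "measure_space UNIV (sets borel) (hausdorff_outer_measure m :: 'a::metric_space set \<Rightarrow> ennreal)"
proof (rule metric_outer_measure_space)
  have le: "hausdorff_content m \<delta> A \<le> hausdorff_outer_measure m A" if "\<delta> > 0" for \<delta> and A :: "'a set"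
    unfolding hausdorff_outer_measure_def using that by (intro SUP_upper) auto
  have "hausdorff_outer_measure m (\<Union>i. A i) \<le> (\<Sum>i. hausdorff_outer_measure m (A i))" for A :: "nat \<Rightarrow> 'a set"
    unfolding hausdorff_outer_measure_def[of m "\<Union>i. A i"]
  proof (rule SUP_least)
    fix \<delta> :: real assume "\<delta> \<in> {0<..}"
    then have "(\<Sum>i. hausdorff_content m \<delta> (A i)) \<le> (\<Sum>i. hausdorff_outer_measure m (A i))"
      by (intro suminf_le le) auto
    with hausdorff_content_countably_subadditive[of m \<delta> A]
    show "hausdorff_content m \<delta> (\<Union>i. A i) \<le> (\<Sum>i. hausdorff_outer_measure m (A i))" by simp
  qed
  moreover have "hausdorff_outer_measure m ({} :: 'a set) = 0"
    unfolding hausdorff_outer_measure_def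
    by (rule antisym) (auto intro!: SUP_least simp: hausdorff_content_empty[OF m])
  moreover have "hausdorff_outer_measure m A \<le> hausdorff_outer_measure m B" if "A \<subseteq> B" for A B :: "'a set"
    unfolding hausdorff_outer_measure_def using that by (intro SUP_mono) (auto intro: hausdorff_content_mono)
  ultimately show "outer_measure_space UNIV (hausdorff_outer_measure m :: 'a set \<Rightarrow> ennreal)"
    by (auto simp: outer_measure_space_def positive_def increasing_def countably_subadditive_def)
  fix A B :: "'a set" and d :: real
  assume d: "d > 0" and sep: "\<And>x y. x \<in> A \<Longrightarrow> y \<in> B \<Longrightarrow> d \<le> dist x y"
  have key: "hausdorff_content m \<delta> A + hausdorff_content m \<epsilon> B \<le> hausdorff_outer_measure m (A \<union> B)"
    if "\<delta> > 0" "\<epsilon> > 0" for \<delta> \<epsilon>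
  proof -
    define \<rho> where "\<rho> = min (min \<delta> \<epsilon>) (d / 2)"
    have "hausdorff_content m \<delta> A + hausdorff_content m \<epsilon> B \<le> hausdorff_content m \<rho> A + hausdorff_content m \<rho> B"
      by (intro add_mono hausdorff_content_antimono) (auto simp: \<rho>_def)
    also have "\<dots> \<le> hausdorff_content m \<rho> (A \<union> B)"
      using d by (intro hausdorff_content_separated[OF m _ sep]) (auto simp: \<rho>_def)
    also have "\<dots> \<le> hausdorff_outer_measure m (A \<union> B)"
      using that d by (intro le) (auto simp: \<rho>_def)
    finally show ?thesis .
  qed
  have "hausdorff_content m \<delta> A + hausdorff_outer_measure m B \<le> hausdorff_outer_measure m (A \<union> B)" if "\<delta> > 0" for \<delta>
    unfolding hausdorff_outer_measure_def[of m B]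
    by (subst ennreal_SUP_add_right) (auto intro!: SUP_least key that)
  then show "hausdorff_outer_measure m A + hausdorff_outer_measure m B \<le> hausdorff_outer_measure m (A \<union> B)"
    unfolding hausdorff_outer_measure_def[of m A]
    by (subst ennreal_SUP_add_left[symmetric]) (auto intro!: SUP_least)
qed

lemma space_hausdorff_measure [simp]: "space (hausdorff_measure m) = UNIV"
  by (simp add: hausdorff_measure_def space_measure_of_conv)

lemma sets_hausdorff_measure [simp, measurable_cong]: "sets (hausdorff_measure m) = sets borel"
  by (metis hausdorff_measure_def sets.sets_measure_of_eq space_borel)

lemma emeasure_hausdorff_measure:
  assumes "m \<ge> 1" "A \<in> sets borel"
  shows "emeasure (hausdorff_measure m) A = hausdorff_outer_measure m A"
proof -
  have "positive (sets borel) (hausdorff_outer_measure m :: 'a set \<Rightarrow> ennreal)"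
    "countably_additive (sets borel) (hausdorff_outer_measure m :: 'a set \<Rightarrow> ennreal)"
    using measure_space_hausdorff_outer_measure[OF assms(1), where 'a = 'a] by (auto simp: measure_space_def)
  moreover have "sigma_algebra UNIV (sets (borel :: 'a measure))"
    using sets.sigma_algebra_axioms[of "borel :: 'a measure"] by simp
  ultimately show ?thesis
    unfolding hausdorff_measure_def by (intro emeasure_measure_of_sigma assms(2))
qed


section \<open>Regularity of sets and functions\<close>

primrec Ck_on :: "nat \<Rightarrow> 'a::euclidean_space set \<Rightarrow> ('a \<Rightarrow> real) \<Rightarrow> bool" where
  "Ck_on 0 S f \<longleftrightarrow> continuous_on S f"
| "Ck_on (Suc k) S f \<longleftrightarrow>
     (\<forall>x\<in>S. f differentiable (at x)) \<and>
     (\<forall>b\<in>Basis. Ck_on k S (\<lambda>x. frechet_derivative f (at x) b))"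

definition smooth_on :: "'a::euclidean_space set \<Rightarrow> ('a \<Rightarrow> real) \<Rightarrow> bool" where
  "smooth_on S f \<longleftrightarrow> (\<forall>k. Ck_on k S f)"

definition gradient :: "('a::euclidean_space \<Rightarrow> real) \<Rightarrow> 'a \<Rightarrow> 'a" where
  "gradient f x = (\<Sum>b\<in>Basis. frechet_derivative f (at x) b *\<^sub>R b)"

text \<open>
  Locally, after a rotation taking the unit vector e to the last coordinate vector, the set is the
  part of a neighbourhood U lying strictly above the graph of a Lipschitz function \<open>\<gamma>\<close>.
\<close>

definition lipschitz_boundary :: "'a::euclidean_space set \<Rightarrow> bool" where
  "lipschitz_boundary \<Omega> \<longleftrightarrow>
     (\<forall>p\<in>frontier \<Omega>. \<exists>e \<gamma> L U.
        norm e = 1 \<and> lipschitz_on L {y. y \<bullet> e = 0} \<gamma> \<and> open U \<and> p \<in> U \<and>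
        \<Omega> \<inter> U = {x \<in> U. \<gamma> (x - (x \<bullet> e) *\<^sub>R e) < x \<bullet> e})"

definition smooth_hypersurface :: "'a::euclidean_space set \<Rightarrow> bool" where
  "smooth_hypersurface M \<longleftrightarrow>
     (\<forall>p\<in>M. \<exists>U g. open U \<and> p \<in> U \<and> smooth_on U g \<and> (\<forall>x\<in>U. gradient g x \<noteq> 0) \<and>
        M \<inter> U = {x \<in> U. g x = 0})"

text \<open>
  Up to a set of surface measure zero (edges, vertices, conical points), S is the union of finitely
  many disjoint, connected, relatively open smooth hypersurfaces.
\<close>

definition piecewise_smooth_surface :: "'a::euclidean_space set \<Rightarrow> bool" where
  "piecewise_smooth_surface S \<longleftrightarrow>
     (\<exists>\<P>. finite \<P> \<and> disjoint \<P> \<and>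
        (\<forall>\<Gamma>\<in>\<P>. openin (top_of_set S) \<Gamma> \<and> connected \<Gamma> \<and> smooth_hypersurface \<Gamma>) \<and>
        S - \<Union>\<P> \<in> null_sets (hausdorff_measure (DIM('a) - 1)))"


section \<open>Admissible domains\<close>

text \<open>
  \<open>\<real>\<^sup>n\<close> is represented as \<open>'a \<times> real\<close>, with \<open>'a\<close> in the role of \<open>\<real>\<^sup>n\<^sup>-\<^sup>1\<close>, so that \<open>snd x\<close> is the last
  coordinate of x and \<open>n \<ge> 2\<close> holds automatically.  The set \<open>flat F\<close> is F viewed as a subset
  of \<open>\<real>\<^sup>n\<^sup>-\<^sup>1\<close>.
\<close>

definition flat :: "('a \<times> real) set \<Rightarrow> 'a set" where
  "flat F = {x. (x, 0) \<in> F}"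

definition admissible_domain ::
    "('a::euclidean_space \<times> real) set \<Rightarrow> ('a \<times> real) set \<Rightarrow> ('a \<times> real) set \<Rightarrow> bool" where
  "admissible_domain \<Omega> F B \<longleftrightarrow>
     \<Omega> \<noteq> {} \<and> open \<Omega> \<and> connected \<Omega> \<and> bounded \<Omega> \<and>
     lipschitz_boundary \<Omega> \<and> piecewise_smooth_surface (frontier \<Omega>) \<and>
     frontier \<Omega> = F \<union> B \<and> F \<subseteq> {x. snd x = 0} \<and> B \<subseteq> {x. snd x < 0} \<and>
     measure lebesgue (flat F) > 0"


section \<open>Sobolev space and traces\<close>

definition square_integrable :: "'a measure \<Rightarrow> ('a \<Rightarrow> 'b::euclidean_space) \<Rightarrow> bool" where
  "square_integrable M f \<longleftrightarrow> f \<in> borel_measurable M \<and> integrable M (\<lambda>x. (norm (f x))\<^sup>2)"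

definition L2_tendsto ::
    "'a measure \<Rightarrow> (nat \<Rightarrow> 'a \<Rightarrow> 'b::euclidean_space) \<Rightarrow> ('a \<Rightarrow> 'b) \<Rightarrow> bool" where
  "L2_tendsto M f g \<longleftrightarrow>
     (\<forall>j. square_integrable M (f j)) \<and> square_integrable M g \<and>
     (\<lambda>j. LINT x|M. (norm (f j x - g x))\<^sup>2) \<longlonglongrightarrow> 0"

definition test_function :: "'a::euclidean_space set \<Rightarrow> ('a \<Rightarrow> real) \<Rightarrow> bool" where
  "test_function \<Omega> \<phi> \<longleftrightarrow> smooth_on UNIV \<phi> \<and> (\<exists>K. compact K \<and> K \<subseteq> \<Omega> \<and> (\<forall>x. x \<notin> K \<longrightarrow> \<phi> x = 0))"

definition has_weak_gradient ::
    "'a::euclidean_space set \<Rightarrow> ('a \<Rightarrow> real) \<Rightarrow> ('a \<Rightarrow> 'a) \<Rightarrow> bool" where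
  "has_weak_gradient \<Omega> f G \<longleftrightarrow>
     square_integrable (lebesgue_on \<Omega>) G \<and>
     (\<forall>\<phi>. test_function \<Omega> \<phi> \<longrightarrow> (\<forall>b\<in>Basis.
        (LINT x|lebesgue_on \<Omega>. f x * frechet_derivative \<phi> (at x) b)
          = - (LINT x|lebesgue_on \<Omega>. (G x \<bullet> b) * \<phi> x)))"

text \<open>
  Functions are not identified when equal almost everywhere.  Weak gradients and traces are
  determined up to null sets only, and the choices made by SOME below are immaterial
  since they are used under integrals and AE quantifiers only.
\<close>

definition weak_gradient :: "'a::euclidean_space set \<Rightarrow> ('a \<Rightarrow> real) \<Rightarrow> 'a \<Rightarrow> 'a" where
  "weak_gradient \<Omega> f = (SOME G. has_weak_gradient \<Omega> f G)"

definition H1 :: "'a::euclidean_space set \<Rightarrow> ('a \<Rightarrow> real) set" where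
  "H1 \<Omega> = {f. square_integrable (lebesgue_on \<Omega>) f \<and> (\<exists>G. has_weak_gradient \<Omega> f G)}"

definition boundary_measure :: "'a::euclidean_space set \<Rightarrow> 'a measure" where
  "boundary_measure \<Omega> = restrict_space (hausdorff_measure (DIM('a) - 1)) (frontier \<Omega>)"

text \<open>
  The trace operator is the continuous extension of the restriction map \<open>\<phi> \<mapsto> \<phi>|\<partial>\<Omega>\<close> from functions
  smooth up to the boundary to H1; h is a trace of f if some sequence of smooth functions
  converges to f in H1 and to h in L2 of the boundary.
\<close>

definition has_trace ::
    "'a::euclidean_space set \<Rightarrow> ('a \<Rightarrow> real) \<Rightarrow> ('a \<Rightarrow> real) \<Rightarrow> bool" where
  "has_trace \<Omega> f h \<longleftrightarrow>
     (\<exists>\<phi> :: nat \<Rightarrow> 'a \<Rightarrow> real. (\<forall>j. smooth_on UNIV (\<phi> j)) \<and>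
        L2_tendsto (lebesgue_on \<Omega>) \<phi> f \<and>
        L2_tendsto (lebesgue_on \<Omega>) (\<lambda>j. gradient (\<phi> j)) (weak_gradient \<Omega> f) \<and>
        L2_tendsto (boundary_measure \<Omega>) \<phi> h)"

definition boundary_trace :: "'a::euclidean_space set \<Rightarrow> ('a \<Rightarrow> real) \<Rightarrow> 'a \<Rightarrow> real" where
  "boundary_trace \<Omega> f = (SOME h. has_trace \<Omega> f h)"

definition H1_vanishing :: "'a::euclidean_space set \<Rightarrow> 'a set \<Rightarrow> ('a \<Rightarrow> real) set" where
  "H1_vanishing \<Omega> B = {f \<in> H1 \<Omega>. AE x in boundary_measure \<Omega>. x \<in> B \<longrightarrow> boundary_trace \<Omega> f x = 0}"


section \<open>Steklov--Dirichlet eigenvalues\<close>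

text \<open>
  Weak solutions of \<open>\<Delta>f = 0\<close> in \<open>\<Omega>\<close>, \<open>f = 0\<close> on B, \<open>\<partial>f/\<partial>x\<^sub>n = \<mu> f\<close> on F, including the zero solution.
\<close>

definition steklov_dirichlet_eigenspace ::
    "('a::euclidean_space \<times> real) set \<Rightarrow> ('a \<times> real) set \<Rightarrow> ('a \<times> real) set \<Rightarrow> real
       \<Rightarrow> ('a \<times> real \<Rightarrow> real) set" where
  "steklov_dirichlet_eigenspace \<Omega> F B \<mu> =
     {f \<in> H1_vanishing \<Omega> B. \<forall>v \<in> H1_vanishing \<Omega> B.
        (LINT x|lebesgue_on \<Omega>. weak_gradient \<Omega> f x \<bullet> weak_gradient \<Omega> v x)
          = \<mu> * (LINT y|lebesgue_on (flat F). boundary_trace \<Omega> f (y, 0) * boundary_trace \<Omega> v (y, 0))}"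

text \<open>V has dimension m modulo equality almost everywhere: \<open>u 0, \<dots>, u (m - 1)\<close> is a basis.\<close>

definition has_dim_AE :: "'a measure \<Rightarrow> ('a \<Rightarrow> real) set \<Rightarrow> nat \<Rightarrow> bool" where
  "has_dim_AE M V m \<longleftrightarrow>
     (\<exists>u :: nat \<Rightarrow> 'a \<Rightarrow> real.
        (\<forall>i<m. u i \<in> V) \<and>
        (\<forall>c :: nat \<Rightarrow> real. (AE x in M. (\<Sum>i<m. c i * u i x) = 0) \<longrightarrow> (\<forall>i<m. c i = 0)) \<and>
        (\<forall>f\<in>V. \<exists>c :: nat \<Rightarrow> real. AE x in M. f x = (\<Sum>i<m. c i * u i x)))"

text \<open>
  The sequence \<open>\<eta> 1 \<le> \<eta> 2 \<le> \<dots>\<close> (the value \<open>\<eta> 0\<close> is not used) lists all the eigenvalues and nothing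
  else, each as often as its multiplicity.  Positivity and divergence to infinity are consequences.
\<close>

definition steklov_dirichlet_eigenvalues ::
    "('a::euclidean_space \<times> real) set \<Rightarrow> ('a \<times> real) set \<Rightarrow> ('a \<times> real) set
       \<Rightarrow> (nat \<Rightarrow> real) \<Rightarrow> bool" where
  "steklov_dirichlet_eigenvalues \<Omega> F B \<eta> \<longleftrightarrow>
     mono_on {1..} \<eta> \<and>
     (\<forall>\<mu>. finite {j. 1 \<le> j \<and> \<eta> j = \<mu>} \<and>
        has_dim_AE (lebesgue_on \<Omega>) (steklov_dirichlet_eigenspace \<Omega> F B \<mu>)
          (card {j. 1 \<le> j \<and> \<eta> j = \<mu>}))"

definition weyl_const :: "nat \<Rightarrow> real \<Rightarrow> nat \<Rightarrow> real" where
  "weyl_const n vol k = 2 * pi * unit_ball_vol (real n - 1) powr (- 1 / (real n - 1)) *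
     (real k / vol) powr (1 / (real n - 1))"

end

theory Submission
  imports Defs "HOL-Probability.Characteristic_Functions" "HOL-Real_Asymp.Real_Asymp"
begin

text \<open>
  Let \<open>H\<^sub>j\<close> be the Fourier transform of the boundary values on F of the j-th member of a system of
  eigenfunctions orthonormal in \<open>L\<^sup>2(F)\<close>, extended by zero to \<open>\<real>\<^bsup>n-1\<^esup>\<close>.  Testing Green's
  formula with the harmonic functions \<open>exp (i\<xi>\<cdot>x + |\<xi>|y)\<close> bounds \<open>|\<xi>||H\<^sub>j(\<xi>)|\<^sup>2\<close> by the integral over
  the depth y of the squared horizontal Fourier transform of the gradient; no boundary terms besides the
  one on F appear because \<open>\<Omega>\<close> lies below F.  With Plancherel, \<open>\<integral>|\<xi>||H\<^sub>j|\<^sup>2 \<le> (2\<pi>)\<^bsup>n-1\<^esup> \<eta>\<^sub>j\<close>.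
  Bessel's inequality gives \<open>\<Sum>|H\<^sub>j|\<^sup>2 \<le> |F|\<close> pointwise, and the total mass of this sum is
  \<open>(2\<pi>)\<^bsup>n-1\<^esup> k\<close>.  Under these two constraints the first moment is smallest for a multiple of the
  indicator of a ball, whence the bound.
\<close>

section \<open>Smooth functions\<close>

text \<open>On B the boundary is merely Lipschitz and no normal field is set up there. Green's
  formula is proved exactly on F, but on B only with an error bounded by a constant times the
  integral of |\<psi>| over B; it becomes exact in the limit because it is applied to products
  \<phi> w, with \<phi> approximating a function whose trace vanishes on B. On F the constant
  matters, and there the layer of depth s below F differs from \<Omega> by o(s) because translations
  act continuously on the indicator of \<open>flat F\<close>. Neither a min-max principle nor
  completeness of the eigenfunctions enters: the list of eigenvalues acts only through bases of
  single eigenspaces, and different eigenspaces are orthogonal by symmetry of the weak equation. The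
  power spectra are not known to be integrable beforehand, so they are damped by Gaussians; the
  upper bounds hold for every width, and the mass is recovered as the width grows. With d = n - 1,
  the ball with density |F| and mass \<open>(2 * pi) ^ d * k\<close> has radius W, and |\<xi>| has
  mean W d / (d + 1) on it; this is the factor (n - 1) / n.\<close>

lemma frechet_derivative_eqI: "(f has_derivative f') (at x) \<Longrightarrow> frechet_derivative f (at x) = f'"
  using frechet_derivative_at by metis

lemma Ck_on_SucI:
  assumes "\<And>x. (f has_derivative f' x) (at x)" "\<And>b. b \<in> Basis \<Longrightarrow> Ck_on k UNIV (\<lambda>x. f' x b)"
  shows "Ck_on (Suc k) UNIV f"
  using assms frechet_derivative_eqI[OF assms(1)] by (auto simp: differentiable_def)

lemma Ck_on_SucD1: "Ck_on (Suc k) UNIV f \<Longrightarrow> (f has_derivative frechet_derivative f (at x)) (at x)"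
  by (simp add: frechet_derivative_works[symmetric])

lemma Ck_on_Suc_imp: "Ck_on (Suc k) UNIV f \<Longrightarrow> Ck_on k UNIV f"
proof (induction k arbitrary: f)
  case 0
  then show ?case
    by (auto intro!: continuous_at_imp_continuous_on differentiable_imp_continuous_within)
next
  case (Suc k)
  from Suc.prems have "\<forall>b\<in>Basis. Ck_on k UNIV (\<lambda>x. frechet_derivative f (at x) b)"
    using Suc.IH by (subst (asm) Ck_on.simps) blast
  then show ?case using Suc.prems by (subst Ck_on.simps) auto
qed

lemma Ck_on_const: "Ck_on k UNIV (\<lambda>_. c)"
  by (induction k arbitrary: c) auto

lemma Ck_on_add: "Ck_on k UNIV f \<Longrightarrow> Ck_on k UNIV g \<Longrightarrow> Ck_on k UNIV (\<lambda>x. f x + g x)"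
proof (induction k arbitrary: f g)
  case (Suc k)
  show ?case
    by (rule Ck_on_SucI[OF has_derivative_add[OF Ck_on_SucD1[OF Suc.prems(1)] Ck_on_SucD1[OF Suc.prems(2)]]])
       (use Suc in auto)
qed (auto intro: continuous_intros)

lemma Ck_on_mult: "Ck_on k UNIV f \<Longrightarrow> Ck_on k UNIV g \<Longrightarrow> Ck_on k UNIV (\<lambda>x. f x * g x)"
proof (induction k arbitrary: f g)
  case (Suc k)
  show ?case
  proof (rule Ck_on_SucI[OF has_derivative_mult[OF Ck_on_SucD1[OF Suc.prems(1)] Ck_on_SucD1[OF Suc.prems(2)]]])
    fix b :: 'a assume "b \<in> Basis"
    then show "Ck_on k UNIV (\<lambda>x. f x * frechet_derivative g (at x) b + frechet_derivative f (at x) b * g x)"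
      using Suc.prems Ck_on_Suc_imp[OF Suc.prems(1)] Ck_on_Suc_imp[OF Suc.prems(2)]
      by (intro Ck_on_add Suc.IH) auto
  qed
qed (auto intro: continuous_intros)

lemma Ck_on_cmult: "Ck_on k UNIV f \<Longrightarrow> Ck_on k UNIV (\<lambda>x. c * f x)"
  by (intro Ck_on_mult Ck_on_const)

lemma Ck_on_diff: "Ck_on k UNIV f \<Longrightarrow> Ck_on k UNIV g \<Longrightarrow> Ck_on k UNIV (\<lambda>x. f x - g x)"
  using Ck_on_add[of k f "\<lambda>x. (- 1) * g x"] Ck_on_cmult[of k g "- 1"] by simp

lemma Ck_on_prod:
  "finite I \<Longrightarrow> (\<And>i. i \<in> I \<Longrightarrow> Ck_on k UNIV (f i)) \<Longrightarrow> Ck_on k UNIV (\<lambda>x. \<Prod>i\<in>I. f i x)"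
  by (induction I rule: finite_induct) (auto intro: Ck_on_mult Ck_on_const)

lemma frechet_derivative_real:
  "(g has_derivative frechet_derivative g (at (y::real))) (at y) \<Longrightarrow> frechet_derivative g (at y) h = h * (frechet_derivative g (at y) 1 :: real)"
  using linear_cmul[OF has_derivative_linear, of g "frechet_derivative g (at y)" "at y" h 1] by simp

text \<open>The derivative along b is the constant c (b \<bullet> i) times a function of the same
  shape with g replaced by g', so the induction on k closes when g is arbitrary.\<close>

lemma Ck_on_compose_affine:
  fixes g :: "real \<Rightarrow> real"
  shows "Ck_on k UNIV g \<Longrightarrow> Ck_on k UNIV (\<lambda>x::'a::euclidean_space. g (c * (x \<bullet> i) + a))"
proof (induction k arbitrary: g)
  case (Suc k)
  note g = Ck_on_SucD1[OF Suc.prems]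
  show ?case
  proof (rule Ck_on_SucI)
    fix x :: 'a
    have "((\<lambda>x. c * (x \<bullet> i) + a) has_derivative (\<lambda>h. c * (h \<bullet> i))) (at x)"
      by (auto intro!: derivative_eq_intros)
    from has_derivative_compose[OF this g]
    show "((\<lambda>x. g (c * (x \<bullet> i) + a)) has_derivative
        (\<lambda>h. c * (h \<bullet> i) * frechet_derivative g (at (c * (x \<bullet> i) + a)) 1)) (at x)"
      by (subst (asm) frechet_derivative_real[OF g]) simp
  next
    fix b :: 'a
    show "Ck_on k UNIV (\<lambda>x. c * (b \<bullet> i) * frechet_derivative g (at (c * (x \<bullet> i) + a)) 1)"
      by (rule Ck_on_cmult, rule Suc.IH) (use Suc.prems in auto)
  qed
next
  case 0
  then have "continuous_on UNIV g" by simp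
  from continuous_on_compose2[OF this, of UNIV "\<lambda>x. c * (x \<bullet> i) + a"]
  show ?case by (simp add: continuous_intros)
qed

lemma Ck_on_Suc_real:
  fixes g :: "real \<Rightarrow> real"
  assumes "\<And>t. (g has_real_derivative g' t) (at t)" "Ck_on k UNIV g'"
  shows "Ck_on (Suc k) UNIV g"
  by (rule Ck_on_SucI[OF assms(1)[unfolded has_field_derivative_def]]) (use assms(2) in simp)

section \<open>Smooth bumps on intervals and boxes\<close>

definition exp_bump :: "nat \<Rightarrow> real \<Rightarrow> real" where
  "exp_bump m t = (if t > 0 then exp (- 1 / t) / t ^ m else 0)"

lemma exp_bump_tendsto_0: "(exp_bump m \<longlongrightarrow> 0) (at 0)"
proof -
  have "((\<lambda>t. inverse t ^ m / exp (inverse t)) \<longlongrightarrow> 0) (at_right (0::real))"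
    by (rule filterlim_compose[OF tendsto_power_div_exp_0 filterlim_inverse_at_top_right])
  then have "(exp_bump m \<longlongrightarrow> 0) (at_right 0)"
    by (rule Lim_transform_eventually)
      (auto simp: eventually_at_right_field exp_bump_def field_simps exp_minus intro!: exI[of _ 1])
  moreover have "(exp_bump m \<longlongrightarrow> 0) (at_left 0)"
    by (rule Lim_transform_eventually[of "\<lambda>_. 0"])
      (auto simp: eventually_at_left_field exp_bump_def intro!: exI[of _ "-1"])
  ultimately show ?thesis by (simp add: filterlim_split_at)
qed

text \<open>Derivatives of members of the family are linear combinations of members, which is why
  the power t^m is carried along: \<open>Ck_on_exp_bump\<close> can then induct on k for all m at
  once.\<close>

lemma exp_bump_deriv: "(exp_bump m has_real_derivative (exp_bump (m + 2) t - m * exp_bump (m + 1) t)) (at t)"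
proof (cases t "0::real" rule: linorder_cases)
  case less
  have "((\<lambda>_. 0) has_real_derivative 0) (at t)" by simp
  then show ?thesis
    by (rule DERIV_cong[OF has_field_derivative_transform_within_open[of _ _ _ "{..<0}"]])
      (use less in \<open>auto simp: exp_bump_def\<close>)
next
  case equal
  \<comment> \<open>At 0 the difference quotient of \<open>exp_bump m\<close> is
    \<open>exp_bump (Suc m)\<close>, because \<open>exp_bump m 0\<close> is 0 and division by h
    raises the power by one. Its limit is already known to be 0.\<close>
  have "((\<lambda>h. (exp_bump m (0 + h) - exp_bump m 0) / h) \<longlongrightarrow> 0) (at 0)"
    by (rule Lim_transform_eventually[OF exp_bump_tendsto_0[of "Suc m"]])
      (auto simp: exp_bump_def eventually_at intro!: exI[of _ 1])
  then show ?thesis using equal by (simp add: DERIV_def exp_bump_def)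
next
  case greater
  have d: "((\<lambda>t. exp (- 1 / t) * inverse (t ^ m)) has_real_derivative
     exp (- 1 / t) * (1 / t^2) * inverse (t ^ m) + exp (- 1 / t) * (- (m * t ^ (m - 1) / (t ^ m)^2))) (at t)"
    using greater by (auto intro!: derivative_eq_intros simp: power2_eq_square divide_simps)
  have e: "real m * t ^ (m - 1) / (t ^ m)\<^sup>2 = m / t ^ (m + 1)"
    using greater by (cases m) (auto simp: field_simps power2_eq_square)
  show ?thesis
  proof (rule DERIV_cong[OF has_field_derivative_transform_within_open[OF d, of "{0<..}"]])
    show "exp (- 1 / t) * (1 / t\<^sup>2) * inverse (t ^ m) + exp (- 1 / t) * - (real m * t ^ (m - 1) / (t ^ m)\<^sup>2) =
      exp_bump (m + 2) t - real m * exp_bump (m + 1) t"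
      unfolding e using greater by (simp add: exp_bump_def field_simps power2_eq_square)
  qed (use greater in \<open>auto simp: exp_bump_def field_simps\<close>)
qed

lemma Ck_on_exp_bump: "Ck_on k UNIV (exp_bump m)"
proof (induction k arbitrary: m)
  case 0
  show ?case using exp_bump_deriv by (auto intro!: DERIV_continuous_on)
next
  case (Suc k)
  show ?case
    by (rule Ck_on_Suc_real[OF exp_bump_deriv], intro Ck_on_diff Ck_on_cmult Suc.IH)
qed

text \<open>Positive exactly inside (a, b). The factor \<open>Suc m\<close> drives exp (-1 / (Suc m
  * t)) to 1 at each t > 0, so the bumps tend to the indicator of the open interval while staying
  between 0 and 1.\<close>

definition interval_bump :: "nat \<Rightarrow> real \<Rightarrow> real \<Rightarrow> real \<Rightarrow> real" where
  "interval_bump m a b t = exp_bump 0 (real (Suc m) * (t - a)) * exp_bump 0 (real (Suc m) * (b - t))"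

lemma Ck_on_interval_bump: "Ck_on k UNIV (interval_bump m a b)"
proof -
  have "Ck_on k UNIV (\<lambda>t. exp_bump 0 (real (Suc m) * (t \<bullet> 1) + (- real (Suc m) * a)) * exp_bump 0 ((- real (Suc m)) * (t \<bullet> 1) + real (Suc m) * b))"
    by (intro Ck_on_mult Ck_on_compose_affine Ck_on_exp_bump)
  also have "(\<lambda>t. exp_bump 0 (real (Suc m) * (t \<bullet> 1) + (- real (Suc m) * a)) * exp_bump 0 ((- real (Suc m)) * (t \<bullet> 1) + real (Suc m) * b)) = interval_bump m a b"
    by (auto simp: interval_bump_def algebra_simps fun_eq_iff)
  finally show ?thesis .
qed

lemma interval_bump_eq_0: "t \<notin> {a<..<b} \<Longrightarrow> interval_bump m a b t = 0"
  by (auto simp: interval_bump_def exp_bump_def zero_less_mult_iff)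

lemma exp_bump_0_bounds: "0 \<le> exp_bump 0 t \<and> exp_bump 0 t \<le> 1"
  by (auto simp: exp_bump_def)

lemma interval_bump_bounds: "0 \<le> interval_bump m a b t" "interval_bump m a b t \<le> 1"
  using exp_bump_0_bounds by (auto simp: interval_bump_def intro: mult_le_one)

lemma exp_bump_scaled_tendsto: "t > 0 \<Longrightarrow> (\<lambda>m. exp_bump 0 (real (Suc m) * t)) \<longlonglongrightarrow> 1"
proof -
  assume t: "t > 0"
  have "(\<lambda>m. exp (- (inverse t * inverse (real (Suc m))))) \<longlonglongrightarrow> exp (- (inverse t * 0))"
    by (intro tendsto_intros LIMSEQ_inverse_real_of_nat)
  moreover have "exp (- (inverse t * inverse (real (Suc m)))) = exp_bump 0 (real (Suc m) * t)" for m
    using t by (simp add: exp_bump_def divide_simps zero_less_mult_iff)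
  ultimately show ?thesis by simp
qed

lemma interval_bump_tendsto: "(\<lambda>m. interval_bump m a b t) \<longlonglongrightarrow> indicator {a<..<b} t"
proof (cases "t \<in> {a<..<b}")
  case True
  then have "(\<lambda>m. exp_bump 0 (real (Suc m) * (t - a)) * exp_bump 0 (real (Suc m) * (b - t))) \<longlonglongrightarrow> 1 * 1"
    by (intro tendsto_mult exp_bump_scaled_tendsto) auto
  then show ?thesis using True by (simp add: interval_bump_def)
qed (simp add: interval_bump_eq_0)

text \<open>A bump and its translate have the same integral, so the primitive of their difference
  that vanishes to the left of both vanishes to the right of both as well. This compact support is
  what turns a vanishing weak derivative into translation invariance of box integrals.\<close>

lemma shifted_bump_primitive:
  assumes "a < b" "0 \<le> s"
  obtains P where "\<And>k. Ck_on k UNIV P"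
    "\<And>t. (P has_real_derivative interval_bump m a b t - interval_bump m a b (t - s)) (at t)"
    "\<And>t. t \<notin> {a..b + s} \<Longrightarrow> P t = 0"
proof -
  let ?r = "interval_bump m a b"
  have cont: "continuous_on S ?r" for S
    using Ck_on_interval_bump[of 0 m a b] by (auto intro: continuous_on_subset)
  \<comment> \<open>Starting at a - 1 instead of a makes every t \<ge> a an interior point of {a -
    1..t + 1}, so the derivative within the interval is a full one.\<close>
  define R where "R t = integral {a - 1..t} ?r" for t
  have R0: "R t = 0" if "t \<le> a" for t
    unfolding R_def using that by (intro integral_unique has_integral_is_0) (auto intro!: interval_bump_eq_0)
  have dR: "(R has_real_derivative ?r t) (at t)" for t
  proof (cases "t < a")
    case True
    have "((\<lambda>_. 0) has_real_derivative 0) (at t)" by simp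
    then show ?thesis
      by (rule DERIV_cong[OF has_field_derivative_transform_within_open[of _ _ _ "{..<a}"]])
        (use True in \<open>auto simp: R0 interval_bump_eq_0\<close>)
  next
    case False
    then have "(R has_real_derivative ?r t) (at t within {a - 1..t + 1})"
      unfolding R_def by (intro integral_has_real_derivative cont) auto
    then show ?thesis using False by (subst (asm) at_within_interior) auto
  qed
  have Rb: "R t = R b" if "t \<ge> b" for t
  proof (cases "t = b")
    case False
    show ?thesis
    proof (rule DERIV_isconst_end[where f = R])
      show "b < t" using False that by simp
      show "continuous_on {b..t} R" using dR by (blast intro: DERIV_continuous_on has_field_derivative_at_within)
      show "(R has_real_derivative 0) (at x)" if "b < x" "x < t" for x
        using dR[of x] that by (simp add: interval_bump_eq_0)
    qed
  qed simp
  define P where "P t = R t - R (t - s)" for t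
  have dP: "(P has_real_derivative ?r t - ?r (t - s)) (at t)" for t
  proof -
    have "((\<lambda>t. R (t - s)) has_real_derivative ?r (t - s) * 1) (at t)"
      by (rule DERIV_chain2[OF dR]) (auto intro!: derivative_eq_intros)
    then have *: "((\<lambda>t. R (t - s)) has_real_derivative ?r (t - s)) (at t)" by simp
    show ?thesis unfolding P_def by (rule DERIV_diff[OF dR *])
  qed
  have *: "Ck_on k UNIV (\<lambda>t. ?r t - ?r (1 * (t \<bullet> 1) + (- s)))" for k
    by (intro Ck_on_diff Ck_on_interval_bump Ck_on_compose_affine)
  show thesis
  proof (rule that)
    show "Ck_on k UNIV P" for k
    proof (rule Ck_on_Suc_imp, rule Ck_on_Suc_real[OF dP])
      show "Ck_on k UNIV (\<lambda>t. ?r t - ?r (t - s))" using *[of k] by simp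
    qed
    show "P t = 0" if "t \<notin> {a..b + s}" for t
    proof (cases "t < a")
      case True
      then show ?thesis using R0[of t] R0[of "t - s"] assms by (simp add: P_def)
    next
      case False
      then have "t \<ge> b" "t - s \<ge> b" using that assms by auto
      then show ?thesis using Rb[of t] Rb[of "t - s"] by (simp add: P_def)
    qed
  qed (rule dP)
qed

text \<open>All test functions constructed in the proof have this product form, which reduces
  smoothness and support to one variable.\<close>

lemma box_test_function:
  fixes a b :: "'a::euclidean_space"
  assumes "cbox a b \<subseteq> \<Omega>"
    and g: "\<And>i k. i \<in> Basis \<Longrightarrow> Ck_on k UNIV (g i)"
    "\<And>i t. i \<in> Basis \<Longrightarrow> t \<notin> {a \<bullet> i..b \<bullet> i} \<Longrightarrow> g i t = 0"
  shows "test_function \<Omega> (\<lambda>x. \<Prod>i\<in>Basis. g i (x \<bullet> i))"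
  unfolding test_function_def smooth_on_def
proof (intro conjI exI allI impI)
  fix k
  show "Ck_on k UNIV (\<lambda>x. \<Prod>i\<in>Basis. g i (x \<bullet> i))"
    using Ck_on_compose_affine[OF g(1), of _ k 1 _ 0] by (intro Ck_on_prod) auto
next
  show "cbox a b \<subseteq> \<Omega>" by fact
  fix x assume "x \<notin> cbox a b"
  then show "(\<Prod>i\<in>Basis. g i (x \<bullet> i)) = 0"
    by (auto simp: mem_box intro!: g(2))
qed auto

lemma frechet_derivative_prod_coordinates:
  fixes g :: "'a::euclidean_space \<Rightarrow> real \<Rightarrow> real"
  assumes j: "j \<in> Basis" and d: "\<And>i t. i \<in> Basis \<Longrightarrow> (g i has_real_derivative g' i t) (at t)"
  shows "frechet_derivative (\<lambda>x. \<Prod>i\<in>Basis. g i (x \<bullet> i)) (at x) j =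
    g' j (x \<bullet> j) * (\<Prod>i\<in>Basis - {j}. g i (x \<bullet> i))"
proof -
  have 1: "((\<lambda>x. g i (x \<bullet> i)) has_derivative (\<lambda>h. (h \<bullet> i) * g' i (x \<bullet> i))) (at x)" if "i \<in> Basis" for i
  proof -
    have "((\<lambda>x. x \<bullet> i) has_derivative (\<lambda>h. h \<bullet> i)) (at x)" by (auto intro!: derivative_eq_intros)
    from has_derivative_compose[OF this d[OF that, unfolded has_field_derivative_def]]
    show ?thesis by (simp add: mult.commute)
  qed
  have "((\<lambda>x. \<Prod>i\<in>Basis. g i (x \<bullet> i)) has_derivative
    (\<lambda>h. \<Sum>i\<in>Basis. (h \<bullet> i) * g' i (x \<bullet> i) * (\<Prod>l\<in>Basis - {i}. g l (x \<bullet> l)))) (at x)"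
    by (rule has_derivative_prod[OF 1])
  then have "frechet_derivative (\<lambda>x. \<Prod>i\<in>Basis. g i (x \<bullet> i)) (at x) j =
     (\<Sum>i\<in>Basis. (j \<bullet> i) * g' i (x \<bullet> i) * (\<Prod>l\<in>Basis - {i}. g l (x \<bullet> l)))"
    by (simp add: frechet_derivative_eqI)
  also have "\<dots> = (\<Sum>i\<in>Basis. if i = j then g' i (x \<bullet> i) * (\<Prod>l\<in>Basis - {i}. g l (x \<bullet> l)) else 0)"
    using j by (intro sum.cong) (auto simp: inner_Basis)
  also have "\<dots> = g' j (x \<bullet> j) * (\<Prod>i\<in>Basis - {j}. g i (x \<bullet> i))" using j by simp
  finally show ?thesis .
qed

section \<open>Weak gradients\<close>

lemma square_integrable_imp_integrable:
  fixes f :: "'a \<Rightarrow> 'b::euclidean_space"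
  assumes "finite_measure M" "square_integrable M f"
  shows "integrable M f"
proof (rule Bochner_Integration.integrable_bound)
  interpret finite_measure M by fact
  show "integrable M (\<lambda>x. 1 + (norm (f x))\<^sup>2)" using assms by (simp add: square_integrable_def)
  show "f \<in> borel_measurable M" using assms by (simp add: square_integrable_def)
  have "t \<le> 1 + t\<^sup>2" if "t \<ge> 0" for t :: real
  proof -
    have "0 \<le> (t - 1)\<^sup>2" by simp
    then have "2 * t \<le> 1 + t\<^sup>2" by (simp add: power2_diff)
    with that show ?thesis by linarith
  qed
  then have "norm (f x) \<le> 1 + (norm (f x))\<^sup>2" for x by simp
  then show "AE x in M. norm (f x) \<le> norm (1 + (norm (f x))\<^sup>2)" by simp
qed

section \<open>Functions determined by their integrals over boxes\<close>

lemma lebesgue_cube_averages: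
  fixes f :: "'a::euclidean_space \<Rightarrow> real"
  assumes "open \<Omega>" and f: "integrable (lebesgue_on \<Omega>) f"
  obtains N where "negligible N"
    "\<And>x. x \<in> \<Omega> - N \<Longrightarrow> ((\<lambda>h. (LINT y|lebesgue_on \<Omega>. f y * indicator (box x (x + h *\<^sub>R One)) y) / h ^ DIM('a)) \<longlongrightarrow> f x) (at_right 0)"
proof -
  have S: "\<Omega> \<in> sets lebesgue" using assms by (simp add: lborelD)
  define g where "g x = (if x \<in> \<Omega> then f x else 0)" for x
  have g: "integrable lebesgue g" unfolding g_def using S f by (simp add: Lebesgue_Measure.integrable_restrict_UNIV)
  then have ga: "g absolutely_integrable_on UNIV" by (simp add: set_integrable_def)
  have gc: "g integrable_on cbox a b" for a b
    using ga absolutely_integrable_on_def integrable_on_subcbox by blast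
  \<comment> \<open>The cubes have x as a corner rather than as centre; this suits the translation
    argument, which moves corners.\<close>
  obtain N where N: "negligible N" "\<And>x e. \<lbrakk>x \<notin> N; 0 < e\<rbrakk> \<Longrightarrow>
      \<exists>d>0. \<forall>h. 0 < h \<and> h < d \<longrightarrow> norm (integral (cbox x (x + h *\<^sub>R One)) g /\<^sub>R h ^ DIM('a) - g x) < e"
    using integrable_ccontinuous_explicit[of g, OF gc] by blast
  have eq: "integral (cbox a b) g = (LINT y|lebesgue_on \<Omega>. f y * indicator (box a b) y)" for a b
  proof -
    have "integral (cbox a b) g = integral (box a b) g" by (simp add: integral_open_interval)
    also have "\<dots> = (LINT y|lebesgue. indicator (box a b) y *\<^sub>R g y)"
    proof -
      have "set_integrable lebesgue (box a b) g"
        by (rule set_integrable_subset[OF ga]) auto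
      from set_lebesgue_integral_eq_integral(2)[OF this] show ?thesis by (simp add: set_lebesgue_integral_def)
    qed
    also have "\<dots> = (LINT y|lebesgue. (if y \<in> \<Omega> then f y * indicator (box a b) y else 0))"
      by (intro Bochner_Integration.integral_cong) (auto simp: g_def indicator_def)
    also have "\<dots> = (LINT y|lebesgue_on \<Omega>. f y * indicator (box a b) y)"
      by (rule Lebesgue_Measure.integral_restrict_UNIV[OF S])
    finally show ?thesis .
  qed
  show thesis
  proof (rule that[OF N(1)])
    fix x assume x: "x \<in> \<Omega> - N"
    show "((\<lambda>h. (LINT y|lebesgue_on \<Omega>. f y * indicator (box x (x + h *\<^sub>R One)) y) / h ^ DIM('a)) \<longlongrightarrow> f x) (at_right 0)"
      unfolding tendsto_iff
    proof (intro allI impI)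
      fix e :: real assume "e > 0"
      then obtain d where d: "d > 0" "\<forall>h. 0 < h \<and> h < d \<longrightarrow> norm (integral (cbox x (x + h *\<^sub>R One)) g /\<^sub>R h ^ DIM('a) - g x) < e"
        using N(2)[of x e] x by blast
      show "\<forall>\<^sub>F h in at_right 0. dist ((LINT y|lebesgue_on \<Omega>. f y * indicator (box x (x + h *\<^sub>R One)) y) / h ^ DIM('a)) (f x) < e"
        unfolding eventually_at_right_field
        using d x by (intro exI[of _ d]) (auto simp: eq dist_norm g_def divide_inverse mult.commute)
    qed
  qed
qed

lemma eventually_small_cube_subset:
  fixes x :: "'a::euclidean_space"
  assumes "open U" "x \<in> U"
  shows "\<forall>\<^sub>F h in at_right 0. cbox x (x + h *\<^sub>R One) \<subseteq> U"
proof -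
  obtain a b where ab: "x \<in> box a b" "cbox a b \<subseteq> U"
    using open_contains_cbox[of U] assms by metis
  have "\<forall>\<^sub>F h in at_right 0. h \<le> b \<bullet> i - x \<bullet> i" if "i \<in> Basis" for i
    using ab(1) that unfolding eventually_at_right_field
    by (intro exI[of _ "b \<bullet> i - x \<bullet> i"]) (auto simp: mem_box)
  then have "\<forall>\<^sub>F h in at_right 0. \<forall>i\<in>Basis. h \<le> b \<bullet> i - x \<bullet> i"
    by (simp add: eventually_ball_finite_distrib)
  then show ?thesis
  proof eventually_elim
    case (elim h)
    have "cbox x (x + h *\<^sub>R One) \<subseteq> cbox a b"
      using ab(1) elim by (auto simp: subset_box mem_box inner_simps less_imp_le algebra_simps)
    with ab(2) show ?case by blast
  qed
qed

lemma box_bump_integral_tendsto: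
  fixes f :: "'a::euclidean_space \<Rightarrow> real"
  assumes "\<Omega> \<in> sets lebesgue" and f: "integrable (lebesgue_on \<Omega>) f"
  shows "(\<lambda>m. LINT x|lebesgue_on \<Omega>. f x * (\<Prod>i\<in>Basis. interval_bump m (a \<bullet> i) (b \<bullet> i) (x \<bullet> i)))
     \<longlonglongrightarrow> (LINT x|lebesgue_on \<Omega>. f x * indicator (box a b) x)"
    and "integrable (lebesgue_on \<Omega>) (\<lambda>x. f x * (\<Prod>i\<in>Basis. interval_bump m (a \<bullet> i) (b \<bullet> i) (x \<bullet> i)))"
proof -
  let ?r = "\<lambda>m x. \<Prod>i\<in>Basis. interval_bump m (a \<bullet> i) (b \<bullet> i) (x \<bullet> i)"
  have r1: "norm (?r m x) \<le> 1" for m x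
    using interval_bump_bounds by (auto simp: abs_prod intro!: prod_le_1)
  have cont: "continuous_on UNIV (\<lambda>x. ?r m x)" for m
  proof -
    have c: "continuous_on UNIV (interval_bump m c d)" for c d using Ck_on_interval_bump[of 0] by simp
    have "continuous_on UNIV (\<lambda>x. interval_bump m (a \<bullet> i) (b \<bullet> i) (x \<bullet> i))" for i
      by (rule continuous_on_compose2[OF c]) (auto intro: continuous_intros)
    then show ?thesis by (intro continuous_on_prod)
  qed
  have meas: "(\<lambda>x. ?r m x) \<in> borel_measurable (lebesgue_on \<Omega>)" for m
    using continuous_imp_measurable_on_sets_lebesgue[OF continuous_on_subset[OF cont] assms(1)] by blast
  have fm: "f \<in> borel_measurable (lebesgue_on \<Omega>)" using f by simp
  have lim: "(\<lambda>m. ?r m x) \<longlonglongrightarrow> indicator (box a b) x" for x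
  proof -
    have "(\<lambda>m. ?r m x) \<longlonglongrightarrow> (\<Prod>i\<in>Basis. indicator {a \<bullet> i<..<b \<bullet> i} (x \<bullet> i))"
      by (intro tendsto_prod interval_bump_tendsto)
    also have "(\<Prod>i\<in>Basis. indicator {a \<bullet> i<..<b \<bullet> i} (x \<bullet> i)) = (indicator (box a b) x :: real)"
      by (auto simp: indicator_def mem_box prod_eq_1_iff prod_zero_iff)
    finally show ?thesis .
  qed
  have nle: "norm (f x * ?r m x) \<le> norm (f x)" for m x
    using mult_left_mono[OF r1[of m x], of "\<bar>f x\<bar>"] by (simp add: abs_mult)
  show "(\<lambda>m. LINT x|lebesgue_on \<Omega>. f x * ?r m x) \<longlonglongrightarrow> (LINT x|lebesgue_on \<Omega>. f x * indicator (box a b) x)"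
  proof (rule integral_dominated_convergence[where w = "\<lambda>x. norm (f x)"])
    have "(\<lambda>x. indicator (box a b) x :: real) \<in> borel_measurable (lebesgue_on \<Omega>)"
      by (rule borel_measurable_LIMSEQ_real[OF lim meas])
    then show "(\<lambda>x. f x * indicator (box a b) x) \<in> borel_measurable (lebesgue_on \<Omega>)"
      using fm by simp
    show "AE x in lebesgue_on \<Omega>. (\<lambda>m. f x * ?r m x) \<longlonglongrightarrow> f x * indicator (box a b) x"
      by (auto intro!: tendsto_mult lim)
  qed (use f nle fm meas in \<open>auto intro!: borel_measurable_times\<close>)
  show "integrable (lebesgue_on \<Omega>) (\<lambda>x. f x * ?r m x)"
    by (rule Bochner_Integration.integrable_bound[OF f]) (use nle fm meas in \<open>auto intro!: borel_measurable_times\<close>)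
qed

lemma AE_lebesgue_onI:
  assumes "\<Omega> \<in> sets lebesgue" "negligible N" "\<And>x. x \<in> \<Omega> - N \<Longrightarrow> P x"
  shows "AE x in lebesgue_on \<Omega>. P x"
proof -
  have "AE x in lebesgue. x \<notin> N"
    using assms(2) by (intro AE_not_in) (simp add: negligible_iff_null_sets)
  then have "AE x in lebesgue. x \<in> \<Omega> \<longrightarrow> P x" by eventually_elim (use assms(3) in auto)
  then show ?thesis using assms(1) by (simp add: AE_restrict_space_iff)
qed

text \<open>Products of interval bumps tend to indicators of boxes, so f integrates to zero over
  every box whose closure lies in \<Omega>. At almost every point f is a limit of averages that are
  eventually zero.\<close>

lemma AE_zero_if_orthogonal_to_test_functions:
  fixes f :: "'a::euclidean_space \<Rightarrow> real"
  assumes "open \<Omega>" and f: "integrable (lebesgue_on \<Omega>) f"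
    and 0: "\<And>\<phi>. test_function \<Omega> \<phi> \<Longrightarrow> (LINT x|lebesgue_on \<Omega>. f x * \<phi> x) = 0"
  shows "AE x in lebesgue_on \<Omega>. f x = 0"
proof -
  have S: "\<Omega> \<in> sets lebesgue" using assms by (simp add: lborelD)
  have box0: "(LINT x|lebesgue_on \<Omega>. f x * indicator (box a b) x) = 0" if "cbox a b \<subseteq> \<Omega>" for a b
  proof -
    have "test_function \<Omega> (\<lambda>x. \<Prod>i\<in>Basis. interval_bump m (a \<bullet> i) (b \<bullet> i) (x \<bullet> i))" for m
      by (rule box_test_function[OF that]) (auto intro: Ck_on_interval_bump interval_bump_eq_0)
    then have "(\<lambda>m. LINT x|lebesgue_on \<Omega>. f x * (\<Prod>i\<in>Basis. interval_bump m (a \<bullet> i) (b \<bullet> i) (x \<bullet> i))) = (\<lambda>_. 0)"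
      using 0 by auto
    with box_bump_integral_tendsto(1)[OF S f, of a b] show ?thesis
      by (simp add: LIMSEQ_const_iff)
  qed
  obtain N where N: "negligible N" "\<And>x. x \<in> \<Omega> - N \<Longrightarrow> ((\<lambda>h. (LINT y|lebesgue_on \<Omega>. f y * indicator (box x (x + h *\<^sub>R One)) y) / h ^ DIM('a)) \<longlongrightarrow> f x) (at_right 0)"
    using lebesgue_cube_averages[OF assms(1) f] by blast
  show ?thesis
  proof (rule AE_lebesgue_onI[OF S N(1)])
    fix x assume x: "x \<in> \<Omega> - N"
    have "\<forall>\<^sub>F h in at_right 0. 0 = (LINT y|lebesgue_on \<Omega>. f y * indicator (box x (x + h *\<^sub>R One)) y) / h ^ DIM('a)"
      using eventually_small_cube_subset[of \<Omega> x] x assms(1) by (auto elim!: eventually_mono simp: box0)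
    then have "\<forall>\<^sub>F h in at_right 0. (LINT y|lebesgue_on \<Omega>. f y * indicator (box x (x + h *\<^sub>R One)) y) / h ^ DIM('a) = 0"
      by (auto elim!: eventually_mono)
    then have "((\<lambda>h::real. 0) \<longlongrightarrow> f x) (at_right 0)"
      by (rule Lim_transform_eventually[OF N(2)[OF x]])
    then show "f x = 0" by (simp add: tendsto_const_iff)
  qed
qed

text \<open>In direction j the test function is the primitive of a bump minus its translate, in
  every other direction a plain bump. Its j-th derivative is the difference of the smoothed
  indicators of the two boxes, and sharpening the bumps gives the claim.\<close>

lemma box_integral_translate:
  fixes f :: "'a::euclidean_space \<Rightarrow> real"
  assumes "open \<Omega>" and f: "integrable (lebesgue_on \<Omega>) f" and j: "j \<in> Basis"
    and 0: "\<And>\<phi>. test_function \<Omega> \<phi> \<Longrightarrow> (LINT x|lebesgue_on \<Omega>. f x * frechet_derivative \<phi> (at x) j) = 0"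
    and sub: "cbox a (b + s *\<^sub>R j) \<subseteq> \<Omega>" and "s \<ge> 0" and ab: "\<And>i. i \<in> Basis \<Longrightarrow> a \<bullet> i < b \<bullet> i"
  shows "(LINT x|lebesgue_on \<Omega>. f x * indicator (box (a + s *\<^sub>R j) (b + s *\<^sub>R j)) x) =
    (LINT x|lebesgue_on \<Omega>. f x * indicator (box a b) x)"
proof -
  have S: "\<Omega> \<in> sets lebesgue" using assms by (simp add: lborelD)
  let ?r = "\<lambda>a b m x. \<Prod>i\<in>Basis. interval_bump m (a \<bullet> i) (b \<bullet> i) (x \<bullet> i)"
  let ?a = "a + s *\<^sub>R j" and ?b = "b + s *\<^sub>R j"
  have "(LINT x|lebesgue_on \<Omega>. f x * ?r a b m x) = (LINT x|lebesgue_on \<Omega>. f x * ?r ?a ?b m x)" for m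
  proof -
    obtain P where P: "\<And>k. Ck_on k UNIV P"
      "\<And>t. (P has_real_derivative interval_bump m (a \<bullet> j) (b \<bullet> j) t - interval_bump m (a \<bullet> j) (b \<bullet> j) (t - s)) (at t)"
      "\<And>t. t \<notin> {a \<bullet> j..b \<bullet> j + s} \<Longrightarrow> P t = 0"
      using shifted_bump_primitive[OF ab[OF j] \<open>s \<ge> 0\<close>, of m] by blast
    define g where "g i = (if i = j then P else interval_bump m (a \<bullet> i) (b \<bullet> i))" for i
    define g' where "g' i = (if i = j then (\<lambda>t. interval_bump m (a \<bullet> j) (b \<bullet> j) t - interval_bump m (a \<bullet> j) (b \<bullet> j) (t - s))
      else (\<lambda>t. frechet_derivative (interval_bump m (a \<bullet> i) (b \<bullet> i)) (at t) 1))" for i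
    have test: "test_function \<Omega> (\<lambda>x. \<Prod>i\<in>Basis. g i (x \<bullet> i))"
      by (rule box_test_function[OF sub])
        (use j in \<open>auto simp: g_def inner_simps inner_Basis intro!: P Ck_on_interval_bump interval_bump_eq_0\<close>)
    have d: "(g i has_real_derivative g' i t) (at t)" if "i \<in> Basis" for i t
    proof (cases "i = j")
      case False
      have *: "(interval_bump m (a \<bullet> i) (b \<bullet> i) has_derivative frechet_derivative (interval_bump m (a \<bullet> i) (b \<bullet> i)) (at t)) (at t)"
        by (rule Ck_on_SucD1[OF Ck_on_interval_bump])
      have "frechet_derivative (interval_bump m (a \<bullet> i) (b \<bullet> i)) (at t) = (*) (frechet_derivative (interval_bump m (a \<bullet> i) (b \<bullet> i)) (at t) 1)"
        by (rule ext, subst frechet_derivative_real[OF *]) (rule mult.commute)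
      with * False show ?thesis by (simp add: g_def g'_def has_field_derivative_def)
    qed (use P(2) in \<open>simp add: g_def g'_def\<close>)
    have deriv: "frechet_derivative (\<lambda>x. \<Prod>i\<in>Basis. g i (x \<bullet> i)) (at x) j = ?r a b m x - ?r ?a ?b m x" for x
    proof -
      have r: "?r c d m x = interval_bump m (c \<bullet> j) (d \<bullet> j) (x \<bullet> j) * (\<Prod>i\<in>Basis - {j}. interval_bump m (c \<bullet> i) (d \<bullet> i) (x \<bullet> i))" for c d
        using j by (subst prod.remove[of _ j]) auto
      have e1: "(\<Prod>i\<in>Basis - {j}. g i (x \<bullet> i)) = (\<Prod>i\<in>Basis - {j}. interval_bump m (a \<bullet> i) (b \<bullet> i) (x \<bullet> i))"
        by (intro prod.cong) (auto simp: g_def)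
      have e2: "(\<Prod>i\<in>Basis - {j}. interval_bump m (?a \<bullet> i) (?b \<bullet> i) (x \<bullet> i)) = (\<Prod>i\<in>Basis - {j}. interval_bump m (a \<bullet> i) (b \<bullet> i) (x \<bullet> i))"
        using j by (intro prod.cong) (auto simp: inner_simps inner_Basis)
      have e3: "interval_bump m (?a \<bullet> j) (?b \<bullet> j) t = interval_bump m (a \<bullet> j) (b \<bullet> j) (t - s)" for t
        using j by (simp add: interval_bump_def inner_simps algebra_simps)
      show ?thesis
        unfolding r e2 e3 by (subst frechet_derivative_prod_coordinates[where g' = g', OF j d])
          (simp_all add: e1 g'_def algebra_simps)
    qed
    have "(LINT x|lebesgue_on \<Omega>. f x * ?r a b m x - f x * ?r ?a ?b m x) = 0"
      using 0[OF test] unfolding deriv by (simp add: right_diff_distrib)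
    then show ?thesis
      using box_bump_integral_tendsto(2)[OF S f] by (subst (asm) Bochner_Integration.integral_diff) auto
  qed
  then have "(\<lambda>m. LINT x|lebesgue_on \<Omega>. f x * ?r a b m x) \<longlonglongrightarrow> (LINT x|lebesgue_on \<Omega>. f x * indicator (box ?a ?b) x)"
    using box_bump_integral_tendsto(1)[OF S f, of ?a ?b] by simp
  with box_bump_integral_tendsto(1)[OF S f, of a b] show ?thesis
    using LIMSEQ_unique by blast
qed

text \<open>Box integrals do not change under translation inside a closed box in \<Omega>, so the
  cube averages at any two of its good points have the same limit. Hence f is constant near each
  point off one null set, and connectedness spreads the constant over \<Omega>.\<close>

lemma AE_const_if_weak_gradient_zero:
  fixes f :: "'a::euclidean_space \<Rightarrow> real"
  assumes "open \<Omega>" "connected \<Omega>" and f: "integrable (lebesgue_on \<Omega>) f"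
    and 0: "\<And>\<phi> j. test_function \<Omega> \<phi> \<Longrightarrow> j \<in> Basis \<Longrightarrow> (LINT x|lebesgue_on \<Omega>. f x * frechet_derivative \<phi> (at x) j) = 0"
  shows "\<exists>v. AE x in lebesgue_on \<Omega>. f x = v"
proof -
  have S: "\<Omega> \<in> sets lebesgue" using assms by (simp add: lborelD)
  obtain N where N: "negligible N" "\<And>x. x \<in> \<Omega> - N \<Longrightarrow> ((\<lambda>h. (LINT y|lebesgue_on \<Omega>. f y * indicator (box x (x + h *\<^sub>R One)) y) / h ^ DIM('a)) \<longlongrightarrow> f x) (at_right 0)"
    using lebesgue_cube_averages[OF assms(1) f] by blast
  define A where "A h x = (LINT y|lebesgue_on \<Omega>. f y * indicator (box x (x + h *\<^sub>R One)) y)" for h x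
  have A_eq: "A h x = A h c" if cd: "cbox c d \<subseteq> \<Omega>" and x: "x \<in> cbox c d" "x + h *\<^sub>R One \<in> cbox c d" and h: "h > 0" for c d x h
  proof -
    \<comment> \<open>The corner is moved from c to x one coordinate at a time: I is the set of
      coordinates already moved, and adding j uses invariance in direction j only. All intermediate
      cubes stay in \<open>cbox c d\<close>.\<close>
    have "A h (c + (\<Sum>i\<in>I. ((x - c) \<bullet> i) *\<^sub>R i)) = A h c" if "finite I" "I \<subseteq> Basis" for I
      using that
    proof (induction I rule: finite_induct)
      case (insert j I)
      let ?p = "c + (\<Sum>i\<in>I. ((x - c) \<bullet> i) *\<^sub>R i)"
      let ?s = "(x - c) \<bullet> j"
      have j: "j \<in> Basis" and I: "I \<subseteq> Basis" using insert by auto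
      have pi: "?p \<bullet> i = (if i \<in> I then x \<bullet> i else c \<bullet> i)" if "i \<in> Basis" for i
      proof -
        have "(\<Sum>l\<in>I. ((x - c) \<bullet> l) *\<^sub>R l) \<bullet> i = (\<Sum>l\<in>I. if l = i then (x - c) \<bullet> i else 0)"
          unfolding inner_sum_left using I that by (intro sum.cong) (auto simp: inner_Basis)
        also have "\<dots> = (if i \<in> I then (x - c) \<bullet> i else 0)" using insert.hyps by simp
        finally show ?thesis by (simp add: inner_simps)
      qed
      have "A h (?p + ?s *\<^sub>R j) = A h ?p"
        unfolding A_def
      proof (subst add.assoc, subst add.commute[of "?s *\<^sub>R j"], subst add.assoc[symmetric],
          rule box_integral_translate[OF assms(1) f j 0[OF _ j]])
        show "0 \<le> ?s" using x(1) j by (auto simp: mem_box inner_simps)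
        show "?p \<bullet> i < (?p + h *\<^sub>R One) \<bullet> i" if "i \<in> Basis" for i using that h by (simp add: inner_simps)
        have "cbox ?p (?p + h *\<^sub>R One + ?s *\<^sub>R j) \<subseteq> cbox c d"
        proof
          fix y assume y: "y \<in> cbox ?p (?p + h *\<^sub>R One + ?s *\<^sub>R j)"
          show "y \<in> cbox c d" unfolding mem_box
          proof (intro ballI conjI)
            fix i :: 'a assume i: "i \<in> Basis"
            have yi: "?p \<bullet> i \<le> y \<bullet> i" "y \<bullet> i \<le> ?p \<bullet> i + h + ?s * (j \<bullet> i)"
              using y i by (auto simp: mem_box inner_simps)
            have xi: "c \<bullet> i \<le> x \<bullet> i" "x \<bullet> i + h \<le> d \<bullet> i" using x i by (auto simp: mem_box inner_simps)
            show "c \<bullet> i \<le> y \<bullet> i" using yi(1) xi(1) unfolding pi[OF i] by (auto split: if_splits)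
            show "y \<bullet> i \<le> d \<bullet> i" using yi(2) xi insert.hyps(2) i j unfolding pi[OF i]
              by (auto split: if_splits simp: inner_Basis inner_simps)
          qed
        qed
        then show "cbox ?p (?p + h *\<^sub>R One + ?s *\<^sub>R j) \<subseteq> \<Omega>" using cd by blast
      qed
      then show ?case using insert by (simp add: add_ac)
    qed simp
    from this[of Basis] show ?thesis by (simp add: euclidean_representation)
  qed
  have loc: "\<exists>U v. open U \<and> p \<in> U \<and> U \<subseteq> \<Omega> \<and> (\<forall>x\<in>U - N. f x = v)" if p: "p \<in> \<Omega>" for p
  proof -
    obtain c d where cd: "p \<in> box c d" "cbox c d \<subseteq> \<Omega>"
      using open_contains_cbox[of \<Omega>] assms(1) p by metis
    have "f x = f y" if x: "x \<in> box c d - N" and y: "y \<in> box c d - N" for x y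
    proof -
      have lim: "((\<lambda>h. A h c / h ^ DIM('a)) \<longlongrightarrow> f x) (at_right 0)" if x: "x \<in> box c d - N" for x
      proof (rule Lim_transform_eventually)
        show "((\<lambda>h. A h x / h ^ DIM('a)) \<longlongrightarrow> f x) (at_right 0)"
          unfolding A_def using N(2)[of x] x cd(2) box_subset_cbox by blast
        have "\<forall>\<^sub>F h::real in at_right 0. 0 < h" by (simp add: eventually_at_right_less)
        moreover have "\<forall>\<^sub>F h in at_right 0. cbox x (x + h *\<^sub>R One) \<subseteq> box c d"
          using x by (intro eventually_small_cube_subset) auto
        ultimately show "\<forall>\<^sub>F h in at_right 0. A h x / h ^ DIM('a) = A h c / h ^ DIM('a)"
        proof eventually_elim
          case (elim h)
          have "x \<in> cbox x (x + h *\<^sub>R One)" "x + h *\<^sub>R One \<in> cbox x (x + h *\<^sub>R One)"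
            using elim by (auto simp: mem_box inner_simps)
          then have "x \<in> cbox c d" "x + h *\<^sub>R One \<in> cbox c d"
            using elim(2) box_subset_cbox[of c d] by (meson subsetD)+
          then show ?case using A_eq[OF cd(2), of x h] elim(1) by simp
        qed
      qed
      show ?thesis using tendsto_unique[OF _ lim[OF x] lim[OF y]] by simp
    qed
    then have "\<exists>v. \<forall>x\<in>box c d - N. f x = v" by metis
    with cd show ?thesis using box_subset_cbox by (metis open_box order_trans)
  qed
  then obtain U v where Uv: "\<And>p. p \<in> \<Omega> \<Longrightarrow> open (U p) \<and> p \<in> U p \<and> U p \<subseteq> \<Omega> \<and> (\<forall>x\<in>U p - N. f x = v p)"
    by metis
  have "v a = v b" if "a \<in> \<Omega>" "b \<in> \<Omega>" for a b
  proof (rule connected_local_const[OF assms(2) that])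
    show "\<forall>a\<in>\<Omega>. \<forall>\<^sub>F b in at a within \<Omega>. v a = v b"
    proof
      fix a assume a: "a \<in> \<Omega>"
      have "v a = v b" if b: "b \<in> U a" "b \<in> \<Omega>" for b
      proof -
        \<comment> \<open>Two overlapping neighbourhoods share a point outside N because a nonempty
          open set is not negligible; there both constants equal f.\<close>
        have "open (U a \<inter> U b)" "U a \<inter> U b \<noteq> {}" using Uv[OF a] Uv[OF b(2)] b by auto
        then have "\<not> negligible (U a \<inter> U b)" using open_not_negligible by blast
        then obtain z where z: "z \<in> U a - N" "z \<in> U b - N" using N(1) negligible_subset by blast
        have "f z = v a" using Uv[OF a] z(1) by blast
        moreover have "f z = v b" using Uv[OF b(2)] z(2) by blast
        ultimately show ?thesis by simp
      qed
      then show "\<forall>\<^sub>F b in at a within \<Omega>. v a = v b"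
        using Uv[OF a] by (auto simp: eventually_at_topological)
    qed
  qed
  then have "\<exists>w. \<forall>a\<in>\<Omega>. v a = w" by metis
  then obtain w where "\<And>a. a \<in> \<Omega> \<Longrightarrow> v a = w" by blast
  then have w: "f x = w" if "x \<in> \<Omega> - N" for x
    using Uv[of x] that by auto
  then show ?thesis using AE_lebesgue_onI[OF S N(1), of "\<lambda>x. f x = w"] by blast
qed

section \<open>Hausdorff measure and Lebesgue measure\<close>

text \<open>Both comparisons of Hausdorff with Lebesgue measure are instances: \<open>T p\<close> is
  a segment starting at p in one and the projection of p in the other. Summing the hypothesis
  \<open>step\<close> over an almost optimal cover gives the bound, and
  \<open>2 ^ m / unit_ball_vol (real m)\<close> undoes the normalisation of the Hausdorff
  measure.\<close>

lemma hausdorff_cover_image: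
  fixes T :: "'a::metric_space \<Rightarrow> 'b::euclidean_space set"
  assumes m: "m \<ge> 1" and k: "k \<ge> 0" and s: "s > 0" and fin: "hausdorff_outer_measure m A < top" and e: "e > 0"
    and step: "\<And>C r. bounded C \<Longrightarrow> C \<noteq> {} \<Longrightarrow> diameter C \<le> r \<Longrightarrow> 0 < r \<Longrightarrow> r \<le> s \<Longrightarrow>
      \<exists>W\<in>sets borel. (\<Union>p\<in>C. T p) \<subseteq> W \<and> emeasure lborel W \<le> ennreal (k * r ^ m)"
  shows "\<exists>W\<in>sets borel. (\<Union>p\<in>A. T p) \<subseteq> W \<and>
    emeasure lborel W \<le> ennreal k * (ennreal (2 ^ m / unit_ball_vol (real m)) * (hausdorff_outer_measure m A + ennreal e) + ennreal e)"
proof -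
  let ?w = "unit_ball_vol (real m)"
  have w: "?w > 0" by simp
  have "hausdorff_content m s A \<le> hausdorff_outer_measure m A"
    unfolding hausdorff_outer_measure_def using s by (intro SUP_upper) auto
  \<comment> \<open>Strict because the outer measure is finite; the infimum defining the content
    then yields an actual cover.\<close>
  also have "\<dots> < hausdorff_outer_measure m A + ennreal e"
    using fin e by (cases "hausdorff_outer_measure m A") (auto simp: ennreal_plus[symmetric] ennreal_less_iff simp del: ennreal_plus)
  finally obtain C :: "nat \<Rightarrow> 'a set" where C: "A \<subseteq> (\<Union>i. C i)" "\<And>i. bounded (C i)" "\<And>i. diameter (C i) \<le> s"
    "(\<Sum>i. ennreal (?w * (diameter (C i) / 2) ^ m)) < hausdorff_outer_measure m A + ennreal e"
    unfolding hausdorff_content_def INF_less_iff by auto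
  have "\<exists>W\<in>sets borel. (\<Union>p\<in>C i. T p) \<subseteq> W \<and>
      emeasure lborel W \<le> ennreal (k * (diameter (C i) ^ m + e * (1/2) ^ Suc i))" for i
  proof (cases "C i = {}")
    case True
    then show ?thesis by (intro bexI[of _ "{}"]) auto
  next
    case False
    \<comment> \<open>A covering set of diameter 0 is given a positive radius, since
      \<open>step\<close> needs r > 0. That radius is at most 1 and at most e / 2^(i + 1), so its
      m-th power costs no more than e / 2^(i + 1), and these costs sum to e.\<close>
    define r where "r = (if diameter (C i) > 0 then diameter (C i) else min s (min 1 (e * (1/2) ^ Suc i)))"
    have d0: "diameter (C i) \<ge> 0" by (rule diameter_ge_0[OF C(2)])
    have r: "0 < r" "r \<le> s" "diameter (C i) \<le> r" using C(3)[of i] s e d0 by (auto simp: r_def)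
    have "r ^ m \<le> diameter (C i) ^ m + e * (1/2) ^ Suc i"
    proof (cases "diameter (C i) > 0")
      case True
      then show ?thesis using e by (simp add: r_def)
    next
      case False
      then have "r \<le> 1" "r \<le> e * (1/2) ^ Suc i" by (auto simp: r_def)
      moreover have "r ^ m \<le> r ^ 1" using r(1) \<open>r \<le> 1\<close> m by (intro power_decreasing) auto
      moreover have "0 \<le> diameter (C i) ^ m" using d0 by (rule zero_le_power)
      ultimately show ?thesis by simp
    qed
    then have le: "ennreal (k * r ^ m) \<le> ennreal (k * (diameter (C i) ^ m + e * (1/2) ^ Suc i))"
      using k by (intro ennreal_leI mult_left_mono) auto
    obtain W where "W\<in>sets borel" "(\<Union>p\<in>C i. T p) \<subseteq> W" "emeasure lborel W \<le> ennreal (k * r ^ m)"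
      using step[OF C(2) False r(3) r(1,2)] by blast
    then show ?thesis using le by (intro bexI[of _ W]) auto
  qed
  then obtain W where W: "\<And>i. W i \<in> sets borel" "\<And>i. (\<Union>p\<in>C i. T p) \<subseteq> W i"
    "\<And>i. emeasure lborel (W i) \<le> ennreal (k * (diameter (C i) ^ m + e * (1/2) ^ Suc i))"
    by metis
  have "emeasure lborel (\<Union>i. W i) \<le> (\<Sum>i. emeasure lborel (W i))"
    using W(1) by (intro emeasure_subadditive_countably) auto
  also have "\<dots> \<le> (\<Sum>i. ennreal k * (ennreal (2 ^ m / ?w) * ennreal (?w * (diameter (C i) / 2) ^ m) + ennreal (e * (1/2) ^ Suc i)))"
  proof (intro suminf_le)
    fix i
    have d0: "diameter (C i) \<ge> 0" by (rule diameter_ge_0[OF C(2)])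
    have "ennreal (k * (diameter (C i) ^ m + e * (1/2) ^ Suc i)) =
      ennreal k * (ennreal (2 ^ m / ?w * (?w * (diameter (C i) / 2) ^ m)) + ennreal (e * (1/2) ^ Suc i))"
    proof -
      have "?w \<noteq> 0" using w by (rule less_imp_neq[symmetric])
      then have "2 ^ m / ?w * (?w * (diameter (C i) / 2) ^ m) = diameter (C i) ^ m" by (simp add: power_divide)
      then show ?thesis using k e d0 by (simp only: ) (simp add: ennreal_mult'' ennreal_plus[symmetric] del: ennreal_plus)
    qed
    also have "ennreal (2 ^ m / ?w * (?w * (diameter (C i) / 2) ^ m)) = ennreal (2 ^ m / ?w) * ennreal (?w * (diameter (C i) / 2) ^ m)"
      using w d0 by (intro ennreal_mult) auto
    finally show "emeasure lborel (W i) \<le> ennreal k * (ennreal (2 ^ m / ?w) * ennreal (?w * (diameter (C i) / 2) ^ m) + ennreal (e * (1/2) ^ Suc i))"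
      using W(3)[of i] by simp
  qed auto
  also have "\<dots> = ennreal k * (ennreal (2 ^ m / ?w) * (\<Sum>i. ennreal (?w * (diameter (C i) / 2) ^ m)) + (\<Sum>i. ennreal (e * (1/2) ^ Suc i)))"
    by (simp add: ennreal_suminf_cmult suminf_add[symmetric])
  also have "(\<Sum>i. ennreal (e * (1/2) ^ Suc i)) = ennreal e"
  proof -
    have "(\<lambda>i. e * (1/2) ^ Suc i) sums (e * 1)" by (intro sums_mult power_half_series)
    then show ?thesis using e by (intro suminf_ennreal_eq) auto
  qed
  also have "ennreal k * (ennreal (2 ^ m / ?w) * (\<Sum>i. ennreal (?w * (diameter (C i) / 2) ^ m)) + ennreal e)
    \<le> ennreal k * (ennreal (2 ^ m / ?w) * (hausdorff_outer_measure m A + ennreal e) + ennreal e)"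
    using less_imp_le[OF C(4)] by (intro mult_left_mono add_right_mono) auto
  finally have "emeasure lborel (\<Union>i. W i) \<le> ennreal k * (ennreal (2 ^ m / ?w) * (hausdorff_outer_measure m A + ennreal e) + ennreal e)" .
  moreover have "(\<Union>p\<in>A. T p) \<subseteq> (\<Union>i. W i)" using C(1) W(2) by blast
  ultimately show ?thesis using W(1) by (intro bexI[of _ "\<Union>i. W i"]) auto
qed

lemma subset_cball_diameter: "bounded C \<Longrightarrow> x \<in> C \<Longrightarrow> diameter C \<le> r \<Longrightarrow> C \<subseteq> cball x r"
  using diameter_bounded_bound by (force simp: mem_cball)

text \<open>About s / r balls of radius 2r, centred along one segment, cover all the segments. Each
  has volume of order r^(m + 1), so the total is of order s r^m. Because r \<le> s, rounding the
  number of balls is absorbed by a factor 2.\<close>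

lemma segment_neighbourhood_measure:
  fixes C :: "'a::euclidean_space set"
  assumes C: "bounded C" "C \<noteq> {}" "diameter C \<le> r" and r: "0 < r" "r \<le> s" and b: "norm b \<le> 1" and n: "DIM('a) = Suc m"
  shows "\<exists>W\<in>sets borel. (\<Union>p\<in>C. {p + t *\<^sub>R b |t. 0 \<le> t \<and> t \<le> s}) \<subseteq> W \<and>
     emeasure lborel W \<le> ennreal (2 * unit_ball_vol (real DIM('a)) * 2 ^ DIM('a) * s * r ^ m)"
proof -
  let ?w = "unit_ball_vol (real DIM('a))"
  obtain x where x: "x \<in> C" using C(2) by blast
  have Cx: "C \<subseteq> cball x r" by (rule subset_cball_diameter[OF C(1) x C(3)])
  define L where "L = nat \<lfloor>s / r\<rfloor>"
  define W where "W = (\<Union>l\<in>{..L}. cball (x + (l * r) *\<^sub>R b) (2 * r))"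
  have LR: "real L \<le> s / r" unfolding L_def using r by simp
  have "emeasure lborel W \<le> (\<Sum>l\<in>{..L}. emeasure lborel (cball (x + (real l * r) *\<^sub>R b) (2 * r)))"
    unfolding W_def by (rule emeasure_subadditive_finite) auto
  also have "\<dots> = (\<Sum>l\<in>{..L}. ennreal (?w * (2 * r) ^ DIM('a)))"
    using r by (intro sum.cong) (auto simp: emeasure_cball)
  also have "\<dots> = ennreal ((real L + 1) * (?w * (2 * r) ^ DIM('a)))"
    using r by (simp add: ennreal_mult'' ennreal_of_nat_eq_real_of_nat algebra_simps)
  also have "\<dots> \<le> ennreal ((2 * s / r) * (?w * (2 * r) ^ DIM('a)))"
  proof (intro ennreal_leI mult_right_mono)
    have "1 \<le> s / r" using r by simp
    then show "real L + 1 \<le> 2 * s / r" using LR by simp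
  qed (use r in auto)
  also have "(2 * s / r) * (?w * (2 * r) ^ DIM('a)) = 2 * ?w * 2 ^ DIM('a) * s * r ^ m"
    using r unfolding n by (simp add: power_mult_distrib field_simps)
  finally have "emeasure lborel W \<le> ennreal (2 * ?w * 2 ^ DIM('a) * s * r ^ m)" .
  moreover have "(\<Union>p\<in>C. {p + t *\<^sub>R b |t. 0 \<le> t \<and> t \<le> s}) \<subseteq> W"
  proof clarify
    fix p t assume p: "p \<in> C" and t: "0 \<le> t" "t \<le> s"
    define l where "l = nat \<lfloor>t / r\<rfloor>"
    have lt: "real l \<le> t / r" "t / r < real l + 1" 
    proof -
      have "0 \<le> t / r" using t r by simp
      then have "real l = of_int \<lfloor>t / r\<rfloor>" by (simp add: l_def)
      then show "real l \<le> t / r" "t / r < real l + 1" by linarith+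
    qed
    have "l \<le> L" unfolding l_def L_def using t r by (intro nat_mono floor_mono divide_right_mono) auto
    moreover have "p + t *\<^sub>R b \<in> cball (x + (real l * r) *\<^sub>R b) (2 * r)"
    proof -
      have "dist x p \<le> r" using Cx p by auto
      have tl: "\<bar>real l * r - t\<bar> \<le> r" using lt r by (auto simp: field_simps abs_le_iff)
      have "dist (x + (real l * r) *\<^sub>R b) (p + t *\<^sub>R b) = norm ((x - p) + (real l * r - t) *\<^sub>R b)"
        by (simp add: dist_norm algebra_simps)
      also have "\<dots> \<le> norm (x - p) + \<bar>real l * r - t\<bar> * norm b"
        using norm_triangle_ineq[of "x - p" "(real l * r - t) *\<^sub>R b"] by simp
      also have "\<dots> \<le> r + r * 1" using \<open>dist x p \<le> r\<close> tl b r by (intro add_mono mult_mono) (auto simp: dist_norm)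
      finally show ?thesis by simp
    qed
    ultimately show "p + t *\<^sub>R b \<in> W" unfolding W_def by blast
  qed
  moreover have "W \<in> sets borel" unfolding W_def by auto
  ultimately show ?thesis by blast
qed

text \<open>This is the link from surface measure on B to volume. K has to be independent of A, b, s
  and e because the level sets of a density are thickened one by one later. Its size is immaterial:
  it will multiply integrals over B that tend to 0.\<close>

lemma hausdorff_thickening:
  assumes n: "DIM('a::euclidean_space) = Suc m" "m \<ge> 1"
  obtains K where "K > 0" "\<And>A b s e. hausdorff_outer_measure m (A :: 'a set) < top \<Longrightarrow> norm b \<le> 1 \<Longrightarrow> 0 < s \<Longrightarrow> 0 < e \<Longrightarrow>
    \<exists>W\<in>sets borel. {p + t *\<^sub>R b |p t. p \<in> A \<and> 0 \<le> t \<and> t \<le> s} \<subseteq> W \<and>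
      emeasure lborel W \<le> ennreal (K * s) * (hausdorff_outer_measure m A + ennreal e)"
proof -
  define k where "k = 2 * unit_ball_vol (real DIM('a)) * 2 ^ DIM('a)"
  define q where "q = 2 ^ m / unit_ball_vol (real m)"
  have k: "k > 0" and q: "q > 0" by (simp_all add: k_def q_def)
  show thesis
  proof (rule that[of "k * (q + 1)"])
    show "k * (q + 1) > 0" using k q by simp
    fix A :: "'a set" and b :: 'a and s e :: real
    assume A: "hausdorff_outer_measure m A < top" and b: "norm b \<le> 1" and s: "0 < s" and e: "0 < e"
    have "\<exists>W\<in>sets borel. (\<Union>p\<in>A. {p + t *\<^sub>R b |t. 0 \<le> t \<and> t \<le> s}) \<subseteq> W \<and>
      emeasure lborel W \<le> ennreal (k * s) * (ennreal (2 ^ m / unit_ball_vol (real m)) * (hausdorff_outer_measure m A + ennreal e) + ennreal e)"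
      by (rule hausdorff_cover_image[OF n(2) _ s A e])
        (use segment_neighbourhood_measure[OF _ _ _ _ _ b n(1)] k s in \<open>auto simp: k_def mult.assoc\<close>)
    then obtain W where W: "W \<in> sets borel" "(\<Union>p\<in>A. {p + t *\<^sub>R b |t. 0 \<le> t \<and> t \<le> s}) \<subseteq> W"
      "emeasure lborel W \<le> ennreal (k * s) * (ennreal q * (hausdorff_outer_measure m A + ennreal e) + ennreal e)"
      by (auto simp: q_def)
    have "ennreal q * (hausdorff_outer_measure m A + ennreal e) + ennreal e \<le>
        ennreal q * (hausdorff_outer_measure m A + ennreal e) + 1 * (hausdorff_outer_measure m A + ennreal e)"
      by (intro add_left_mono) simp
    also have "\<dots> = ennreal (q + 1) * (hausdorff_outer_measure m A + ennreal e)"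
    proof -
      have "ennreal (q + 1) = ennreal q + 1" using q by simp
      then show ?thesis by (simp add: distrib_right)
    qed
    finally have "ennreal (k * s) * (ennreal q * (hausdorff_outer_measure m A + ennreal e) + ennreal e) \<le>
      ennreal (k * s) * (ennreal (q + 1) * (hausdorff_outer_measure m A + ennreal e))"
      by (intro mult_left_mono) auto
    also have "\<dots> = ennreal (k * (q + 1) * s) * (hausdorff_outer_measure m A + ennreal e)"
    proof -
      have "k * (q + 1) * s = (k * s) * (q + 1)" by (simp add: mult_ac)
      then show ?thesis using k q s by (simp add: ennreal_mult mult.assoc mult.left_commute)
    qed
    finally have "emeasure lborel W \<le> ennreal (k * (q + 1) * s) * (hausdorff_outer_measure m A + ennreal e)"
      using W(3) by (rule order_trans[rotated])
    moreover have "{p + t *\<^sub>R b |p t. p \<in> A \<and> 0 \<le> t \<and> t \<le> s} \<subseteq> W" using W(2) by blast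
    ultimately show "\<exists>W\<in>sets borel. {p + t *\<^sub>R b |p t. p \<in> A \<and> 0 \<le> t \<and> t \<le> s} \<subseteq> W \<and>
      emeasure lborel W \<le> ennreal (k * (q + 1) * s) * (hausdorff_outer_measure m A + ennreal e)"
      using W(1) by blast
  qed
qed

text \<open>A set of diameter r projects into a ball of radius r, not r / 2, so the constant
  obtained is 2^m rather than 1. Any constant will do, since the inequality only carries L2
  convergence from the boundary over to F.\<close>

lemma lebesgue_le_hausdorff_flat:
  obtains K where "K > 0" "\<And>A :: 'a::euclidean_space set. A \<in> sets borel \<Longrightarrow> hausdorff_outer_measure DIM('a) (A \<times> {0::real}) < top \<Longrightarrow>
    emeasure lborel A \<le> ennreal K * hausdorff_outer_measure DIM('a) (A \<times> {0::real})"
proof -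
  let ?m = "DIM('a)"
  define k where "k = unit_ball_vol (real ?m)"
  define q where "q = 2 ^ ?m / unit_ball_vol (real ?m)"
  have k: "k > 0" and q: "q > 0" by (simp_all add: k_def q_def)
  show thesis
  proof (rule that[of "k * q"])
    show "k * q > 0" using k q by simp
    fix A :: "'a set" assume A: "A \<in> sets borel" and fin: "hausdorff_outer_measure ?m (A \<times> {0::real}) < top"
    have step: "\<exists>W\<in>sets borel. (\<Union>p\<in>C. {fst p}) \<subseteq> W \<and> emeasure lborel W \<le> ennreal (k * r ^ ?m)"
      if C: "bounded C" "C \<noteq> {}" "diameter C \<le> r" "0 < r" for C :: "('a \<times> real) set" and r
    proof -
      obtain x where x: "x \<in> C" using C(2) by blast
      have Cx: "C \<subseteq> cball x r" by (rule subset_cball_diameter[OF C(1) x C(3)])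
      have "fst p \<in> cball (fst x) r" if "p \<in> C" for p
      proof -
        have "dist (fst x) (fst p) \<le> dist x p" by (rule dist_fst_le)
        also have "\<dots> \<le> r" using Cx that by auto
        finally show ?thesis by simp
      qed
      then have "(\<Union>p\<in>C. {fst p}) \<subseteq> cball (fst x) r" by blast
      moreover have "emeasure lborel (cball (fst x) r) = ennreal (k * r ^ ?m)"
        using C(4) by (simp add: emeasure_cball k_def)
      ultimately show ?thesis by (intro bexI[of _ "cball (fst x) r"]) auto
    qed
    have le: "emeasure lborel A \<le> ennreal k * (ennreal q * (hausdorff_outer_measure ?m (A \<times> {0::real}) + ennreal e) + ennreal e)" if e: "e > 0" for e
    proof -
      have "\<exists>W\<in>sets borel. (\<Union>p\<in>A \<times> {0::real}. {fst p}) \<subseteq> W \<and>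
         emeasure lborel W \<le> ennreal k * (ennreal (2 ^ ?m / unit_ball_vol (real ?m)) * (hausdorff_outer_measure ?m (A \<times> {0::real}) + ennreal e) + ennreal e)"
        by (rule hausdorff_cover_image[OF _ _ zero_less_one fin e]) (use step k DIM_positive[where 'a = 'a] in auto)
      moreover have "(\<Union>p\<in>A \<times> {0::real}. {fst p}) = A" by force
      ultimately obtain W where W: "W \<in> sets borel" "A \<subseteq> W" "emeasure lborel W \<le> ennreal k * (ennreal q * (hausdorff_outer_measure ?m (A \<times> {0::real}) + ennreal e) + ennreal e)"
        unfolding q_def by metis
      have "emeasure lborel A \<le> emeasure lborel W" using W by (intro emeasure_mono) auto
      then show ?thesis using W(3) by simp
    qed
    have "((\<lambda>e. ennreal k * (ennreal q * (hausdorff_outer_measure ?m (A \<times> {0::real}) + ennreal e) + ennreal e)) \<longlongrightarrow>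
      ennreal k * (ennreal q * (hausdorff_outer_measure ?m (A \<times> {0::real}) + ennreal 0) + ennreal 0)) (at_right 0)"
      by (intro tendsto_intros ennreal_tendsto_cmult tendsto_add tendsto_const tendsto_ennrealI) (auto simp: less_top)
    moreover have "\<forall>\<^sub>F e in at_right 0. emeasure lborel A \<le> ennreal k * (ennreal q * (hausdorff_outer_measure ?m (A \<times> {0::real}) + ennreal e) + ennreal e)"
      using le by (auto simp: eventually_at_right_field intro!: exI[of _ 1])
    ultimately have "emeasure lborel A \<le> ennreal k * (ennreal q * (hausdorff_outer_measure ?m (A \<times> {0::real}) + ennreal 0) + ennreal 0)"
      by (intro tendsto_lowerbound[of _ _ "at_right (0::real)"]) auto
    then show "emeasure lborel A \<le> ennreal (k * q) * hausdorff_outer_measure ?m (A \<times> {0::real})"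
      using k q by (simp add: ennreal_mult mult.assoc)
  qed
qed

section \<open>Lipschitz boundaries\<close>

text \<open>Moving up by t gains height t above the graph, and a further displacement by less than c
  t costs at most (L + 1) c t = t / 2 of it. Vertices in the closure are allowed because the graph
  inequality survives there in its weak form. This uniform interior cone is the form in which the
  Lipschitz hypothesis enters everything that follows.\<close>

lemma lipschitz_boundary_cone:
  fixes \<Omega> :: "'a::euclidean_space set"
  assumes "lipschitz_boundary \<Omega>" "p \<in> frontier \<Omega>"
  obtains e c r \<tau> where "norm e = 1" "0 < c" "c \<le> 1" "0 < r" "0 < \<tau>"
    "\<And>x t. x \<in> closure \<Omega> \<inter> ball p r \<Longrightarrow> 0 < t \<Longrightarrow> t < \<tau> \<Longrightarrow> ball (x + t *\<^sub>R e) (c * t) \<subseteq> \<Omega>"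
proof -
  obtain e \<gamma> L U where e: "norm e = 1" and lip: "lipschitz_on L {y. y \<bullet> e = 0} \<gamma>" and U: "open U" "p \<in> U"
    and eq: "\<Omega> \<inter> U = {x \<in> U. \<gamma> (x - (x \<bullet> e) *\<^sub>R e) < x \<bullet> e}"
    using assms unfolding lipschitz_boundary_def by blast
  have L: "L \<ge> 0" using lip by (rule lipschitz_on_nonneg)
  obtain R where R: "R > 0" "ball p R \<subseteq> U" using U by (meson openE)
  define P where "P x = x - (x \<bullet> e) *\<^sub>R e" for x
  have ee: "e \<bullet> e = 1" using e by (simp add: norm_eq_1)
  have Pe: "P x \<in> {y. y \<bullet> e = 0}" for x by (simp add: P_def inner_simps ee)
  have Pn: "norm (P x) \<le> norm x" for x
  proof -
    have "P x \<bullet> P x = x \<bullet> x - (x \<bullet> e) * (x \<bullet> e)"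
      by (simp add: P_def inner_diff_left inner_diff_right ee inner_commute)
    then show ?thesis by (simp add: norm_le)
  qed
  have Plin: "P x - P y = P (x - y)" for x y by (simp add: P_def inner_simps algebra_simps)
  have \<gamma>: "\<bar>\<gamma> (P x) - \<gamma> (P y)\<bar> \<le> L * norm (P (x - y))" for x y
    using lipschitz_onD[OF lip Pe Pe, of x y] by (simp add: dist_norm Plin)
  have cl: "\<gamma> (P x) \<le> x \<bullet> e" if x: "x \<in> closure \<Omega>" "x \<in> U" for x
  proof (rule ccontr)
    assume "\<not> ?thesis"
    then have d: "\<gamma> (P x) - x \<bullet> e > 0" (is "?d > 0") by simp
    obtain \<rho> where \<rho>: "\<rho> > 0" "ball x \<rho> \<subseteq> U" using U x by (meson openE)
    \<comment> \<open>Within this distance the change of height and the change of \<gamma>, together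
      at most L + 1 times the distance, stay below half of the assumed gap.\<close>
    define \<epsilon> where "\<epsilon> = min \<rho> (?d / (2 * (L + 1)))"
    have "\<epsilon> > 0" using \<rho> d L by (simp add: \<epsilon>_def)
    then obtain y where y: "y \<in> \<Omega>" "dist y x < \<epsilon>" using x(1) by (meson closure_approachable)
    then have "y \<in> \<Omega> \<inter> U" using \<rho>(2) by (auto simp: \<epsilon>_def dist_commute)
    then have yy: "\<gamma> (P y) < y \<bullet> e" unfolding eq by (simp add: P_def)
    have n: "norm (y - x) < \<epsilon>" using y by (simp add: dist_norm)
    have "?d \<le> L * norm (P (y - x)) + (y - x) \<bullet> e" using \<gamma>[of y x] yy by (simp add: inner_simps)
    also have "\<dots> \<le> L * norm (y - x) + norm (y - x)"
      using Pn[of "y - x"] L norm_cauchy_schwarz[of "y - x" e] e by (intro add_mono mult_left_mono) auto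
    also have "\<dots> = (L + 1) * norm (y - x)" by (simp add: algebra_simps)
    also have "\<dots> \<le> (L + 1) * (?d / (2 * (L + 1)))" using n L by (intro mult_left_mono) (auto simp: \<epsilon>_def)
    also have "\<dots> = ?d / 2" using L by (simp add: field_simps)
    finally show False using d by simp
  qed
  define c where "c = 1 / (2 * (L + 1))"
  have c: "0 < c" "c \<le> 1" "(L + 1) * c = 1 / 2" using L by (auto simp: c_def field_simps)
  show thesis
  proof (rule that[of e c "R / 2" "R / 4"])
    fix x t assume x: "x \<in> closure \<Omega> \<inter> ball p (R / 2)" and t: "0 < t" "t < R / 4"
    show "ball (x + t *\<^sub>R e) (c * t) \<subseteq> \<Omega>"
    proof
      fix z assume "z \<in> ball (x + t *\<^sub>R e) (c * t)"
      then have w: "norm (z - (x + t *\<^sub>R e)) < c * t" (is "norm ?w < _") by (simp add: dist_norm norm_minus_commute)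
      have ct: "c * t \<le> t" using c t by simp
      have "norm (z - x) \<le> norm ?w + norm (t *\<^sub>R e)" using norm_triangle_ineq[of ?w "t *\<^sub>R e"] by (simp add: algebra_simps)
      moreover have "norm ?w < R / 4" using w ct t by linarith
      ultimately have "norm (z - x) < R / 2" using t e by simp
      then have zU: "z \<in> U" using x R(2) dist_triangle[of p z x] by (auto simp: dist_norm norm_minus_commute)
      have xU: "x \<in> U" using x R by auto
      have Pz: "P (z - x) = P ?w" by (simp add: P_def inner_simps ee algebra_simps)
      have "\<gamma> (P z) \<le> \<gamma> (P x) + L * norm ?w"
        using \<gamma>[of z x] Pn[of ?w] L unfolding Pz by (smt (verit) mult_left_mono)
      also have "\<dots> \<le> x \<bullet> e + L * (c * t)" using cl[of x] x xU w L by (intro add_mono mult_left_mono) auto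
      also have "\<dots> < x \<bullet> e + t - c * t"
      proof -
        have "(L + 1) * c * t < t" using c(3) t by simp
        then show ?thesis by (simp add: algebra_simps)
      qed
      also have "\<dots> \<le> z \<bullet> e"
      proof -
        have "(- ?w) \<bullet> e \<le> norm ?w" using norm_cauchy_schwarz[of "- ?w" e] e by (simp only: norm_minus_cancel mult_1_right)
        then show ?thesis using w ee by (simp add: inner_simps)
      qed
      finally have "z \<in> \<Omega> \<inter> U" unfolding eq using zU by (simp add: P_def)
      then show "z \<in> \<Omega>" by simp
    qed
  qed (use e c R in auto)
qed

text \<open>A packing argument. Over each point of X a column of about \<tau> / h balls of radius k
  \<delta> is stacked along the cone direction. All these balls are disjoint, so up to constants
  card X * (\<tau> / \<delta>) * \<delta>^(m + 1) is at most the volume of a fixed ball, which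
  bounds card X by a multiple of \<delta>^(-m).\<close>

lemma separated_subset_card_bound:
  fixes \<Omega> :: "'a::euclidean_space set"
  assumes n: "DIM('a) = Suc m" and "open \<Omega>" and e: "norm e = 1" and c: "0 < c" "c \<le> 1" and "0 < r" and \<tau>: "0 < \<tau>"
    and cone: "\<And>x t. x \<in> closure \<Omega> \<inter> ball p r \<Longrightarrow> 0 < t \<Longrightarrow> t < \<tau> \<Longrightarrow> ball (x + t *\<^sub>R e) (c * t) \<subseteq> \<Omega>"
    and \<delta>: "0 < \<delta>" "\<delta> \<le> 1" "c * \<delta> / 4 \<le> \<tau> / 2"
    and X: "finite X" "X \<subseteq> frontier \<Omega> \<inter> ball p r" "\<And>x y. x \<in> X \<Longrightarrow> y \<in> X \<Longrightarrow> x \<noteq> y \<Longrightarrow> \<delta> \<le> dist x y"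
  shows "real (card X) * \<delta> ^ m \<le> 4 * (r + \<tau> + 1) ^ Suc m / (\<tau> * (c / 8) ^ m)"
proof -
  \<comment> \<open>Tuned so that h = 2 k \<delta> = c \<delta> / 4: centres of two meeting balls
    are closer than h, and h / c is \<delta> / 4.\<close>
  define k where "k = c / 8"
  have k: "k > 0" "k \<le> 1 / 8" using c by (auto simp: k_def)
  define h where "h = 2 * k * \<delta>"
  have h: "h > 0" "h \<le> \<tau> / 2" using k \<delta> by (auto simp: h_def k_def)
  define L where "L = nat \<lfloor>\<tau> / h\<rfloor>"
  have "\<tau> / h \<ge> 2" using h by (simp add: field_simps)
  then have rL: "real L = of_int \<lfloor>\<tau> / h\<rfloor>" by (simp add: L_def)
  have Lup: "real L \<le> \<tau> / h" unfolding rL by linarith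
  \<comment> \<open>Rounding down loses at most half, since \<tau> / h \<ge> 2; this is what the
    assumption c \<delta> / 4 \<le> \<tau> / 2 provides.\<close>
  have Llo: "\<tau> / (2 * h) \<le> real L"
  proof -
    have "\<tau> / h - 1 < real L" unfolding rL by linarith
    moreover have "\<tau> / (2 * h) = (\<tau> / h) / 2" by simp
    ultimately show ?thesis using \<open>\<tau> / h \<ge> 2\<close> by linarith
  qed
  let ?B = "\<lambda>(q, l). ball (q + (real l * h) *\<^sub>R e) (k * \<delta>)"
  let ?I = "X \<times> {..<L}"
  have lh: "real l * h < \<tau>" if "l < L" for l
  proof -
    have "real l * h < real L * h" using that h by simp
    also have "\<dots> \<le> \<tau>" using Lup h by (simp add: field_simps)
    finally show ?thesis .
  qed
  have key: False if q: "q \<in> X" "q' \<in> X" "l < L" "l' \<le> l" "(q, l) \<noteq> (q', l')"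
      and z: "z \<in> ?B (q, l)" "z \<in> ?B (q', l')" for q q' l l' z
  proof -
    \<comment> \<open>u is the height difference of two meeting balls, so q + u e lies within h of
      q'. In one column this is impossible, as u \<ge> h. In different columns, c u > h would put q'
      into the cone at q and hence a boundary point into the open set \<Omega>; otherwise u \<le>
      \<delta> / 4, and q and q' are closer than \<delta>.\<close>
    define u where "u = (real l - real l') * h"
    have u0: "u \<ge> 0" using q h by (simp add: u_def)
    have "u \<le> real l * h" using h by (simp add: u_def algebra_simps)
    then have ut: "u < \<tau>" using lh[OF q(3)] by simp
    have d: "dist (q + (real l * h) *\<^sub>R e) (q' + (real l' * h) *\<^sub>R e) < 2 * (k * \<delta>)"
      using z dist_triangle2[of "q + (real l * h) *\<^sub>R e" "q' + (real l' * h) *\<^sub>R e" z] by (auto simp: dist_commute)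
    have d': "dist (q + u *\<^sub>R e) q' < h"
    proof -
      have "dist (q + u *\<^sub>R e) q' = dist (q + (real l * h) *\<^sub>R e) (q' + (real l' * h) *\<^sub>R e)"
        by (simp add: dist_norm u_def algebra_simps)
      with d show ?thesis by (simp add: h_def)
    qed
    show False
    proof (cases "q = q'")
      case True
      then have "l' < l" using q by auto
      then have "1 \<le> real l - real l'" by linarith
      then have "h \<le> u" using h by (simp add: u_def)
      with d' u0 e True show False by (simp add: dist_norm)
    next
      case False
      have "c * u \<le> h"
      proof (rule ccontr)
        assume "\<not> c * u \<le> h"
        then have "c * u > 0" using h by simp
        then have "u > 0" using c by (simp add: zero_less_mult_iff)
        have "q \<in> closure \<Omega> \<inter> ball p r" using X(2) q(1) by (auto simp: frontier_def)
        from cone[OF this \<open>u > 0\<close> ut] d' \<open>\<not> c * u \<le> h\<close> have "q' \<in> \<Omega>" by auto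
        moreover have "q' \<in> frontier \<Omega>" using X(2) q(2) by auto
        ultimately show False using \<open>open \<Omega>\<close> by (simp add: frontier_def interior_open)
      qed
      then have "u \<le> \<delta> / 4" using c by (simp add: h_def k_def field_simps)
      have "dist q q' \<le> dist (q + u *\<^sub>R e) q' + dist q (q + u *\<^sub>R e)" using dist_triangle[of q q' "q + u *\<^sub>R e"] by (simp add: dist_commute)
      also have "\<dots> < h + u" using d' u0 e by (simp add: dist_norm)
      also have "\<dots> \<le> 2 * (1/8) * \<delta> + \<delta> / 4" unfolding h_def using k \<delta> \<open>u \<le> \<delta> / 4\<close> by (intro add_mono mult_right_mono) auto
      also have "\<dots> < \<delta>" using \<delta> by simp
      finally show False using X(3)[OF q(1,2) False] by simp
    qed
  qed
  have disj: "disjoint_family_on ?B ?I"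
    unfolding disjoint_family_on_def
  proof (intro ballI impI)
    fix a b assume ab: "a \<in> ?I" "b \<in> ?I" "a \<noteq> b"
    obtain q l q' l' where [simp]: "a = (q, l)" "b = (q', l')" by (metis prod.exhaust)
    show "?B a \<inter> ?B b = {}"
    proof (rule ccontr)
      assume "?B a \<inter> ?B b \<noteq> {}"
      then obtain z where z: "z \<in> ?B (q, l)" "z \<in> ?B (q', l')" by auto
      show False
        using key[OF _ _ _ _ _ z] key[OF _ _ _ _ _ z(2,1)] ab by (cases "l' \<le> l") auto
    qed
  qed
  have sub: "(\<Union>a\<in>?I. ?B a) \<subseteq> ball p (r + \<tau> + 1)"
  proof clarify
    fix q l z assume q: "q \<in> X" "l < L" and z: "z \<in> ball (q + (real l * h) *\<^sub>R e) (k * \<delta>)"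
    have "dist p z \<le> dist p q + dist q (q + (real l * h) *\<^sub>R e) + dist (q + (real l * h) *\<^sub>R e) z"
      using dist_triangle[of p z q] dist_triangle[of q z "q + (real l * h) *\<^sub>R e"] by linarith
    moreover have "dist p q < r" using X(2) q(1) by auto
    moreover have "dist q (q + (real l * h) *\<^sub>R e) < \<tau>" using lh[OF q(2)] e h by (simp add: dist_norm)
    moreover have "dist (q + (real l * h) *\<^sub>R e) z < 1 * 1" using z k \<delta> mult_mono[of k 1 \<delta> 1] by auto
    ultimately show "z \<in> ball p (r + \<tau> + 1)" by simp
  qed
  let ?w = "unit_ball_vol (real (Suc m))"
  have ball_fin: "emeasure lborel (ball a \<rho>) \<noteq> top" for a :: 'a and \<rho>
    using emeasure_bounded_finite[OF bounded_ball, of a \<rho>] by (simp add: less_top)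
  have "(\<Sum>a\<in>?I. measure lborel (?B a)) = measure lborel (\<Union>a\<in>?I. ?B a)"
    using X(1) disj by (intro measure_finite_Union[symmetric]) (auto simp: ball_fin)
  also have "\<dots> \<le> measure lborel (ball p (r + \<tau> + 1))"
    using sub X(1) by (intro measure_mono_fmeasurable) (auto simp: fmeasurable_def less_top[symmetric] ball_fin split: prod.splits)
  also have "\<dots> = ?w * (r + \<tau> + 1) ^ Suc m" using n \<tau> \<open>0 < r\<close> by (subst content_ball) auto
  also have "(\<Sum>a\<in>?I. measure lborel (?B a)) = (\<Sum>a\<in>?I. ?w * (k * \<delta>) ^ Suc m)"
    using k \<delta> n by (intro sum.cong) (auto simp: content_ball simp del: power_Suc split: prod.splits)
  also have "\<dots> = ?w * (real (card X) * real L * (k * \<delta>) ^ Suc m)"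
    using X(1) by (simp add: card_cartesian_product)
  finally have "real (card X) * real L * (k * \<delta>) ^ Suc m \<le> (r + \<tau> + 1) ^ Suc m"
    by (simp del: power_Suc)
  then have "real (card X) * (\<tau> / (2 * h)) * (k * \<delta>) ^ Suc m \<le> (r + \<tau> + 1) ^ Suc m"
    using Llo k \<delta> by (elim order_trans[rotated]) (intro mult_right_mono mult_left_mono; simp)
  also have eq: "real (card X) * (\<tau> / (2 * h)) * (k * \<delta>) ^ Suc m = real (card X) * \<delta> ^ m * (\<tau> * k ^ m / 4)"
    using k \<delta> by (simp add: h_def field_simps power_mult_distrib)
  finally have "real (card X) * \<delta> ^ m * (\<tau> * k ^ m / 4) \<le> (r + \<tau> + 1) ^ Suc m" .
  moreover have "\<tau> * k ^ m / 4 > 0" using \<tau> k by simp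
  ultimately show ?thesis unfolding k_def[symmetric]
    by (simp add: pos_le_divide_eq[symmetric] mult.commute[of 4] del: power_Suc)
qed

lemma hausdorff_content_finite_cover:
  assumes "finite X" "A \<subseteq> (\<Union>x\<in>X. cball x \<delta>)" "\<delta> \<ge> 0" "m \<ge> 1"
  shows "hausdorff_content m (2 * \<delta>) (A :: 'a::euclidean_space set) \<le> ennreal (unit_ball_vol (real m) * (real (card X) * \<delta> ^ m))"
proof -
  obtain f where f: "bij_betw f {..<card X} X" using assms(1) bij_betw_from_nat_into_finite by (metis lessThan_atLeast0 ex_bij_betw_nat_finite)
  define C where "C i = (if i < card X then cball (f i) \<delta> else {})" for i
  have dC: "diameter (C i) = (if i < card X then 2 * \<delta> else 0)" for i
    using assms(3) by (simp add: C_def diameter_cball)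
  have "A \<subseteq> (\<Union>i. C i)"
  proof
    fix a assume "a \<in> A"
    then obtain x where "x \<in> X" "a \<in> cball x \<delta>" using assms(2) by blast
    moreover obtain i where "i < card X" "x = f i" using f \<open>x \<in> X\<close> by (auto simp: bij_betw_def)
    ultimately show "a \<in> (\<Union>i. C i)" by (auto simp: C_def)
  qed
  then have "hausdorff_content m (2 * \<delta>) A \<le> (\<Sum>i. ennreal (unit_ball_vol (real m) * (diameter (C i) / 2) ^ m))"
    unfolding hausdorff_content_def using assms(3) by (intro INF_lower) (auto simp: dC, simp add: C_def)
  also have "\<dots> = (\<Sum>i<card X. ennreal (unit_ball_vol (real m) * (diameter (C i) / 2) ^ m))"
    using assms(4) by (intro suminf_finite) (auto simp: dC)
  also have "\<dots> = (\<Sum>i<card X. ennreal (unit_ball_vol (real m) * \<delta> ^ m))" by (simp add: dC)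
  also have "\<dots> = ennreal (unit_ball_vol (real m) * (real (card X) * \<delta> ^ m))"
    using assms(3) by (simp add: ennreal_of_nat_eq_real_of_nat ennreal_mult''[symmetric] mult_ac)
  finally show ?thesis .
qed

text \<open>A separated set of largest size is a \<delta>-net, so closed balls of radius \<delta>
  around it cover. The packing bound on its size makes the content at scale 2 \<delta> bounded
  independently of \<delta>.\<close>

lemma hausdorff_local_finite:
  fixes \<Omega> :: "'a::euclidean_space set"
  assumes n: "DIM('a) = Suc m" "m \<ge> 1" and "open \<Omega>" and e: "norm e = 1" and c: "0 < c" "c \<le> 1" and r: "0 < r" and \<tau>: "0 < \<tau>"
    and cone: "\<And>x t. x \<in> closure \<Omega> \<inter> ball p r \<Longrightarrow> 0 < t \<Longrightarrow> t < \<tau> \<Longrightarrow> ball (x + t *\<^sub>R e) (c * t) \<subseteq> \<Omega>"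
  shows "hausdorff_outer_measure m (frontier \<Omega> \<inter> ball p r) < top"
proof -
  define M where "M = 4 * (r + \<tau> + 1) ^ Suc m / (\<tau> * (c / 8) ^ m)"
  let ?S = "frontier \<Omega> \<inter> ball p r"
  have bound: "hausdorff_content m (2 * \<delta>) ?S \<le> ennreal (unit_ball_vol (real m) * M)"
    if \<delta>: "0 < \<delta>" "\<delta> \<le> 1" "c * \<delta> / 4 \<le> \<tau> / 2" for \<delta>
  proof -
    define sep where "sep X \<longleftrightarrow> finite X \<and> X \<subseteq> ?S \<and> (\<forall>x\<in>X. \<forall>y\<in>X. x \<noteq> y \<longrightarrow> \<delta> \<le> dist x y)" for X
    have card: "real (card X) * \<delta> ^ m \<le> M" if "sep X" for X
      unfolding M_def using separated_subset_card_bound[OF n(1) \<open>open \<Omega>\<close> e c r \<tau> cone \<delta>] that unfolding sep_def by blast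
    have "card X < nat \<lceil>M / \<delta> ^ m\<rceil> + 1" if "sep X" for X
    proof -
      have "real (card X) \<le> M / \<delta> ^ m" using card[OF that] \<delta>(1) by (simp add: field_simps)
      then show ?thesis by linarith
    qed
    moreover have "sep {}" by (simp add: sep_def)
    \<comment> \<open>The packing bound limits the sizes of separated sets, so one of largest size
      exists.\<close>
    ultimately have "\<exists>X. sep X \<and> (\<forall>Y. sep Y \<longrightarrow> card Y \<le> card X)"
      by (intro ex_has_greatest_nat[where b = "nat \<lceil>M / \<delta> ^ m\<rceil> + 1"]) auto
    then obtain X where sX: "sep X" and Xmax: "\<And>Y. sep Y \<Longrightarrow> card Y \<le> card X" by blast
    then have X: "finite X" "X \<subseteq> ?S" "\<And>x y. x \<in> X \<Longrightarrow> y \<in> X \<Longrightarrow> x \<noteq> y \<Longrightarrow> \<delta> \<le> dist x y"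
      unfolding sep_def by blast+
    have "?S \<subseteq> (\<Union>x\<in>X. cball x \<delta>)"
    proof (rule ccontr)
      assume "\<not> ?thesis"
      then obtain z where z: "z \<in> ?S" "\<And>x. x \<in> X \<Longrightarrow> \<delta> < dist x z" by force
      then have "z \<notin> X" using \<delta> by force
      have "\<delta> \<le> dist x y" if "x \<in> insert z X" "y \<in> insert z X" "x \<noteq> y" for x y
        using that X(3) z(2)[of x] z(2)[of y] by (auto simp: dist_commute)
      then have "sep (insert z X)" using X(1,2) z(1) by (auto simp: sep_def)
      then have "card (insert z X) \<le> card X" by (rule Xmax)
      then show False using \<open>z \<notin> X\<close> X(1) by simp
    qed
    then have "hausdorff_content m (2 * \<delta>) ?S \<le> ennreal (unit_ball_vol (real m) * (real (card X) * \<delta> ^ m))"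
      using X(1) \<delta> n by (intro hausdorff_content_finite_cover) auto
    also have "\<dots> \<le> ennreal (unit_ball_vol (real m) * M)"
      using card[OF sX] by (intro ennreal_leI mult_left_mono) auto
    finally show ?thesis .
  qed
  have "hausdorff_outer_measure m ?S \<le> ennreal (unit_ball_vol (real m) * M)"
    unfolding hausdorff_outer_measure_def
  proof (rule SUP_least)
    fix d :: real assume "d \<in> {0<..}"
    then have d: "d > 0" by simp
    \<comment> \<open>Small enough for the packing bound, and with 2 \<delta> \<le> d, so that the
      content at the given scale d is at most the one at scale 2 \<delta>.\<close>
    define \<delta> where "\<delta> = min (d / 2) (min 1 (2 * \<tau>))"
    have \<delta>: "0 < \<delta>" "\<delta> \<le> 1" "\<delta> \<le> 2 * \<tau>" "2 * \<delta> \<le> d" using d \<tau> by (auto simp: \<delta>_def)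
    have "c * \<delta> \<le> 1 * \<delta>" using c \<delta> by (intro mult_right_mono) auto
    then have "c * \<delta> / 4 \<le> \<tau> / 2" using \<delta> by linarith
    from bound[OF \<delta>(1,2) this] hausdorff_content_antimono[OF \<delta>(4)]
    show "hausdorff_content m d ?S \<le> ennreal (unit_ball_vol (real m) * M)" by (rule order_trans[rotated])
  qed
  then show ?thesis using ennreal_less_top le_less_trans by blast
qed

text \<open>Compactness of the frontier patches the local bounds. Finiteness makes constants square
  integrable on the boundary and lets L2 convergence there pass to integrals against bounded
  weights.\<close>

lemma hausdorff_frontier_finite:
  fixes \<Omega> :: "'a::euclidean_space set"
  assumes "lipschitz_boundary \<Omega>" "open \<Omega>" "bounded \<Omega>" "DIM('a) \<ge> 2"
  shows "emeasure (hausdorff_measure (DIM('a) - 1)) (frontier \<Omega>) < top"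
proof -
  let ?m = "DIM('a) - 1"
  have n: "DIM('a) = Suc ?m" "?m \<ge> 1" using assms(4) by auto
  have "\<exists>r>0. hausdorff_outer_measure ?m (frontier \<Omega> \<inter> ball p r) < top" if p: "p \<in> frontier \<Omega>" for p
  proof -
    obtain e c r \<tau> where "norm e = 1" "0 < c" "c \<le> 1" "0 < r" "0 < \<tau>"
      "\<And>x t. x \<in> closure \<Omega> \<inter> ball p r \<Longrightarrow> 0 < t \<Longrightarrow> t < \<tau> \<Longrightarrow> ball (x + t *\<^sub>R e) (c * t) \<subseteq> \<Omega>"
      using lipschitz_boundary_cone[OF assms(1) p] by blast
    then show ?thesis using hausdorff_local_finite[OF n assms(2)] by blast
  qed
  then obtain r where r: "\<And>p. p \<in> frontier \<Omega> \<Longrightarrow> r p > 0 \<and> hausdorff_outer_measure ?m (frontier \<Omega> \<inter> ball p (r p)) < top"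
    by metis
  have "compact (frontier \<Omega>)" using assms(3) by (simp add: compact_frontier_bounded)
  then obtain D where D: "D \<subseteq> frontier \<Omega>" "finite D" "frontier \<Omega> \<subseteq> (\<Union>p\<in>D. ball p (r p))"
    using compactE_image[of "frontier \<Omega>" "frontier \<Omega>" "\<lambda>p. ball p (r p)"] r by (metis (no_types, lifting) UN_I centre_in_ball open_ball subsetI)
  have fb: "frontier \<Omega> \<inter> ball p \<rho> \<in> sets borel" for p \<rho>
    by (intro sets.Int borel_closed frontier_closed borel_open open_ball)
  have "emeasure (hausdorff_measure ?m) (frontier \<Omega>) \<le> emeasure (hausdorff_measure ?m) (\<Union>p\<in>D. frontier \<Omega> \<inter> ball p (r p))"
  proof (rule emeasure_mono)
    show "(\<Union>p\<in>D. frontier \<Omega> \<inter> ball p (r p)) \<in> sets (hausdorff_measure ?m)"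
      unfolding sets_hausdorff_measure by (intro sets.finite_UN fb D)
  qed (use D(3) in auto)
  also have "\<dots> \<le> (\<Sum>p\<in>D. emeasure (hausdorff_measure ?m) (frontier \<Omega> \<inter> ball p (r p)))"
    using D(2) fb by (intro emeasure_subadditive_finite) auto
  also have "\<dots> < top"
  proof -
    have "emeasure (hausdorff_measure ?m) (frontier \<Omega> \<inter> ball p (r p)) < top" if "p \<in> D" for p
    proof -
      have "p \<in> frontier \<Omega>" using that D(1) by blast
      from r[OF this] show ?thesis using n(2) by (subst emeasure_hausdorff_measure) auto
    qed
    then show ?thesis using D(2) by (simp add: less_top)
  qed
  finally show ?thesis .
qed

lemma finite_measure_boundary_measure:
  fixes \<Omega> :: "'a::euclidean_space set"
  assumes "lipschitz_boundary \<Omega>" "open \<Omega>" "bounded \<Omega>" "DIM('a) \<ge> 2"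
  shows "finite_measure (boundary_measure \<Omega>)"
  using hausdorff_frontier_finite[OF assms] unfolding boundary_measure_def
  by (intro finite_measureI) (auto simp: space_restrict_space emeasure_restrict_space less_top)

section \<open>Continuity of translations\<close>

lemma integrable_lborel_shift:
  fixes f :: "'a::euclidean_space \<Rightarrow> 'b::{banach, second_countable_topology}"
  assumes "integrable lborel f"
  shows "integrable lborel (\<lambda>x. f (x + h))"
proof -
  have "integrable (distr lborel borel ((+) h)) f" using assms by (simp add: lborel_distr_plus)
  then show ?thesis by (subst (asm) integrable_distr_eq) (use assms in \<open>auto simp: add.commute\<close>)
qed

lemma integral_lborel_shift:
  fixes f :: "'a::euclidean_space \<Rightarrow> 'b::{banach, second_countable_topology}"
  assumes "f \<in> borel_measurable borel"
  shows "(LINT x|lborel. f (x + h)) = (LINT x|lborel. f x)"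
proof -
  have "(LINT x|lborel. f x) = (LINT x|distr lborel borel ((+) h). f x)" by (simp add: lborel_distr_plus)
  also have "\<dots> = (LINT x|lborel. f (h + x))" by (rule integral_distr) (use assms in auto)
  finally show ?thesis by (simp add: add.commute)
qed

text \<open>The L1 modulus of continuity of f, as a function of the shift instead of a supremum over
  small shifts.\<close>

definition shift_dist :: "('a::euclidean_space \<Rightarrow> real) \<Rightarrow> 'a \<Rightarrow> real" where
  "shift_dist f h = (LINT x|lborel. \<bar>f (x + h) - f x\<bar>)"

lemma integrable_shift_diff:
  "integrable lborel f \<Longrightarrow> integrable lborel (\<lambda>x. \<bar>f (x + h) - f x\<bar> :: real)"
  by (intro integrable_abs Bochner_Integration.integrable_diff integrable_lborel_shift)

lemma shift_dist_nonneg: "shift_dist f h \<ge> 0"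
  unfolding shift_dist_def by simp

lemma shift_dist_add:
  assumes "integrable lborel f" "integrable lborel g"
  shows "shift_dist (\<lambda>x. f x + g x) h \<le> shift_dist f h + shift_dist g h"
proof -
  have "shift_dist (\<lambda>x. f x + g x) h \<le> (LINT x|lborel. \<bar>f (x + h) - f x\<bar> + \<bar>g (x + h) - g x\<bar>)"
    unfolding shift_dist_def
    using assms by (intro integral_mono Bochner_Integration.integrable_add integrable_shift_diff) auto
  also have "\<dots> = shift_dist f h + shift_dist g h"
    unfolding shift_dist_def using assms by (intro Bochner_Integration.integral_add integrable_shift_diff)
  finally show ?thesis .
qed

lemma shift_dist_le:
  assumes f: "integrable lborel f"
  shows "shift_dist f h \<le> 2 * (LINT x|lborel. \<bar>f x\<bar>)"
proof -
  have fs: "integrable lborel (\<lambda>x. f (x + h))" by (rule integrable_lborel_shift[OF f])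
  have "shift_dist f h \<le> (LINT x|lborel. \<bar>f (x + h)\<bar> + \<bar>f x\<bar>)"
    unfolding shift_dist_def
    using f fs by (intro integral_mono Bochner_Integration.integrable_add integrable_shift_diff integrable_abs) auto
  also have "\<dots> = (LINT x|lborel. \<bar>f (x + h)\<bar>) + (LINT x|lborel. \<bar>f x\<bar>)"
    using f fs by (intro Bochner_Integration.integral_add integrable_abs)
  also have "(LINT x|lborel. \<bar>f (x + h)\<bar>) = (LINT x|lborel. \<bar>f x\<bar>)"
    using f by (intro integral_lborel_shift) simp
  finally show ?thesis by simp
qed

lemma lmeasurable_inner_compact_approx:
  fixes A :: "'a::euclidean_space set"
  assumes A: "A \<in> lmeasurable" and e: "e > 0"
  obtains K where "compact K" "K \<subseteq> A" "measure lebesgue A < measure lebesgue K + e"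
proof -
  obtain T where T: "closed T" "T \<subseteq> A" "A - T \<in> lmeasurable" "emeasure lebesgue (A - T) < ennreal (e / 2)"
    using sets_lebesgue_inner_closed[of A "e / 2"] A e by auto
  have Tm: "T \<in> lmeasurable" using A T by (intro fmeasurableI2[OF A T(2)]) auto
  have "measure lebesgue (A - T) < e / 2"
    using T(3,4) e by (simp add: emeasure_eq_measure2 ennreal_less_iff)
  then have 1: "measure lebesgue A - measure lebesgue T < e / 2"
    using measurable_measure_Diff[OF A _ T(2)] Tm by auto
  have lim: "(\<lambda>n. measure lebesgue (T \<inter> cball 0 (real n))) \<longlonglongrightarrow> measure lebesgue (\<Union>n. T \<inter> cball 0 (real n))"
  proof (rule Lim_measure_incseq)
    show "range (\<lambda>n. T \<inter> cball 0 (real n)) \<subseteq> sets lebesgue" using Tm by auto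
    show "incseq (\<lambda>n. T \<inter> cball 0 (real n))" by (auto simp: incseq_def)
    have "(\<Union>n. T \<inter> cball 0 (real n)) \<subseteq> T" by auto
    then have "emeasure lebesgue (\<Union>n. T \<inter> cball 0 (real n)) \<le> emeasure lebesgue T"
      using Tm by (intro emeasure_mono) auto
    then show "emeasure lebesgue (\<Union>n. T \<inter> cball 0 (real n)) \<noteq> \<infinity>" using Tm by (auto simp: fmeasurable_def top_unique)
  qed
  have "(\<Union>n. T \<inter> cball 0 (real n)) = T" by (auto simp: real_arch_simple)
  with lim have "(\<lambda>n. measure lebesgue (T \<inter> cball 0 (real n))) \<longlonglongrightarrow> measure lebesgue T" by simp
  then have "\<forall>\<^sub>F n in sequentially. measure lebesgue T - e / 2 < measure lebesgue (T \<inter> cball 0 (real n))"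
    using e by (intro order_tendstoD(1)) auto
  then obtain n where "measure lebesgue T - e / 2 < measure lebesgue (T \<inter> cball 0 (real n))"
    by (auto simp: eventually_sequentially)
  then show thesis using 1 T by (intro that[of "T \<inter> cball 0 (real n)"]) (auto intro: closed_Int_compact)
qed

text \<open>A is squeezed between a compact K and an open U of nearly the same measure. Shifts
  shorter than the distance from K to the complement of U keep K inside U, and the integrand is then
  dominated by differences of indicators with total integral 2 (|U| - |K|), less than 4 e /
  5.\<close>

lemma shift_dist_indicator_tendsto_0:
  fixes A :: "'a::euclidean_space set"
  assumes A: "A \<in> sets borel" "emeasure lborel A < \<infinity>"
  shows "((\<lambda>h. shift_dist (indicator A) h) \<longlongrightarrow> 0) (at 0)"
proof (rule tendstoI)
  fix e :: real assume e: "e > 0"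
  have Al: "A \<in> lmeasurable" using A by (auto simp: fmeasurable_def)
  obtain K where K: "compact K" "K \<subseteq> A" "measure lebesgue A < measure lebesgue K + e / 5"
    using lmeasurable_inner_compact_approx[OF Al, of "e / 5"] e by auto
  obtain U where U: "open U" "A \<subseteq> U" "U \<in> lmeasurable" "measure lebesgue U < measure lebesgue A + e / 5"
  proof -
    obtain U where U: "open U" "A \<subseteq> U" "U - A \<in> lmeasurable" "emeasure lebesgue (U - A) < ennreal (e / 5)"
      using sets_lebesgue_outer_open[of A "e / 5"] Al e by auto
    have "measure lebesgue (U - A) < e / 5"
      using U(3,4) e by (simp add: emeasure_eq_measure2 ennreal_less_iff)
    moreover have Ueq: "A \<union> (U - A) = U" using U(2) by blast
    moreover have "measure lebesgue (A \<union> (U - A)) = measure lebesgue A + measure lebesgue (U - A)"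
      using Al U(3) by (intro measure_Un2[THEN trans]) auto
    moreover have "A \<union> (U - A) \<in> lmeasurable" using Al U(3) by (intro fmeasurable.Un)
    ultimately show thesis using that[OF U(1,2)] unfolding Ueq by linarith
  qed
  obtain d where d: "d > 0" "\<And>x y. x \<in> K \<Longrightarrow> dist x y < d \<Longrightarrow> y \<in> U"
  proof -
    have "\<exists>d>0. \<forall>x\<in>K. \<forall>y\<in>- U. d \<le> dist x y"
      by (rule separate_compact_closed) (use K U in auto)
    then show thesis using that by (metis ComplI not_le)
  qed
  have Kb: "K \<in> sets borel" "U \<in> sets borel" using K(1) U(1) by (auto intro: borel_compact)
  have Kf: "emeasure lborel K < \<infinity>" using K(1) emeasure_bounded_finite compact_imp_bounded by blast
  have Uf: "emeasure lborel U < \<infinity>" using U(3) Kb by (auto simp: fmeasurable_def)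
  have iU: "integrable lborel (indicator U :: 'a \<Rightarrow> real)" and iK: "integrable lborel (indicator K :: 'a \<Rightarrow> real)" and iA: "integrable lborel (indicator A :: 'a \<Rightarrow> real)"
    using Uf Kf A Kb by (auto intro!: integrable_real_indicator)
  have mU: "(LINT x|lborel. indicator U x :: real) = measure lebesgue U" and mK: "(LINT x|lborel. indicator K x :: real) = measure lebesgue K"
    using Kb by auto
  have "shift_dist (indicator A) h < e" if h: "norm h < d" for h
  proof -
    \<comment> \<open>Both brackets are nonnegative by the choice of d. The first is 1 when x is in
      A and x + h is not, the second in the opposite case.\<close>
    have *: "\<bar>indicator A (x + h) - indicator A x\<bar> \<le> (indicator U x - indicator K (x + h)) + (indicator U (x + h) - indicator K x :: real)" for x
    proof -
      have "K \<subseteq> U" using K U by auto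
      have "x \<in> K \<Longrightarrow> x + h \<in> U" using d(2)[of x "x + h"] h by (simp add: dist_norm)
      moreover have "x + h \<in> K \<Longrightarrow> x \<in> U" using d(2)[of "x + h" x] h by (simp add: dist_norm)
      ultimately show ?thesis using K(2) U(2) by (auto simp: indicator_def)
    qed
    have iUs: "integrable lborel (\<lambda>x. indicator U (x + h) :: real)" and iKs: "integrable lborel (\<lambda>x. indicator K (x + h) :: real)"
      by (intro integrable_lborel_shift iU iK)+
    have "shift_dist (indicator A) h \<le> (LINT x|lborel. (indicator U x - indicator K (x + h)) + (indicator U (x + h) - indicator K x :: real))"
      unfolding shift_dist_def
      by (intro integral_mono integrable_shift_diff Bochner_Integration.integrable_add Bochner_Integration.integrable_diff iU iK iA iUs iKs *)
    also have "\<dots> = ((LINT x|lborel. indicator U x :: real) - (LINT x|lborel. indicator K (x + h) :: real)) + ((LINT x|lborel. indicator U (x + h) :: real) - (LINT x|lborel. indicator K x :: real))"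
      by (subst Bochner_Integration.integral_add Bochner_Integration.integral_diff, (intro Bochner_Integration.integrable_diff iU iK iUs iKs)+)+ simp
    also have "(LINT x|lborel. indicator U (x + h) :: real) = (LINT x|lborel. indicator U x :: real)"
      using Kb by (intro integral_lborel_shift) auto
    also have "(LINT x|lborel. indicator K (x + h) :: real) = (LINT x|lborel. indicator K x :: real)"
      using Kb by (intro integral_lborel_shift) auto
    finally show ?thesis unfolding mU mK using K(3) U(4) e by linarith
  qed
  then show "\<forall>\<^sub>F h in at 0. dist (shift_dist (indicator A) h) 0 < e"
    using d(1) unfolding eventually_at by (intro exI[of _ d]) (auto simp: abs_of_nonneg[OF shift_dist_nonneg])
qed

lemma shift_dist_tendsto_0:
  fixes f :: "'a::euclidean_space \<Rightarrow> real"
  assumes "integrable lborel f"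
  shows "((\<lambda>h. shift_dist f h) \<longlongrightarrow> 0) (at 0)"
  using assms
proof (induction rule: integrable_induct)
  case (base A c)
  have "shift_dist (\<lambda>x. indicator A x *\<^sub>R c) h = \<bar>c\<bar> * shift_dist (indicator A) h" for h
  proof -
    have "\<bar>indicator A (x + h) *\<^sub>R c - indicator A x *\<^sub>R c\<bar> = \<bar>c\<bar> * \<bar>indicator A (x + h) - indicator A x\<bar>" for x
      by (simp add: left_diff_distrib[symmetric] abs_mult mult.commute[of _ "\<bar>c\<bar>"])
    then show ?thesis unfolding shift_dist_def by simp
  qed
  moreover have "((\<lambda>h. \<bar>c\<bar> * shift_dist (indicator A) h) \<longlongrightarrow> \<bar>c\<bar> * 0) (at 0)"
    using base by (intro tendsto_mult tendsto_const shift_dist_indicator_tendsto_0) auto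
  ultimately show ?case by simp
next
  case (add f g)
  show ?case
  proof (rule tendsto_sandwich[of "\<lambda>_. 0"])
    show "((\<lambda>h. shift_dist f h + shift_dist g h) \<longlongrightarrow> 0) (at 0)" using tendsto_add[OF add.IH] by simp
  qed (intro always_eventually allI shift_dist_nonneg shift_dist_add[OF add.hyps(1,2)] tendsto_const)+
next
  case (lim f s)
  have meas: "f \<in> borel_measurable lborel" using lim by simp
  have conv: "(\<lambda>i. LINT x|lborel. \<bar>f x - s i x\<bar>) \<longlonglongrightarrow> (LINT x|(lborel :: 'a measure). 0)"
  proof (rule integral_dominated_convergence[where w = "\<lambda>x. 3 * norm (f x)"])
    show "AE x in lborel. (\<lambda>i. \<bar>f x - s i x\<bar>) \<longlonglongrightarrow> 0"
    proof (rule AE_I2)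
      fix x assume "x \<in> space (lborel :: 'a measure)"
      from lim.hyps(2)[OF this] have "(\<lambda>i. \<bar>f x - s i x\<bar>) \<longlonglongrightarrow> \<bar>f x - f x\<bar>"
        by (intro tendsto_intros)
      then show "(\<lambda>i. \<bar>f x - s i x\<bar>) \<longlonglongrightarrow> 0" by simp
    qed
    show "AE x in lborel. norm \<bar>f x - s i x\<bar> \<le> 3 * norm (f x)" for i
    proof (rule AE_I2)
      fix x assume "x \<in> space (lborel :: 'a measure)"
      from lim.hyps(3)[OF this, of i] show "norm \<bar>f x - s i x\<bar> \<le> 3 * norm (f x)" by simp
    qed
  qed (use lim meas in auto)
  show ?case
  proof (rule tendstoI)
    fix e :: real assume e: "e > 0"
    from conv have "\<forall>\<^sub>F i in sequentially. (LINT x|lborel. \<bar>f x - s i x\<bar>) < e / 4"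
      using e by (intro order_tendstoD(2)) auto
    then obtain i where i: "(LINT x|lborel. \<bar>f x - s i x\<bar>) < e / 4"
      by (auto simp: eventually_sequentially)
    have int: "integrable lborel (\<lambda>x. f x - s i x)" using lim by auto
    \<comment> \<open>f is within e / 4 of a simple function in L1, which costs at most twice as
      much in the modulus.\<close>
    have le: "shift_dist f h \<le> shift_dist (s i) h + e / 2" for h
    proof -
      have "shift_dist f h \<le> shift_dist (\<lambda>x. f x - s i x) h + shift_dist (s i) h"
        using shift_dist_add[OF int lim.hyps(1)[of i], of h] by simp
      also have "shift_dist (\<lambda>x. f x - s i x) h \<le> 2 * (e / 4)"
        using shift_dist_le[OF int, of h] i by linarith
      finally show ?thesis by simp
    qed
    have "\<forall>\<^sub>F h in at 0. shift_dist (s i) h < e / 2"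
      using e lim.IH[of i] by (intro order_tendstoD(2)) auto
    then show "\<forall>\<^sub>F h in at 0. dist (shift_dist f h) 0 < e"
    proof eventually_elim
      case (elim h)
      then have "shift_dist f h < e" using le[of h] by simp
      then show ?case by (simp add: abs_of_nonneg[OF shift_dist_nonneg])
    qed
  qed
qed

text \<open>Continuity of translations has been shown in L1. The integrable function k = g |g|
  transfers it to a square integrable g, because the squared increment of g is at most twice the
  increment of k in absolute value.\<close>

lemma correlation_tendsto:
  fixes g :: "'a::euclidean_space \<Rightarrow> real"
  assumes g: "g \<in> borel_measurable borel" "integrable lborel (\<lambda>x. (g x)\<^sup>2)"
  shows "integrable lborel (\<lambda>x. g (x + h) * g x)"
    and "((\<lambda>h. LINT x|lborel. g (x + h) * g x) \<longlongrightarrow> (LINT x|lborel. (g x)\<^sup>2)) (at 0)"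
    and "\<bar>LINT x|lborel. g (x + h) * g x\<bar> \<le> (LINT x|lborel. (g x)\<^sup>2)"
proof -
  have gs: "integrable lborel (\<lambda>x. (g (x + h))\<^sup>2)" for h
    using integrable_lborel_shift[OF g(2)] by simp
  have gse: "(LINT x|lborel. (g (x + h))\<^sup>2) = (LINT x|lborel. (g x)\<^sup>2)" for h
    using g(1) by (intro integral_lborel_shift[where f = "\<lambda>x. (g x)\<^sup>2"]) auto
  have meas: "(\<lambda>x. g (x + h)) \<in> borel_measurable lborel" for h using g(1) by simp
  have ab: "\<bar>a * b\<bar> \<le> (a\<^sup>2 + b\<^sup>2) / 2" for a b :: real
  proof -
    have "0 \<le> (\<bar>a\<bar> - \<bar>b\<bar>)\<^sup>2" by simp
    then show ?thesis by (simp add: power2_diff abs_mult)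
  qed
  show int: "integrable lborel (\<lambda>x. g (x + h) * g x)" for h
  proof (rule Bochner_Integration.integrable_bound)
    show "integrable lborel (\<lambda>x. ((g (x + h))\<^sup>2 + (g x)\<^sup>2) / 2)" using gs g(2) by simp
    show "(\<lambda>x. g (x + h) * g x) \<in> borel_measurable lborel" using meas g(1) by simp
    show "AE x in lborel. norm (g (x + h) * g x) \<le> norm (((g (x + h))\<^sup>2 + (g x)\<^sup>2) / 2)" using ab by simp
  qed
  have "\<bar>LINT x|lborel. g (x + h) * g x\<bar> \<le> (LINT x|lborel. ((g (x + h))\<^sup>2 + (g x)\<^sup>2) / 2)"
    using gs g(2) int ab by (intro order_trans[OF integral_abs_bound] integral_mono) auto
  also have "\<dots> = (LINT x|lborel. (g x)\<^sup>2)" using gs g(2) gse by simp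
  finally show "\<bar>LINT x|lborel. g (x + h) * g x\<bar> \<le> (LINT x|lborel. (g x)\<^sup>2)" .
  define k where "k x = g x * \<bar>g x\<bar>" for x
  have k: "integrable lborel k"
    by (rule Bochner_Integration.integrable_bound[OF g(2)]) (use g(1) in \<open>auto simp: k_def[abs_def] power2_eq_square abs_mult\<close>)
  \<comment> \<open>For equal signs this holds even with factor 1, because |a - b| \<le> |a + b|;
    for opposite signs the right side is 2 (a^2 + b^2).\<close>
  have sq: "(a - b)\<^sup>2 \<le> 2 * \<bar>a * \<bar>a\<bar> - b * \<bar>b\<bar>\<bar>" for a b :: real
  proof -
    have *: "(a - b)\<^sup>2 \<le> 2 * \<bar>a * a - b * b\<bar>" if "a \<ge> 0" "b \<ge> 0" for a b :: real
    proof -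
      have "(a - b)\<^sup>2 = \<bar>a - b\<bar> * \<bar>a - b\<bar>" by (simp add: power2_eq_square)
      also have "\<dots> \<le> \<bar>a - b\<bar> * (a + b)" using that by (intro mult_left_mono) auto
      also have "\<dots> = \<bar>a * a - b * b\<bar>" using that by (simp add: square_diff_square_factored abs_mult)
      finally have "(a - b)\<^sup>2 \<le> \<bar>a * a - b * b\<bar>" .
      then show ?thesis by (rule order_trans) simp
    qed
    have **: "(a - b)\<^sup>2 \<le> 2 * (a * a + b * b)" for a b :: real
      using zero_le_power2[of "a + b"] by (simp add: power2_eq_square algebra_simps)
    consider "a \<ge> 0" "b \<ge> 0" | "a \<le> 0" "b \<le> 0" | "a \<ge> 0" "b < 0" | "a < 0" "b \<ge> 0" by linarith
    then show ?thesis
    proof cases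
      case 1 then show ?thesis using *[of a b] by simp
    next
      case 2 then show ?thesis using *[of "- a" "- b"] by (simp add: power2_commute abs_minus_commute)
    next
      case 3
      then have "\<bar>a * \<bar>a\<bar> - b * \<bar>b\<bar>\<bar> = a * a + b * b" by simp
      then show ?thesis using **[of a b] by simp
    next
      case 4
      then have "a * \<bar>a\<bar> - b * \<bar>b\<bar> = - (a * a + b * b)" by simp
      then have "\<bar>a * \<bar>a\<bar> - b * \<bar>b\<bar>\<bar> = a * a + b * b" by simp
      then show ?thesis using **[of a b] by simp
    qed
  qed
  have dist: "\<bar>(LINT x|lborel. g (x + h) * g x) - (LINT x|lborel. (g x)\<^sup>2)\<bar> \<le> shift_dist k h" for h
  proof -
    have isq: "integrable lborel (\<lambda>x. (g (x + h) - g x)\<^sup>2)"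
      using gs[of h] g(2) int[of h] unfolding power2_diff by (simp add: mult.assoc)
    have "(LINT x|lborel. (g (x + h) - g x)\<^sup>2) = (LINT x|lborel. (g (x + h))\<^sup>2 + (g x)\<^sup>2 - 2 * (g (x + h) * g x))"
      by (simp add: power2_diff mult.assoc)
    also have "\<dots> = 2 * ((LINT x|lborel. (g x)\<^sup>2) - (LINT x|lborel. g (x + h) * g x))"
      using gs[of h] g(2) int[of h] gse[of h] by simp
    finally have eq: "(LINT x|lborel. (g x)\<^sup>2) - (LINT x|lborel. g (x + h) * g x) = (LINT x|lborel. (g (x + h) - g x)\<^sup>2) / 2" by simp
    have "(LINT x|lborel. (g (x + h) - g x)\<^sup>2) \<le> (LINT x|lborel. 2 * \<bar>k (x + h) - k x\<bar>)"
      using sq isq integrable_shift_diff[OF k] by (intro integral_mono) (auto simp: k_def)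
    also have "\<dots> = 2 * shift_dist k h" by (simp add: shift_dist_def)
    finally have "(LINT x|lborel. (g (x + h) - g x)\<^sup>2) / 2 \<le> shift_dist k h" by simp
    moreover have "0 \<le> (LINT x|lborel. (g (x + h) - g x)\<^sup>2) / 2" by simp
    ultimately show ?thesis using eq by linarith
  qed
  show "((\<lambda>h. LINT x|lborel. g (x + h) * g x) \<longlongrightarrow> (LINT x|lborel. (g x)\<^sup>2)) (at 0)"
  proof (rule Lim_transform)
    show "((\<lambda>h. (LINT x|lborel. (g x)\<^sup>2)) \<longlongrightarrow> (LINT x|lborel. (g x)\<^sup>2)) (at 0)" by simp
    show "((\<lambda>h. (LINT x|lborel. g (x + h) * g x) - (LINT x|lborel. (g x)\<^sup>2)) \<longlongrightarrow> 0) (at 0)"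
      by (rule tendsto_0_le[OF shift_dist_tendsto_0[OF k], of _ 1]) (use dist in \<open>auto intro!: always_eventually simp: abs_of_nonneg[OF shift_dist_nonneg]\<close>)
  qed
qed

section \<open>The divergence theorem up to the lateral boundary\<close>

text \<open>Thickening bounds volumes only, so S is cut into slices on which |\<psi>| varies by at
  most e1. Each slice is thickened separately, and \<psi> changes little along short segments; the
  sum of level times slice measure is at most the integral of |\<psi>| over S. The thickening
  property is a hypothesis so that the same K appears for every \<psi> in
  \<open>green\<close>.\<close>

lemma thickening_integral:
  fixes S :: "'e::euclidean_space set" and \<psi> :: "'e \<Rightarrow> real"
  assumes m: "m \<ge> 1" and K: "K > 0"
    and thick: "\<And>A b s e. hausdorff_outer_measure m (A :: 'e set) < top \<Longrightarrow> norm b \<le> 1 \<Longrightarrow> 0 < s \<Longrightarrow> 0 < e \<Longrightarrow>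
      \<exists>W\<in>sets borel. {p + t *\<^sub>R b |p t. p \<in> A \<and> 0 \<le> t \<and> t \<le> s} \<subseteq> W \<and>
      emeasure lborel W \<le> ennreal (K * s) * (hausdorff_outer_measure m A + ennreal e)"
    and S: "S \<in> sets borel" "bounded S" "hausdorff_outer_measure m S < top"
    and \<psi>: "continuous_on UNIV \<psi>" and b: "norm b \<le> 1" and e: "0 < (e::real)"
  shows "\<exists>s0>0. \<forall>s Z. 0 < s \<and> s \<le> s0 \<and> Z \<in> sets borel \<and> Z \<subseteq> {p + t *\<^sub>R b |p t. p \<in> S \<and> 0 \<le> t \<and> t \<le> s} \<longrightarrow>
     (\<integral>\<^sup>+x. ennreal (\<bar>\<psi> x\<bar> * indicator Z x) \<partial>lborel) \<le> ennreal (s * (K * (LINT x|hausdorff_measure m. \<bar>\<psi> x\<bar> * indicator S x) + e))"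
proof -
  let ?H = "hausdorff_measure m :: 'e measure"
  define h where "h A = measure ?H A" for A
  have Hfin: "emeasure ?H A < top" if "A \<in> sets borel" "A \<subseteq> S" for A
  proof -
    have "emeasure ?H A \<le> emeasure ?H S" using that S by (intro emeasure_mono) auto
    also have "\<dots> < top" using S m by (simp add: emeasure_hausdorff_measure)
    finally show ?thesis .
  qed
  have hA: "hausdorff_outer_measure m A = ennreal (h A)" if "A \<in> sets borel" "A \<subseteq> S" for A
    using Hfin[OF that] that m by (simp add: h_def emeasure_hausdorff_measure[symmetric] emeasure_eq_ennreal_measure less_top)
  have h0: "h A \<ge> 0" for A by (simp add: h_def)
  obtain R where R: "\<And>x. x \<in> S \<Longrightarrow> norm x \<le> R" using S(2) by (auto simp: bounded_iff)
  have "compact (cball (0::'e) (R + 1))" by simp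
  moreover have \<psi>c: "continuous_on (cball 0 (R + 1)) \<psi>" using \<psi> continuous_on_subset by blast
  ultimately obtain M where M: "\<And>x. x \<in> cball 0 (R + 1) \<Longrightarrow> \<bar>\<psi> x\<bar> \<le> M"
    using compact_continuous_image[THEN compact_imp_bounded] by (force simp: bounded_iff)
  \<comment> \<open>The width e1 is paid twice, for rounding |\<psi>| to a level and for its change
    along a segment, which together cost 2 e1 K h(S) \<le> e / 2. The other half of e is spent on
    e2, the slack in thickening each slice.\<close>
  define e1 where "e1 = e / (4 * K * (h S + 1))"
  have e1: "e1 > 0" using e K h0[of S] by (simp add: e1_def add_nonneg_pos)
  have e1h: "2 * e1 * K * h S \<le> e / 2"
  proof -
    have "2 * e1 * K * h S \<le> 2 * e1 * K * (h S + 1)" using e1 K by (intro mult_left_mono) auto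
    also have "\<dots> = e / 2" using K h0[of S] by (simp add: e1_def field_simps add_nonneg_eq_0_iff)
    finally show ?thesis .
  qed
  define N where "N = nat \<lceil>M / e1\<rceil> + 1"
  define Sk where "Sk k = {p \<in> S. real k * e1 \<le> \<bar>\<psi> p\<bar> \<and> \<bar>\<psi> p\<bar> < (real k + 1) * e1}" for k
  have \<psi>m: "\<psi> \<in> borel_measurable borel" using \<psi> by (rule borel_measurable_continuous_onI)
  have Skb: "Sk k \<in> sets borel" for k
  proof -
    have "Sk k = S \<inter> {p \<in> space borel. real k * e1 \<le> \<bar>\<psi> p\<bar> \<and> \<bar>\<psi> p\<bar> < (real k + 1) * e1}" by (auto simp: Sk_def)
    also have "\<dots> \<in> sets borel"
    proof (rule sets.Int[OF S(1)])
      note [measurable] = \<psi>m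
      show "{p \<in> space borel. real k * e1 \<le> \<bar>\<psi> p\<bar> \<and> \<bar>\<psi> p\<bar> < (real k + 1) * e1} \<in> sets borel" by measurable
    qed
    finally show ?thesis .
  qed
  have SkS: "Sk k \<subseteq> S" for k by (auto simp: Sk_def)
  have Sk_ex: "\<exists>k<N. p \<in> Sk k" if "p \<in> S" for p
  proof (intro exI conjI)
    let ?k = "nat \<lfloor>\<bar>\<psi> p\<bar> / e1\<rfloor>"
    have q0: "0 \<le> \<bar>\<psi> p\<bar> / e1" using e1 by simp
    have k: "real ?k \<le> \<bar>\<psi> p\<bar> / e1" "\<bar>\<psi> p\<bar> / e1 < real ?k + 1"
    proof -
      have "real ?k = of_int \<lfloor>\<bar>\<psi> p\<bar> / e1\<rfloor>" using q0 by simp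
      then show "real ?k \<le> \<bar>\<psi> p\<bar> / e1" "\<bar>\<psi> p\<bar> / e1 < real ?k + 1" by linarith+
    qed
    show "p \<in> Sk ?k"
      unfolding Sk_def using that k(1)[unfolded pos_le_divide_eq[OF e1]] k(2)[unfolded pos_divide_less_eq[OF e1]] by blast
    have "\<bar>\<psi> p\<bar> \<le> M" using M[of p] R[OF that] by simp
    then have "\<bar>\<psi> p\<bar> / e1 \<le> M / e1" using e1 by (intro divide_right_mono) auto
    with k(1) show "?k < N" unfolding N_def by linarith
  qed
  have disj: "disjoint_family_on Sk {..<N}"
    unfolding disjoint_family_on_def
  proof (intro ballI impI)
    have *: "Sk k \<inter> Sk l = {}" if "k < l" for k l
    proof -
      have "(real k + 1) * e1 \<le> real l * e1" using that e1 by (intro mult_right_mono) auto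
      then show ?thesis by (auto simp: Sk_def)
    qed
    fix k l :: nat assume "k \<noteq> l"
    then show "Sk k \<inter> Sk l = {}" using *[of k l] *[of l k] by (cases k l rule: linorder_cases) auto
  qed
  have sum_h: "(\<Sum>k<N. h (Sk k)) \<le> h S"
  proof -
    have "(\<Sum>k<N. h (Sk k)) = measure ?H (\<Union>k<N. Sk k)"
      unfolding h_def using disj Hfin[OF Skb SkS] Skb by (intro measure_finite_Union[symmetric]) (auto simp: less_top)
    also have "\<dots> \<le> measure ?H S"
      using SkS S Skb Hfin[of S] by (intro measure_mono_fmeasurable) (auto simp: fmeasurable_def)
    finally show ?thesis by (simp add: h_def)
  qed
  define I where "I = (LINT x|?H. \<bar>\<psi> x\<bar> * indicator S x)"
  have int_ind: "integrable ?H (indicator A :: 'e \<Rightarrow> real)" if "A \<in> sets borel" "A \<subseteq> S" for A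
    using Hfin[OF that] that by (intro integrable_real_indicator) auto
  have int_\<psi>: "integrable ?H (\<lambda>x. \<bar>\<psi> x\<bar> * indicator S x)"
  proof (rule Bochner_Integration.integrable_bound)
    show "integrable ?H (\<lambda>x. M * indicator S x)" using int_ind[of S] S by simp
    show "(\<lambda>x. \<bar>\<psi> x\<bar> * indicator S x) \<in> borel_measurable ?H" using \<psi>m S by simp
    show "AE x in ?H. norm (\<bar>\<psi> x\<bar> * indicator S x) \<le> norm (M * indicator S x)"
    proof (rule AE_I2)
      fix x show "norm (\<bar>\<psi> x\<bar> * indicator S x) \<le> norm (M * indicator S x)"
        using M[of x] R[of x] by (auto simp: indicator_def)
    qed
  qed
  have sum_I: "(\<Sum>k<N. real k * e1 * h (Sk k)) \<le> I"
  proof -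
    have "(\<Sum>k<N. real k * e1 * h (Sk k)) = (\<Sum>k<N. LINT x|?H. real k * e1 * indicator (Sk k) x)"
      using Skb by (simp add: h_def)
    also have "\<dots> = (LINT x|?H. (\<Sum>k<N. real k * e1 * indicator (Sk k) x))"
      using int_ind[OF Skb SkS] by (intro Bochner_Integration.integral_sum[symmetric]) auto
    also have "\<dots> \<le> I" unfolding I_def
    proof (rule integral_mono[OF _ int_\<psi>])
      show "integrable ?H (\<lambda>x. \<Sum>k<N. real k * e1 * indicator (Sk k) x)"
        using int_ind[OF Skb SkS] by (intro Bochner_Integration.integrable_sum) auto
      fix x
      show "(\<Sum>k<N. real k * e1 * indicator (Sk k) x) \<le> \<bar>\<psi> x\<bar> * indicator S x"
      proof (cases "x \<in> S")
        case True
        then obtain k where k: "k < N" "x \<in> Sk k" using Sk_ex by blast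
        have "(\<Sum>l<N. real l * e1 * indicator (Sk l) x) = (\<Sum>l<N. if l = k then real k * e1 else 0)"
          using disj k by (intro sum.cong) (auto simp: indicator_def disjoint_family_on_def)
        also have "\<dots> \<le> \<bar>\<psi> x\<bar>" using k by (simp add: Sk_def)
        finally show ?thesis using True by simp
      next
        case False
        then have "x \<notin> Sk k" for k using SkS by blast
        then show ?thesis using False by simp
      qed
    qed
    finally show ?thesis .
  qed
  define T where "T = (\<Sum>k<N. (real k + 2) * e1)"
  have T0: "T \<ge> 0" unfolding T_def using e1 by (intro sum_nonneg) auto
  define e2 where "e2 = e / (2 * K * (T + 1))"
  have e2: "e2 > 0" using e K T0 by (simp add: e2_def add_nonneg_pos)
  have e2T: "K * e2 * T \<le> e / 2"
  proof -
    have "K * e2 * T \<le> K * e2 * (T + 1)" using e2 K by (intro mult_left_mono) auto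
    also have "\<dots> = e / 2" using K T0 by (simp add: e2_def field_simps add_nonneg_eq_0_iff)
    finally show ?thesis .
  qed
  have "uniformly_continuous_on (cball 0 (R + 1)) \<psi>"
    using \<psi>c by (intro compact_uniformly_continuous) auto
  then obtain d where d: "d > 0" "\<And>x y. x \<in> cball 0 (R + 1) \<Longrightarrow> y \<in> cball 0 (R + 1) \<Longrightarrow> dist y x < d \<Longrightarrow> dist (\<psi> y) (\<psi> x) < e1"
    using e1 unfolding uniformly_continuous_on_def by metis
  define s0 where "s0 = min 1 (d / 2)"
  show ?thesis
  proof (intro exI[of _ s0] conjI allI impI)
    show "s0 > 0" using d by (simp add: s0_def)
    fix s Z assume "0 < s \<and> s \<le> s0 \<and> Z \<in> sets borel \<and> Z \<subseteq> {p + t *\<^sub>R b |p t. p \<in> S \<and> 0 \<le> t \<and> t \<le> s}"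
    then have s: "0 < s" "s \<le> 1" "s < d" and Z: "Z \<in> sets borel" "Z \<subseteq> {p + t *\<^sub>R b |p t. p \<in> S \<and> 0 \<le> t \<and> t \<le> s}"
      using d by (auto simp: s0_def)
    have ex: "\<exists>W. W \<in> sets borel \<and> {p + t *\<^sub>R b |p t. p \<in> Sk k \<and> 0 \<le> t \<and> t \<le> s} \<subseteq> W \<and>
      emeasure lborel W \<le> ennreal (K * s) * (ennreal (h (Sk k)) + ennreal e2)" for k
    proof -
      have "hausdorff_outer_measure m (Sk k) < top" unfolding hA[OF Skb SkS] by simp
      from thick[OF this b s(1) e2] show ?thesis unfolding hA[OF Skb SkS] by blast
    qed
    from choice[OF allI[OF ex]] obtain W where
      W: "\<forall>k. W k \<in> sets borel \<and> {p + t *\<^sub>R b |p t. p \<in> Sk k \<and> 0 \<le> t \<and> t \<le> s} \<subseteq> W k \<and>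
        emeasure lborel (W k) \<le> ennreal (K * s) * (ennreal (h (Sk k)) + ennreal e2)" ..
    then have Wb: "W k \<in> sets borel" and Ws: "{p + t *\<^sub>R b |p t. p \<in> Sk k \<and> 0 \<le> t \<and> t \<le> s} \<subseteq> W k"
      and We: "emeasure lborel (W k) \<le> ennreal (K * s) * (ennreal (h (Sk k)) + ennreal e2)" for k
      by blast+
    \<comment> \<open>The coefficient k + 2 is the upper end k + 1 of the level, plus one more e1
      for the change of \<psi> from p to x.\<close>
    have pt: "\<bar>\<psi> x\<bar> * indicator Z x \<le> (\<Sum>k<N. (real k + 2) * e1 * indicator (W k) x)" for x
    proof (cases "x \<in> Z")
      case True
      then obtain p t where p: "x = p + t *\<^sub>R b" "p \<in> S" "0 \<le> t" "t \<le> s" using Z(2) by blast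
      obtain k where k: "k < N" "p \<in> Sk k" using Sk_ex[OF p(2)] by blast
      have "x \<in> W k" using Ws[of k] p k by blast
      have xp: "dist x p \<le> s"
      proof -
        have "dist x p = \<bar>t\<bar> * norm b" unfolding p(1) by (simp add: dist_norm)
        also have "\<dots> \<le> s * 1" using p b by (intro mult_mono) auto
        finally show ?thesis by simp
      qed
      have "norm x \<le> R + 1"
        using xp norm_triangle_ineq[of p "x - p"] R[OF p(2)] s by (simp add: dist_norm)
      then have "dist (\<psi> x) (\<psi> p) < e1" using R[OF p(2)] xp s by (intro d) auto
      then have "\<bar>\<psi> x\<bar> \<le> (real k + 2) * e1" using k(2) by (auto simp: Sk_def dist_real_def algebra_simps)
      also have "\<dots> = (real k + 2) * e1 * indicator (W k) x" using \<open>x \<in> W k\<close> by simp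
      also have "\<dots> \<le> (\<Sum>k<N. (real k + 2) * e1 * indicator (W k) x)"
        using k e1 by (intro member_le_sum) auto
      finally show ?thesis using True by simp
    next
      case False
      then show ?thesis using e1 by (auto intro!: sum_nonneg)
    qed
    have "(\<integral>\<^sup>+x. ennreal (\<bar>\<psi> x\<bar> * indicator Z x) \<partial>lborel) \<le> (\<integral>\<^sup>+x. (\<Sum>k<N. ennreal ((real k + 2) * e1) * indicator (W k) x) \<partial>lborel)"
    proof (rule nn_integral_mono)
      fix x
      have "ennreal (\<bar>\<psi> x\<bar> * indicator Z x) \<le> ennreal (\<Sum>k<N. (real k + 2) * e1 * indicator (W k) x)"
        using pt by (rule ennreal_leI)
      also have "\<dots> = (\<Sum>k<N. ennreal ((real k + 2) * e1 * indicator (W k) x))"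
        using e1 by (intro sum_ennreal[symmetric]) auto
      also have "\<dots> = (\<Sum>k<N. ennreal ((real k + 2) * e1) * indicator (W k) x)"
        by (intro sum.cong) (auto simp: indicator_def)
      finally show "ennreal (\<bar>\<psi> x\<bar> * indicator Z x) \<le> (\<Sum>k<N. ennreal ((real k + 2) * e1) * indicator (W k) x)" .
    qed
    also have "\<dots> = (\<Sum>k<N. ennreal ((real k + 2) * e1) * emeasure lborel (W k))"
      using Wb by (subst nn_integral_sum) (auto simp: nn_integral_cmult_indicator)
    also have "\<dots> \<le> (\<Sum>k<N. ennreal ((real k + 2) * e1 * (K * s * (h (Sk k) + e2))))"
    proof (rule sum_mono)
      fix k
      have "ennreal ((real k + 2) * e1) * emeasure lborel (W k) \<le> ennreal ((real k + 2) * e1) * (ennreal (K * s) * (ennreal (h (Sk k)) + ennreal e2))"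
        by (intro mult_left_mono We) auto
      also have "\<dots> = ennreal ((real k + 2) * e1 * (K * s * (h (Sk k) + e2)))"
        using e1 e2 K s h0 by (simp add: ennreal_mult)
      finally show "ennreal ((real k + 2) * e1) * emeasure lborel (W k) \<le> ennreal ((real k + 2) * e1 * (K * s * (h (Sk k) + e2)))" .
    qed
    also have "\<dots> = ennreal (\<Sum>k<N. (real k + 2) * e1 * (K * s * (h (Sk k) + e2)))"
      using e1 e2 K s h0 by (intro sum_ennreal) (auto intro!: mult_nonneg_nonneg add_nonneg_nonneg)
    also have "\<dots> \<le> ennreal (s * (K * I + e))"
    proof (rule ennreal_leI)
      have "(\<Sum>k<N. (real k + 2) * e1 * (K * s * (h (Sk k) + e2))) =
        K * s * ((\<Sum>k<N. real k * e1 * h (Sk k)) + 2 * e1 * (\<Sum>k<N. h (Sk k)) + e2 * T)"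
        unfolding T_def sum_distrib_left sum.distrib[symmetric] by (intro sum.cong) (auto simp: algebra_simps)
      also have "\<dots> \<le> K * s * (I + 2 * e1 * h S + e2 * T)"
        using K s e1 e2 T0 sum_I sum_h by (intro mult_left_mono add_mono) auto
      also have "\<dots> = s * (K * I + 2 * e1 * K * h S + K * e2 * T)" by (simp add: algebra_simps)
      also have "\<dots> \<le> s * (K * I + e)" using s e1h e2T by (intro mult_left_mono) auto
      finally show "(\<Sum>k<N. (real k + 2) * e1 * (K * s * (h (Sk k) + e2))) \<le> s * (K * I + e)" .
    qed
    finally show "(\<integral>\<^sup>+x. ennreal (\<bar>\<psi> x\<bar> * indicator Z x) \<partial>lborel) \<le> ennreal (s * (K * (LINT x|?H. \<bar>\<psi> x\<bar> * indicator S x) + e))"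
      by (simp add: I_def)
  qed
qed

text \<open>The quotients are taken backwards so that, after a translation, they become integrals of
  \<psi> against the difference of the indicators of \<Omega> and of \<Omega> - s b. The divergence
  theorem is thereby reduced to a thin set where the two domains differ.\<close>

lemma backward_quotient_integral_tendsto:
  fixes \<psi> :: "'e::euclidean_space \<Rightarrow> real"
  assumes \<psi>: "\<And>x. (\<psi> has_derivative \<psi>' x) (at x)" and c: "continuous_on UNIV (\<lambda>x. \<psi>' x b)"
    and \<Omega>: "\<Omega> \<in> sets borel" "bounded \<Omega>"
  shows "(\<lambda>n. (LINT x|lborel. indicator \<Omega> x * (\<psi> x - \<psi> (x - inverse (real (Suc n)) *\<^sub>R b))) / inverse (real (Suc n)))
     \<longlonglongrightarrow> (LINT x|lborel. indicator \<Omega> x * \<psi>' x b)"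
proof -
  define s where "s n = inverse (real (Suc n))" for n
  have s: "s n > 0" "s n \<le> 1" for n by (auto simp: s_def divide_simps)
  obtain R where R: "\<And>x. x \<in> \<Omega> \<Longrightarrow> norm x \<le> R" using \<Omega>(2) by (auto simp: bounded_iff)
  have "compact (cball (0::'e) (R + norm b))" by simp
  moreover have "continuous_on (cball 0 (R + norm b)) (\<lambda>x. \<psi>' x b)" using c continuous_on_subset by blast
  ultimately obtain M where M: "\<And>x. x \<in> cball 0 (R + norm b) \<Longrightarrow> \<bar>\<psi>' x b\<bar> \<le> M"
    using compact_continuous_image[THEN compact_imp_bounded] by (force simp: bounded_iff)
  have \<psi>c: "continuous_on UNIV \<psi>"
    using \<psi> by (meson continuous_at_imp_continuous_on has_derivative_continuous)
  have \<psi>m: "\<psi> \<in> borel_measurable borel" using \<psi>c by (rule borel_measurable_continuous_onI)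
  have \<psi>'m: "(\<lambda>x. \<psi>' x b) \<in> borel_measurable borel" using c by (rule borel_measurable_continuous_onI)
  have line: "((\<lambda>t. \<psi> (x + t *\<^sub>R b)) has_real_derivative \<psi>' (x + t *\<^sub>R b) b) (at t)" for x t
  proof -
    have "((\<lambda>t. x + t *\<^sub>R b) has_derivative (\<lambda>h. h *\<^sub>R b)) (at t)" by (auto intro!: derivative_eq_intros)
    from has_derivative_compose[OF this \<psi>]
    have "((\<lambda>t. \<psi> (x + t *\<^sub>R b)) has_derivative (\<lambda>h. \<psi>' (x + t *\<^sub>R b) (h *\<^sub>R b))) (at t)" .
    moreover have "\<psi>' (x + t *\<^sub>R b) (h *\<^sub>R b) = h * \<psi>' (x + t *\<^sub>R b) b" for h
      using linear_cmul[OF has_derivative_linear[OF \<psi>]] by simp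
    moreover have "(\<lambda>h. h * \<psi>' (x + t *\<^sub>R b) b) = (*) (\<psi>' (x + t *\<^sub>R b) b)" by (simp add: fun_eq_iff)
    ultimately show ?thesis by (simp add: has_field_derivative_def)
  qed
  have pt: "(\<lambda>n. indicator \<Omega> x * ((\<psi> x - \<psi> (x - s n *\<^sub>R b)) / s n)) \<longlonglongrightarrow> indicator \<Omega> x * \<psi>' x b" for x
  proof (intro tendsto_mult tendsto_const)
    have "((\<lambda>h. (\<psi> (x + h *\<^sub>R b) - \<psi> x) / h) \<longlongrightarrow> \<psi>' x b) (at 0)"
      using line[of x 0] by (simp add: DERIV_def)
    moreover have "filterlim (\<lambda>n. - s n) (at 0) sequentially"
    proof (rule filterlim_atI)
      show "(\<lambda>n. - s n) \<longlonglongrightarrow> 0" using tendsto_minus[OF LIMSEQ_inverse_real_of_nat] by (simp add: s_def)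
      show "\<forall>\<^sub>F n in sequentially. - s n \<noteq> 0" using s by (auto simp: less_imp_neq[symmetric])
    qed
    ultimately have "(\<lambda>n. (\<psi> (x + (- s n) *\<^sub>R b) - \<psi> x) / (- s n)) \<longlonglongrightarrow> \<psi>' x b" by (rule filterlim_compose)
    moreover have "(\<psi> (x + (- s n) *\<^sub>R b) - \<psi> x) / (- s n) = (\<psi> x - \<psi> (x - s n *\<^sub>R b)) / s n" for n
      by (metis (no_types, lifting) add.commute minus_diff_eq minus_divide_divide minus_minus scaleR_minus_left uminus_add_conv_diff)
    ultimately show "(\<lambda>n. (\<psi> x - \<psi> (x - s n *\<^sub>R b)) / s n) \<longlonglongrightarrow> \<psi>' x b" by simp
  qed
  have bd: "\<bar>(\<psi> x - \<psi> (x - s n *\<^sub>R b)) / s n\<bar> \<le> M" if x: "x \<in> \<Omega>" for x n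
  proof -
    \<comment> \<open>The mean value theorem bounds the quotients by the maximum of the derivative
      on a slightly larger ball, which supplies the dominating function.\<close>
    have "\<exists>z>- s n. z < 0 \<and> \<psi> (x + 0 *\<^sub>R b) - \<psi> (x + (- s n) *\<^sub>R b) = (0 - (- s n)) * \<psi>' (x + z *\<^sub>R b) b"
      by (rule MVT2) (use s[of n] line in auto)
    then obtain z where z: "- s n < z" "z < 0" "\<psi> x - \<psi> (x - s n *\<^sub>R b) = s n * \<psi>' (x + z *\<^sub>R b) b" by auto
    have "norm (x + z *\<^sub>R b) \<le> norm x + \<bar>z\<bar> * norm b" using norm_triangle_ineq[of x "z *\<^sub>R b"] by simp
    also have "\<dots> \<le> R + 1 * norm b" using z s[of n] R[OF x] by (intro add_mono mult_right_mono) auto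
    finally have "\<bar>\<psi>' (x + z *\<^sub>R b) b\<bar> \<le> M" by (intro M) simp
    then show ?thesis using z(3) s(1)[of n] by simp
  qed
  have "(\<lambda>n. LINT x|lborel. indicator \<Omega> x * ((\<psi> x - \<psi> (x - s n *\<^sub>R b)) / s n)) \<longlonglongrightarrow> (LINT x|lborel. indicator \<Omega> x * \<psi>' x b)"
  proof (rule integral_dominated_convergence[where w = "\<lambda>x. M * indicator \<Omega> x"])
    show "integrable lborel (\<lambda>x. M * indicator \<Omega> x)"
      using \<Omega> emeasure_bounded_finite[OF \<Omega>(2)] by (intro integrable_mult_right integrable_real_indicator) auto
    show "AE x in lborel. norm (indicator \<Omega> x * ((\<psi> x - \<psi> (x - s n *\<^sub>R b)) / s n)) \<le> M * indicator \<Omega> x" for n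
    proof (rule AE_I2)
      fix x show "norm (indicator \<Omega> x * ((\<psi> x - \<psi> (x - s n *\<^sub>R b)) / s n)) \<le> M * indicator \<Omega> x"
        using bd[of x n] by (simp add: indicator_def)
    qed
  qed (use pt \<Omega> \<psi>m \<psi>'m in auto)
  then show ?thesis unfolding s_def by simp
qed

lemma integrable_indicator_continuous:
  fixes f :: "'e::euclidean_space \<Rightarrow> real"
  assumes S: "S \<in> sets borel" "bounded S" and f: "continuous_on UNIV f"
  shows "integrable lborel (\<lambda>x. indicator S x * f x)"
proof -
  obtain R where "\<And>x. x \<in> S \<Longrightarrow> norm x \<le> R" using S(2) by (auto simp: bounded_iff)
  then have R: "S \<subseteq> cball 0 R" by auto
  have "continuous_on (cball 0 R) f" using f continuous_on_subset by blast
  then obtain M where M: "\<And>x. x \<in> cball 0 R \<Longrightarrow> norm (f x) \<le> M"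
    using compact_continuous_image[THEN compact_imp_bounded, of "cball 0 R" f] by (force simp: bounded_iff)
  have fm: "f \<in> borel_measurable borel" using f by (rule borel_measurable_continuous_onI)
  show ?thesis
  proof (rule Bochner_Integration.integrable_bound)
    show "integrable lborel (\<lambda>x. M * indicator S x)"
      using S emeasure_bounded_finite[OF S(2)] by (intro integrable_mult_right integrable_real_indicator) auto
    show "AE x in lborel. norm (indicator S x * f x) \<le> norm (M * indicator S x)"
    proof (rule AE_I2)
      fix x show "norm (indicator S x * f x) \<le> norm (M * indicator S x)"
        using M[of x] R by (auto simp: indicator_def)
    qed
  qed (use fm S in simp)
qed

section \<open>Domains lying below the flat part of their boundary\<close>

locale cylindrical_domain =
  fixes \<Omega> F B :: "('a::euclidean_space \<times> real) set"
  assumes admissible: "admissible_domain \<Omega> F B" and cylinder: "\<Omega> \<subseteq> flat F \<times> {..0}"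
begin

lemma open_\<Omega>: "open \<Omega>" and bounded_\<Omega>: "bounded \<Omega>" and connected_\<Omega>: "connected \<Omega>" and lipschitz_\<Omega>: "lipschitz_boundary \<Omega>"
  and frontier_eq: "frontier \<Omega> = F \<union> B" and F_snd: "F \<subseteq> {x. snd x = 0}" and B_snd: "B \<subseteq> {x. snd x < 0}"
  and flat_pos: "measure lebesgue (flat F) > 0"
  using admissible by (auto simp: admissible_domain_def)

lemma borel_\<Omega>: "\<Omega> \<in> sets borel"
  using open_\<Omega> by simp

lemma snd_neg: "x \<in> \<Omega> \<Longrightarrow> snd x < 0"
proof -
  assume x: "x \<in> \<Omega>"
  then obtain e where e: "e > 0" "ball x e \<subseteq> \<Omega>" using open_\<Omega> by (meson openE)
  have "x + (0, e / 2) \<in> ball x e" using e by (simp add: dist_norm norm_Pair)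
  then have "x + (0, e / 2) \<in> flat F \<times> {..0}" using e cylinder by blast
  then have "snd (x + (0, e / 2)) \<le> 0" by (simp add: mem_Times_iff)
  then show ?thesis using e by simp
qed

lemma F_eq: "F = frontier \<Omega> \<inter> {x. snd x = 0}" and B_eq: "B = frontier \<Omega> \<inter> {x. snd x < 0}"
  using frontier_eq F_snd B_snd by auto

lemma compact_frontier_\<Omega>: "compact (frontier \<Omega>)"
  using bounded_\<Omega> by (rule compact_frontier_bounded)

lemma compact_F: "compact F"
proof -
  have "closed {x :: 'a \<times> real. snd x = 0}" by (intro closed_Collect_eq continuous_intros)
  then show ?thesis unfolding F_eq using compact_frontier_\<Omega> by (rule compact_Int_closed[rotated])
qed

lemma borel_B: "B \<in> sets borel"
proof -
  have "open {x :: 'a \<times> real. snd x < 0}" by (intro open_Collect_less continuous_intros)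
  then show ?thesis unfolding B_eq by (intro sets.Int borel_closed frontier_closed borel_open)
qed

lemma bounded_B: "bounded B"
  using compact_frontier_\<Omega> bounded_subset compact_imp_bounded unfolding B_eq by blast

lemma flat_eq: "flat F = fst ` F"
  using F_snd by (force simp: flat_def)

lemma compact_flat: "compact (flat F)"
  unfolding flat_eq by (intro compact_continuous_image compact_F continuous_intros)

lemma borel_flat: "flat F \<in> sets borel"
  using compact_flat by (rule borel_compact)

lemma bounded_flat: "bounded (flat F)"
  using compact_flat by (rule compact_imp_bounded)

lemma hausdorff_B_finite: "hausdorff_outer_measure DIM('a) B < top"
proof -
  have "DIM('a \<times> real) \<ge> 2" by (simp add: Suc_leI)
  from hausdorff_frontier_finite[OF lipschitz_\<Omega> open_\<Omega> bounded_\<Omega> this]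
  have "emeasure (hausdorff_measure DIM('a)) (frontier \<Omega>) < top" by simp
  moreover have "emeasure (hausdorff_measure DIM('a)) B \<le> emeasure (hausdorff_measure DIM('a)) (frontier \<Omega>)"
    by (rule emeasure_mono) (auto simp: B_eq intro: borel_closed)
  ultimately show ?thesis
    using emeasure_hausdorff_measure[of "DIM('a)" B] borel_B by (simp add: Suc_leI)
qed

text \<open>Near a point of F the cone direction e points downwards, and (x, -u) lies on the ray in
  direction e from (x + u v, 0). If (x, -u) misses \<Omega>, then x + u v must be outside
  \<open>flat F\<close>; such x form a set of measure at most
  \<open>shift_dist (indicator (flat F)) (u *\<^sub>R v)\<close>, which tends to 0 with u. Finitely
  many cones suffice by compactness, and integrating over depths below s gives o(s).\<close>

lemma flat_layer_small:
  assumes \<epsilon>: "\<epsilon> > 0"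
  shows "\<exists>s0>0. \<forall>s. 0 < s \<and> s < s0 \<longrightarrow> emeasure lborel (flat F \<times> {-s<..<0} - \<Omega>) \<le> ennreal (\<epsilon> * s)"
proof -
  have "\<exists>r e \<tau>. r > 0 \<and> \<tau> > 0 \<and> snd e < 0 \<and>
      (\<forall>x t. x \<in> F \<inter> ball p r \<longrightarrow> 0 < t \<longrightarrow> t < \<tau> \<longrightarrow> x + t *\<^sub>R e \<in> \<Omega>)" if p: "p \<in> F" for p
  proof -
    have pf: "p \<in> frontier \<Omega>" using p frontier_eq by blast
    obtain e c r \<tau> where ecr: "norm e = 1" "0 < c" "c \<le> 1" "0 < r" "0 < \<tau>"
      and cone: "\<And>x t. x \<in> closure \<Omega> \<inter> ball p r \<Longrightarrow> 0 < t \<Longrightarrow> t < \<tau> \<Longrightarrow> ball (x + t *\<^sub>R e) (c * t) \<subseteq> \<Omega>"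
      using lipschitz_boundary_cone[OF lipschitz_\<Omega> pf] by blast
    \<comment> \<open>A whole ball around a point p + t e lies in \<Omega>, hence at negative
      height, while p itself has height 0.\<close>
    have "snd e < 0"
    proof -
      let ?t = "\<tau> / 2"
      have "p \<in> closure \<Omega> \<inter> ball p r" using pf ecr by (simp add: frontier_def)
      from cone[OF this, of ?t] ecr have "ball (p + ?t *\<^sub>R e) (c * ?t) \<subseteq> \<Omega>" by simp
      moreover have "p + ?t *\<^sub>R e + (0, c * ?t / 2) \<in> ball (p + ?t *\<^sub>R e) (c * ?t)"
        using ecr by (simp add: dist_norm norm_Pair)
      ultimately have "snd (p + ?t *\<^sub>R e + (0, c * ?t / 2)) < 0" using snd_neg by blast
      moreover have "snd p = 0" using p F_snd by auto
      moreover have "0 < c * ?t / 2" using ecr by simp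
      ultimately have "?t * snd e < 0" by simp
      then show ?thesis using ecr by (simp add: mult_less_0_iff)
    qed
    moreover have "x + t *\<^sub>R e \<in> \<Omega>" if "x \<in> F \<inter> ball p r" "0 < t" "t < \<tau>" for x t
    proof -
      have "x \<in> closure \<Omega> \<inter> ball p r" using that frontier_eq by (auto simp: frontier_def)
      from cone[OF this that(2,3)] have "ball (x + t *\<^sub>R e) (c * t) \<subseteq> \<Omega>" .
      moreover have "x + t *\<^sub>R e \<in> ball (x + t *\<^sub>R e) (c * t)" using ecr that by simp
      ultimately show ?thesis by blast
    qed
    ultimately show ?thesis using ecr by blast
  qed
  then obtain r e \<tau> where cone: "\<And>p. p \<in> F \<Longrightarrow> r p > 0 \<and> \<tau> p > 0 \<and> snd (e p) < 0 \<and>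
      (\<forall>x t. x \<in> F \<inter> ball p (r p) \<longrightarrow> 0 < t \<longrightarrow> t < \<tau> p \<longrightarrow> x + t *\<^sub>R e p \<in> \<Omega>)" by metis
  have "\<forall>p\<in>F. p \<in> ball p (r p / 2)" using cone by simp
  then have "F \<subseteq> (\<Union>p\<in>F. ball p (r p / 2))" by blast
  then obtain D where D: "D \<subseteq> F" "finite D" "F \<subseteq> (\<Union>p\<in>D. ball p (r p / 2))"
    using compactE_image[OF compact_F, of F "\<lambda>p. ball p (r p / 2)"] by auto
  \<comment> \<open>Chosen so that following e from (x + u v, 0) down to height -u ends exactly at
    (x, -u).\<close>
  define v where "v p = (1 / snd (e p)) *\<^sub>R fst (e p)" for p
  let ?A = "flat F"
  have Aint: "integrable lborel (indicator ?A :: 'a \<Rightarrow> real)"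
    using borel_flat emeasure_bounded_finite[OF bounded_flat] by (intro integrable_real_indicator) auto
  \<comment> \<open>For such u the shifted point stays in the ball where the cone at p is available
    (F is covered by balls of half the radius), and the parameter u / (- snd (e p)) on the ray stays
    below \<tau>.\<close>
  have ev: "\<forall>\<^sub>F u in at_right 0. u * norm (v p) < r p / 2 \<and> u / (- snd (e p)) < \<tau> p" if "p \<in> D" for p
  proof -
    have p: "r p > 0" "\<tau> p > 0" "snd (e p) < 0" using cone[of p] D(1) that by blast+
    have "((\<lambda>u. u * norm (v p)) \<longlongrightarrow> 0 * norm (v p)) (at_right 0)" "((\<lambda>u. u / (- snd (e p))) \<longlongrightarrow> 0 / (- snd (e p))) (at_right 0)"
      using p by (intro tendsto_intros; simp)+
    then show ?thesis using p by (intro eventually_conj order_tendstoD(2)) auto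
  qed
  have ev2: "\<forall>\<^sub>F u in at_right 0. (\<Sum>p\<in>D. shift_dist (indicator ?A) (u *\<^sub>R v p)) < \<epsilon>"
  proof (rule order_tendstoD(2))
    have "((\<lambda>u. shift_dist (indicator ?A) (u *\<^sub>R v p)) \<longlongrightarrow> 0) (at_right 0)" for p
    proof (cases "v p = 0")
      case True
      then show ?thesis by (simp add: shift_dist_def)
    next
      case False
      have "filterlim (\<lambda>u. u *\<^sub>R v p) (at 0) (at_right 0)"
      proof (rule filterlim_atI)
        have "((\<lambda>u. u *\<^sub>R v p) \<longlongrightarrow> 0 *\<^sub>R v p) (at_right 0)" by (intro tendsto_intros)
        then show "((\<lambda>u. u *\<^sub>R v p) \<longlongrightarrow> 0) (at_right 0)" by simp
        show "\<forall>\<^sub>F u in at_right 0. u *\<^sub>R v p \<noteq> 0" using False by (auto simp: eventually_at_right_field intro!: exI[of _ 1])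
      qed
      then show ?thesis by (rule filterlim_compose[OF shift_dist_tendsto_0[OF Aint]])
    qed
    then have "((\<lambda>u. \<Sum>p\<in>D. shift_dist (indicator ?A) (u *\<^sub>R v p)) \<longlongrightarrow> (\<Sum>p\<in>D. 0)) (at_right 0)"
      by (intro tendsto_sum)
    then show "((\<lambda>u. \<Sum>p\<in>D. shift_dist (indicator ?A) (u *\<^sub>R v p)) \<longlongrightarrow> 0) (at_right 0)" by simp
  qed (rule \<epsilon>)
  have "\<forall>\<^sub>F u in at_right 0. \<forall>p\<in>D. u * norm (v p) < r p / 2 \<and> u / (- snd (e p)) < \<tau> p"
    using ev D(2) by (simp add: eventually_ball_finite_distrib)
  from eventually_conj[OF this ev2] obtain s0 where s0: "s0 > 0"
    "\<And>u. 0 < u \<Longrightarrow> u < s0 \<Longrightarrow> (\<forall>p\<in>D. u * norm (v p) < r p / 2 \<and> u / (- snd (e p)) < \<tau> p) \<and> (\<Sum>p\<in>D. shift_dist (indicator ?A) (u *\<^sub>R v p)) < \<epsilon>"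
    unfolding eventually_at_right_field by auto
  have slice: "emeasure lborel {x \<in> ?A. (x, - u) \<notin> \<Omega>} \<le> ennreal \<epsilon>" if u: "0 < u" "u < s0" for u
  proof -
    let ?N = "\<lambda>p. {x \<in> ?A. x + u *\<^sub>R v p \<notin> ?A}"
    have Nb: "?N p \<in> sets borel" for p
    proof -
      have [measurable]: "?A \<in> sets borel" by (rule borel_flat)
      have "{x \<in> space borel. x \<in> ?A \<and> x + u *\<^sub>R v p \<notin> ?A} \<in> sets borel" by measurable
      then show ?thesis by simp
    qed
    have sub: "{x \<in> ?A. (x, - u) \<notin> \<Omega>} \<subseteq> (\<Union>p\<in>D. ?N p)"
    proof
      fix x assume x: "x \<in> {x \<in> ?A. (x, - u) \<notin> \<Omega>}"
      then have xF: "(x, 0) \<in> F" by (simp add: flat_def)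
      then obtain p where p: "p \<in> D" "(x, 0) \<in> ball p (r p / 2)" using D(3) by blast
      have pF: "p \<in> F" using p D(1) by blast
      have small: "u * norm (v p) < r p / 2" "u / (- snd (e p)) < \<tau> p" using s0(2)[OF u] p(1) by auto
      have e2: "snd (e p) < 0" using cone[OF pF] by blast
      have "x + u *\<^sub>R v p \<notin> ?A"
      proof
        assume "x + u *\<^sub>R v p \<in> ?A"
        then have q: "(x + u *\<^sub>R v p, 0) \<in> F" by (simp add: flat_def)
        have "dist p (x + u *\<^sub>R v p, 0) \<le> dist p (x, 0) + dist (x, 0::real) (x + u *\<^sub>R v p, 0)" by (rule dist_triangle)
        also have "dist (x, 0::real) (x + u *\<^sub>R v p, 0) = u * norm (v p)"
          using u by (simp add: dist_norm norm_Pair)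
        finally have "(x + u *\<^sub>R v p, 0) \<in> F \<inter> ball p (r p)" using p(2) small(1) q by simp
        moreover have "0 < u / (- snd (e p))" using u e2 by (simp add: divide_pos_neg)
        ultimately have "(x + u *\<^sub>R v p, 0) + (u / (- snd (e p))) *\<^sub>R e p \<in> \<Omega>" using cone[OF pF] small(2) by blast
        moreover have "(x + u *\<^sub>R v p, 0) + (u / (- snd (e p))) *\<^sub>R e p = (x, - u)"
        proof -
          have "(x + u *\<^sub>R v p, 0) + (u / (- snd (e p))) *\<^sub>R e p = (x + u *\<^sub>R v p + (u / (- snd (e p))) *\<^sub>R fst (e p), (u / (- snd (e p))) * snd (e p))"
            by (simp add: prod_eq_iff)
          then show ?thesis using e2 by (simp add: v_def)
        qed
        ultimately show False using x by simp
      qed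
      then show "x \<in> (\<Union>p\<in>D. ?N p)" using x p(1) by auto
    qed
    have "emeasure lborel {x \<in> ?A. (x, - u) \<notin> \<Omega>} \<le> emeasure lborel (\<Union>p\<in>D. ?N p)"
      using sub D(2) Nb by (intro emeasure_mono) (auto intro!: sets.finite_UN)
    also have "\<dots> \<le> (\<Sum>p\<in>D. emeasure lborel (?N p))"
      using Nb D(2) by (intro emeasure_subadditive_finite) auto
    also have "\<dots> \<le> (\<Sum>p\<in>D. ennreal (shift_dist (indicator ?A) (u *\<^sub>R v p)))"
    proof (rule sum_mono)
      fix p
      have "emeasure lborel (?N p) = (\<integral>\<^sup>+x. indicator (?N p) x \<partial>lborel)" using Nb by simp
      also have "\<dots> \<le> (\<integral>\<^sup>+x. ennreal \<bar>indicator ?A (x + u *\<^sub>R v p) - indicator ?A x\<bar> \<partial>lborel)"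
        by (intro nn_integral_mono) (auto simp: indicator_def)
      also have "\<dots> = ennreal (shift_dist (indicator ?A) (u *\<^sub>R v p))"
        unfolding shift_dist_def by (intro nn_integral_eq_integral integrable_shift_diff Aint) auto
      finally show "emeasure lborel (?N p) \<le> ennreal (shift_dist (indicator ?A) (u *\<^sub>R v p))" .
    qed
    also have "\<dots> = ennreal (\<Sum>p\<in>D. shift_dist (indicator ?A) (u *\<^sub>R v p))"
      by (intro sum_ennreal) (simp add: shift_dist_nonneg)
    also have "\<dots> \<le> ennreal \<epsilon>" using s0(2)[OF u] by (intro ennreal_leI) auto
    finally show ?thesis .
  qed
  show ?thesis
  proof (intro exI[of _ s0] conjI allI impI s0(1))
    fix s assume s: "0 < s \<and> s < s0"
    let ?X = "?A \<times> {-s<..<0} - \<Omega>"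
    have Xb: "?X \<in> sets (borel \<Otimes>\<^sub>M borel)"
      using borel_flat borel_\<Omega> unfolding borel_prod[symmetric] by (intro sets.Diff pair_measureI) auto
    have "emeasure lborel ?X = emeasure (lborel \<Otimes>\<^sub>M lborel) ?X" by (simp add: lborel_prod)
    also have "\<dots> = (\<integral>\<^sup>+y. emeasure lborel ((\<lambda>x. (x, y)) -` ?X) \<partial>lborel)"
      using Xb by (intro lborel_pair.emeasure_pair_measure_alt2) simp
    also have "\<dots> \<le> (\<integral>\<^sup>+y. ennreal \<epsilon> * indicator {-s<..<0} y \<partial>lborel)"
    proof (rule nn_integral_mono)
      fix y :: real
      show "emeasure lborel ((\<lambda>x. (x, y)) -` ?X) \<le> ennreal \<epsilon> * indicator {-s<..<0} y"
      proof (cases "y \<in> {-s<..<0}")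
        case True
        then have "(\<lambda>x. (x, y)) -` ?X = {x \<in> ?A. (x, - (- y)) \<notin> \<Omega>}" by auto
        then show ?thesis using slice[of "- y"] True s by simp
      qed (auto simp: vimage_def)
    qed
    also have "\<dots> = ennreal \<epsilon> * ennreal s" using s by (simp add: nn_integral_cmult_indicator)
    also have "\<dots> = ennreal (\<epsilon> * s)" using \<epsilon> s by (simp add: ennreal_mult)
    finally show "emeasure lborel ?X \<le> ennreal (\<epsilon> * s)" .
  qed
qed

end

context cylindrical_domain
begin

text \<open>The missing part of the layer has volume o(s) and \<psi> is bounded there; on the full
  layer \<psi> is within e1 of its value at height 0. Dividing by s leaves the Lebesgue integral
  over \<open>flat F\<close> with constant exactly 1, which the final bound depends on.\<close>

lemma flat_layer_integral:
  fixes \<psi> :: "'a \<times> real \<Rightarrow> real"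
  assumes \<psi>: "continuous_on UNIV \<psi>" and \<epsilon>: "\<epsilon> > 0"
  shows "\<exists>s0>0. \<forall>s. 0 < s \<and> s < s0 \<longrightarrow>
    \<bar>(LINT x|lborel. indicator (\<Omega> \<inter> {x. - s < snd x}) x * \<psi> x) / s - (LINT x|lborel. indicator (flat F) x * \<psi> (x, 0))\<bar> \<le> \<epsilon>"
proof -
  let ?A = "flat F"
  define J where "J = (LINT x|lborel. indicator ?A x * \<psi> (x, 0))"
  define L where "L = measure lborel ?A"
  obtain R where R: "\<And>x. x \<in> ?A \<Longrightarrow> norm x \<le> R" using bounded_flat by (auto simp: bounded_iff)
  let ?K = "cball (0::'a \<times> real) (R + 1)"
  have inK: "(x, y) \<in> ?K" if "x \<in> ?A" "\<bar>y\<bar> \<le> 1" for x y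
    using R[OF that(1)] that(2) norm_Pair_le[of x y] by simp
  have \<psi>K: "continuous_on ?K \<psi>" using \<psi> continuous_on_subset by blast
  obtain M where M: "\<And>x. x \<in> ?K \<Longrightarrow> \<bar>\<psi> x\<bar> \<le> M"
    using compact_continuous_image[THEN compact_imp_bounded, OF \<psi>K] by (force simp: bounded_iff)
  have M': "\<bar>\<psi> x\<bar> \<le> \<bar>M\<bar> + 1" if "x \<in> ?K" for x using M[OF that] by simp
  define e1 where "e1 = \<epsilon> / (2 * (L + 1))"
  define e2 where "e2 = \<epsilon> / (2 * (\<bar>M\<bar> + 1))"
  have L0: "L \<ge> 0" by (simp add: L_def)
  have e12: "e1 > 0" "e2 > 0" using \<epsilon> L0 by (auto simp: e1_def e2_def add_nonneg_pos)
  have e1L: "e1 * L \<le> \<epsilon> / 2"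
  proof -
    have "e1 * L \<le> e1 * (L + 1)" using e12 by (intro mult_left_mono) auto
    also have "\<dots> = \<epsilon> / 2" using L0 by (simp add: e1_def field_simps add_nonneg_eq_0_iff)
    finally show ?thesis .
  qed
  have e2M: "(\<bar>M\<bar> + 1) * e2 = \<epsilon> / 2" by (simp add: e2_def field_simps add_nonneg_eq_0_iff)
  have "uniformly_continuous_on ?K \<psi>" using \<psi>K by (intro compact_uniformly_continuous) auto
  then obtain d where d: "d > 0" "\<And>x y. x \<in> ?K \<Longrightarrow> y \<in> ?K \<Longrightarrow> dist y x < d \<Longrightarrow> dist (\<psi> y) (\<psi> x) < e1"
    using e12 unfolding uniformly_continuous_on_def by metis
  obtain s1 where s1: "s1 > 0" "\<And>s. 0 < s \<Longrightarrow> s < s1 \<Longrightarrow> emeasure lborel (?A \<times> {-s<..<0} - \<Omega>) \<le> ennreal (e2 * s)"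
    using flat_layer_small[OF e12(2)] by blast
  have \<psi>0: "continuous_on UNIV (\<lambda>x. \<psi> (fst x, 0))" "continuous_on UNIV (\<lambda>x. \<psi> (x, 0))"
    by (intro continuous_on_compose2[OF \<psi>] continuous_intros; auto)+
  show ?thesis
  proof (intro exI[of _ "min s1 (min d 1)"] conjI allI impI)
    show "0 < min s1 (min d 1)" using s1 d by simp
    fix s assume "0 < s \<and> s < min s1 (min d 1)"
    then have s: "0 < s" "s < s1" "s < d" "s < 1" by auto
    define C where "C = ?A \<times> {-s<..<0::real}"
    have Cb: "C \<in> sets borel"
      unfolding C_def borel_prod[symmetric] using borel_flat by (intro pair_measureI) auto
    have Cbd: "bounded C" unfolding C_def by (intro bounded_Times bounded_flat) auto
    have Pb: "\<Omega> \<inter> {x. - s < snd x} \<in> sets borel"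
      by (intro borel_open open_Int open_\<Omega> open_Collect_less continuous_intros)
    have DCb: "C - \<Omega> \<in> sets borel" using Cb borel_\<Omega> by auto
    have DCbd: "bounded (C - \<Omega>)" using Cbd by (rule bounded_diff)
    have CK: "C \<subseteq> ?K" using inK s by (auto simp: C_def)
    \<comment> \<open>Within the layer \<Omega> is the cylinder C minus its missing part: the
      inclusion in the infinite cylinder keeps \<Omega> from extending sideways beyond
      \<open>flat F\<close>.\<close>
    have ind: "indicator (\<Omega> \<inter> {x. - s < snd x}) x = (indicator C x - indicator (C - \<Omega>) x :: real)" for x
      using cylinder snd_neg[of x] by (cases x) (auto simp: indicator_def C_def)
    have i1: "integrable lborel (\<lambda>x. indicator C x * \<psi> x)" by (rule integrable_indicator_continuous[OF Cb Cbd \<psi>])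
    have i2: "integrable lborel (\<lambda>x. indicator (C - \<Omega>) x * \<psi> x)" by (rule integrable_indicator_continuous[OF DCb DCbd \<psi>])
    have i3: "integrable lborel (\<lambda>x. indicator C x * \<psi> (fst x, 0))" by (rule integrable_indicator_continuous[OF Cb Cbd \<psi>0(1)])
    have "(LINT x|lborel. indicator C x * \<psi> (fst x, 0)) = (LINT x|(lborel \<Otimes>\<^sub>M lborel). indicator C x * \<psi> (fst x, 0))"
      by (simp add: lborel_prod)
    also have "\<dots> = (LINT x|lborel. LINT y|lborel. indicator C (x, y) * \<psi> (x, 0))"
      using lborel_pair.integral_fst'[of "\<lambda>x. indicator C x * \<psi> (fst x, 0)"] i3 by (simp add: lborel_prod)
    also have "\<dots> = (LINT x|lborel. s * (indicator ?A x * \<psi> (x, 0)))"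
    proof (rule Bochner_Integration.integral_cong)
      fix x :: 'a
      have "(LINT y|lborel. indicator C (x, y) * \<psi> (x, 0)) = (LINT y|lborel. indicator ?A x * \<psi> (x, 0) * indicator {-s<..<0} y)"
        by (intro Bochner_Integration.integral_cong) (auto simp: C_def indicator_def)
      also have "\<dots> = s * (indicator ?A x * \<psi> (x, 0))" using s by simp
      finally show "(LINT y|lborel. indicator C (x, y) * \<psi> (x, 0)) = s * (indicator ?A x * \<psi> (x, 0))" .
    qed simp
    also have "\<dots> = s * J" by (simp add: J_def)
    finally have sJ: "(LINT x|lborel. indicator C x * \<psi> (fst x, 0)) = s * J" .
    have iC: "integrable lborel (indicator C :: 'a \<times> real \<Rightarrow> real)"
      using Cb emeasure_bounded_finite[OF Cbd] by (intro integrable_real_indicator) auto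
    have mC: "measure lborel C = L * s"
    proof -
      have "emeasure lborel C = emeasure (lborel \<Otimes>\<^sub>M lborel) C" by (simp add: lborel_prod)
      also have "\<dots> = emeasure lborel ?A * emeasure lborel {-s<..<0}"
        unfolding C_def using borel_flat by (intro lborel.emeasure_pair_measure_Times) auto
      finally show ?thesis using s by (simp add: measure_def L_def enn2real_mult)
    qed
    have "\<bar>LINT x|lborel. indicator C x * \<psi> x - indicator C x * \<psi> (fst x, 0)\<bar> \<le> (LINT x|lborel. e1 * indicator C x)"
    proof (rule order_trans[OF integral_abs_bound], rule integral_mono)
      show "integrable lborel (\<lambda>x. \<bar>indicator C x * \<psi> x - indicator C x * \<psi> (fst x, 0)\<bar>)" using i1 i3 by simp
      show "integrable lborel (\<lambda>x. e1 * indicator C x)" using iC by simp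
      fix x
      show "\<bar>indicator C x * \<psi> x - indicator C x * \<psi> (fst x, 0)\<bar> \<le> e1 * indicator C x"
      proof (cases "x \<in> C")
        case True
        then obtain a y where x: "x = (a, y)" "a \<in> ?A" "- s < y" "y < 0" by (auto simp: C_def)
        have "dist (\<psi> (a, y)) (\<psi> (a, 0)) < e1"
          using inK[OF x(2), of y] inK[OF x(2), of 0] x s by (intro d) (auto simp: dist_norm norm_Pair)
        then show ?thesis using True x by (simp add: dist_real_def)
      qed (simp add: e12)
    qed
    also have "\<dots> = e1 * (L * s)" using Cb by (simp add: mC)
    finally have b1: "\<bar>(LINT x|lborel. indicator C x * \<psi> x) - s * J\<bar> \<le> e1 * L * s"
      using i1 i3 by (simp add: sJ mult.assoc)
    have "ennreal \<bar>LINT x|lborel. indicator (C - \<Omega>) x * \<psi> x\<bar> \<le> (\<integral>\<^sup>+x. norm (indicator (C - \<Omega>) x * \<psi> x) \<partial>lborel)"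
      using integral_norm_bound_ennreal[OF i2] by simp
    also have "\<dots> \<le> (\<integral>\<^sup>+x. ennreal (\<bar>M\<bar> + 1) * indicator (C - \<Omega>) x \<partial>lborel)"
    proof (rule nn_integral_mono)
      fix x show "ennreal (norm (indicator (C - \<Omega>) x * \<psi> x)) \<le> ennreal (\<bar>M\<bar> + 1) * indicator (C - \<Omega>) x"
      proof (cases "x \<in> C - \<Omega>")
        case True
        then have "x \<in> ?K" using CK by blast
        from ennreal_leI[OF M'[OF this]] True show ?thesis by (simp del: ennreal_plus)
      qed simp
    qed
    also have "\<dots> = ennreal (\<bar>M\<bar> + 1) * emeasure lborel (C - \<Omega>)" using DCb by (simp add: nn_integral_cmult_indicator)
    also have "\<dots> \<le> ennreal (\<bar>M\<bar> + 1) * ennreal (e2 * s)" using s1(2)[OF s(1,2)] by (intro mult_left_mono) (auto simp: C_def)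
    also have "\<dots> = ennreal (\<epsilon> / 2 * s)"
      unfolding e2M[symmetric] using e12 s by (simp add: ennreal_mult mult.assoc)
    finally have b2: "\<bar>LINT x|lborel. indicator (C - \<Omega>) x * \<psi> x\<bar> \<le> \<epsilon> / 2 * s"
      using \<epsilon> s by (subst (asm) ennreal_le_iff) auto
    have "(LINT x|lborel. indicator (\<Omega> \<inter> {x. - s < snd x}) x * \<psi> x) = (LINT x|lborel. indicator C x * \<psi> x) - (LINT x|lborel. indicator (C - \<Omega>) x * \<psi> x)"
      unfolding ind left_diff_distrib by (rule Bochner_Integration.integral_diff[OF i1 i2])
    then have "\<bar>(LINT x|lborel. indicator (\<Omega> \<inter> {x. - s < snd x}) x * \<psi> x) - s * J\<bar> \<le> e1 * L * s + \<epsilon> / 2 * s"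
      using b1 b2 by linarith
    also have "\<dots> = s * (e1 * L + \<epsilon> / 2)" by (simp add: algebra_simps)
    also have "\<dots> \<le> s * \<epsilon>" using e1L s by (intro mult_left_mono) auto
    finally have "\<bar>(LINT x|lborel. indicator (\<Omega> \<inter> {x. - s < snd x}) x * \<psi> x) - s * J\<bar> / s \<le> \<epsilon>"
      using s by (simp add: pos_divide_le_eq mult.commute)
    moreover have "(LINT x|lborel. indicator (\<Omega> \<inter> {x. - s < snd x}) x * \<psi> x) / s - J = ((LINT x|lborel. indicator (\<Omega> \<inter> {x. - s < snd x}) x * \<psi> x) - s * J) / s"
      using s by (simp add: diff_divide_distrib)
    ultimately show "\<bar>(LINT x|lborel. indicator (\<Omega> \<inter> {x. - s < snd x}) x * \<psi> x) / s - (LINT x|lborel. indicator ?A x * \<psi> (x, 0))\<bar> \<le> \<epsilon>"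
      unfolding J_def[symmetric] using s by (simp add: abs_divide)
  qed
qed

section \<open>Green's formula by shifting the domain\<close>

lemma crossing_frontier:
  assumes "(x \<in> \<Omega>) \<noteq> (x + s *\<^sub>R b \<in> \<Omega>)" "s > 0"
  obtains t where "0 \<le> t" "t \<le> s" "x + t *\<^sub>R b \<in> frontier \<Omega>"
proof -
  let ?S = "(\<lambda>t. x + t *\<^sub>R b) ` {0..s}"
  have "connected ?S" by (intro connected_continuous_image continuous_intros) auto
  moreover have "x \<in> ?S" using assms(2) by (auto intro!: image_eqI[of _ _ 0])
  moreover have "x + s *\<^sub>R b \<in> ?S" using assms(2) by auto
  ultimately have "?S \<inter> frontier \<Omega> \<noteq> {}" using assms(1) by (intro connected_Int_frontier) auto
  then show thesis using that by auto
qed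

lemma snd_hyperplane_null: "AE x in lborel. snd (x :: 'a \<times> real) \<noteq> c"
proof -
  have "negligible {x :: 'a \<times> real. (0, 1) \<bullet> x = c}" by (rule negligible_hyperplane) (simp add: zero_prod_def)
  moreover have "{x :: 'a \<times> real. (0, 1) \<bullet> x = c} = {x. snd x = c}" by (auto simp: inner_prod_def)
  ultimately have n: "{x :: 'a \<times> real. snd x = c} \<in> null_sets lebesgue" by (simp add: negligible_iff_null_sets)
  have "closed {x :: 'a \<times> real. snd x = c}" by (intro closed_Collect_eq continuous_intros)
  then have "{x :: 'a \<times> real. snd x = c} \<in> null_sets lborel"
    using n by (auto simp: null_sets_def)
  from AE_not_in[OF this] show ?thesis by simp
qed

text \<open>After a translation the difference quotient is an integral of \<psi> against the
  difference of two indicators, and a segment from x to x + s b with just one end in \<Omega> meets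
  the boundary. For vertical b the points of \<Omega> above height -s leave through the top, and
  their share tends to the integral over F. Apart from a null set every other crossing takes place
  at negative height, hence on B, so those points lie in a thickening of B, where
  \<open>thickening_integral\<close> applies.\<close>

theorem green:
  obtains K :: real where "K > 0" "\<And>(\<psi> :: 'a \<times> real \<Rightarrow> real) \<psi>' b. (\<And>x. (\<psi> has_derivative \<psi>' x) (at x)) \<Longrightarrow> continuous_on UNIV (\<lambda>x. \<psi>' x b) \<Longrightarrow> b \<in> Basis \<Longrightarrow>
    \<bar>(LINT x|lborel. indicator \<Omega> x * \<psi>' x b) - (if b = (0, 1) then LINT x|lborel. indicator (flat F) x * \<psi> (x, 0) else 0)\<bar>
      \<le> K * (LINT x|hausdorff_measure DIM('a). \<bar>\<psi> x\<bar> * indicator B x)"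
proof -
  have dim: "DIM('a \<times> real) = Suc DIM('a)" "DIM('a) \<ge> 1" by (auto simp: Suc_leI)
  show thesis
  proof (rule hausdorff_thickening[OF dim])
    fix K :: real
    assume K: "K > 0" and thick: "\<And>A b s e. hausdorff_outer_measure DIM('a) (A :: ('a \<times> real) set) < top \<Longrightarrow> norm b \<le> 1 \<Longrightarrow> 0 < s \<Longrightarrow> 0 < e \<Longrightarrow>
      \<exists>W\<in>sets borel. {p + t *\<^sub>R b |p t. p \<in> A \<and> 0 \<le> t \<and> t \<le> s} \<subseteq> W \<and>
      emeasure lborel W \<le> ennreal (K * s) * (hausdorff_outer_measure DIM('a) A + ennreal e)"
  show thesis
  proof (rule that[OF K])
    fix \<psi> :: "'a \<times> real \<Rightarrow> real" and \<psi>' and b :: "'a \<times> real"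
    assume \<psi>: "\<And>x. (\<psi> has_derivative \<psi>' x) (at x)" and c: "continuous_on UNIV (\<lambda>x. \<psi>' x b)" and b: "b \<in> Basis"
    let ?I = "LINT x|hausdorff_measure DIM('a). \<bar>\<psi> x\<bar> * indicator B x"
    let ?vert = "b = (0, 1)"
    let ?J = "if ?vert then LINT x|lborel. indicator (flat F) x * \<psi> (x, 0) else 0"
    let ?D = "LINT x|lborel. indicator \<Omega> x * \<psi>' x b"
    have nb: "norm b = 1" using b by simp
    have bcase: "?vert \<or> snd b = 0" using b by (auto simp: Basis_prod_def)
    have \<psi>c: "continuous_on UNIV \<psi>"
      using \<psi> by (meson continuous_at_imp_continuous_on has_derivative_continuous)
    have \<psi>m: "\<psi> \<in> borel_measurable borel" using \<psi>c by (rule borel_measurable_continuous_onI)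
    have "\<bar>?D - ?J\<bar> \<le> K * ?I + \<epsilon>" if \<epsilon>: "\<epsilon> > 0" for \<epsilon>
    proof -
      \<comment> \<open>V s is the layer that leaves through the top, empty for horizontal b. E s is
        what remains of the difference of indicators. Z s omits the plane at height -s, from which a
        vertical segment would end at height 0 and so possibly on F; the plane is a null
        set.\<close>
      define V where "V s = \<Omega> \<inter> {x. ?vert \<and> - s < snd x}" for s
      define E where "E s x = (indicator \<Omega> x - indicator \<Omega> (x + s *\<^sub>R b) - indicator (V s) x :: real)" for s x
      define Z where "Z s = {x. E s x \<noteq> 0 \<and> snd x \<noteq> - s}" for s
      have Vb: "V s \<in> sets borel" for s
      proof -
        have o: "open {x :: 'a \<times> real. - s < snd x}" by (intro open_Collect_less continuous_intros)
        have "V s = (if ?vert then \<Omega> \<inter> {x. - s < snd x} else {})" by (auto simp: V_def)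
        then show ?thesis using borel_open[OF open_Int[OF open_\<Omega> o]] by (simp split: if_splits)
      qed
      note [measurable] = borel_\<Omega> Vb
      have Em [measurable]: "E s \<in> borel_measurable borel" for s unfolding E_def by measurable
      have Zb: "Z s \<in> sets borel" for s
      proof -
        have "E s -` (- {0}) \<inter> space borel \<in> sets borel" by (rule measurable_sets[OF Em]) simp
        moreover have "open (- {x :: 'a \<times> real. snd x = - s})"
          by (intro open_Compl closed_Collect_eq continuous_intros)
        moreover have "Z s = (E s -` (- {0}) \<inter> space borel) \<inter> - {x. snd x = - s}" by (auto simp: Z_def)
        ultimately show ?thesis by (simp del: vimage_Compl)
      qed
      have E1: "\<bar>E s x\<bar> \<le> 1" for s x
        by (auto simp: E_def indicator_def V_def)
      have ZB: "Z s \<subseteq> {p + t *\<^sub>R (- b) |p t. p \<in> B \<and> 0 \<le> t \<and> t \<le> s}" if s: "s > 0" for s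
      proof
        fix x assume "x \<in> Z s"
        then have x: "E s x \<noteq> 0" "snd x \<noteq> - s" by (auto simp: Z_def)
        \<comment> \<open>Points of V s are no exception: the other end of their segment has
          positive height and is outside \<Omega>, so E vanishes at them.\<close>
        have ne: "(x \<in> \<Omega>) \<noteq> (x + s *\<^sub>R b \<in> \<Omega>)"
        proof
          assume eq: "(x \<in> \<Omega>) = (x + s *\<^sub>R b \<in> \<Omega>)"
          then have xV: "x \<in> V s" using x(1) by (auto simp: E_def indicator_def split: if_splits)
          then have "x + s *\<^sub>R b \<in> \<Omega>" "?vert" "- s < snd x" using eq by (auto simp: V_def)
          then show False using snd_neg[of "x + s *\<^sub>R b"] by simp
        qed
        obtain t where t: "0 \<le> t" "t \<le> s" "x + t *\<^sub>R b \<in> frontier \<Omega>" using crossing_frontier[OF ne s] by blast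
        have "snd (x + t *\<^sub>R b) < 0"
        proof (cases ?vert)
          case True
          have "snd x + s < 0"
          proof (cases "x \<in> \<Omega>")
            case xin: True
            then have "x + s *\<^sub>R b \<notin> \<Omega>" using ne by simp
            then have "x \<notin> V s" using x(1) xin by (auto simp: E_def)
            then show ?thesis using xin True x(2) by (auto simp: V_def)
          next
            case False
            then show ?thesis using ne snd_neg[of "x + s *\<^sub>R b"] True by simp
          qed
          then show ?thesis using True t by simp
        next
          case False
          then have "snd b = 0" using bcase by blast
          then show ?thesis using ne snd_neg[of x] snd_neg[of "x + s *\<^sub>R b"] by auto
        qed
        then have "x + t *\<^sub>R b \<in> B" using t(3) unfolding B_eq by simp
        moreover have "x = (x + t *\<^sub>R b) + t *\<^sub>R (- b)" by simp
        ultimately show "x \<in> {p + t *\<^sub>R (- b) |p t. p \<in> B \<and> 0 \<le> t \<and> t \<le> s}" using t by blast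
      qed
      have nmb: "norm (- b) \<le> 1" using nb by simp
      obtain s1 where s1: "s1 > 0" "\<And>s Z. 0 < s \<Longrightarrow> s \<le> s1 \<Longrightarrow> Z \<in> sets borel \<Longrightarrow> Z \<subseteq> {p + t *\<^sub>R (- b) |p t. p \<in> B \<and> 0 \<le> t \<and> t \<le> s} \<Longrightarrow>
         (\<integral>\<^sup>+x. ennreal (\<bar>\<psi> x\<bar> * indicator Z x) \<partial>lborel) \<le> ennreal (s * (K * ?I + \<epsilon> / 2))"
        using thickening_integral[OF dim(2) K thick borel_B bounded_B hausdorff_B_finite \<psi>c nmb half_gt_zero[OF \<epsilon>]] by auto
      obtain s2 where s2: "s2 > 0" "\<And>s. 0 < s \<Longrightarrow> s < s2 \<Longrightarrow>
         \<bar>(LINT x|lborel. indicator (\<Omega> \<inter> {x. - s < snd x}) x * \<psi> x) / s - (LINT x|lborel. indicator (flat F) x * \<psi> (x, 0))\<bar> \<le> \<epsilon> / 2"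
        using flat_layer_integral[OF \<psi>c half_gt_zero[OF \<epsilon>]] by blast
      have I0: "0 \<le> ?I" by simp
      define Q where "Q s = (LINT x|lborel. indicator \<Omega> x * (\<psi> x - \<psi> (x - s *\<^sub>R b))) / s" for s
      have Q: "\<bar>Q s - ?J\<bar> \<le> K * ?I + \<epsilon>" if s: "0 < s" "s < min s1 s2" for s
      proof -
        have \<psi>sc: "continuous_on UNIV (\<lambda>x. \<psi> (x - s *\<^sub>R b))"
          by (rule continuous_on_compose2[OF \<psi>c]) (auto intro: continuous_intros)
        have i1: "integrable lborel (\<lambda>x. indicator \<Omega> x * \<psi> x)"
          by (rule integrable_indicator_continuous[OF borel_\<Omega> bounded_\<Omega> \<psi>c])
        have i2: "integrable lborel (\<lambda>x. indicator \<Omega> x * \<psi> (x - s *\<^sub>R b))"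
          by (rule integrable_indicator_continuous[OF borel_\<Omega> bounded_\<Omega> \<psi>sc])
        have i3: "integrable lborel (\<lambda>x. indicator \<Omega> (x + s *\<^sub>R b) * \<psi> x)"
          using integrable_lborel_shift[OF i2, of "s *\<^sub>R b"] by simp
        have i4: "integrable lborel (\<lambda>x. indicator (V s) x * \<psi> x)"
          using bounded_\<Omega> by (intro integrable_indicator_continuous Vb \<psi>c) (auto simp: V_def intro: bounded_subset)
        have sh: "(LINT x|lborel. indicator \<Omega> (x + s *\<^sub>R b) * \<psi> x) = (LINT x|lborel. indicator \<Omega> x * \<psi> (x - s *\<^sub>R b))"
          using integral_lborel_shift[of "\<lambda>x. indicator \<Omega> x * \<psi> (x - s *\<^sub>R b)" "s *\<^sub>R b"] i2 by simp
        have "(LINT x|lborel. indicator \<Omega> x * (\<psi> x - \<psi> (x - s *\<^sub>R b))) = (LINT x|lborel. indicator \<Omega> x * \<psi> x) - (LINT x|lborel. indicator \<Omega> (x + s *\<^sub>R b) * \<psi> x)"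
          unfolding right_diff_distrib sh by (rule Bochner_Integration.integral_diff[OF i1 i2])
        also have "\<dots> = (LINT x|lborel. E s x * \<psi> x) + (LINT x|lborel. indicator (V s) x * \<psi> x)"
          unfolding E_def left_diff_distrib using i1 i3 i4 by simp
        finally have Qs: "Q s = (LINT x|lborel. E s x * \<psi> x) / s + (LINT x|lborel. indicator (V s) x * \<psi> x) / s"
          unfolding Q_def by (simp add: add_divide_distrib)
        have iE: "integrable lborel (\<lambda>x. E s x * \<psi> x)"
          unfolding E_def left_diff_distrib using i1 i3 i4 by simp
        have "ennreal \<bar>LINT x|lborel. E s x * \<psi> x\<bar> \<le> (\<integral>\<^sup>+x. norm (E s x * \<psi> x) \<partial>lborel)"
          using integral_norm_bound_ennreal[OF iE] by simp
        also have "\<dots> \<le> (\<integral>\<^sup>+x. ennreal (\<bar>\<psi> x\<bar> * indicator (Z s) x) \<partial>lborel)"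
        proof (rule nn_integral_mono_AE)
          show "AE x in lborel. ennreal (norm (E s x * \<psi> x)) \<le> ennreal (\<bar>\<psi> x\<bar> * indicator (Z s) x)"
            using snd_hyperplane_null[of "- s"]
          proof eventually_elim
            case (elim x)
            show ?case
            proof (rule ennreal_leI)
              show "norm (E s x * \<psi> x) \<le> \<bar>\<psi> x\<bar> * indicator (Z s) x"
                using mult_right_mono[OF E1[of s x], of "\<bar>\<psi> x\<bar>"] elim by (cases "E s x = 0") (auto simp: Z_def abs_mult)
            qed
          qed
        qed
        also have "\<dots> \<le> ennreal (s * (K * ?I + \<epsilon> / 2))"
          using s by (intro s1(2) Zb ZB) auto
        finally have "\<bar>LINT x|lborel. E s x * \<psi> x\<bar> \<le> s * (K * ?I + \<epsilon> / 2)"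
          using s K I0 \<epsilon> by (subst (asm) ennreal_le_iff) auto
        then have b1: "\<bar>(LINT x|lborel. E s x * \<psi> x) / s\<bar> \<le> K * ?I + \<epsilon> / 2"
          using s by (simp add: abs_divide pos_divide_le_eq mult.commute)
        have "\<bar>(LINT x|lborel. indicator (V s) x * \<psi> x) / s - ?J\<bar> \<le> \<epsilon> / 2"
        proof (cases ?vert)
          case True
          then show ?thesis using s2(2)[of s] s by (simp add: V_def)
        next
          case False
          then show ?thesis using \<epsilon> by (simp add: V_def)
        qed
        with b1 show ?thesis unfolding Qs by linarith
      qed
      have lim: "(\<lambda>n. \<bar>Q (inverse (real (Suc n))) - ?J\<bar>) \<longlonglongrightarrow> \<bar>?D - ?J\<bar>"
        unfolding Q_def by (intro tendsto_intros backward_quotient_integral_tendsto[OF \<psi> c borel_\<Omega> bounded_\<Omega>])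
      have "\<forall>\<^sub>F n in sequentially. inverse (real (Suc n)) < min s1 s2"
        using LIMSEQ_inverse_real_of_nat s1(1) s2(1) by (intro order_tendstoD(2)) auto
      then have "\<forall>\<^sub>F n in sequentially. \<bar>Q (inverse (real (Suc n))) - ?J\<bar> \<le> K * ?I + \<epsilon>"
        by eventually_elim (rule Q, auto)
      then show ?thesis using tendsto_upperbound[OF lim] by simp
    qed
    then show "\<bar>?D - ?J\<bar> \<le> K * ?I" by (rule field_le_epsilon)
  qed
  qed
qed

end

section \<open>Traces of eigenfunctions\<close>

lemma square_integrable_add:
  fixes f g :: "'a \<Rightarrow> 'b::euclidean_space"
  assumes "square_integrable M f" "square_integrable M g"
  shows "square_integrable M (\<lambda>x. f x + g x)"
  unfolding square_integrable_def
proof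
  show m: "(\<lambda>x. f x + g x) \<in> borel_measurable M" using assms by (auto simp: square_integrable_def)
  show "integrable M (\<lambda>x. (norm (f x + g x))\<^sup>2)"
  proof (rule Bochner_Integration.integrable_bound)
    show "integrable M (\<lambda>x. 2 * (norm (f x))\<^sup>2 + 2 * (norm (g x))\<^sup>2)" using assms by (auto simp: square_integrable_def)
    have "(norm (a + b))\<^sup>2 \<le> 2 * (norm a)\<^sup>2 + 2 * (norm b)\<^sup>2" for a b :: 'b
    proof -
      have "(norm (a + b))\<^sup>2 \<le> (norm a + norm b)\<^sup>2" by (intro power_mono norm_triangle_ineq) auto
      also have "\<dots> \<le> 2 * (norm a)\<^sup>2 + 2 * (norm b)\<^sup>2"
        using zero_le_power2[of "norm a - norm b"] by (simp add: power2_eq_square algebra_simps)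
      finally show ?thesis .
    qed
    then show "AE x in M. norm ((norm (f x + g x))\<^sup>2) \<le> norm (2 * (norm (f x))\<^sup>2 + 2 * (norm (g x))\<^sup>2)" by simp
  qed (use m in simp)
qed

lemma square_integrable_scaleR:
  fixes f :: "'a \<Rightarrow> 'b::euclidean_space"
  shows "square_integrable M f \<Longrightarrow> square_integrable M (\<lambda>x. c *\<^sub>R f x)"
  by (auto simp: square_integrable_def power_mult_distrib)

lemma square_integrable_inner:
  fixes f :: "'a \<Rightarrow> 'b::euclidean_space"
  assumes "square_integrable M f" "norm b \<le> 1"
  shows "square_integrable M (\<lambda>x. f x \<bullet> b)"
  unfolding square_integrable_def
proof
  show m: "(\<lambda>x. f x \<bullet> b) \<in> borel_measurable M" using assms by (auto simp: square_integrable_def)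
  show "integrable M (\<lambda>x. (norm (f x \<bullet> b))\<^sup>2)"
  proof (rule Bochner_Integration.integrable_bound)
    show "integrable M (\<lambda>x. (norm (f x))\<^sup>2)" using assms by (simp add: square_integrable_def)
    have "\<bar>v \<bullet> b\<bar> \<le> norm v" for v :: 'b
      using Cauchy_Schwarz_ineq2[of v b] mult_left_mono[OF assms(2), of "norm v"] by simp
    then have "(v \<bullet> b)\<^sup>2 \<le> (norm v)\<^sup>2" for v :: 'b by (simp add: power2_le_iff_abs_le)
    then show "AE x in M. norm ((norm (f x \<bullet> b))\<^sup>2) \<le> norm ((norm (f x))\<^sup>2)" by simp
  qed (use m in simp)
qed

lemma integrable_inner_square_integrable:
  fixes f g :: "'a \<Rightarrow> 'b::euclidean_space"
  assumes "square_integrable M f" "square_integrable M g"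
  shows "integrable M (\<lambda>x. f x \<bullet> g x)"
proof (rule Bochner_Integration.integrable_bound)
  show "integrable M (\<lambda>x. (norm (f x))\<^sup>2 + (norm (g x))\<^sup>2)" using assms by (auto simp: square_integrable_def)
  show "(\<lambda>x. f x \<bullet> g x) \<in> borel_measurable M" using assms by (auto simp: square_integrable_def)
  have "\<bar>v \<bullet> w\<bar> \<le> (norm v)\<^sup>2 + (norm w)\<^sup>2" for v w :: 'b
  proof -
    have "\<bar>v \<bullet> w\<bar> \<le> norm v * norm w" by (rule Cauchy_Schwarz_ineq2)
    moreover have "0 \<le> (norm v - norm w)\<^sup>2" "0 \<le> norm v * norm w" by simp_all
    then have "norm v * norm w \<le> (norm v)\<^sup>2 + (norm w)\<^sup>2" unfolding power2_diff by linarith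
    ultimately show ?thesis by linarith
  qed
  then show "AE x in M. norm (f x \<bullet> g x) \<le> norm ((norm (f x))\<^sup>2 + (norm (g x))\<^sup>2)" by simp
qed

lemma L2_tendsto_scaleR:
  fixes g :: "'a \<Rightarrow> 'b::euclidean_space"
  assumes "L2_tendsto M f g"
  shows "L2_tendsto M (\<lambda>j x. c *\<^sub>R f j x) (\<lambda>x. c *\<^sub>R g x)"
proof -
  have eq: "(LINT x|M. (norm (c *\<^sub>R f j x - c *\<^sub>R g x))\<^sup>2) = c\<^sup>2 * (LINT x|M. (norm (f j x - g x))\<^sup>2)" for j
    by (simp add: scaleR_diff_right[symmetric] power_mult_distrib)
  have "(\<lambda>j. c\<^sup>2 * (LINT x|M. (norm (f j x - g x))\<^sup>2)) \<longlonglongrightarrow> c\<^sup>2 * 0"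
    using assms by (intro tendsto_intros) (simp add: L2_tendsto_def)
  then show ?thesis using assms unfolding L2_tendsto_def eq by (auto intro: square_integrable_scaleR)
qed

lemma L2_tendsto_AE_cong:
  fixes g g' :: "'a \<Rightarrow> 'b::euclidean_space"
  assumes "L2_tendsto M f g" "AE x in M. g x = g' x" "square_integrable M g'"
  shows "L2_tendsto M f g'"
proof -
  have "(LINT x|M. (norm (f j x - g x))\<^sup>2) = (LINT x|M. (norm (f j x - g' x))\<^sup>2)" for j
  proof (rule integral_cong_AE)
    have [measurable]: "f j \<in> borel_measurable M" "g \<in> borel_measurable M" "g' \<in> borel_measurable M"
      using assms by (auto simp: L2_tendsto_def square_integrable_def)
    show "(\<lambda>x. (norm (f j x - g x))\<^sup>2) \<in> borel_measurable M" "(\<lambda>x. (norm (f j x - g' x))\<^sup>2) \<in> borel_measurable M"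
      by measurable
    show "AE x in M. (norm (f j x - g x))\<^sup>2 = (norm (f j x - g' x))\<^sup>2"
      using assms(2) by eventually_elim simp
  qed
  then show ?thesis using assms by (simp add: L2_tendsto_def)
qed

lemma L2_tendsto_integral:
  fixes f :: "nat \<Rightarrow> 'a \<Rightarrow> real"
  assumes M: "finite_measure M" and f: "L2_tendsto M f g" and w: "w \<in> borel_measurable M" and C: "\<And>x. x \<in> space M \<Longrightarrow> \<bar>w x\<bar> \<le> C"
  shows "(\<lambda>j. LINT x|M. f j x * w x) \<longlonglongrightarrow> (LINT x|M. g x * w x)"
    and "(\<lambda>j. LINT x|M. \<bar>f j x * w x\<bar>) \<longlonglongrightarrow> (LINT x|M. \<bar>g x * w x\<bar>)"
proof -
  note sqi = square_integrable_imp_integrable[OF M]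
  interpret finite_measure M by fact
  have sq: "square_integrable M (f j)" "square_integrable M g" for j using f by (auto simp: L2_tendsto_def)
  have d: "(\<lambda>j. LINT x|M. (f j x - g x)\<^sup>2) \<longlonglongrightarrow> 0" using f by (simp add: L2_tendsto_def)
  have fm: "f j \<in> borel_measurable M" "g \<in> borel_measurable M" for j using sq by (auto simp: square_integrable_def)
  have fi: "integrable M (f j)" and gi: "integrable M g" for j
    using sqi sq by blast+
  have diff_sq: "integrable M (\<lambda>x. (f j x - g x)\<^sup>2)" for j
  proof -
    have "square_integrable M (\<lambda>x. f j x + (- 1) *\<^sub>R g x)" by (intro square_integrable_add square_integrable_scaleR sq)
    then show ?thesis by (simp add: square_integrable_def)
  qed
  have wi: "integrable M (\<lambda>x. u x * w x)" if "integrable M u" for u :: "'a \<Rightarrow> real"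
  proof (rule Bochner_Integration.integrable_bound[OF integrable_mult_right[OF that, of C]])
    show "(\<lambda>x. u x * w x) \<in> borel_measurable M" using that w by simp
    show "AE x in M. norm (u x * w x) \<le> norm (C * u x)"
    proof (rule AE_I2)
      fix x assume "x \<in> space M"
      then have "\<bar>w x\<bar> \<le> \<bar>C\<bar>" using C[of x] by linarith
      then show "norm (u x * w x) \<le> norm (C * u x)" by (simp add: abs_mult mult.commute[of "\<bar>u x\<bar>"] mult_right_mono)
    qed
  qed
  have L1: "(\<lambda>j. LINT x|M. \<bar>f j x - g x\<bar> * \<bar>C\<bar>) \<longlonglongrightarrow> 0"
  proof (rule LIMSEQ_I)
    fix r :: real assume r: "r > 0"
    define m where "m = measure M (space M)"
    define e where "e = r / ((\<bar>C\<bar> + 1) * (m + 1))"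
    have m0: "m \<ge> 0" by (simp add: m_def)
    have e: "e > 0" using r m0 by (simp add: e_def add_nonneg_pos)
    have "\<forall>\<^sub>F j in sequentially. (LINT x|M. (f j x - g x)\<^sup>2) < e * e"
      using d e by (intro order_tendstoD(2)) auto
    then obtain N where N: "\<And>j. j \<ge> N \<Longrightarrow> (LINT x|M. (f j x - g x)\<^sup>2) < e * e" by (auto simp: eventually_sequentially)
    have "norm ((LINT x|M. \<bar>f j x - g x\<bar> * \<bar>C\<bar>) - 0) < r" if j: "j \<ge> N" for j
    proof -
      \<comment> \<open>The inequality t \<le> e / 2 + t^2 / (2 e) takes the place of
        Cauchy-Schwarz: once the squares integrate to less than e^2, both terms are of order
        e.\<close>
      have "(LINT x|M. \<bar>f j x - g x\<bar>) \<le> (LINT x|M. e / 2 + (f j x - g x)\<^sup>2 / (2 * e))"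
      proof (rule integral_mono)
        show "integrable M (\<lambda>x. \<bar>f j x - g x\<bar>)" using fi gi by simp
        show "integrable M (\<lambda>x. e / 2 + (f j x - g x)\<^sup>2 / (2 * e))" using diff_sq by simp
        fix x
        have "0 \<le> (e - \<bar>f j x - g x\<bar>)\<^sup>2" by simp
        then have "2 * e * \<bar>f j x - g x\<bar> \<le> e\<^sup>2 + (f j x - g x)\<^sup>2" by (simp add: power2_diff)
        then show "\<bar>f j x - g x\<bar> \<le> e / 2 + (f j x - g x)\<^sup>2 / (2 * e)"
          using e by (simp add: field_simps power2_eq_square)
      qed
      also have "\<dots> = e / 2 * m + (LINT x|M. (f j x - g x)\<^sup>2) / (2 * e)"
        using diff_sq by (simp add: m_def)
      also have "\<dots> < e / 2 * m + e * e / (2 * e)" using N[OF j] e by (intro add_strict_left_mono divide_strict_right_mono) auto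
      also have "\<dots> \<le> e * (m + 1)" using e m0 by (simp add: field_simps)
      finally have "(LINT x|M. \<bar>f j x - g x\<bar>) < e * (m + 1)" .
      then have "(LINT x|M. \<bar>f j x - g x\<bar>) * \<bar>C\<bar> \<le> e * (m + 1) * \<bar>C\<bar>" by (intro mult_right_mono) auto
      also have "\<dots> < e * (m + 1) * (\<bar>C\<bar> + 1)" using e m0 by (intro mult_strict_left_mono) auto
      also have "\<dots> = r" using m0 by (simp add: e_def field_simps add_nonneg_eq_0_iff)
      finally show ?thesis by simp
    qed
    then show "\<exists>no. \<forall>n\<ge>no. norm ((LINT x|M. \<bar>f n x - g x\<bar> * \<bar>C\<bar>) - 0) < r" by blast
  qed
  have pt: "\<bar>a * w x - b * w x\<bar> \<le> \<bar>a - b\<bar> * \<bar>C\<bar>" if "x \<in> space M" for a b x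
    using C[OF that] by (simp add: left_diff_distrib[symmetric] abs_mult mult_left_mono)
  have L1i: "integrable M (\<lambda>x. \<bar>f j x - g x\<bar> * \<bar>C\<bar>)" for j using fi gi by simp
  show "(\<lambda>j. LINT x|M. f j x * w x) \<longlonglongrightarrow> (LINT x|M. g x * w x)"
  proof (rule Lim_transform)
    show "(\<lambda>j. LINT x|M. g x * w x) \<longlonglongrightarrow> (LINT x|M. g x * w x)" by simp
    have "norm ((LINT x|M. f j x * w x) - (LINT x|M. g x * w x)) \<le> norm (LINT x|M. \<bar>f j x - g x\<bar> * \<bar>C\<bar>) * 1" for j
    proof -
      have "\<bar>(LINT x|M. f j x * w x) - (LINT x|M. g x * w x)\<bar> = \<bar>LINT x|M. f j x * w x - g x * w x\<bar>"
        using wi fi gi by simp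
      also have "\<dots> \<le> (LINT x|M. \<bar>f j x - g x\<bar> * \<bar>C\<bar>)"
        by (rule order_trans[OF integral_abs_bound], rule integral_mono) (use wi fi gi L1i pt in auto)
      finally show ?thesis by simp
    qed
    then show "(\<lambda>j. (LINT x|M. f j x * w x) - (LINT x|M. g x * w x)) \<longlonglongrightarrow> 0"
      by (intro tendsto_0_le[OF L1, where K = 1] always_eventually allI)
  qed
  show "(\<lambda>j. LINT x|M. \<bar>f j x * w x\<bar>) \<longlonglongrightarrow> (LINT x|M. \<bar>g x * w x\<bar>)"
  proof (rule Lim_transform)
    show "(\<lambda>j. LINT x|M. \<bar>g x * w x\<bar>) \<longlonglongrightarrow> (LINT x|M. \<bar>g x * w x\<bar>)" by simp
    have "norm ((LINT x|M. \<bar>f j x * w x\<bar>) - (LINT x|M. \<bar>g x * w x\<bar>)) \<le> norm (LINT x|M. \<bar>f j x - g x\<bar> * \<bar>C\<bar>) * 1" for j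
    proof -
      have "\<bar>(LINT x|M. \<bar>f j x * w x\<bar>) - (LINT x|M. \<bar>g x * w x\<bar>)\<bar> = \<bar>LINT x|M. \<bar>f j x * w x\<bar> - \<bar>g x * w x\<bar>\<bar>"
        using wi fi gi by simp
      also have "\<dots> \<le> (LINT x|M. \<bar>f j x - g x\<bar> * \<bar>C\<bar>)"
      proof (rule order_trans[OF integral_abs_bound], rule integral_mono)
        fix x assume "x \<in> space M"
        then show "\<bar>\<bar>f j x * w x\<bar> - \<bar>g x * w x\<bar>\<bar> \<le> \<bar>f j x - g x\<bar> * \<bar>C\<bar>"
          using pt[of x "f j x" "g x"] by linarith
      qed (use wi fi gi L1i in auto)
      finally show ?thesis by simp
    qed
    then show "(\<lambda>j. (LINT x|M. \<bar>f j x * w x\<bar>) - (LINT x|M. \<bar>g x * w x\<bar>)) \<longlonglongrightarrow> 0"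
      by (intro tendsto_0_le[OF L1, where K = 1] always_eventually allI)
  qed
qed

lemma L2_tendsto_inner:
  fixes f :: "nat \<Rightarrow> 'a \<Rightarrow> 'b::euclidean_space"
  assumes "L2_tendsto M f g" "norm b \<le> 1"
  shows "L2_tendsto M (\<lambda>j x. f j x \<bullet> b) (\<lambda>x. g x \<bullet> b)"
  unfolding L2_tendsto_def
proof (intro conjI allI)
  have sq: "square_integrable M (f j)" "square_integrable M g" for j using assms by (auto simp: L2_tendsto_def)
  show "square_integrable M (\<lambda>x. f j x \<bullet> b)" "square_integrable M (\<lambda>x. g x \<bullet> b)" for j
    using square_integrable_inner[OF _ assms(2)] sq by blast+
  have d: "square_integrable M (\<lambda>x. f j x + (- 1) *\<^sub>R g x)" for j by (intro square_integrable_add square_integrable_scaleR sq)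
  have le: "\<bar>v \<bullet> b\<bar> \<le> norm v" for v :: 'b
    using Cauchy_Schwarz_ineq2[of v b] mult_left_mono[OF assms(2), of "norm v"] by simp
  have mono: "(LINT x|M. (norm (f j x \<bullet> b - g x \<bullet> b))\<^sup>2) \<le> (LINT x|M. (norm (f j x - g x))\<^sup>2)" for j
  proof (rule integral_mono)
    show "integrable M (\<lambda>x. (norm (f j x - g x))\<^sup>2)" using d by (simp add: square_integrable_def)
    show "integrable M (\<lambda>x. (norm (f j x \<bullet> b - g x \<bullet> b))\<^sup>2)"
      using square_integrable_inner[OF d assms(2)] by (simp add: square_integrable_def inner_diff_left)
    show "(norm (f j x \<bullet> b - g x \<bullet> b))\<^sup>2 \<le> (norm (f j x - g x))\<^sup>2" for x
      using le[of "f j x - g x"] by (intro power_mono) (auto simp: inner_diff_left)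
  qed
  have lim: "(\<lambda>j. LINT x|M. (norm (f j x - g x))\<^sup>2) \<longlonglongrightarrow> 0" using assms(1) by (simp add: L2_tendsto_def)
  show "(\<lambda>j. LINT x|M. (norm (f j x \<bullet> b - g x \<bullet> b))\<^sup>2) \<longlonglongrightarrow> 0"
    by (rule tendsto_sandwich[OF always_eventually always_eventually tendsto_const lim]) (simp, intro allI mono)
qed

section \<open>Uniqueness of weak gradients, and multiples of traces\<close>

lemma has_weak_gradient_weak_gradient: "f \<in> H1 \<Omega> \<Longrightarrow> has_weak_gradient \<Omega> f (weak_gradient \<Omega> f)"
  unfolding H1_def weak_gradient_def by (auto intro: someI[of "has_weak_gradient \<Omega> f"])

lemma finite_measure_lebesgue_on_bounded:
  "\<Omega> \<in> sets lebesgue \<Longrightarrow> bounded \<Omega> \<Longrightarrow> finite_measure (lebesgue_on \<Omega>)"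
  by (simp add: finite_measure_lebesgue_on bounded_set_imp_lmeasurable)

lemma test_function_bounded_measurable:
  fixes \<phi> :: "'a::euclidean_space \<Rightarrow> real"
  assumes "test_function \<Omega> \<phi>"
  obtains C where "continuous_on UNIV \<phi>" "\<And>x. \<bar>\<phi> x\<bar> \<le> C"
proof -
  obtain K where K: "compact K" "\<And>x. x \<notin> K \<Longrightarrow> \<phi> x = 0" using assms unfolding test_function_def by blast
  have "Ck_on 0 UNIV \<phi>" using assms unfolding test_function_def smooth_on_def by blast
  then have c: "continuous_on UNIV \<phi>" by simp
  then have "bounded (\<phi> ` K)" using K(1) continuous_on_subset compact_continuous_image compact_imp_bounded by (metis subset_UNIV)
  then obtain C where "\<And>x. x \<in> K \<Longrightarrow> \<bar>\<phi> x\<bar> \<le> C" by (auto simp: bounded_iff)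
  then have "\<bar>\<phi> x\<bar> \<le> \<bar>C\<bar>" for x using K(2)[of x] by (cases "x \<in> K") (auto intro: order_trans[OF _ abs_ge_self])
  then show thesis using c that by blast
qed

text \<open>This makes the choice in \<open>weak_gradient\<close> harmless: components of two
  candidates have equal integrals against every test function, so their difference is orthogonal to
  all of them.\<close>

lemma weak_gradient_unique:
  fixes \<Omega> :: "'a::euclidean_space set"
  assumes \<Omega>: "open \<Omega>" "bounded \<Omega>" and G: "has_weak_gradient \<Omega> f G" and G': "has_weak_gradient \<Omega> f G'"
  shows "AE x in lebesgue_on \<Omega>. G x = G' x"
proof -
  have S: "\<Omega> \<in> sets lebesgue" using \<Omega> by (simp add: lborelD)
  note fin = finite_measure_lebesgue_on_bounded[OF S \<Omega>(2)]
  have sq: "square_integrable (lebesgue_on \<Omega>) G" "square_integrable (lebesgue_on \<Omega>) G'"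
    using G G' by (auto simp: has_weak_gradient_def)
  have "AE x in lebesgue_on \<Omega>. (G x - G' x) \<bullet> b = 0" if b: "b \<in> Basis" for b
  proof (rule AE_zero_if_orthogonal_to_test_functions[OF \<Omega>(1)])
    have nb: "norm b \<le> 1" using b by simp
    have i: "integrable (lebesgue_on \<Omega>) (\<lambda>x. G x \<bullet> b)" "integrable (lebesgue_on \<Omega>) (\<lambda>x. G' x \<bullet> b)"
      using square_integrable_imp_integrable[OF fin square_integrable_inner[OF _ nb]] sq by blast+
    then show "integrable (lebesgue_on \<Omega>) (\<lambda>x. (G x - G' x) \<bullet> b)" by (simp add: inner_diff_left)
    fix \<phi> assume \<phi>: "test_function \<Omega> \<phi>"
    obtain C where C: "continuous_on UNIV \<phi>" "\<And>x. \<bar>\<phi> x\<bar> \<le> C" using test_function_bounded_measurable[OF \<phi>] by blast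
    have \<phi>m: "\<phi> \<in> borel_measurable (lebesgue_on \<Omega>)"
      using continuous_imp_measurable_on_sets_lebesgue[OF continuous_on_subset[OF C(1)] S] by blast
    have ii: "integrable (lebesgue_on \<Omega>) (\<lambda>x. u x * \<phi> x)" if u: "integrable (lebesgue_on \<Omega>) u" for u :: "'a \<Rightarrow> real"
    proof (rule Bochner_Integration.integrable_bound[OF integrable_mult_right[OF u, of C]])
      show "(\<lambda>x. u x * \<phi> x) \<in> borel_measurable (lebesgue_on \<Omega>)" using u \<phi>m by (intro borel_measurable_times) auto
      have "\<bar>\<phi> x\<bar> \<le> \<bar>C\<bar>" for x using C(2)[of x] by linarith
      then show "AE x in lebesgue_on \<Omega>. norm (u x * \<phi> x) \<le> norm (C * u x)"
        by (intro AE_I2) (simp add: abs_mult mult.commute mult_right_mono)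
    qed
    have "(LINT x|lebesgue_on \<Omega>. (G x \<bullet> b) * \<phi> x) = (LINT x|lebesgue_on \<Omega>. (G' x \<bullet> b) * \<phi> x)"
      using G[unfolded has_weak_gradient_def, THEN conjunct2, rule_format, OF \<phi> b]
        G'[unfolded has_weak_gradient_def, THEN conjunct2, rule_format, OF \<phi> b] by simp
    then show "(LINT x|lebesgue_on \<Omega>. (G x - G' x) \<bullet> b * \<phi> x) = 0"
      using ii[OF i(1)] ii[OF i(2)] by (simp add: inner_diff_left left_diff_distrib)
  qed
  then have "AE x in lebesgue_on \<Omega>. \<forall>b\<in>Basis. (G x - G' x) \<bullet> b = 0"
    by (intro AE_finite_allI) auto
  then show ?thesis
  proof eventually_elim
    case (elim x)
    then show ?case using euclidean_eqI[of "G x" "G' x"] by (auto simp: inner_diff_left)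
  qed
qed

lemma gradient_cmult:
  assumes "f differentiable (at x)"
  shows "gradient (\<lambda>x. c * f x) x = c *\<^sub>R gradient f x"
proof -
  have "(f has_derivative frechet_derivative f (at x)) (at x)" using assms frechet_derivative_works by blast
  from has_derivative_mult_right[OF this, of c]
  have "frechet_derivative (\<lambda>x. c * f x) (at x) = (\<lambda>h. c * frechet_derivative f (at x) h)" by (rule frechet_derivative_eqI)
  then show ?thesis by (simp add: gradient_def scaleR_sum_right)
qed

lemma smooth_on_differentiable: "smooth_on UNIV f \<Longrightarrow> f differentiable (at x)"
proof -
  assume "smooth_on UNIV f"
  then have "Ck_on (Suc 0) UNIV f" unfolding smooth_on_def by blast
  then show ?thesis by simp
qed

text \<open>Serves to show that u and 2u have traces together. As \<open>weak_gradient\<close> is a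
  choice, the gradient of the multiple agrees with the multiple of the gradient only almost
  everywhere, and this enters as a hypothesis.\<close>

lemma has_trace_cmult:
  fixes \<Omega> :: "'a::euclidean_space set"
  assumes h: "has_trace \<Omega> f h" and G: "square_integrable (lebesgue_on \<Omega>) (weak_gradient \<Omega> (\<lambda>x. c * f x))"
    and eq: "AE x in lebesgue_on \<Omega>. c *\<^sub>R weak_gradient \<Omega> f x = weak_gradient \<Omega> (\<lambda>x. c * f x) x"
  shows "has_trace \<Omega> (\<lambda>x. c * f x) (\<lambda>x. c * h x)"
proof -
  obtain \<phi> where \<phi>: "\<And>j. smooth_on UNIV (\<phi> j)" "L2_tendsto (lebesgue_on \<Omega>) \<phi> f"
    "L2_tendsto (lebesgue_on \<Omega>) (\<lambda>j. gradient (\<phi> j)) (weak_gradient \<Omega> f)" "L2_tendsto (boundary_measure \<Omega>) \<phi> h"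
    using h unfolding has_trace_def by blast
  have "gradient (\<lambda>x. c * \<phi> j x) = (\<lambda>x. c *\<^sub>R gradient (\<phi> j) x)" for j
    by (rule ext) (rule gradient_cmult[OF smooth_on_differentiable[OF \<phi>(1)]])
  then have "L2_tendsto (lebesgue_on \<Omega>) (\<lambda>j. gradient (\<lambda>x. c * \<phi> j x)) (weak_gradient \<Omega> (\<lambda>x. c * f x))"
    using L2_tendsto_AE_cong[OF L2_tendsto_scaleR[OF \<phi>(3), of c] eq G] by simp
  moreover have "smooth_on UNIV (\<lambda>x. c * \<phi> j x)" for j
    using \<phi>(1)[of j] unfolding smooth_on_def by (blast intro: Ck_on_cmult)
  ultimately show ?thesis
    unfolding has_trace_def using L2_tendsto_scaleR[OF \<phi>(2), of c] L2_tendsto_scaleR[OF \<phi>(4), of c]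
    by (intro exI[of _ "\<lambda>j x. c * \<phi> j x"]) auto
qed

lemma lint_lebesgue_on:
  fixes f :: "'e::euclidean_space \<Rightarrow> real"
  assumes "f \<in> borel_measurable borel" "S \<in> sets borel"
  shows "(LINT x|lebesgue_on S. f x) = (LINT x|lborel. indicator S x * f x)"
proof -
  have S: "S \<in> sets lebesgue" using assms by simp
  have "(LINT x|lebesgue_on S. f x) = (LINT x|lebesgue. indicator S x *\<^sub>R f x)"
    using S by (subst integral_restrict_space) auto
  also have "\<dots> = (LINT x|lborel. indicator S x *\<^sub>R f x)"
    using assms by (intro integral_completion) auto
  finally show ?thesis by simp
qed

lemma hausdorff_outer_measure_mono: "A \<subseteq> B \<Longrightarrow> hausdorff_outer_measure m A \<le> hausdorff_outer_measure m B"
  unfolding hausdorff_outer_measure_def by (intro SUP_mono) (auto intro: hausdorff_content_mono)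

lemma L2_tendsto_const:
  fixes g :: "'a \<Rightarrow> 'b::euclidean_space"
  shows "square_integrable M g \<Longrightarrow> L2_tendsto M (\<lambda>_. g) g"
  by (simp add: L2_tendsto_def)

context cylindrical_domain
begin

lemma lebesgue_\<Omega>: "\<Omega> \<in> sets lebesgue"
  using borel_\<Omega> by simp

lemma finite_measure_\<Omega>: "finite_measure (lebesgue_on \<Omega>)"
  by (rule finite_measure_lebesgue_on_bounded[OF lebesgue_\<Omega> bounded_\<Omega>])

lemma finite_measure_frontier: "finite_measure (boundary_measure \<Omega>)"
  by (rule finite_measure_boundary_measure[OF lipschitz_\<Omega> open_\<Omega> bounded_\<Omega>]) (simp add: Suc_leI)

lemma boundary_measure_eq: "boundary_measure \<Omega> = restrict_space (hausdorff_measure DIM('a)) (frontier \<Omega>)"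
  by (simp add: boundary_measure_def)

lemma space_boundary: "space (boundary_measure \<Omega>) = frontier \<Omega>"
  by (simp add: boundary_measure_eq space_restrict_space)

lemma sets_boundary: "X \<in> sets (boundary_measure \<Omega>) \<longleftrightarrow> X \<subseteq> frontier \<Omega> \<and> X \<in> sets borel"
  by (subst boundary_measure_eq, subst sets_restrict_space_iff) (auto intro: borel_closed)

lemma emeasure_boundary: "X \<in> sets (boundary_measure \<Omega>) \<Longrightarrow> emeasure (boundary_measure \<Omega>) X = hausdorff_outer_measure DIM('a) X"
  using sets_boundary[of X] unfolding boundary_measure_eq
  by (subst emeasure_restrict_space) (auto simp: emeasure_hausdorff_measure Suc_leI intro: borel_closed)

lemma has_trace_if_AE_const:
  assumes u: "u \<in> H1 \<Omega>" and c: "AE x in lebesgue_on \<Omega>. u x = c" and G: "AE x in lebesgue_on \<Omega>. weak_gradient \<Omega> u x = 0"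
  shows "has_trace \<Omega> u (\<lambda>_. c)"
  unfolding has_trace_def
proof (intro exI[of _ "\<lambda>_ _. c"] conjI allI)
  have sqc: "square_integrable M (\<lambda>_. c)" if "finite_measure M" for M :: "('a \<times> real) measure"
    using that by (simp add: square_integrable_def finite_measure.integrable_const)
  show "smooth_on UNIV (\<lambda>_. c)" by (simp add: smooth_on_def Ck_on_const)
  show "L2_tendsto (lebesgue_on \<Omega>) (\<lambda>_ _. c) u"
    by (rule L2_tendsto_AE_cong[OF L2_tendsto_const[OF sqc[OF finite_measure_\<Omega>]]]) (use c u in \<open>auto simp: H1_def elim: eventually_mono\<close>)
  show "L2_tendsto (boundary_measure \<Omega>) (\<lambda>_ _. c) (\<lambda>_. c)"
    by (rule L2_tendsto_const[OF sqc[OF finite_measure_frontier]])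
  have 0: "gradient (\<lambda>_. c) = (\<lambda>x::'a \<times> real. 0)" by (auto simp: gradient_def)
  show "L2_tendsto (lebesgue_on \<Omega>) (\<lambda>_. gradient (\<lambda>_. c)) (weak_gradient \<Omega> u)"
    unfolding 0
    by (rule L2_tendsto_AE_cong[OF L2_tendsto_const])
      (use G has_weak_gradient_weak_gradient[OF u] in \<open>auto simp: square_integrable_def has_weak_gradient_def elim: eventually_mono\<close>)
qed

lemma weak_gradient_cmult:
  assumes u: "u \<in> H1 \<Omega>"
  shows "(\<lambda>x. c * u x) \<in> H1 \<Omega>" "AE x in lebesgue_on \<Omega>. c *\<^sub>R weak_gradient \<Omega> u x = weak_gradient \<Omega> (\<lambda>x. c * u x) x"
proof -
  have G: "has_weak_gradient \<Omega> u (weak_gradient \<Omega> u)" by (rule has_weak_gradient_weak_gradient[OF u])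
  have cG: "has_weak_gradient \<Omega> (\<lambda>x. c * u x) (\<lambda>x. c *\<^sub>R weak_gradient \<Omega> u x)"
    using G unfolding has_weak_gradient_def by (auto intro: square_integrable_scaleR simp: mult.assoc)
  then show cu: "(\<lambda>x. c * u x) \<in> H1 \<Omega>"
    using u square_integrable_scaleR[of "lebesgue_on \<Omega>" u c] unfolding H1_def by auto
  show "AE x in lebesgue_on \<Omega>. c *\<^sub>R weak_gradient \<Omega> u x = weak_gradient \<Omega> (\<lambda>x. c * u x) x"
    by (rule weak_gradient_unique[OF open_\<Omega> bounded_\<Omega> cG has_weak_gradient_weak_gradient[OF cu]])
qed

lemma AE_const_if_gradient_zero:
  assumes "square_integrable (lebesgue_on \<Omega>) u"
    "\<And>\<phi> b. test_function \<Omega> \<phi> \<Longrightarrow> b \<in> Basis \<Longrightarrow> (LINT x|lebesgue_on \<Omega>. u x * frechet_derivative \<phi> (at x) b) = 0"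
  shows "\<exists>c. AE x in lebesgue_on \<Omega>. u x = c"
  using AE_const_if_weak_gradient_zero[OF open_\<Omega> connected_\<Omega> square_integrable_imp_integrable[OF finite_measure_\<Omega> assms(1)] assms(2)]
  by blast

text \<open>
  If a trace did not exist for an eigenfunction u, then neither would one for 2u, and the junk value
  \<open>boundary_trace\<close> would be the same function for both.  Testing the weak equation with u and with 2u
  shows that the gradient of u vanishes, so that u is constant and has a trace after all.
\<close>

lemma eigenfunction_has_trace:
  assumes "u \<in> steklov_dirichlet_eigenspace \<Omega> F B \<mu>"
  shows "has_trace \<Omega> u (boundary_trace \<Omega> u)"
proof (rule ccontr)
  assume not: "\<not> ?thesis"
  then have no: "\<not> has_trace \<Omega> u h" for h unfolding boundary_trace_def by (metis someI)
  define v where "v = (\<lambda>x. 2 * u x)"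
  have uV: "u \<in> H1_vanishing \<Omega> B"
    and eqn: "\<And>v. v \<in> H1_vanishing \<Omega> B \<Longrightarrow> (LINT x|lebesgue_on \<Omega>. weak_gradient \<Omega> u x \<bullet> weak_gradient \<Omega> v x)
        = \<mu> * (LINT y|lebesgue_on (flat F). boundary_trace \<Omega> u (y, 0) * boundary_trace \<Omega> v (y, 0))"
    using assms by (auto simp: steklov_dirichlet_eigenspace_def)
  have uH: "u \<in> H1 \<Omega>" using uV by (simp add: H1_vanishing_def)
  note G = has_weak_gradient_weak_gradient[OF uH]
  have vH: "v \<in> H1 \<Omega>" unfolding v_def by (rule weak_gradient_cmult[OF uH])
  have Gv: "AE x in lebesgue_on \<Omega>. 2 *\<^sub>R weak_gradient \<Omega> u x = weak_gradient \<Omega> v x"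
    unfolding v_def by (rule weak_gradient_cmult[OF uH])
  have nov: "\<not> has_trace \<Omega> v h" for h
  proof
    assume h: "has_trace \<Omega> v h"
    have vu: "(\<lambda>x. (1/2) * v x) = u" by (simp add: v_def)
    have "has_trace \<Omega> (\<lambda>x. (1/2) * v x) (\<lambda>x. (1/2) * h x)"
    proof (rule has_trace_cmult[OF h])
      show "square_integrable (lebesgue_on \<Omega>) (weak_gradient \<Omega> (\<lambda>x. (1/2) * v x))"
        unfolding vu using G by (simp add: has_weak_gradient_def)
      show "AE x in lebesgue_on \<Omega>. (1/2) *\<^sub>R weak_gradient \<Omega> v x = weak_gradient \<Omega> (\<lambda>x. (1/2) * v x) x"
        unfolding vu using Gv
      proof eventually_elim
        case (elim x)
        then show ?case by (simp add: elim[symmetric])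
      qed
    qed
    then show False using no unfolding vu by blast
  qed
  have "has_trace \<Omega> v = has_trace \<Omega> u" using no nov by blast
  then have bt: "boundary_trace \<Omega> v = boundary_trace \<Omega> u" by (simp add: boundary_trace_def)
  then have vV: "v \<in> H1_vanishing \<Omega> B" using uV vH by (simp add: H1_vanishing_def)
  have gm: "weak_gradient \<Omega> u \<in> borel_measurable (lebesgue_on \<Omega>)" "weak_gradient \<Omega> v \<in> borel_measurable (lebesgue_on \<Omega>)"
    using G has_weak_gradient_weak_gradient[OF vH] by (auto simp: has_weak_gradient_def square_integrable_def)
  have "(LINT x|lebesgue_on \<Omega>. weak_gradient \<Omega> u x \<bullet> weak_gradient \<Omega> v x) = (LINT x|lebesgue_on \<Omega>. 2 * (weak_gradient \<Omega> u x \<bullet> weak_gradient \<Omega> u x))"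
  proof (rule integral_cong_AE)
    show "AE x in lebesgue_on \<Omega>. weak_gradient \<Omega> u x \<bullet> weak_gradient \<Omega> v x = 2 * (weak_gradient \<Omega> u x \<bullet> weak_gradient \<Omega> u x)"
      using Gv by eventually_elim (metis inner_scaleR_right)
  qed (use gm in auto)
  moreover have "(LINT x|lebesgue_on \<Omega>. weak_gradient \<Omega> u x \<bullet> weak_gradient \<Omega> v x) = (LINT x|lebesgue_on \<Omega>. weak_gradient \<Omega> u x \<bullet> weak_gradient \<Omega> u x)"
    using eqn[OF vV] eqn[OF uV] unfolding bt by simp
  ultimately have "(LINT x|lebesgue_on \<Omega>. (norm (weak_gradient \<Omega> u x))\<^sup>2) = 0" by (simp add: power2_norm_eq_inner)
  then have "AE x in lebesgue_on \<Omega>. (norm (weak_gradient \<Omega> u x))\<^sup>2 = 0"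
    using G by (subst (asm) integral_nonneg_eq_0_iff_AE) (auto simp: has_weak_gradient_def square_integrable_def)
  then have G0: "AE x in lebesgue_on \<Omega>. weak_gradient \<Omega> u x = 0" by simp
  have "\<exists>c. AE x in lebesgue_on \<Omega>. u x = c"
  proof (rule AE_const_if_gradient_zero)
    show "square_integrable (lebesgue_on \<Omega>) u" using uH by (simp add: H1_def)
    fix \<phi> and b :: "'a \<times> real" assume *: "test_function \<Omega> \<phi>" "b \<in> Basis"
    have "(LINT x|lebesgue_on \<Omega>. (weak_gradient \<Omega> u x \<bullet> b) * \<phi> x) = 0"
      using G0 by (intro integral_eq_zero_AE) (auto elim: eventually_mono)
    with G * show "(LINT x|lebesgue_on \<Omega>. u x * frechet_derivative \<phi> (at x) b) = 0"
      unfolding has_weak_gradient_def by simp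
  qed
  then show False using has_trace_if_AE_const[OF uH _ G0] no by blast
qed

section \<open>Boundary values on the flat part\<close>

lemma measurable_flat_boundary: "(\<lambda>x. (x, 0)) \<in> measurable (lebesgue_on (flat F)) (boundary_measure \<Omega>)"
  unfolding boundary_measure_eq
proof (rule measurable_restrict_space2)
  show "(\<lambda>x. (x, 0)) \<in> space (lebesgue_on (flat F)) \<rightarrow> frontier \<Omega>"
    using frontier_eq by (auto simp: flat_def)
  have "(\<lambda>x::'a. (x, 0::real)) \<in> measurable lborel (hausdorff_measure DIM('a))"
    by (subst measurable_cong_sets[OF sets_lborel sets_hausdorff_measure]) simp
  then show "(\<lambda>x. (x, 0)) \<in> measurable (lebesgue_on (flat F)) (hausdorff_measure DIM('a) :: ('a \<times> real) measure)"
    by (intro measurable_restrict_space1 measurable_completion)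
qed

text \<open>Traces converge in L2 of the Hausdorff measure, while the eigenvalue equation integrates
  over \<open>flat F\<close> with Lebesgue measure. The image of the latter on the boundary is
  dominated, as a measure, by K times the former, and integrals of nonnegative functions
  follow.\<close>

lemma flat_le_boundary_measure:
  obtains K :: real where "K > 0" "\<And>g. g \<in> borel_measurable (boundary_measure \<Omega>) \<Longrightarrow>
    (\<integral>\<^sup>+x. g (x, 0) \<partial>lebesgue_on (flat F)) \<le> ennreal K * (\<integral>\<^sup>+x. g x \<partial>boundary_measure \<Omega>)"
proof -
  interpret bm: finite_measure "boundary_measure \<Omega>" by (rule finite_measure_frontier)
  show thesis
  proof (rule lebesgue_le_hausdorff_flat[where 'a = 'a])
    fix K :: real assume K: "K > 0" and le: "\<And>A :: 'a set. A \<in> sets borel \<Longrightarrow> hausdorff_outer_measure DIM('a) (A \<times> {0::real}) < top \<Longrightarrow>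
      emeasure lborel A \<le> ennreal K * hausdorff_outer_measure DIM('a) (A \<times> {0::real})"
    let ?M = "distr (lebesgue_on (flat F)) (boundary_measure \<Omega>) (\<lambda>x. (x, 0))"
    let ?N = "scale_measure (ennreal K) (boundary_measure \<Omega>)"
    \<comment> \<open>A Borel set X of the boundary is compared through its part Y on F. Finiteness
      of the boundary measure supplies the finiteness that \<open>le\<close> asks for.\<close>
    have "?M \<le> ?N"
    proof (subst le_measure)
      show "sets ?M = sets ?N" by simp
      show "\<forall>X\<in>sets ?M. emeasure ?M X \<le> emeasure ?N X"
      proof
        fix X assume "X \<in> sets ?M"
        then have X: "X \<in> sets (boundary_measure \<Omega>)" by simp
        then have Xb: "X \<subseteq> frontier \<Omega>" "X \<in> sets borel" by (auto simp: sets_boundary)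
        define Y where "Y = {x \<in> flat F. (x, 0) \<in> X}"
        have Yb: "Y \<in> sets borel"
        proof -
          have "(\<lambda>x::'a. (x, 0::real)) \<in> borel_measurable borel" by simp
          from measurable_sets[OF this Xb(2)] have "(\<lambda>x. (x, 0)) -` X \<in> sets borel" by simp
          moreover have "Y = flat F \<inter> (\<lambda>x. (x, 0)) -` X" by (auto simp: Y_def)
          ultimately show ?thesis using borel_flat by simp
        qed
        have "Y \<times> {0} \<subseteq> X" by (auto simp: Y_def)
        then have out: "hausdorff_outer_measure DIM('a) (Y \<times> {0::real}) \<le> emeasure (boundary_measure \<Omega>) X"
          unfolding emeasure_boundary[OF X] by (rule hausdorff_outer_measure_mono)
        also have "\<dots> < top" using bm.emeasure_finite[of X] by (simp add: less_top[symmetric])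
        finally have fin: "hausdorff_outer_measure DIM('a) (Y \<times> {0::real}) < top" .
        have "emeasure ?M X = emeasure (lebesgue_on (flat F)) Y"
          using X measurable_flat_boundary by (subst emeasure_distr) (auto simp: Y_def vimage_def Int_def conj_commute)
        also have "\<dots> = emeasure lborel Y"
          using borel_flat Yb by (subst emeasure_restrict_space) (auto simp: Y_def)
        also have "\<dots> \<le> ennreal K * hausdorff_outer_measure DIM('a) (Y \<times> {0::real})" by (rule le[OF Yb fin])
        also have "\<dots> \<le> ennreal K * emeasure (boundary_measure \<Omega>) X" by (intro mult_left_mono out) simp
        finally show "emeasure ?M X \<le> emeasure ?N X" by simp
      qed
    qed
    show thesis
    proof (rule that[OF K])
      fix g :: "'a \<times> real \<Rightarrow> ennreal" assume g: "g \<in> borel_measurable (boundary_measure \<Omega>)"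
      have "(\<integral>\<^sup>+x. g (x, 0) \<partial>lebesgue_on (flat F)) = (\<integral>\<^sup>+x. g x \<partial>?M)"
        using g measurable_flat_boundary by (subst nn_integral_distr) auto
      also have "\<dots> \<le> (\<integral>\<^sup>+x. g x \<partial>?N)"
        by (rule nn_integral_mono_measure[OF _ \<open>?M \<le> ?N\<close>]) simp
      also have "\<dots> = ennreal K * (\<integral>\<^sup>+x. g x \<partial>boundary_measure \<Omega>)"
        using g by (simp add: nn_integral_scale_measure)
      finally show "(\<integral>\<^sup>+x. g (x, 0) \<partial>lebesgue_on (flat F)) \<le> ennreal K * (\<integral>\<^sup>+x. g x \<partial>boundary_measure \<Omega>)" .
    qed
  qed
qed

lemma L2_tendsto_flat:
  fixes \<phi> :: "nat \<Rightarrow> 'a \<times> real \<Rightarrow> real"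
  assumes \<phi>: "L2_tendsto (boundary_measure \<Omega>) \<phi> h"
  shows "L2_tendsto (lebesgue_on (flat F)) (\<lambda>j x. \<phi> j (x, 0)) (\<lambda>x. h (x, 0))"
proof -
  obtain K where K: "K > 0" "\<And>g. g \<in> borel_measurable (boundary_measure \<Omega>) \<Longrightarrow>
    (\<integral>\<^sup>+x. g (x, 0) \<partial>lebesgue_on (flat F)) \<le> ennreal K * (\<integral>\<^sup>+x. g x \<partial>boundary_measure \<Omega>)"
    using flat_le_boundary_measure by blast
  have m: "(\<lambda>x. v (x, 0)) \<in> borel_measurable (lebesgue_on (flat F))" if "v \<in> borel_measurable (boundary_measure \<Omega>)" for v :: "'a \<times> real \<Rightarrow> real"
    using measurable_compose[OF measurable_flat_boundary that] .
  have le: "integrable (lebesgue_on (flat F)) (\<lambda>x. v (x, 0)) \<and> (LINT x|lebesgue_on (flat F). v (x, 0)) \<le> K * (LINT x|boundary_measure \<Omega>. v x)"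
    if v: "integrable (boundary_measure \<Omega>) v" "\<And>x. v x \<ge> 0" for v
  proof -
    have vm: "v \<in> borel_measurable (boundary_measure \<Omega>)" using v by simp
    have "(\<integral>\<^sup>+x. ennreal (v (x, 0)) \<partial>lebesgue_on (flat F)) \<le> ennreal K * (\<integral>\<^sup>+x. ennreal (v x) \<partial>boundary_measure \<Omega>)"
      using vm by (intro K(2)) simp
    also have "\<dots> = ennreal (K * (LINT x|boundary_measure \<Omega>. v x))"
      using v K by (subst nn_integral_eq_integral) (auto simp: ennreal_mult)
    finally have b: "(\<integral>\<^sup>+x. ennreal (v (x, 0)) \<partial>lebesgue_on (flat F)) \<le> ennreal (K * (LINT x|boundary_measure \<Omega>. v x))" .
    then have i: "integrable (lebesgue_on (flat F)) (\<lambda>x. v (x, 0))"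
      using v m[OF vm] by (intro integrableI_nonneg) (auto intro: le_less_trans)
    moreover have "(LINT x|lebesgue_on (flat F). v (x, 0)) \<le> K * (LINT x|boundary_measure \<Omega>. v x)"
      using b v K unfolding nn_integral_eq_integral[OF i AE_I2[OF v(2)]] by (subst (asm) ennreal_le_iff) auto
    ultimately show ?thesis ..
  qed
  have sq: "square_integrable (boundary_measure \<Omega>) (\<phi> j)" "square_integrable (boundary_measure \<Omega>) h" for j
    using \<phi> by (auto simp: L2_tendsto_def)
  have sqf: "square_integrable (lebesgue_on (flat F)) (\<lambda>x. v (x, 0))" if "square_integrable (boundary_measure \<Omega>) v" for v :: "'a \<times> real \<Rightarrow> real"
    using that m le[of "\<lambda>x. (v x)\<^sup>2"] by (auto simp: square_integrable_def)
  have d: "integrable (boundary_measure \<Omega>) (\<lambda>x. (\<phi> j x - h x)\<^sup>2)" for j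
    using square_integrable_add[OF sq(1)[of j] square_integrable_scaleR[OF sq(2), of "- 1"]] by (simp add: square_integrable_def)
  have lim: "(\<lambda>j. K * (LINT x|boundary_measure \<Omega>. (\<phi> j x - h x)\<^sup>2)) \<longlonglongrightarrow> K * 0"
    using \<phi> by (intro tendsto_intros) (simp add: L2_tendsto_def)
  have "(\<lambda>j. LINT x|lebesgue_on (flat F). (\<phi> j (x, 0) - h (x, 0))\<^sup>2) \<longlonglongrightarrow> 0"
  proof (rule tendsto_sandwich[OF always_eventually always_eventually tendsto_const])
    show "(\<lambda>j. K * (LINT x|boundary_measure \<Omega>. (\<phi> j x - h x)\<^sup>2)) \<longlonglongrightarrow> 0" using lim by simp
    show "\<forall>j. (LINT x|lebesgue_on (flat F). (\<phi> j (x, 0) - h (x, 0))\<^sup>2) \<le> K * (LINT x|boundary_measure \<Omega>. (\<phi> j x - h x)\<^sup>2)"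
      using le[OF d] by simp
  qed simp
  then show ?thesis using sq sqf by (auto simp: L2_tendsto_def)
qed

text \<open>\<open>green\<close> is applied to \<open>\<phi> j x * w x\<close> for smooth
  approximations \<open>\<phi> j\<close> of u. The error is at most K times the integral of their
  absolute value over B, and this tends to the integral of |h w| over B, where h vanishes. Hence the
  limit is an identity although \<open>green\<close> is an inequality.\<close>

lemma weak_green:
  fixes w :: "'a \<times> real \<Rightarrow> real"
  assumes tr: "has_trace \<Omega> u h" and hB: "AE x in boundary_measure \<Omega>. x \<in> B \<longrightarrow> h x = 0"
    and w: "\<And>x. (w has_derivative w' x) (at x)" and wc: "continuous_on UNIV (\<lambda>x. w' x b)" and b: "b \<in> Basis"
  shows "(LINT x|lebesgue_on \<Omega>. (weak_gradient \<Omega> u x \<bullet> b) * w x) + (LINT x|lebesgue_on \<Omega>. u x * w' x b) =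
    (if b = (0, 1) then LINT x|lebesgue_on (flat F). h (x, 0) * w (x, 0) else 0)"
proof -
  obtain \<phi> where \<phi>s: "\<And>j. smooth_on UNIV (\<phi> j)" and \<phi>: "L2_tendsto (lebesgue_on \<Omega>) \<phi> u"
    "L2_tendsto (lebesgue_on \<Omega>) (\<lambda>j. gradient (\<phi> j)) (weak_gradient \<Omega> u)" "L2_tendsto (boundary_measure \<Omega>) \<phi> h"
    using tr unfolding has_trace_def by blast
  have "\<exists>K>0. \<forall>(\<psi> :: 'a \<times> real \<Rightarrow> real) \<psi>' b. (\<forall>x. (\<psi> has_derivative \<psi>' x) (at x)) \<longrightarrow> continuous_on UNIV (\<lambda>x. \<psi>' x b) \<longrightarrow> b \<in> Basis \<longrightarrow>
    \<bar>(LINT x|lborel. indicator \<Omega> x * \<psi>' x b) - (if b = (0, 1) then LINT x|lborel. indicator (flat F) x * \<psi> (x, 0) else 0)\<bar>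
      \<le> K * (LINT x|hausdorff_measure DIM('a). \<bar>\<psi> x\<bar> * indicator B x)"
    by (rule green) blast
  then obtain K where K: "K > 0" and green': "\<And>(\<psi> :: 'a \<times> real \<Rightarrow> real) \<psi>' b. (\<And>x. (\<psi> has_derivative \<psi>' x) (at x)) \<Longrightarrow> continuous_on UNIV (\<lambda>x. \<psi>' x b) \<Longrightarrow> b \<in> Basis \<Longrightarrow>
    \<bar>(LINT x|lborel. indicator \<Omega> x * \<psi>' x b) - (if b = (0, 1) then LINT x|lborel. indicator (flat F) x * \<psi> (x, 0) else 0)\<bar>
      \<le> K * (LINT x|hausdorff_measure DIM('a). \<bar>\<psi> x\<bar> * indicator B x)"
    by blast
  have nb: "norm b \<le> 1" using b by simp
  have wcont: "continuous_on UNIV w"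
    using w by (meson continuous_at_imp_continuous_on has_derivative_continuous)
  have wm: "w \<in> borel_measurable borel" "(\<lambda>x. w' x b) \<in> borel_measurable borel"
    using wcont wc by (auto intro: borel_measurable_continuous_onI)
  have "compact (closure \<Omega>)" using bounded_\<Omega> by simp
  have bdd: "\<exists>C. \<forall>x\<in>closure \<Omega>. \<bar>g x\<bar> \<le> C" if "continuous_on UNIV g" for g :: "'a \<times> real \<Rightarrow> real"
  proof -
    have "bounded (g ` closure \<Omega>)"
      using \<open>compact (closure \<Omega>)\<close> that by (intro compact_imp_bounded compact_continuous_image) (auto intro: continuous_on_subset)
    then show ?thesis by (auto simp: bounded_iff)
  qed
  obtain C1 where C1: "\<And>x. x \<in> closure \<Omega> \<Longrightarrow> \<bar>w x\<bar> \<le> C1" using bdd[OF wcont] by blast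
  obtain C2 where C2: "\<And>x. x \<in> closure \<Omega> \<Longrightarrow> \<bar>w' x b\<bar> \<le> C2" using bdd[OF wc] by blast
  have \<Omega>cl: "x \<in> \<Omega> \<Longrightarrow> x \<in> closure \<Omega>" for x using closure_subset by blast
  have frcl: "x \<in> frontier \<Omega> \<Longrightarrow> x \<in> closure \<Omega>" for x by (simp add: frontier_def)
  have leb: "f \<in> borel_measurable (lebesgue_on \<Omega>)" if "f \<in> borel_measurable borel" for f :: "'a \<times> real \<Rightarrow> real"
    using that by (intro measurable_restrict_space1 measurable_completion) simp
  have Ck: "Ck_on k UNIV (\<phi> j)" for k j using \<phi>s unfolding smooth_on_def by blast
  have d\<phi>: "(\<phi> j has_derivative frechet_derivative (\<phi> j) (at x)) (at x)" for j x
    by (rule Ck_on_SucD1[OF Ck[of "Suc 0" j]])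
  have \<phi>c: "continuous_on UNIV (\<phi> j)" for j using Ck[of 0] by simp
  have d\<phi>c: "continuous_on UNIV (\<lambda>x. frechet_derivative (\<phi> j) (at x) b)" for j using Ck[of "Suc 0" j] b by simp
  have grad: "gradient (\<phi> j) x \<bullet> b = frechet_derivative (\<phi> j) (at x) b" for j x
    unfolding gradient_def using b by (simp add: inner_sum_left inner_Basis if_distrib cong: if_cong)
  have d\<psi>: "((\<lambda>x. \<phi> j x * w x) has_derivative (\<lambda>h. \<phi> j x * w' x h + frechet_derivative (\<phi> j) (at x) h * w x)) (at x)" for j x
    by (rule has_derivative_mult[OF d\<phi> w])
  have d\<psi>c: "continuous_on UNIV (\<lambda>x. \<phi> j x * w' x b + frechet_derivative (\<phi> j) (at x) b * w x)" for j
    by (intro continuous_intros \<phi>c d\<phi>c wcont wc)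
  define L where "L j = (LINT x|lebesgue_on \<Omega>. (gradient (\<phi> j) x \<bullet> b) * w x) + (LINT x|lebesgue_on \<Omega>. \<phi> j x * w' x b)" for j
  define R where "R j = (if b = (0, 1) then LINT x|lebesgue_on (flat F). \<phi> j (x, 0) * w (x, 0) else 0)" for j
  define E where "E j = (LINT x|boundary_measure \<Omega>. \<bar>\<phi> j x * (w x * indicator B x)\<bar>)" for j
  have bound: "\<bar>L j - R j\<bar> \<le> K * E j" for j
  proof -
    let ?\<psi>' = "\<lambda>x. \<phi> j x * w' x b + frechet_derivative (\<phi> j) (at x) b * w x"
    have i: "integrable lborel (\<lambda>x. indicator \<Omega> x * (\<phi> j x * w' x b))" "integrable lborel (\<lambda>x. indicator \<Omega> x * (frechet_derivative (\<phi> j) (at x) b * w x))"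
      by (intro integrable_indicator_continuous borel_\<Omega> bounded_\<Omega> continuous_intros \<phi>c d\<phi>c wcont wc)+
    have "(LINT x|lborel. indicator \<Omega> x * ?\<psi>' x) = L j"
    proof -
      have "(LINT x|lborel. indicator \<Omega> x * ?\<psi>' x) = (LINT x|lborel. indicator \<Omega> x * (\<phi> j x * w' x b)) + (LINT x|lborel. indicator \<Omega> x * (frechet_derivative (\<phi> j) (at x) b * w x))"
        unfolding distrib_left by (rule Bochner_Integration.integral_add[OF i])
      also have "\<dots> = L j"
        unfolding L_def grad
        by (subst (1 2) lint_lebesgue_on) (auto intro!: borel_measurable_continuous_onI continuous_intros \<phi>c d\<phi>c wcont wc borel_\<Omega>)
      finally show ?thesis .
    qed
    moreover have "(LINT x|lborel. indicator (flat F) x * (\<phi> j (x, 0) * w (x, 0))) = (LINT x|lebesgue_on (flat F). \<phi> j (x, 0) * w (x, 0))"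
    proof (rule lint_lebesgue_on[symmetric, OF _ borel_flat])
      have "continuous_on UNIV (\<lambda>x::'a. \<phi> j (x, 0) * w (x, 0))"
        by (intro continuous_on_mult continuous_on_compose2[OF \<phi>c] continuous_on_compose2[OF wcont] continuous_intros) auto
      then show "(\<lambda>x::'a. \<phi> j (x, 0) * w (x, 0)) \<in> borel_measurable borel" by (rule borel_measurable_continuous_onI)
    qed
    moreover have "(LINT x|hausdorff_measure DIM('a). \<bar>\<phi> j x * w x\<bar> * indicator B x) = E j"
    proof -
      have "E j = (LINT x|hausdorff_measure DIM('a). indicator (frontier \<Omega>) x *\<^sub>R \<bar>\<phi> j x * (w x * indicator B x)\<bar>)"
        unfolding E_def boundary_measure_eq by (rule integral_restrict_space) (auto intro: borel_closed)
      also have "\<dots> = (LINT x|hausdorff_measure DIM('a). \<bar>\<phi> j x * w x\<bar> * indicator B x)"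
        using frontier_eq by (intro Bochner_Integration.integral_cong) (auto simp: indicator_def)
      finally show ?thesis ..
    qed
    ultimately show ?thesis
      using green'[OF d\<psi> d\<psi>c b, of j] by (cases "b = (0, 1)") (simp_all add: R_def)
  qed
  have Llim: "L \<longlonglongrightarrow> (LINT x|lebesgue_on \<Omega>. (weak_gradient \<Omega> u x \<bullet> b) * w x) + (LINT x|lebesgue_on \<Omega>. u x * w' x b)"
    unfolding L_def
  proof (intro tendsto_add)
    show "(\<lambda>j. LINT x|lebesgue_on \<Omega>. (gradient (\<phi> j) x \<bullet> b) * w x) \<longlonglongrightarrow> (LINT x|lebesgue_on \<Omega>. (weak_gradient \<Omega> u x \<bullet> b) * w x)"
      by (rule L2_tendsto_integral(1)[OF finite_measure_\<Omega> L2_tendsto_inner[OF \<phi>(2) nb] leb[OF wm(1)], of C1]) (auto intro: C1 \<Omega>cl)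
    show "(\<lambda>j. LINT x|lebesgue_on \<Omega>. \<phi> j x * w' x b) \<longlonglongrightarrow> (LINT x|lebesgue_on \<Omega>. u x * w' x b)"
      by (rule L2_tendsto_integral(1)[OF finite_measure_\<Omega> \<phi>(1) leb[OF wm(2)], of C2]) (auto intro: C2 \<Omega>cl)
  qed
  have fF: "finite_measure (lebesgue_on (flat F))"
    by (rule finite_measure_lebesgue_on_bounded) (use borel_flat bounded_flat in auto)
  have Rlim: "R \<longlonglongrightarrow> (if b = (0, 1) then LINT x|lebesgue_on (flat F). h (x, 0) * w (x, 0) else 0)"
  proof (cases "b = (0, 1)")
    case True
    have "(\<lambda>j. LINT x|lebesgue_on (flat F). \<phi> j (x, 0) * w (x, 0)) \<longlonglongrightarrow> (LINT x|lebesgue_on (flat F). h (x, 0) * w (x, 0))"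
    proof (rule L2_tendsto_integral(1)[OF fF L2_tendsto_flat[OF \<phi>(3)], of _ C1])
      have "w \<in> borel_measurable (boundary_measure \<Omega>)"
        unfolding boundary_measure_eq using wm(1) by (intro measurable_restrict_space1) simp
      then show "(\<lambda>x. w (x, 0)) \<in> borel_measurable (lebesgue_on (flat F))"
        by (rule measurable_compose[OF measurable_flat_boundary])
      show "\<bar>w (x, 0)\<bar> \<le> C1" if "x \<in> space (lebesgue_on (flat F))" for x
        using that frontier_eq by (intro C1 frcl) (auto simp: flat_def)
    qed
    then show ?thesis using True by (simp add: R_def[abs_def])
  next
    case False
    then show ?thesis by (simp add: R_def[abs_def])
  qed
  have "E \<longlonglongrightarrow> (LINT x|boundary_measure \<Omega>. \<bar>h x * (w x * indicator B x)\<bar>)"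
    unfolding E_def
  proof (rule L2_tendsto_integral(2)[OF finite_measure_frontier \<phi>(3), of _ C1])
    show "(\<lambda>x. w x * indicator B x) \<in> borel_measurable (boundary_measure \<Omega>)"
      unfolding boundary_measure_eq using wm(1) borel_B by (intro measurable_restrict_space1) simp
    show "\<bar>w x * indicator B x\<bar> \<le> C1" if "x \<in> space (boundary_measure \<Omega>)" for x
      using C1[of x] frcl[of x] that by (auto simp: space_boundary indicator_def)
  qed
  also have "(LINT x|boundary_measure \<Omega>. \<bar>h x * (w x * indicator B x)\<bar>) = 0"
    using hB by (intro integral_eq_zero_AE) (auto elim!: eventually_mono simp: indicator_def)
  finally have Elim: "(\<lambda>j. K * E j) \<longlonglongrightarrow> K * 0" by (intro tendsto_intros)
  have "(\<lambda>j. L j - R j) \<longlonglongrightarrow> 0"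
    by (rule Lim_null_comparison[of _ "\<lambda>j. K * E j"]) (use bound Elim in auto)
  moreover have "(\<lambda>j. L j - R j) \<longlonglongrightarrow> ((LINT x|lebesgue_on \<Omega>. (weak_gradient \<Omega> u x \<bullet> b) * w x) + (LINT x|lebesgue_on \<Omega>. u x * w' x b)) -
      (if b = (0, 1) then LINT x|lebesgue_on (flat F). h (x, 0) * w (x, 0) else 0)"
    by (rule tendsto_diff[OF Llim Rlim])
  ultimately show ?thesis using LIMSEQ_unique by fastforce
qed

end

section \<open>Fourier transforms and Gaussian regularisation\<close>

definition gauss :: "'a::euclidean_space \<Rightarrow> real" where
  "gauss x = exp (- (norm x)\<^sup>2 / 2)"

text \<open>With \<open>sin_transform\<close> the real and imaginary part of the integral of g(x)
  exp (i \<xi> \<bullet> x), kept apart so that all integrals stay real. As there is no normalising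
  factor, Plancherel carries \<open>(2 * pi) ^ DIM('a)\<close>.\<close>

definition cos_transform :: "('a::euclidean_space \<Rightarrow> real) \<Rightarrow> 'a \<Rightarrow> real" where
  "cos_transform g \<xi> = (LINT x|lborel. g x * cos (\<xi> \<bullet> x))"

definition sin_transform :: "('a::euclidean_space \<Rightarrow> real) \<Rightarrow> 'a \<Rightarrow> real" where
  "sin_transform g \<xi> = (LINT x|lborel. g x * sin (\<xi> \<bullet> x))"

lemma gauss_pos: "0 < gauss x" and gauss_le_1: "gauss x \<le> 1"
  by (simp_all add: gauss_def)

lemma gauss_measurable [measurable]: "gauss \<in> borel_measurable borel"
  unfolding gauss_def[abs_def] by measurable

lemma gauss_prod: "gauss x = (\<Prod>b\<in>Basis. exp (- (x \<bullet> b)\<^sup>2 / 2))"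
proof -
  have "(norm x)\<^sup>2 = (\<Sum>b\<in>Basis. (x \<bullet> b)\<^sup>2)"
    unfolding power2_norm_eq_inner by (subst euclidean_inner) (simp add: power2_eq_square)
  then show ?thesis by (simp add: gauss_def exp_sum[symmetric] sum_negf sum_divide_distrib)
qed

lemma lborel_integral_prod:
  fixes f :: "'a::euclidean_space \<Rightarrow> real \<Rightarrow> complex"
  assumes f: "\<And>b. b \<in> Basis \<Longrightarrow> integrable lborel (f b)"
  shows "integrable lborel (\<lambda>x. \<Prod>b\<in>Basis. f b (x \<bullet> b))"
    and "(LINT x|lborel. (\<Prod>b\<in>Basis. f b (x \<bullet> b))) = (\<Prod>b\<in>Basis. LINT x|lborel. f b x)"
proof -
  interpret product_sigma_finite "\<lambda>_. lborel :: real measure" by standard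
  let ?T = "\<lambda>g. \<Sum>b\<in>Basis. g b *\<^sub>R b :: 'a"
  have T: "?T \<in> measurable (\<Pi>\<^sub>M b\<in>Basis. lborel) borel" by measurable
  have fm: "f b \<in> borel_measurable borel" if "b \<in> Basis" for b using f[OF that] by simp
  have m: "(\<lambda>x. \<Prod>b\<in>Basis. f b (x \<bullet> b)) \<in> borel_measurable (borel :: 'a measure)"
    by (intro borel_measurable_prod measurable_compose[OF _ fm]) auto
  have co: "(\<Prod>b\<in>Basis. f b (?T g \<bullet> b)) = (\<Prod>b\<in>Basis. f b (g b))" for g
    by (intro prod.cong) (auto simp: inner_sum_left inner_Basis if_distrib cong: if_cong)
  show "integrable lborel (\<lambda>x. \<Prod>b\<in>Basis. f b (x \<bullet> b))"
    using product_integrable_prod[of Basis f] f by (subst lborel_eq, subst integrable_distr_eq[OF T m]) (simp add: co)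
  show "(LINT x|lborel. (\<Prod>b\<in>Basis. f b (x \<bullet> b))) = (\<Prod>b\<in>Basis. LINT x|lborel. f b x)"
    using product_integral_prod[of Basis f] f by (subst lborel_eq, subst integral_distr[OF T m]) (simp add: co)
qed

text \<open>Up to the factor sqrt (2 pi) the integral is the characteristic function of the standard
  normal distribution.\<close>

lemma gauss_fourier_real:
  shows "integrable lborel (\<lambda>x::real. complex_of_real (exp (- x\<^sup>2 / 2)) * iexp (x * w))"
    and "(LINT x|lborel. complex_of_real (exp (- x\<^sup>2 / 2)) * iexp (x * w)) = of_real (sqrt (2 * pi) * exp (- w\<^sup>2 / 2))"
proof -
  have e: "(complex_of_real (exp (- x\<^sup>2 / 2)) * iexp (x * w) :: complex) = of_real (sqrt (2 * pi)) * (std_normal_density x *\<^sub>R iexp (w * x))" for x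
    by (simp add: std_normal_density_def scaleR_conv_of_real mult.commute)
  have m: "(\<lambda>x. iexp (w * x)) \<in> borel_measurable lborel" by simp
  have i: "integrable lborel (\<lambda>x. std_normal_density x *\<^sub>R iexp (w * x))"
  proof (rule Bochner_Integration.integrable_bound)
    show "integrable lborel std_normal_density" by (rule integrable_normal_density) simp
    show "(\<lambda>x. std_normal_density x *\<^sub>R iexp (w * x)) \<in> borel_measurable lborel" by simp
  qed auto
  show "integrable lborel (\<lambda>x::real. complex_of_real (exp (- x\<^sup>2 / 2)) * iexp (x * w))"
    unfolding e by (rule integrable_mult_right[OF i])
  have "char std_normal_distribution w = (LINT x|lborel. std_normal_density x *\<^sub>R iexp (w * x))"
    unfolding char_def by (subst integral_density) auto
  then have "(LINT x|lborel. std_normal_density x *\<^sub>R iexp (w * x)) = of_real (exp (- w\<^sup>2 / 2))"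
    by (simp add: char_std_normal_distribution)
  then show "(LINT x|lborel. complex_of_real (exp (- x\<^sup>2 / 2)) * iexp (x * w)) = of_real (sqrt (2 * pi) * exp (- w\<^sup>2 / 2))"
    unfolding e by (subst integral_mult_right_zero) simp
qed

lemma gauss_fourier:
  fixes w :: "'a::euclidean_space"
  shows "integrable lborel (gauss :: 'a \<Rightarrow> real)"
    and "(LINT x|lborel. gauss x * cos (x \<bullet> w)) = sqrt (2 * pi) ^ DIM('a) * gauss w"
    and "(LINT x|lborel. gauss (x::'a)) = sqrt (2 * pi) ^ DIM('a)"
proof -
  have e: "(\<Prod>b\<in>Basis. complex_of_real (exp (- (x \<bullet> b)\<^sup>2 / 2)) * iexp ((x \<bullet> b) * (w \<bullet> b))) = complex_of_real (gauss x) * iexp (x \<bullet> w)" for x w :: 'a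
  proof -
    have "iexp (x \<bullet> w) = exp (\<Sum>b\<in>Basis. \<i> * complex_of_real ((x \<bullet> b) * (w \<bullet> b)))"
      by (subst euclidean_inner[of x w]) (simp add: sum_distrib_left)
    then have "(\<Prod>b\<in>Basis. iexp ((x \<bullet> b) * (w \<bullet> b))) = iexp (x \<bullet> w)"
      by (simp only: exp_sum[OF finite_Basis])
    then show ?thesis by (simp add: prod.distrib gauss_prod)
  qed
  have i: "integrable lborel (\<lambda>x::'a. complex_of_real (gauss x) * iexp (x \<bullet> w))" for w
    using lborel_integral_prod(1)[of "\<lambda>b x. complex_of_real (exp (- x\<^sup>2 / 2)) * iexp (x * (w \<bullet> b))"] gauss_fourier_real(1) unfolding e by simp
  have v: "(LINT x|lborel. complex_of_real (gauss x) * iexp (x \<bullet> w)) = of_real (sqrt (2 * pi) ^ DIM('a) * gauss w)" for w :: 'a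
    using lborel_integral_prod(2)[of "\<lambda>b x. complex_of_real (exp (- x\<^sup>2 / 2)) * iexp (x * (w \<bullet> b))"] gauss_fourier_real[of "w \<bullet> _"]
    unfolding e by (simp add: prod.distrib gauss_prod)
  have re: "Re (complex_of_real (gauss x) * iexp (x \<bullet> w)) = gauss x * cos (x \<bullet> w)" for x w :: 'a
    by (simp add: Re_exp)
  show c: "(LINT x|lborel. gauss x * cos (x \<bullet> w)) = sqrt (2 * pi) ^ DIM('a) * gauss w" for w :: 'a
    using integral_Re[OF i[of w]] v[of w] unfolding re by simp
  show "integrable lborel (gauss :: 'a \<Rightarrow> real)"
    using integrable_Re[OF i[of 0]] unfolding re by simp
  show "(LINT x|lborel. gauss (x::'a)) = sqrt (2 * pi) ^ DIM('a)"
    using c[of 0] by (simp add: gauss_def)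
qed

section \<open>Power spectra and Plancherel with Gaussian weights\<close>

lemma lborel_scaleR:
  fixes f :: "'a::euclidean_space \<Rightarrow> real"
  assumes f: "f \<in> borel_measurable borel" and c: "c > 0"
  shows "(LINT x|lborel. f x) = c ^ DIM('a) * (LINT x|lborel. f (c *\<^sub>R x))"
    and "integrable lborel f \<Longrightarrow> integrable lborel (\<lambda>x. f (c *\<^sub>R x))"
proof -
  have L: "lborel = density (distr lborel borel (\<lambda>x::'a. c *\<^sub>R x)) (\<lambda>_. ennreal (c ^ DIM('a)))"
    using lborel_affine[of c "0::'a"] c by simp
  show "(LINT x|lborel. f x) = c ^ DIM('a) * (LINT x|lborel. f (c *\<^sub>R x))"
    using f c by (subst L, subst integral_density) (auto simp: integral_distr)
  assume "integrable lborel f"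
  then have "integrable (distr lborel borel (\<lambda>x::'a. c *\<^sub>R x)) (\<lambda>x. c ^ DIM('a) *\<^sub>R f x)"
    using f c by (subst (asm) L, subst (asm) integrable_density) auto
  then have "integrable (distr lborel borel (\<lambda>x::'a. c *\<^sub>R x)) f" using c by simp
  then show "integrable lborel (\<lambda>x. f (c *\<^sub>R x))" using f by (subst (asm) integrable_distr_eq) auto
qed

lemma integrable_mult_bounded:
  fixes f g :: "'a \<Rightarrow> real"
  assumes "integrable M f" "g \<in> borel_measurable M" "\<And>x. \<bar>g x\<bar> \<le> 1"
  shows "integrable M (\<lambda>x. f x * g x)"
proof (rule Bochner_Integration.integrable_bound[OF assms(1)])
  show "(\<lambda>x. f x * g x) \<in> borel_measurable M" using assms by simp
  show "AE x in M. norm (f x * g x) \<le> norm (f x)"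
    using mult_left_mono[OF assms(3)] by (auto simp: abs_mult intro!: AE_I2)
qed

text \<open>The Wiener-Khinchin relation. After the shift v = w + x, the addition formula for cos
  (\<xi> \<bullet> (v - x)) splits the double integral into the two squares.\<close>

lemma power_spectrum_eq_correlation_transform:
  fixes g :: "'a::euclidean_space \<Rightarrow> real"
  assumes g [measurable]: "g \<in> borel_measurable borel" and gi: "integrable lborel g"
  shows "integrable lborel (\<lambda>w. LINT x|lborel. g (x + w) * g x)"
    and "(cos_transform g \<xi>)\<^sup>2 + (sin_transform g \<xi>)\<^sup>2 = (LINT w|lborel. (LINT x|lborel. g (x + w) * g x) * cos (\<xi> \<bullet> w))"
proof -
  have base: "integrable (lborel \<Otimes>\<^sub>M lborel) (\<lambda>(x, w). g (x + w) * g x)"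
  proof (rule lborel_pair.Fubini_integrable)
    show "(\<lambda>(x, w). g (x + w) * g x) \<in> borel_measurable (lborel \<Otimes>\<^sub>M lborel)" by measurable
    have sh: "integrable lborel (\<lambda>w. g (x + w))" for x using integrable_lborel_shift[OF gi, of x] by (simp add: add.commute)
    have "(LINT w|lborel. norm (case (x, w) of (x, w) \<Rightarrow> g (x + w) * g x)) = (LINT w|lborel. \<bar>g w\<bar>) * \<bar>g x\<bar>" for x
    proof -
      have "(LINT w|lborel. \<bar>g (x + w)\<bar>) = (LINT w|lborel. \<bar>g w\<bar>)"
        using integral_lborel_shift[of "\<lambda>w. \<bar>g w\<bar>" x] by (simp add: add.commute)
      then show ?thesis by (simp add: abs_mult)
    qed
    then show "integrable lborel (\<lambda>x. LINT w|lborel. norm (case (x, w) of (x, w) \<Rightarrow> g (x + w) * g x))" using gi by simp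
    show "AE x in lborel. integrable lborel (\<lambda>w. case (x, w) of (x, w) \<Rightarrow> g (x + w) * g x)" using sh by simp
  qed
  show "integrable lborel (\<lambda>w. LINT x|lborel. g (x + w) * g x)"
    by (rule lborel_pair.integrable_snd[OF base])
  have full: "integrable (lborel \<Otimes>\<^sub>M lborel) (\<lambda>(x, w). g (x + w) * g x * cos (\<xi> \<bullet> w))"
    using integrable_mult_bounded[OF base, of "\<lambda>(x, w). cos (\<xi> \<bullet> w)"] by (simp add: case_prod_beta')
  have gc: "integrable lborel (\<lambda>x. g x * cos (\<xi> \<bullet> x))" and gs: "integrable lborel (\<lambda>x. g x * sin (\<xi> \<bullet> x))"
    by (intro integrable_mult_bounded[OF gi]; simp)+
  have "(LINT w|lborel. (LINT x|lborel. g (x + w) * g x) * cos (\<xi> \<bullet> w)) = (LINT w|lborel. LINT x|lborel. g (x + w) * g x * cos (\<xi> \<bullet> w))"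
    by simp
  also have "\<dots> = (LINT x|lborel. LINT w|lborel. g (x + w) * g x * cos (\<xi> \<bullet> w))"
    by (rule lborel_pair.Fubini_integral[OF full])
  also have "\<dots> = (LINT x|lborel. g x * cos (\<xi> \<bullet> x) * cos_transform g \<xi> + g x * sin (\<xi> \<bullet> x) * sin_transform g \<xi>)"
  proof (rule Bochner_Integration.integral_cong)
    fix x
    have "(LINT w|lborel. g (x + w) * g x * cos (\<xi> \<bullet> w)) = (LINT w|lborel. g (w + x) * cos (\<xi> \<bullet> (w + x - x))) * g x"
      by (subst integral_mult_left_zero[symmetric]) (simp add: add.commute mult_ac)
    also have "(LINT w|lborel. g (w + x) * cos (\<xi> \<bullet> (w + x - x))) = (LINT v|lborel. g v * cos (\<xi> \<bullet> (v - x)))"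
      by (rule integral_lborel_shift[of "\<lambda>v. g v * cos (\<xi> \<bullet> (v - x))" x]) simp
    also have "\<dots> = (LINT v|lborel. g v * cos (\<xi> \<bullet> v) * cos (\<xi> \<bullet> x) + g v * sin (\<xi> \<bullet> v) * sin (\<xi> \<bullet> x))"
      by (simp add: inner_diff_right cos_diff algebra_simps)
    also have "\<dots> = cos_transform g \<xi> * cos (\<xi> \<bullet> x) + sin_transform g \<xi> * sin (\<xi> \<bullet> x)"
      using gc gs by (simp add: cos_transform_def sin_transform_def)
    finally show "(LINT w|lborel. g (x + w) * g x * cos (\<xi> \<bullet> w)) = g x * cos (\<xi> \<bullet> x) * cos_transform g \<xi> + g x * sin (\<xi> \<bullet> x) * sin_transform g \<xi>"
      by (simp add: algebra_simps)
  qed simp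
  also have "\<dots> = cos_transform g \<xi> * cos_transform g \<xi> + sin_transform g \<xi> * sin_transform g \<xi>"
    using gc gs by (simp add: cos_transform_def sin_transform_def)
  finally show "(cos_transform g \<xi>)\<^sup>2 + (sin_transform g \<xi>)\<^sup>2 = (LINT w|lborel. (LINT x|lborel. g (x + w) * g x) * cos (\<xi> \<bullet> w))"
    by (simp add: power2_eq_square)
qed

lemma transform_measurable [measurable]:
  fixes g :: "'a::euclidean_space \<Rightarrow> real"
  assumes [measurable]: "g \<in> borel_measurable borel"
  shows "cos_transform g \<in> borel_measurable borel" "sin_transform g \<in> borel_measurable borel"
proof -
  have "(\<lambda>\<xi>. LINT x|lborel. g x * cos (\<xi> \<bullet> x)) \<in> borel_measurable (borel :: 'a measure)"
    "(\<lambda>\<xi>. LINT x|lborel. g x * sin (\<xi> \<bullet> x)) \<in> borel_measurable (borel :: 'a measure)"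
    by measurable
  then show "cos_transform g \<in> borel_measurable borel" "sin_transform g \<in> borel_measurable borel"
    unfolding cos_transform_def[abs_def] sin_transform_def[abs_def] .
qed

text \<open>Integrability of the power spectrum is not known at this point; the Gaussian makes the
  double integral over \<xi> and w absolutely convergent, so that the order may be exchanged. The
  transform in \<xi> is a Gaussian in w / t, and putting w = t z moves t from the weight into the
  correlation.\<close>

lemma gaussian_power_spectrum:
  fixes g :: "'a::euclidean_space \<Rightarrow> real"
  assumes g [measurable]: "g \<in> borel_measurable borel" and gi: "integrable lborel g" and t: "t > 0"
  shows "integrable lborel (\<lambda>\<xi>. gauss (t *\<^sub>R \<xi>) * ((cos_transform g \<xi>)\<^sup>2 + (sin_transform g \<xi>)\<^sup>2))"
    and "(LINT \<xi>|lborel. gauss (t *\<^sub>R \<xi>) * ((cos_transform g \<xi>)\<^sup>2 + (sin_transform g \<xi>)\<^sup>2)) =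
      sqrt (2 * pi) ^ DIM('a) * (LINT z|lborel. gauss z * (LINT x|lborel. g (x + t *\<^sub>R z) * g x))"
proof -
  define r where "r w = (LINT x|lborel. g (x + w) * g x)" for w
  have ri: "integrable lborel r" unfolding r_def by (rule power_spectrum_eq_correlation_transform(1)[OF g gi])
  have rm [measurable]: "r \<in> borel_measurable borel" using ri by simp
  have ps: "(cos_transform g \<xi>)\<^sup>2 + (sin_transform g \<xi>)\<^sup>2 = (LINT w|lborel. r w * cos (\<xi> \<bullet> w))" for \<xi>
    unfolding r_def by (rule power_spectrum_eq_correlation_transform(2)[OF g gi])
  let ?c = "sqrt (2 * pi) ^ DIM('a)"
  have gti: "integrable lborel (\<lambda>\<xi>::'a. gauss (t *\<^sub>R \<xi>))"
    by (rule lborel_scaleR(2)[OF gauss_measurable t gauss_fourier(1)])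
  have base: "integrable (lborel \<Otimes>\<^sub>M lborel) (\<lambda>(\<xi>::'a, w). gauss (t *\<^sub>R \<xi>) * r w)"
  proof (rule lborel_pair.Fubini_integrable)
    show "(\<lambda>(\<xi>::'a, w). gauss (t *\<^sub>R \<xi>) * r w) \<in> borel_measurable (lborel \<Otimes>\<^sub>M lborel)" by measurable
    show "integrable lborel (\<lambda>\<xi>::'a. LINT w|lborel. norm (case (\<xi>, w) of (\<xi>, w) \<Rightarrow> gauss (t *\<^sub>R \<xi>) * r w))"
      using gti by (simp add: abs_mult)
    show "AE \<xi>::'a in lborel. integrable lborel (\<lambda>w. case (\<xi>, w) of (\<xi>, w) \<Rightarrow> gauss (t *\<^sub>R \<xi>) * r w)" using ri by simp
  qed
  have full: "integrable (lborel \<Otimes>\<^sub>M lborel) (\<lambda>(\<xi>, w). gauss (t *\<^sub>R \<xi>) * r w * cos (\<xi> \<bullet> w))"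
    using integrable_mult_bounded[OF base, of "\<lambda>(\<xi>, w). cos (\<xi> \<bullet> w)"] by (simp add: case_prod_beta')
  have e: "gauss (t *\<^sub>R \<xi>) * ((cos_transform g \<xi>)\<^sup>2 + (sin_transform g \<xi>)\<^sup>2) = (LINT w|lborel. gauss (t *\<^sub>R \<xi>) * r w * cos (\<xi> \<bullet> w))" for \<xi>
    unfolding ps by (simp add: mult.assoc)
  show "integrable lborel (\<lambda>\<xi>. gauss (t *\<^sub>R \<xi>) * ((cos_transform g \<xi>)\<^sup>2 + (sin_transform g \<xi>)\<^sup>2))"
    unfolding e by (rule lborel_pair.integrable_fst[OF full])
  have "(LINT \<xi>|lborel. gauss (t *\<^sub>R \<xi>) * ((cos_transform g \<xi>)\<^sup>2 + (sin_transform g \<xi>)\<^sup>2)) = (LINT w|lborel. LINT \<xi>|lborel. gauss (t *\<^sub>R \<xi>) * r w * cos (\<xi> \<bullet> w))"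
    unfolding e by (rule lborel_pair.Fubini_integral[OF full, symmetric])
  \<comment> \<open>Rescaling \<xi> by t reduces the inner integral to the transform of the standard
    Gaussian at w / t.\<close>
  also have "\<dots> = (LINT w|lborel. r w * (?c * gauss (inverse t *\<^sub>R w) / t ^ DIM('a)))"
  proof (rule Bochner_Integration.integral_cong)
    fix w :: 'a
    have "?c * gauss (inverse t *\<^sub>R w) = (LINT x|lborel. gauss x * cos (x \<bullet> (inverse t *\<^sub>R w)))"
      by (rule gauss_fourier(2)[symmetric])
    also have "\<dots> = t ^ DIM('a) * (LINT \<xi>|lborel. gauss (t *\<^sub>R \<xi>) * cos ((t *\<^sub>R \<xi>) \<bullet> (inverse t *\<^sub>R w)))"
      by (rule lborel_scaleR(1)) (use t in simp_all)
    also have "\<dots> = t ^ DIM('a) * (LINT \<xi>|lborel. gauss (t *\<^sub>R \<xi>) * cos (\<xi> \<bullet> w))"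
    proof -
      have eq: "(t *\<^sub>R \<xi>) \<bullet> (inverse t *\<^sub>R w) = \<xi> \<bullet> w" for \<xi> :: 'a
        using t by (simp add: field_simps)
      show ?thesis by (simp only: eq)
    qed
    finally have "(LINT \<xi>|lborel. gauss (t *\<^sub>R \<xi>) * cos (\<xi> \<bullet> w)) = ?c * gauss (inverse t *\<^sub>R w) / t ^ DIM('a)"
      using t by simp
    moreover have "(LINT \<xi>|lborel. gauss (t *\<^sub>R \<xi>) * r w * cos (\<xi> \<bullet> w)) = r w * (LINT \<xi>|lborel. gauss (t *\<^sub>R \<xi>) * cos (\<xi> \<bullet> w))"
      by (subst integral_mult_right_zero[symmetric]) (simp add: mult_ac)
    ultimately show "(LINT \<xi>|lborel. gauss (t *\<^sub>R \<xi>) * r w * cos (\<xi> \<bullet> w)) = r w * (?c * gauss (inverse t *\<^sub>R w) / t ^ DIM('a))" by simp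
  qed simp
  also have "\<dots> = t ^ DIM('a) * (LINT z|lborel. r (t *\<^sub>R z) * (?c * gauss (inverse t *\<^sub>R (t *\<^sub>R z)) / t ^ DIM('a)))"
    by (rule lborel_scaleR(1)) (use t in simp_all)
  also have "\<dots> = t ^ DIM('a) * (LINT z|lborel. (?c / t ^ DIM('a)) * (gauss z * r (t *\<^sub>R z)))"
    using t by (simp add: mult_ac)
  also have "\<dots> = ?c * (LINT z|lborel. gauss z * r (t *\<^sub>R z))"
    using t by (subst integral_mult_right_zero) simp
  finally show "(LINT \<xi>|lborel. gauss (t *\<^sub>R \<xi>) * ((cos_transform g \<xi>)\<^sup>2 + (sin_transform g \<xi>)\<^sup>2)) =
      ?c * (LINT z|lborel. gauss z * (LINT x|lborel. g (x + t *\<^sub>R z) * g x))" unfolding r_def .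
qed

text \<open>With r the autocorrelation of g, |r| \<le> r 0 gives the inequality for every t, and
  continuity of r at 0 gives the limit by dominated convergence. The inequality will be used for
  slices of the gradient, the limit for the boundary values.\<close>

lemma gaussian_plancherel:
  fixes g :: "'a::euclidean_space \<Rightarrow> real"
  assumes g [measurable]: "g \<in> borel_measurable borel" and gi: "integrable lborel g" and g2: "integrable lborel (\<lambda>x. (g x)\<^sup>2)"
  shows "t > 0 \<Longrightarrow> (LINT \<xi>|lborel. gauss (t *\<^sub>R \<xi>) * ((cos_transform g \<xi>)\<^sup>2 + (sin_transform g \<xi>)\<^sup>2)) \<le> (2 * pi) ^ DIM('a) * (LINT x|lborel. (g x)\<^sup>2)"
    and "(\<lambda>n. LINT \<xi>|lborel. gauss (inverse (real (Suc n)) *\<^sub>R \<xi>) * ((cos_transform g \<xi>)\<^sup>2 + (sin_transform g \<xi>)\<^sup>2))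
      \<longlonglongrightarrow> (2 * pi) ^ DIM('a) * (LINT x|lborel. (g x)\<^sup>2)"
proof -
  define r where "r w = (LINT x|lborel. g (x + w) * g x)" for w
  let ?c = "sqrt (2 * pi) ^ DIM('a)"
  let ?I = "LINT x|lborel. (g x)\<^sup>2"
  have ri: "integrable lborel r" unfolding r_def by (rule power_spectrum_eq_correlation_transform(1)[OF g gi])
  have rm [measurable]: "r \<in> borel_measurable borel" using ri by simp
  have rb: "\<bar>r w\<bar> \<le> ?I" for w unfolding r_def by (rule correlation_tendsto(3)[OF g g2])
  \<comment> \<open>One factor \<open>sqrt (2 * pi) ^ DIM('a)\<close> comes from the transform of
    the Gaussian, the other from its total mass.\<close>
  have cc: "?c * (?c * x) = (2 * pi) ^ DIM('a) * x" for x
  proof -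
    have q: "sqrt (2 * pi) * sqrt (2 * pi) = 2 * pi" by simp
    have "?c * ?c = (sqrt (2 * pi) * sqrt (2 * pi)) ^ DIM('a)" by (rule power_mult_distrib[symmetric])
    then have "?c * ?c = (2 * pi) ^ DIM('a)" by (simp only: q)
    then show ?thesis by (simp only: mult.assoc[symmetric])
  qed
  have gI: "(LINT z|lborel. gauss (z::'a) * ?I) = ?c * ?I" by (simp add: gauss_fourier(3))
  have bnd: "norm (gauss z * r (s *\<^sub>R z)) \<le> gauss z * ?I" for z s
    using rb[of "s *\<^sub>R z"] gauss_pos[of z] by (simp add: abs_mult)
  have iI: "integrable lborel (\<lambda>z::'a. gauss z * ?I)" by (rule integrable_mult_left) (rule gauss_fourier(1))
  have ii: "integrable lborel (\<lambda>z::'a. gauss z * r (s *\<^sub>R z))" for s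
    by (rule Bochner_Integration.integrable_bound[OF iI]) (use bnd in \<open>auto intro: order_trans[OF _ abs_ge_self]\<close>)
  show "(LINT \<xi>|lborel. gauss (t *\<^sub>R \<xi>) * ((cos_transform g \<xi>)\<^sup>2 + (sin_transform g \<xi>)\<^sup>2)) \<le> (2 * pi) ^ DIM('a) * ?I" if t: "t > 0"
  proof -
    have "(LINT z|lborel. gauss z * r (t *\<^sub>R z)) \<le> (LINT z|lborel. gauss (z::'a) * ?I)"
      using bnd by (intro integral_mono ii iI) (auto intro: order_trans[OF abs_ge_self])
    also have "\<dots> = ?c * ?I" by (rule gI)
    finally have "?c * (LINT z|lborel. gauss z * r (t *\<^sub>R z)) \<le> ?c * (?c * ?I)" by (intro mult_left_mono) auto
    then show ?thesis unfolding gaussian_power_spectrum(2)[OF g gi t] cc r_def .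
  qed
  define s where "s n = inverse (real (Suc n))" for n
  have s: "s n > 0" for n by (simp add: s_def)
  have "(\<lambda>n. LINT z|lborel. gauss z * r (s n *\<^sub>R z)) \<longlonglongrightarrow> (LINT z|lborel. gauss (z::'a) * ?I)"
  proof (rule integral_dominated_convergence[OF _ _ iI])
    show "AE z::'a in lborel. (\<lambda>n. gauss z * r (s n *\<^sub>R z)) \<longlonglongrightarrow> gauss z * ?I"
    proof (intro AE_I2 tendsto_mult tendsto_const)
      fix z :: 'a
      show "(\<lambda>n. r (s n *\<^sub>R z)) \<longlonglongrightarrow> ?I"
      \<comment> \<open>Continuity of the correlation was shown as a punctured limit at 0, so the
        point z = 0 is treated apart.\<close>
      proof (cases "z = 0")
        case True
        then show ?thesis by (simp add: r_def power2_eq_square)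
      next
        case False
        have "filterlim (\<lambda>n. s n *\<^sub>R z) (at 0) sequentially"
        proof (rule filterlim_atI)
          have "(\<lambda>n. s n *\<^sub>R z) \<longlonglongrightarrow> 0 *\<^sub>R z" unfolding s_def by (intro tendsto_intros LIMSEQ_inverse_real_of_nat)
          then show "(\<lambda>n. s n *\<^sub>R z) \<longlonglongrightarrow> 0" by simp
          show "\<forall>\<^sub>F n in sequentially. s n *\<^sub>R z \<noteq> 0" using False s by (auto simp: less_imp_neq[symmetric])
        qed
        then show ?thesis unfolding r_def by (rule filterlim_compose[OF correlation_tendsto(2)[OF g g2]])
      qed
    qed
  qed (use bnd in auto)
  then have "(\<lambda>n. ?c * (LINT z|lborel. gauss z * r (s n *\<^sub>R z))) \<longlonglongrightarrow> ?c * (?c * ?I)"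
    unfolding gI by (intro tendsto_intros)
  then show "(\<lambda>n. LINT \<xi>|lborel. gauss (inverse (real (Suc n)) *\<^sub>R \<xi>) * ((cos_transform g \<xi>)\<^sup>2 + (sin_transform g \<xi>)\<^sup>2))
      \<longlonglongrightarrow> (2 * pi) ^ DIM('a) * ?I"
    unfolding s_def[symmetric] gaussian_power_spectrum(2)[OF g gi s] cc r_def .
qed

text \<open>Functions on \<Omega> and F are measurable for the completed measure only, whereas
  slicing and Fubini need Borel functions on the product. Extension by zero turns integrals over S
  into integrals over the whole space.\<close>

lemma borel_representative:
  fixes u :: "'e::euclidean_space \<Rightarrow> real"
  assumes S: "S \<in> sets borel" and u: "square_integrable (lebesgue_on S) u"
  obtains v where "v \<in> borel_measurable borel" "\<And>x. x \<notin> S \<Longrightarrow> v x = 0" "AE x in lebesgue_on S. u x = v x"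
    "integrable lborel (\<lambda>x. (v x)\<^sup>2)" "(LINT x|lborel. (v x)\<^sup>2) = (LINT x|lebesgue_on S. (u x)\<^sup>2)"
proof -
  have Sl: "S \<in> sets lebesgue" using S by simp
  have "(\<lambda>x. indicator S x *\<^sub>R u x) \<in> borel_measurable lebesgue"
    using u Sl by (subst borel_measurable_restrict_space_iff[symmetric]) (auto simp: square_integrable_def)
  then obtain v0 where v0: "v0 \<in> borel_measurable lborel" "AE x in lborel. indicator S x *\<^sub>R u x = v0 x"
    using completion_ex_borel_measurable_real by blast
  define v where "v x = indicator S x * v0 x" for x
  have vm: "v \<in> borel_measurable borel" unfolding v_def[abs_def] using v0(1) S by simp
  have "AE x in lebesgue. indicator S x *\<^sub>R u x = v0 x" using v0(2) by (rule AE_completion)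
  then have ae: "AE x in lebesgue_on S. u x = v x"
    using Sl by (auto simp: AE_restrict_space_iff v_def indicator_def elim!: eventually_mono)
  have um: "u \<in> borel_measurable (lebesgue_on S)" using u by (simp add: square_integrable_def)
  have vml: "v \<in> borel_measurable (lebesgue_on S)"
    using vm by (intro measurable_restrict_space1 measurable_completion) simp
  have "integrable (lebesgue_on S) (\<lambda>x. (v x)\<^sup>2)"
  proof (rule integrable_cong_AE_imp)
    show "integrable (lebesgue_on S) (\<lambda>x. (u x)\<^sup>2)" using u by (simp add: square_integrable_def)
    show "AE x in lebesgue_on S. (u x)\<^sup>2 = (v x)\<^sup>2" using ae by eventually_elim simp
  qed (use vml in simp)
  then have "integrable lebesgue (\<lambda>x. indicator S x *\<^sub>R (v x)\<^sup>2)" using Sl by (subst (asm) integrable_restrict_space) auto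
  moreover have e: "indicator S x *\<^sub>R (v x)\<^sup>2 = (v x)\<^sup>2" for x by (simp add: v_def indicator_def)
  ultimately have "integrable lebesgue (\<lambda>x. (v x)\<^sup>2)" by (simp only: e)
  moreover have "(\<lambda>x. (v x)\<^sup>2) \<in> borel_measurable lborel" using vm by simp
  ultimately have i: "integrable lborel (\<lambda>x. (v x)\<^sup>2)" using integrable_completion by blast
  have "(LINT x|lebesgue_on S. (u x)\<^sup>2) = (LINT x|lebesgue_on S. (v x)\<^sup>2)"
    by (rule integral_cong_AE) (use um vml ae in \<open>auto elim!: eventually_mono\<close>)
  also have "\<dots> = (LINT x|lborel. indicator S x * (v x)\<^sup>2)" using vm by (intro lint_lebesgue_on S) simp
  finally have "(LINT x|lborel. (v x)\<^sup>2) = (LINT x|lebesgue_on S. (u x)\<^sup>2)" by (simp only: e[unfolded real_scaleR_def])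
  then show thesis using that[of v] vm ae i by (simp add: v_def)
qed

lemma lint_representative:
  fixes u :: "'e::euclidean_space \<Rightarrow> real"
  assumes S: "S \<in> sets borel" and u: "u \<in> borel_measurable (lebesgue_on S)" and v: "v \<in> borel_measurable borel" "\<And>x. x \<notin> S \<Longrightarrow> v x = 0"
    and ae: "AE x in lebesgue_on S. u x = v x" and w: "w \<in> borel_measurable borel"
  shows "(LINT x|lebesgue_on S. u x * w x) = (LINT x|lborel. v x * w x)"
proof -
  have m: "g \<in> borel_measurable (lebesgue_on S)" if "g \<in> borel_measurable borel" for g :: "'e \<Rightarrow> real"
    using that by (intro measurable_restrict_space1 measurable_completion) simp
  have "(LINT x|lebesgue_on S. u x * w x) = (LINT x|lebesgue_on S. v x * w x)"
    by (rule integral_cong_AE) (use u m[OF v(1)] m[OF w] ae in \<open>auto elim!: eventually_mono\<close>)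
  also have "\<dots> = (LINT x|lborel. indicator S x * (v x * w x))" using v w by (intro lint_lebesgue_on S) simp
  also have "\<dots> = (LINT x|lborel. v x * w x)"
    using v(2) by (intro Bochner_Integration.integral_cong) (auto simp: indicator_def)
  finally show ?thesis .
qed

lemma integrable_if_square_integrable_bounded_support:
  fixes v :: "'e::euclidean_space \<Rightarrow> real"
  assumes v: "v \<in> borel_measurable borel" "integrable lborel (\<lambda>x. (v x)\<^sup>2)" and S: "bounded S" "\<And>x. x \<notin> S \<Longrightarrow> v x = 0"
  shows "integrable lborel v"
proof -
  have "bounded (closure S)" using S(1) by (rule bounded_closure)
  then have "integrable lborel (indicator (closure S) :: 'e \<Rightarrow> real)"
    using emeasure_bounded_finite[of "closure S"] by (intro integrable_real_indicator) auto
  then have i: "integrable lborel (\<lambda>x. indicator (closure S) x + (v x)\<^sup>2)" using v(2) by simp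
  show ?thesis
  proof (rule Bochner_Integration.integrable_bound[OF i])
    have "\<bar>a\<bar> \<le> 1 + a\<^sup>2" for a :: real
    proof -
      have "0 \<le> (\<bar>a\<bar> - 1)\<^sup>2" by simp
      then have "2 * \<bar>a\<bar> \<le> 1 + a\<^sup>2" by (simp add: power2_diff)
      then show ?thesis using abs_ge_zero[of a] by linarith
    qed
    then show "AE x in lborel. norm (v x) \<le> norm (indicator (closure S) x + (v x)\<^sup>2)"
    proof (intro AE_I2)
      fix x
      have "x \<notin> closure S \<Longrightarrow> v x = 0" using S(2)[of x] closure_subset[of S] by blast
      with \<open>\<And>a. \<bar>a\<bar> \<le> 1 + a\<^sup>2\<close>[of "v x"] show "norm (v x) \<le> norm (indicator (closure S) x + (v x)\<^sup>2)"
        by (auto simp: indicator_def)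
    qed
  qed (use v in simp)
qed

section \<open>Depth integrals and horizontal slices\<close>

lemma cauchy_schwarz_integral:
  fixes u v :: "'a \<Rightarrow> real"
  assumes u: "integrable M (\<lambda>x. (u x)\<^sup>2)" and v: "integrable M (\<lambda>x. (v x)\<^sup>2)" and uv: "integrable M (\<lambda>x. u x * v x)"
    and pos: "(LINT x|M. (v x)\<^sup>2) > 0"
  shows "(LINT x|M. u x * v x)\<^sup>2 \<le> (LINT x|M. (u x)\<^sup>2) * (LINT x|M. (v x)\<^sup>2)"
proof -
  let ?A = "LINT x|M. (u x)\<^sup>2" and ?B = "LINT x|M. u x * v x" and ?D = "LINT x|M. (v x)\<^sup>2"
  define l where "l = ?B / ?D"
  have "0 \<le> (LINT x|M. (u x - l * v x)\<^sup>2)" by simp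
  also have "(LINT x|M. (u x - l * v x)\<^sup>2) = (LINT x|M. (u x)\<^sup>2 - 2 * l * (u x * v x) + l\<^sup>2 * (v x)\<^sup>2)"
    by (intro Bochner_Integration.integral_cong) (simp_all add: power2_diff power_mult_distrib)
  also have "\<dots> = ?A - 2 * l * ?B + l\<^sup>2 * ?D" using u v uv by simp
  also have "\<dots> = ?A - ?B\<^sup>2 / ?D" using pos by (simp add: l_def field_simps power2_eq_square)
  finally show ?thesis using pos by (simp add: field_simps)
qed

text \<open>Cauchy-Schwarz against exp (l y) on y \<le> 0, whose square integrates to 1 / (2 l).
  With l = |\<xi>| this is the source of the weight |\<xi>|. Extended nonnegative values dispose of
  profiles that are not square integrable.\<close>

lemma exp_weighted_integral_square_le:
  fixes a :: "real \<Rightarrow> real"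
  assumes a: "a \<in> borel_measurable borel" "\<And>y. y \<ge> 0 \<Longrightarrow> a y = 0" and l: "l > 0"
  shows "ennreal (2 * l * (LINT y|lborel. a y * exp (l * y))\<^sup>2) \<le> (\<integral>\<^sup>+y. ennreal ((a y)\<^sup>2) \<partial>lborel)"
proof (cases "(\<integral>\<^sup>+y. ennreal ((a y)\<^sup>2) \<partial>lborel) = top")
  case False
  then have a2: "integrable lborel (\<lambda>y. (a y)\<^sup>2)"
    using a(1) by (intro integrableI_nonneg) (auto simp: less_top)
  \<comment> \<open>The cut-off does not affect the product, since a vanishes for y \<ge> 0, and it
    makes the exponential square integrable.\<close>
  define v where "v y = exp (l * y) * indicator {..0::real} y" for y
  have v2: "(v y)\<^sup>2 = exp (2 * l * y) * indicator {..0} y" for y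
    by (simp add: v_def power_mult_distrib exp_double[symmetric] mult.assoc indicator_def)
  have hb: "has_bochner_integral lborel (\<lambda>y. (v y)\<^sup>2) (1 / (2 * l))"
  proof (rule has_bochner_integral_nn_integral)
    have "(\<integral>\<^sup>+y. ennreal ((v y)\<^sup>2) \<partial>lborel) = (\<integral>\<^sup>+y. ennreal ((v (0 + (-1) * y))\<^sup>2) \<partial>lborel)"
      by (subst nn_integral_real_affine[where c = "-1" and t = 0]) (auto simp: v2)
    also have "\<dots> = (\<integral>\<^sup>+y. ennreal (exp (- (2 * l) * y)) * indicator {0..} y \<partial>lborel)"
      by (intro nn_integral_cong) (auto simp: v2 indicator_def)
    also have "\<dots> = ennreal (0 - (- exp (- (2 * l) * 0) / (2 * l)))"
    proof (rule nn_integral_FTC_atLeast)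
      show "((\<lambda>y. - exp (- (2 * l) * y) / (2 * l)) has_real_derivative exp (- (2 * l) * x)) (at x)" for x
        using l by (auto intro!: derivative_eq_intros)
      show "((\<lambda>y. - exp (- (2 * l) * y) / (2 * l)) \<longlongrightarrow> 0) at_top"
        using l by real_asymp
    qed auto
    finally show "(\<integral>\<^sup>+y. ennreal ((v y)\<^sup>2) \<partial>lborel) = ennreal (1 / (2 * l))" by simp
  qed (use l in \<open>auto simp: v2\<close>)
  have vi: "integrable lborel (\<lambda>y. (v y)\<^sup>2)" and vI: "(LINT y|lborel. (v y)\<^sup>2) = 1 / (2 * l)"
    using hb by (auto simp: has_bochner_integral_iff)
  have vm: "v \<in> borel_measurable borel" unfolding v_def[abs_def] by measurable
  have av: "a y * exp (l * y) = a y * v y" for y using a(2)[of y] by (auto simp: v_def indicator_def)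
  have avi: "integrable lborel (\<lambda>y. a y * v y)"
  proof (rule Bochner_Integration.integrable_bound)
    show "integrable lborel (\<lambda>y. (a y)\<^sup>2 + (v y)\<^sup>2)" using a2 vi by simp
    have "\<bar>p * q\<bar> \<le> p\<^sup>2 + q\<^sup>2" for p q :: real
    proof -
      have "0 \<le> (\<bar>p\<bar> - \<bar>q\<bar>)\<^sup>2" "0 \<le> \<bar>p\<bar> * \<bar>q\<bar>" by simp_all
      then have "\<bar>p\<bar> * \<bar>q\<bar> \<le> p\<^sup>2 + q\<^sup>2" unfolding power2_diff power2_abs by linarith
      then show ?thesis by (simp add: abs_mult)
    qed
    then show "AE y in lborel. norm (a y * v y) \<le> norm ((a y)\<^sup>2 + (v y)\<^sup>2)" by simp
  qed (use a vm in simp)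
  have "(LINT y|lborel. a y * v y)\<^sup>2 \<le> (LINT y|lborel. (a y)\<^sup>2) * (1 / (2 * l))"
    using cauchy_schwarz_integral[OF a2 vi avi] l by (simp add: vI)
  then have "2 * l * (LINT y|lborel. a y * exp (l * y))\<^sup>2 \<le> (LINT y|lborel. (a y)\<^sup>2)"
    unfolding av using l by (simp add: field_simps)
  then have "ennreal (2 * l * (LINT y|lborel. a y * exp (l * y))\<^sup>2) \<le> ennreal (LINT y|lborel. (a y)\<^sup>2)" by (rule ennreal_leI)
  also have "\<dots> = (\<integral>\<^sup>+y. ennreal ((a y)\<^sup>2) \<partial>lborel)" using a2 by (intro nn_integral_eq_integral[symmetric]) auto
  finally show ?thesis .
qed simp

lemma slice_transform_measurable:
  fixes g :: "'a::euclidean_space \<times> real \<Rightarrow> real"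
  assumes g: "g \<in> borel_measurable borel"
  shows "(\<lambda>z. cos_transform (\<lambda>x. g (x, snd z)) (fst z)) \<in> borel_measurable (borel \<Otimes>\<^sub>M borel)"
    "(\<lambda>z. sin_transform (\<lambda>x. g (x, snd z)) (fst z)) \<in> borel_measurable (borel \<Otimes>\<^sub>M borel)"
proof -
  have [measurable]: "g \<in> borel_measurable (borel \<Otimes>\<^sub>M borel)" using g by (simp add: borel_prod)
  have "(\<lambda>z. LINT x|lborel. g (x, snd z) * cos (fst z \<bullet> x)) \<in> borel_measurable ((borel :: 'a measure) \<Otimes>\<^sub>M (borel :: real measure))"
    "(\<lambda>z. LINT x|lborel. g (x, snd z) * sin (fst z \<bullet> x)) \<in> borel_measurable ((borel :: 'a measure) \<Otimes>\<^sub>M (borel :: real measure))"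
    by measurable
  then show "(\<lambda>z. cos_transform (\<lambda>x. g (x, snd z)) (fst z)) \<in> borel_measurable (borel \<Otimes>\<^sub>M borel)"
    "(\<lambda>z. sin_transform (\<lambda>x. g (x, snd z)) (fst z)) \<in> borel_measurable (borel \<Otimes>\<^sub>M borel)"
    unfolding cos_transform_def sin_transform_def .
qed

lemma slice_transform_integral:
  fixes g :: "'a::euclidean_space \<times> real \<Rightarrow> real"
  assumes g: "g \<in> borel_measurable borel" "integrable lborel g" "\<And>x y. y \<ge> 0 \<Longrightarrow> g (x, y) = 0" and l: "l > 0"
  shows "integrable lborel (\<lambda>y. cos_transform (\<lambda>x. g (x, y)) \<xi> * exp (l * y))"
    "(LINT z|lborel. g z * (cos (\<xi> \<bullet> fst z) * exp (l * snd z))) = (LINT y|lborel. cos_transform (\<lambda>x. g (x, y)) \<xi> * exp (l * y))"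
    "integrable lborel (\<lambda>y. sin_transform (\<lambda>x. g (x, y)) \<xi> * exp (l * y))"
    "(LINT z|lborel. g z * (sin (\<xi> \<bullet> fst z) * exp (l * snd z))) = (LINT y|lborel. sin_transform (\<lambda>x. g (x, y)) \<xi> * exp (l * y))"
    "integrable lborel (\<lambda>z. g z * (cos (\<xi> \<bullet> fst z) * exp (l * snd z)))"
    "integrable lborel (\<lambda>z. g z * (sin (\<xi> \<bullet> fst z) * exp (l * snd z)))"
proof -
  have i: "integrable lborel (\<lambda>z. g z * (T (\<xi> \<bullet> fst z) * exp (l * snd z)))"
    if T: "T \<in> borel_measurable borel" "\<And>s. \<bar>T s\<bar> \<le> 1" for T :: "real \<Rightarrow> real"
  proof (rule Bochner_Integration.integrable_bound[OF g(2)])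
    have "(\<lambda>z::'a \<times> real. T (\<xi> \<bullet> fst z)) \<in> borel_measurable borel"
      by (rule measurable_compose[OF _ T(1)]) (intro borel_measurable_continuous_onI continuous_intros)
    moreover have "(\<lambda>z::'a \<times> real. exp (l * snd z)) \<in> borel_measurable borel"
      by (intro borel_measurable_continuous_onI continuous_intros)
    ultimately show "(\<lambda>z. g z * (T (\<xi> \<bullet> fst z) * exp (l * snd z))) \<in> borel_measurable lborel" using g(1) by simp
    show "AE z in lborel. norm (g z * (T (\<xi> \<bullet> fst z) * exp (l * snd z))) \<le> norm (g z)"
    proof (rule AE_I2)
      fix z :: "'a \<times> real"
      show "norm (g z * (T (\<xi> \<bullet> fst z) * exp (l * snd z))) \<le> norm (g z)"
      proof (cases "snd z \<ge> 0")
        case True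
        then show ?thesis using g(3)[of "snd z" "fst z"] by simp
      next
        case False
        then have "exp (l * snd z) \<le> 1" using l by (simp add: mult_pos_neg less_imp_le)
        then have "\<bar>T (\<xi> \<bullet> fst z)\<bar> * exp (l * snd z) \<le> 1" using T(2) by (intro mult_le_one) auto
        then show ?thesis using mult_left_mono[of "\<bar>T (\<xi> \<bullet> fst z)\<bar> * exp (l * snd z)" 1 "\<bar>g z\<bar>"] by (simp add: abs_mult)
      qed
    qed
  qed
  have f: "integrable lborel (\<lambda>y. (LINT x|lborel. g (x, y) * T (\<xi> \<bullet> x)) * exp (l * y)) \<and>
      (LINT z|lborel. g z * (T (\<xi> \<bullet> fst z) * exp (l * snd z))) = (LINT y|lborel. (LINT x|lborel. g (x, y) * T (\<xi> \<bullet> x)) * exp (l * y))"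
    if T: "T \<in> borel_measurable borel" "\<And>s. \<bar>T s\<bar> \<le> 1" for T :: "real \<Rightarrow> real"
  proof -
    have I: "integrable (lborel \<Otimes>\<^sub>M lborel) (\<lambda>(x, y). g (x, y) * T (\<xi> \<bullet> x) * exp (l * y))"
      using i[OF T] by (simp add: lborel_prod case_prod_beta' mult.assoc)
    have "(LINT z|lborel. g z * (T (\<xi> \<bullet> fst z) * exp (l * snd z))) = (LINT z|(lborel \<Otimes>\<^sub>M lborel). (case z of (x, y) \<Rightarrow> g (x, y) * T (\<xi> \<bullet> x) * exp (l * y)))"
      by (simp add: lborel_prod case_prod_beta' mult.assoc)
    with lborel_pair.integrable_snd[OF I] lborel_pair.integral_snd[OF I] show ?thesis by simp
  qed
  show "integrable lborel (\<lambda>z. g z * (cos (\<xi> \<bullet> fst z) * exp (l * snd z)))"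
    "integrable lborel (\<lambda>z. g z * (sin (\<xi> \<bullet> fst z) * exp (l * snd z)))"
    using i[of cos] i[of sin] by simp_all
  show "integrable lborel (\<lambda>y. cos_transform (\<lambda>x. g (x, y)) \<xi> * exp (l * y))"
    "(LINT z|lborel. g z * (cos (\<xi> \<bullet> fst z) * exp (l * snd z))) = (LINT y|lborel. cos_transform (\<lambda>x. g (x, y)) \<xi> * exp (l * y))"
    using f[of cos] unfolding cos_transform_def by simp_all
  show "integrable lborel (\<lambda>y. sin_transform (\<lambda>x. g (x, y)) \<xi> * exp (l * y))"
    "(LINT z|lborel. g z * (sin (\<xi> \<bullet> fst z) * exp (l * snd z))) = (LINT y|lborel. sin_transform (\<lambda>x. g (x, y)) \<xi> * exp (l * y))"
    using f[of sin] unfolding sin_transform_def by simp_all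
qed

text \<open>Plancherel at each depth y, integrated over y. A slice that is not square integrable
  makes its right side infinite; any other slice is integrable because its support is bounded, as
  the Plancherel inequality demands.\<close>

lemma slice_plancherel:
  fixes g :: "'a::euclidean_space \<times> real \<Rightarrow> real"
  assumes g: "g \<in> borel_measurable borel" and S: "bounded S" "\<And>z. z \<notin> S \<Longrightarrow> g z = 0" and t: "t > 0"
  shows "(\<integral>\<^sup>+\<xi>. \<integral>\<^sup>+y. ennreal (gauss (t *\<^sub>R \<xi>) * ((cos_transform (\<lambda>x. g (x, y)) \<xi>)\<^sup>2 + (sin_transform (\<lambda>x. g (x, y)) \<xi>)\<^sup>2)) \<partial>lborel \<partial>lborel)
    \<le> ennreal ((2 * pi) ^ DIM('a)) * (\<integral>\<^sup>+z. ennreal ((g z)\<^sup>2) \<partial>lborel)"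
proof -
  let ?c = "ennreal ((2 * pi) ^ DIM('a))"
  note [measurable] = slice_transform_measurable[OF g]
  have gp [measurable]: "g \<in> borel_measurable (borel \<Otimes>\<^sub>M borel)" using g by (simp add: borel_prod)
  have slice: "(\<integral>\<^sup>+\<xi>. ennreal (gauss (t *\<^sub>R \<xi>) * ((cos_transform (\<lambda>x. g (x, y)) \<xi>)\<^sup>2 + (sin_transform (\<lambda>x. g (x, y)) \<xi>)\<^sup>2)) \<partial>lborel)
      \<le> ?c * (\<integral>\<^sup>+x. ennreal ((g (x, y))\<^sup>2) \<partial>lborel)" for y
  proof (cases "(\<integral>\<^sup>+x. ennreal ((g (x, y))\<^sup>2) \<partial>lborel) = top")
    case True
    then show ?thesis by (simp add: ennreal_mult_top)
  next
    case False
    have m: "(\<lambda>x. g (x, y)) \<in> borel_measurable borel" by measurable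
    have i2: "integrable lborel (\<lambda>x. (g (x, y))\<^sup>2)" using False m by (intro integrableI_nonneg) (auto simp: less_top)
    have i1: "integrable lborel (\<lambda>x. g (x, y))"
      by (rule integrable_if_square_integrable_bounded_support[OF m i2 bounded_fst[OF S(1)]]) (use S(2) in \<open>force\<close>)
    have pos: "0 \<le> gauss (t *\<^sub>R \<xi>) * ((cos_transform (\<lambda>x. g (x, y)) \<xi>)\<^sup>2 + (sin_transform (\<lambda>x. g (x, y)) \<xi>)\<^sup>2)" for \<xi>
      using gauss_pos[of "t *\<^sub>R \<xi>"] by simp
    have "(\<integral>\<^sup>+\<xi>. ennreal (gauss (t *\<^sub>R \<xi>) * ((cos_transform (\<lambda>x. g (x, y)) \<xi>)\<^sup>2 + (sin_transform (\<lambda>x. g (x, y)) \<xi>)\<^sup>2)) \<partial>lborel)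
      = ennreal (LINT \<xi>|lborel. gauss (t *\<^sub>R \<xi>) * ((cos_transform (\<lambda>x. g (x, y)) \<xi>)\<^sup>2 + (sin_transform (\<lambda>x. g (x, y)) \<xi>)\<^sup>2))"
      using pos by (intro nn_integral_eq_integral gaussian_power_spectrum(1) m i1 t) auto
    also have "\<dots> \<le> ennreal ((2 * pi) ^ DIM('a) * (LINT x|lborel. (g (x, y))\<^sup>2))"
      by (intro ennreal_leI gaussian_plancherel(1) m i1 i2 t)
    also have "\<dots> = ?c * (\<integral>\<^sup>+x. ennreal ((g (x, y))\<^sup>2) \<partial>lborel)"
      using i2 by (subst nn_integral_eq_integral) (auto simp: ennreal_mult)
    finally show ?thesis .
  qed
  have "(\<integral>\<^sup>+\<xi>. \<integral>\<^sup>+y. ennreal (gauss (t *\<^sub>R \<xi>) * ((cos_transform (\<lambda>x. g (x, y)) \<xi>)\<^sup>2 + (sin_transform (\<lambda>x. g (x, y)) \<xi>)\<^sup>2)) \<partial>lborel \<partial>lborel)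
    = (\<integral>\<^sup>+y. \<integral>\<^sup>+\<xi>. ennreal (gauss (t *\<^sub>R \<xi>) * ((cos_transform (\<lambda>x. g (x, y)) \<xi>)\<^sup>2 + (sin_transform (\<lambda>x. g (x, y)) \<xi>)\<^sup>2)) \<partial>lborel \<partial>lborel)"
  proof (rule lborel_pair.Fubini'[symmetric])
    have "(\<lambda>z. ennreal (gauss (t *\<^sub>R fst z) * ((cos_transform (\<lambda>x. g (x, snd z)) (fst z))\<^sup>2 + (sin_transform (\<lambda>x. g (x, snd z)) (fst z))\<^sup>2)))
      \<in> borel_measurable (borel \<Otimes>\<^sub>M borel)" by measurable
    then show "(\<lambda>(\<xi>, y). ennreal (gauss (t *\<^sub>R \<xi>) * ((cos_transform (\<lambda>x. g (x, y)) \<xi>)\<^sup>2 + (sin_transform (\<lambda>x. g (x, y)) \<xi>)\<^sup>2)))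
      \<in> borel_measurable (lborel \<Otimes>\<^sub>M lborel)" by (simp add: case_prod_beta')
  qed
  also have "\<dots> \<le> (\<integral>\<^sup>+y. ?c * (\<integral>\<^sup>+x. ennreal ((g (x, y))\<^sup>2) \<partial>lborel) \<partial>lborel)"
    by (intro nn_integral_mono slice)
  also have "\<dots> = ?c * (\<integral>\<^sup>+y. \<integral>\<^sup>+x. ennreal ((g (x, y))\<^sup>2) \<partial>lborel \<partial>lborel)"
    by (rule nn_integral_cmult) measurable
  also have "(\<integral>\<^sup>+y. \<integral>\<^sup>+x. ennreal ((g (x, y))\<^sup>2) \<partial>lborel \<partial>lborel) = (\<integral>\<^sup>+z. ennreal ((g z)\<^sup>2) \<partial>(lborel \<Otimes>\<^sub>M lborel))"
    by (rule lborel_pair.nn_integral_snd[of "\<lambda>z. ennreal ((g z)\<^sup>2)"]) measurable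
  finally show ?thesis by (simp add: lborel_prod)
qed

section \<open>Functions tied to a gradient and boundary values by Green's identity\<close>

context cylindrical_domain
begin

text \<open>\<open>weak_gradient\<close> and \<open>boundary_trace\<close> are choices and therefore
  not literally linear. A triple records a function, a gradient field and boundary values on F,
  bound together by the weak Green identity alone and without a term on B; such triples are closed
  under linear combinations.\<close>

definition green_triple :: "('a \<times> real \<Rightarrow> real) \<Rightarrow> ('a \<times> real \<Rightarrow> 'a \<times> real) \<Rightarrow> ('a \<Rightarrow> real) \<Rightarrow> bool" where
  "green_triple f G h \<longleftrightarrow>
    square_integrable (lebesgue_on \<Omega>) f \<and> square_integrable (lebesgue_on \<Omega>) G \<and> square_integrable (lebesgue_on (flat F)) h \<and>
    (\<forall>w w' b. (\<forall>x. (w has_derivative w' x) (at x)) \<longrightarrow> continuous_on UNIV (\<lambda>x. w' x b) \<longrightarrow> b \<in> Basis \<longrightarrow>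
      (LINT x|lebesgue_on \<Omega>. (G x \<bullet> b) * w x) + (LINT x|lebesgue_on \<Omega>. f x * w' x b) =
      (if b = (0, 1) then LINT x|lebesgue_on (flat F). h x * w (x, 0) else 0))"

lemma integrable_square_integrable_times_continuous:
  fixes u w :: "'e::euclidean_space \<Rightarrow> real"
  assumes S: "S \<in> sets borel" "bounded S" and u: "square_integrable (lebesgue_on S) u" and w: "continuous_on UNIV w"
  shows "integrable (lebesgue_on S) (\<lambda>x. u x * w x)"
proof -
  have fin: "finite_measure (lebesgue_on S)" by (rule finite_measure_lebesgue_on_bounded) (use S in auto)
  have ui: "integrable (lebesgue_on S) u" by (rule square_integrable_imp_integrable[OF fin u])
  have "bounded (w ` closure S)"
    using S(2) w by (intro compact_imp_bounded compact_continuous_image) (auto intro: continuous_on_subset)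
  then obtain C where C: "\<And>x. x \<in> closure S \<Longrightarrow> \<bar>w x\<bar> \<le> C" by (auto simp: bounded_iff)
  have wm: "w \<in> borel_measurable (lebesgue_on S)"
    using borel_measurable_continuous_onI[OF w] by (intro measurable_restrict_space1 measurable_completion) simp
  show ?thesis
  proof (rule Bochner_Integration.integrable_bound[OF integrable_mult_right[OF ui, of C]])
    show "(\<lambda>x. u x * w x) \<in> borel_measurable (lebesgue_on S)" using ui wm by simp
    show "AE x in lebesgue_on S. norm (u x * w x) \<le> norm (C * u x)"
    proof (rule AE_I2)
      fix x assume "x \<in> space (lebesgue_on S)"
      then have "\<bar>w x\<bar> \<le> \<bar>C\<bar>" using C[of x] closure_subset[of S] by force
      then show "norm (u x * w x) \<le> norm (C * u x)" by (simp add: abs_mult mult.commute[of "\<bar>u x\<bar>"] mult_right_mono)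
    qed
  qed
qed

lemma green_triple_zero: "green_triple (\<lambda>_. 0) (\<lambda>_. 0) (\<lambda>_. 0)"
  by (simp add: green_triple_def square_integrable_def)

lemma continuous_flat: "continuous_on UNIV (w :: 'a \<times> real \<Rightarrow> real) \<Longrightarrow> continuous_on UNIV (\<lambda>x. w (x, 0))"
  by (rule continuous_on_compose2[of UNIV w]) (auto intro: continuous_intros)

lemma green_triple_add_scaled:
  assumes 1: "green_triple f G h" and 2: "green_triple f' G' h'"
  shows "green_triple (\<lambda>x. c * f x + f' x) (\<lambda>x. c *\<^sub>R G x + G' x) (\<lambda>x. c * h x + h' x)"
proof -
  have sq: "square_integrable (lebesgue_on \<Omega>) f" "square_integrable (lebesgue_on \<Omega>) G" "square_integrable (lebesgue_on (flat F)) h"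
    "square_integrable (lebesgue_on \<Omega>) f'" "square_integrable (lebesgue_on \<Omega>) G'" "square_integrable (lebesgue_on (flat F)) h'"
    using 1 2 by (auto simp: green_triple_def)
  have sq': "square_integrable (lebesgue_on \<Omega>) (\<lambda>x. c *\<^sub>R f x + f' x)" "square_integrable (lebesgue_on \<Omega>) (\<lambda>x. c *\<^sub>R G x + G' x)"
    "square_integrable (lebesgue_on (flat F)) (\<lambda>x. c *\<^sub>R h x + h' x)"
    by (intro square_integrable_add square_integrable_scaleR sq)+
  show ?thesis
    unfolding green_triple_def
  proof (intro conjI allI impI)
    fix w :: "'a \<times> real \<Rightarrow> real" and w' and b :: "'a \<times> real"
    assume w: "\<forall>x. (w has_derivative w' x) (at x)" and wc: "continuous_on UNIV (\<lambda>x. w' x b)" and b: "b \<in> Basis"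
    have cw: "continuous_on UNIV w" using w by (meson continuous_at_imp_continuous_on has_derivative_continuous)
    have nb: "norm b \<le> 1" using b by simp
    note I\<Omega> = integrable_square_integrable_times_continuous[OF borel_\<Omega> bounded_\<Omega>]
    note IF = integrable_square_integrable_times_continuous[OF borel_flat bounded_flat]
    have i: "integrable (lebesgue_on \<Omega>) (\<lambda>x. (G x \<bullet> b) * w x)" "integrable (lebesgue_on \<Omega>) (\<lambda>x. (G' x \<bullet> b) * w x)"
      "integrable (lebesgue_on \<Omega>) (\<lambda>x. f x * w' x b)" "integrable (lebesgue_on \<Omega>) (\<lambda>x. f' x * w' x b)"
      "integrable (lebesgue_on (flat F)) (\<lambda>x. h x * w (x, 0))" "integrable (lebesgue_on (flat F)) (\<lambda>x. h' x * w (x, 0))"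
      by (intro I\<Omega> IF square_integrable_inner sq nb cw wc continuous_flat)+
    have e1: "(LINT x|lebesgue_on \<Omega>. ((c *\<^sub>R G x + G' x) \<bullet> b) * w x) = c * (LINT x|lebesgue_on \<Omega>. (G x \<bullet> b) * w x) + (LINT x|lebesgue_on \<Omega>. (G' x \<bullet> b) * w x)"
      using i by (simp add: inner_add_left distrib_right mult.assoc)
    have e2: "(LINT x|lebesgue_on \<Omega>. (c * f x + f' x) * w' x b) = c * (LINT x|lebesgue_on \<Omega>. f x * w' x b) + (LINT x|lebesgue_on \<Omega>. f' x * w' x b)"
      using i by (simp add: distrib_right mult.assoc)
    have e3: "(LINT x|lebesgue_on (flat F). (c * h x + h' x) * w (x, 0)) = c * (LINT x|lebesgue_on (flat F). h x * w (x, 0)) + (LINT x|lebesgue_on (flat F). h' x * w (x, 0))"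
      using i by (simp add: distrib_right mult.assoc)
    have g1: "(LINT x|lebesgue_on \<Omega>. (G x \<bullet> b) * w x) + (LINT x|lebesgue_on \<Omega>. f x * w' x b) = (if b = (0, 1) then LINT x|lebesgue_on (flat F). h x * w (x, 0) else 0)"
      using 1 w wc b unfolding green_triple_def by blast
    have g2: "(LINT x|lebesgue_on \<Omega>. (G' x \<bullet> b) * w x) + (LINT x|lebesgue_on \<Omega>. f' x * w' x b) = (if b = (0, 1) then LINT x|lebesgue_on (flat F). h' x * w (x, 0) else 0)"
      using 2 w wc b unfolding green_triple_def by blast
    have "c * ((LINT x|lebesgue_on \<Omega>. (G x \<bullet> b) * w x) + (LINT x|lebesgue_on \<Omega>. f x * w' x b)) + ((LINT x|lebesgue_on \<Omega>. (G' x \<bullet> b) * w x) + (LINT x|lebesgue_on \<Omega>. f' x * w' x b))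
       = (if b = (0, 1) then c * (LINT x|lebesgue_on (flat F). h x * w (x, 0)) + (LINT x|lebesgue_on (flat F). h' x * w (x, 0)) else 0)"
      unfolding g1 g2 by (cases "b = (0, 1)") simp_all
    then show "(LINT x|lebesgue_on \<Omega>. ((c *\<^sub>R G x + G' x) \<bullet> b) * w x) + (LINT x|lebesgue_on \<Omega>. (c * f x + f' x) * w' x b) =
      (if b = (0, 1) then LINT x|lebesgue_on (flat F). (c * h x + h' x) * w (x, 0) else 0)"
      unfolding e1 e2 e3 by (simp only: distrib_left add.assoc add.left_commute)
  qed (use sq' in auto)
qed

lemma green_triple_sum:
  assumes "finite I" "\<And>i. i \<in> I \<Longrightarrow> green_triple (f i) (G i) (h i)"
  shows "green_triple (\<lambda>x. \<Sum>i\<in>I. c i * f i x) (\<lambda>x. \<Sum>i\<in>I. c i *\<^sub>R G i x) (\<lambda>x. \<Sum>i\<in>I. c i * h i x)"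
  using assms
proof (induction I rule: finite_induct)
  case (insert i I)
  then show ?case using green_triple_add_scaled[of "f i" "G i" "h i" _ _ _ "c i"] by simp
qed (simp add: green_triple_zero)

lemma eigenfunction_green_triple:
  assumes u: "u \<in> steklov_dirichlet_eigenspace \<Omega> F B \<mu>"
  shows "green_triple u (weak_gradient \<Omega> u) (\<lambda>x. boundary_trace \<Omega> u (x, 0))"
proof -
  have tr: "has_trace \<Omega> u (boundary_trace \<Omega> u)" by (rule eigenfunction_has_trace[OF u])
  have uV: "u \<in> H1_vanishing \<Omega> B" using u by (simp add: steklov_dirichlet_eigenspace_def)
  then have hB: "AE x in boundary_measure \<Omega>. x \<in> B \<longrightarrow> boundary_trace \<Omega> u x = 0" and uH: "u \<in> H1 \<Omega>" by (auto simp: H1_vanishing_def)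
  obtain \<phi> where \<phi>: "L2_tendsto (boundary_measure \<Omega>) \<phi> (boundary_trace \<Omega> u)" using tr unfolding has_trace_def by blast
  have "square_integrable (lebesgue_on (flat F)) (\<lambda>x. boundary_trace \<Omega> u (x, 0))"
    using L2_tendsto_flat[OF \<phi>] by (simp add: L2_tendsto_def)
  then show ?thesis
    using weak_green[OF tr hB] has_weak_gradient_weak_gradient[OF uH] uH
    by (auto simp: green_triple_def has_weak_gradient_def H1_def)
qed

text \<open>A vanishing gradient makes f almost everywhere a constant c. Testing in the vertical
  direction with w = \<open>snd\<close>, which is 0 on F and has derivative 1, gives c |\<Omega>| =
  0. This does the work of a Poincare inequality when Gram forms are shown to be positive.\<close>

lemma green_triple_gradient_zero:
  assumes g: "green_triple f G h" and G: "AE x in lebesgue_on \<Omega>. G x = 0"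
  shows "AE x in lebesgue_on \<Omega>. f x = 0"
proof -
  have ge: "(LINT x|lebesgue_on \<Omega>. (G x \<bullet> b) * w x) + (LINT x|lebesgue_on \<Omega>. f x * w' x b) = (if b = (0, 1) then LINT x|lebesgue_on (flat F). h x * w (x, 0) else 0)"
    if "\<And>x. (w has_derivative w' x) (at x)" "continuous_on UNIV (\<lambda>x. w' x b)" "b \<in> Basis" for w w' b
    using g that unfolding green_triple_def by blast
  have G0: "(LINT x|lebesgue_on \<Omega>. (G x \<bullet> b) * w x) = 0" for b and w :: "'a \<times> real \<Rightarrow> real"
    using G by (intro integral_eq_zero_AE) (auto elim: eventually_mono)
  have "\<exists>c. AE x in lebesgue_on \<Omega>. f x = c"
  proof (rule AE_const_if_gradient_zero)
    show "square_integrable (lebesgue_on \<Omega>) f" using g by (simp add: green_triple_def)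
    fix \<phi> and b :: "'a \<times> real" assume \<phi>: "test_function \<Omega> \<phi>" and b: "b \<in> Basis"
    have Ck: "Ck_on k UNIV \<phi>" for k using \<phi> by (simp add: test_function_def smooth_on_def)
    \<comment> \<open>\<phi> vanishes outside \<Omega>, and \<Omega> lies strictly below height 0,
      so the boundary term disappears.\<close>
    have 0: "\<phi> (x, 0) = 0" for x
      using \<phi> snd_neg[of "(x, 0)"] unfolding test_function_def by force
    show "(LINT x|lebesgue_on \<Omega>. f x * frechet_derivative \<phi> (at x) b) = 0"
      using ge[OF Ck_on_SucD1[OF Ck[of "Suc 0"]] _ b] Ck[of "Suc 0"] b unfolding G0 0 by (simp split: if_splits)
  qed
  then obtain c where c: "AE x in lebesgue_on \<Omega>. f x = c" ..
  have "(LINT x|lebesgue_on \<Omega>. f x * 1) = 0"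
  proof -
    have d: "(snd has_derivative snd) (at x)" for x :: "'a \<times> real" by (rule has_derivative_snd[OF has_derivative_ident])
    have b: "(0, 1) \<in> (Basis :: ('a \<times> real) set)" by (simp add: Basis_prod_def)
    show ?thesis using ge[OF d _ b] unfolding G0 by simp
  qed
  moreover have "(LINT x|lebesgue_on \<Omega>. f x) = (LINT x|lebesgue_on \<Omega>. c)"
    by (rule integral_cong_AE) (use g c in \<open>auto simp: green_triple_def square_integrable_def\<close>)
  ultimately have "c * measure (lebesgue_on \<Omega>) \<Omega> = 0" by auto
  moreover have "measure (lebesgue_on \<Omega>) \<Omega> > 0"
  proof -
    have "\<Omega> \<noteq> {}" using admissible by (simp add: admissible_domain_def)
    then have "\<not> negligible \<Omega>" using open_\<Omega> open_not_negligible by blast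
    moreover have "\<Omega> \<in> lmeasurable" using bounded_\<Omega> lebesgue_\<Omega> by (simp add: bounded_set_imp_lmeasurable)
    ultimately have "measure lebesgue \<Omega> \<noteq> 0" by (simp add: negligible_iff_measure)
    then show ?thesis using lebesgue_\<Omega> by (simp add: measure_restrict_space zero_less_measure_iff)
  qed
  ultimately show ?thesis using c by simp
qed

end

section \<open>The spectral inequality for one boundary function\<close>

lemma inner_sum_square_le:
  fixes \<nu> s :: "'a::euclidean_space \<Rightarrow> real"
  assumes "(\<Sum>i\<in>Basis. (\<nu> i)\<^sup>2) \<le> 1"
  shows "(\<Sum>i\<in>Basis. \<nu> i * s i)\<^sup>2 \<le> (\<Sum>i\<in>Basis. (s i)\<^sup>2)"
proof -
  have "(\<Sum>i\<in>Basis. \<nu> i * s i)\<^sup>2 \<le> (\<Sum>i\<in>Basis. (\<nu> i)\<^sup>2) * (\<Sum>i\<in>Basis. (s i)\<^sup>2)"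
    by (rule Cauchy_Schwarz_ineq_sum)
  also have "\<dots> \<le> 1 * (\<Sum>i\<in>Basis. (s i)\<^sup>2)" by (intro mult_right_mono assms sum_nonneg) auto
  finally show ?thesis by simp
qed

lemma sum_Basis_times_real:
  fixes \<phi> :: "'a::euclidean_space \<times> real \<Rightarrow> real"
  shows "(\<Sum>b\<in>Basis. \<phi> b) = (\<Sum>i\<in>Basis. \<phi> (i, 0)) + \<phi> (0, 1)"
proof -
  have "(\<Sum>b\<in>Basis. \<phi> b) = sum \<phi> ((\<lambda>u. (u, 0)) ` Basis) + sum \<phi> ((\<lambda>v. (0, v)) ` Basis)"
    unfolding Basis_prod_def by (rule sum.union_disjoint) auto
  then show ?thesis by (simp add: sum.reindex inj_on_def)
qed

lemma half_square_add_le: "(p + q)\<^sup>2 / 2 \<le> p\<^sup>2 + (q::real)\<^sup>2"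
  using zero_le_power2[of "p - q"] by (simp add: power2_diff power2_sum)

context cylindrical_domain
begin

text \<open>The vertical direction contributes a term |\<xi>| A, with A the integral of f against
  the test function. The horizontal directions carry no boundary term; tested with sin they give A
  times the components of -\<xi>, so contraction with \<xi> / |\<xi>| reproduces |\<xi>| A up to
  sign. Eliminating it, and likewise D for the sine, leaves an expression in the gradient
  alone.\<close>

lemma boundary_transform_identity:
  assumes g: "green_triple f G h" and \<xi>: "\<xi> \<noteq> 0"
  defines "e \<equiv> \<lambda>z :: 'a \<times> real. exp (norm \<xi> * snd z)"
  defines "P \<equiv> \<lambda>b. LINT z|lebesgue_on \<Omega>. (G z \<bullet> b) * (cos (\<xi> \<bullet> fst z) * e z)"
    and "Q \<equiv> \<lambda>b. LINT z|lebesgue_on \<Omega>. (G z \<bullet> b) * (sin (\<xi> \<bullet> fst z) * e z)"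
  shows "(LINT x|lebesgue_on (flat F). h x * cos (\<xi> \<bullet> x)) = P (0, 1) - (\<Sum>i\<in>Basis. (\<xi> \<bullet> i) / norm \<xi> * Q (i, 0))"
    and "(LINT x|lebesgue_on (flat F). h x * sin (\<xi> \<bullet> x)) = Q (0, 1) + (\<Sum>i\<in>Basis. (\<xi> \<bullet> i) / norm \<xi> * P (i, 0))"
proof -
  let ?l = "norm \<xi>"
  have l: "?l > 0" using \<xi> by simp
  have ge: "(LINT x|lebesgue_on \<Omega>. (G x \<bullet> b) * w x) + (LINT x|lebesgue_on \<Omega>. f x * w' x b) = (if b = (0, 1) then LINT x|lebesgue_on (flat F). h x * w (x, 0) else 0)"
    if "\<And>x. (w has_derivative w' x) (at x)" "continuous_on UNIV (\<lambda>x. w' x b)" "b \<in> Basis" for w w' b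
    using g that unfolding green_triple_def by blast
  define w1' where "w1' z k = cos (\<xi> \<bullet> fst z) * (e z * (?l * snd k)) + (- sin (\<xi> \<bullet> fst z) * (\<xi> \<bullet> fst k)) * e z" for z k :: "'a \<times> real"
  define w2' where "w2' z k = sin (\<xi> \<bullet> fst z) * (e z * (?l * snd k)) + (cos (\<xi> \<bullet> fst z) * (\<xi> \<bullet> fst k)) * e z" for z k :: "'a \<times> real"
  have de: "(e has_derivative (\<lambda>k. e z * (?l * snd k))) (at z)" for z
    unfolding e_def by (auto intro!: derivative_eq_intros)
  have dc: "((\<lambda>z. cos (\<xi> \<bullet> fst z)) has_derivative (\<lambda>k. - sin (\<xi> \<bullet> fst z) * (\<xi> \<bullet> fst k))) (at z)" for z :: "'a \<times> real"
    by (auto intro!: derivative_eq_intros)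
  have ds: "((\<lambda>z. sin (\<xi> \<bullet> fst z)) has_derivative (\<lambda>k. cos (\<xi> \<bullet> fst z) * (\<xi> \<bullet> fst k))) (at z)" for z :: "'a \<times> real"
    by (auto intro!: derivative_eq_intros)
  have d1: "((\<lambda>z. cos (\<xi> \<bullet> fst z) * e z) has_derivative w1' z) (at z)" for z
    unfolding w1'_def[abs_def] by (rule has_derivative_mult[OF dc de])
  have d2: "((\<lambda>z. sin (\<xi> \<bullet> fst z) * e z) has_derivative w2' z) (at z)" for z
    unfolding w2'_def[abs_def] by (rule has_derivative_mult[OF ds de])
  have c1: "continuous_on UNIV (\<lambda>z. w1' z b)" and c2: "continuous_on UNIV (\<lambda>z. w2' z b)" for b
    unfolding w1'_def w2'_def e_def by (intro continuous_intros)+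
  define A where "A = (LINT z|lebesgue_on \<Omega>. f z * (cos (\<xi> \<bullet> fst z) * e z))"
  define D where "D = (LINT z|lebesgue_on \<Omega>. f z * (sin (\<xi> \<bullet> fst z) * e z))"
  have bn: "(0, 1) \<in> (Basis :: ('a \<times> real) set)" and bi: "i \<in> Basis \<Longrightarrow> (i, 0) \<in> (Basis :: ('a \<times> real) set)" and bne: "i \<in> Basis \<Longrightarrow> (i, 0::real) \<noteq> (0, 1)" for i :: 'a
    by (auto simp: Basis_prod_def)
  have pull: "(LINT z|lebesgue_on \<Omega>. f z * (k * T z)) = k * (LINT z|lebesgue_on \<Omega>. f z * T z)" for k and T :: "'a \<times> real \<Rightarrow> real"
    by (subst integral_mult_right_zero[symmetric]) (simp add: mult.left_commute)
  have w1n: "w1' z (0, 1) = ?l * (cos (\<xi> \<bullet> fst z) * e z)" and w2n: "w2' z (0, 1) = ?l * (sin (\<xi> \<bullet> fst z) * e z)" for z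
    by (simp_all add: w1'_def w2'_def)
  have w1i: "w1' z (i, 0) = (- (\<xi> \<bullet> i)) * (sin (\<xi> \<bullet> fst z) * e z)" and w2i: "w2' z (i, 0) = (\<xi> \<bullet> i) * (cos (\<xi> \<bullet> fst z) * e z)" for z i
    by (simp_all add: w1'_def w2'_def)
  have e0: "e (x, 0) = 1" for x by (simp add: e_def)
  have I1: "P (0, 1) + ?l * A = (LINT x|lebesgue_on (flat F). h x * cos (\<xi> \<bullet> x))"
    using ge[OF d1 c1 bn] unfolding w1n pull P_def A_def by (simp add: e0)
  have I2: "Q (0, 1) + ?l * D = (LINT x|lebesgue_on (flat F). h x * sin (\<xi> \<bullet> x))"
    using ge[OF d2 c2 bn] unfolding w2n pull Q_def D_def by (simp add: e0)
  have I3: "P (i, 0) = (\<xi> \<bullet> i) * D" if "i \<in> Basis" for i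
    using ge[OF d1 c1 bi[OF that]] bne[OF that] unfolding w1i pull P_def D_def by simp
  have I4: "Q (i, 0) = - (\<xi> \<bullet> i) * A" if "i \<in> Basis" for i
    using ge[OF d2 c2 bi[OF that]] bne[OF that] unfolding w2i pull Q_def A_def by simp
  have nn: "(\<Sum>i\<in>Basis. (\<xi> \<bullet> i) * (\<xi> \<bullet> i)) = ?l * ?l"
    unfolding euclidean_inner[of \<xi> \<xi>, symmetric] by (simp add: power2_norm_eq_inner[symmetric] power2_eq_square)
  have "(\<Sum>i\<in>Basis. (\<xi> \<bullet> i) / ?l * P (i, 0)) = (\<Sum>i\<in>Basis. (\<xi> \<bullet> i) * (\<xi> \<bullet> i)) * (D / ?l)"
    unfolding sum_distrib_right by (intro sum.cong) (auto simp: I3)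
  also have "\<dots> = ?l * D" unfolding nn using l by simp
  finally have SP: "(\<Sum>i\<in>Basis. (\<xi> \<bullet> i) / ?l * P (i, 0)) = ?l * D" .
  have "(\<Sum>i\<in>Basis. (\<xi> \<bullet> i) / ?l * Q (i, 0)) = (\<Sum>i\<in>Basis. (\<xi> \<bullet> i) * (\<xi> \<bullet> i)) * (- A / ?l)"
    unfolding sum_distrib_right by (intro sum.cong) (auto simp: I4)
  also have "\<dots> = - (?l * A)" unfolding nn using l by simp
  finally have SQ: "(\<Sum>i\<in>Basis. (\<xi> \<bullet> i) / ?l * Q (i, 0)) = - (?l * A)" .
  show "(LINT x|lebesgue_on (flat F). h x * cos (\<xi> \<bullet> x)) = P (0, 1) - (\<Sum>i\<in>Basis. (\<xi> \<bullet> i) / ?l * Q (i, 0))"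
    unfolding SQ I1[symmetric] by simp
  show "(LINT x|lebesgue_on (flat F). h x * sin (\<xi> \<bullet> x)) = Q (0, 1) + (\<Sum>i\<in>Basis. (\<xi> \<bullet> i) / ?l * P (i, 0))"
    unfolding SP I2[symmetric] by simp
qed

text \<open>For each \<xi> the boundary transform is a depth integral, with weight exp (|\<xi>| y),
  of the horizontally transformed gradient contracted with a complex vector of vertical part 1 and
  horizontal part i \<xi> / |\<xi>|. Cauchy-Schwarz in the depth gives 1 / (2 |\<xi>|) and the
  vector has squared length 2, so the factors cancel and only the constant of Plancherel
  remains.\<close>

lemma mode_inequality:
  assumes g: "green_triple f G h"
    and h0: "h0 \<in> borel_measurable borel" "\<And>x. x \<notin> flat F \<Longrightarrow> h0 x = 0" "AE x in lebesgue_on (flat F). h x = h0 x"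
    and t: "t > 0"
  shows "(\<integral>\<^sup>+\<xi>. ennreal (gauss (t *\<^sub>R \<xi>) * (norm \<xi> * ((cos_transform h0 \<xi>)\<^sup>2 + (sin_transform h0 \<xi>)\<^sup>2))) \<partial>lborel)
    \<le> ennreal ((2 * pi) ^ DIM('a) * (LINT x|lebesgue_on \<Omega>. (norm (G x))\<^sup>2))"
proof -
  have sqG: "square_integrable (lebesgue_on \<Omega>) G" and sqh: "square_integrable (lebesgue_on (flat F)) h"
    using g by (auto simp: green_triple_def)
  have sqb: "square_integrable (lebesgue_on \<Omega>) (\<lambda>x. G x \<bullet> b)" if "b \<in> Basis" for b
    using that by (intro square_integrable_inner sqG) simp
  have "\<exists>v. v \<in> borel_measurable borel \<and> (\<forall>x. x \<notin> \<Omega> \<longrightarrow> v x = 0) \<and> (AE x in lebesgue_on \<Omega>. G x \<bullet> b = v x) \<and>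
    integrable lborel (\<lambda>x. (v x)\<^sup>2) \<and> (LINT x|lborel. (v x)\<^sup>2) = (LINT x|lebesgue_on \<Omega>. (G x \<bullet> b)\<^sup>2)" if "b \<in> Basis" for b
    by (rule borel_representative[OF borel_\<Omega> sqb[OF that]]) blast
  then have "\<forall>b\<in>Basis. \<exists>v. v \<in> borel_measurable borel \<and> (\<forall>x. x \<notin> \<Omega> \<longrightarrow> v x = 0) \<and> (AE x in lebesgue_on \<Omega>. G x \<bullet> b = v x) \<and>
    integrable lborel (\<lambda>x. (v x)\<^sup>2) \<and> (LINT x|lborel. (v x)\<^sup>2) = (LINT x|lebesgue_on \<Omega>. (G x \<bullet> b)\<^sup>2)" by blast
  from bchoice[OF this] obtain r where "\<forall>b\<in>Basis. r b \<in> borel_measurable borel \<and> (\<forall>x. x \<notin> \<Omega> \<longrightarrow> r b x = 0) \<and> (AE x in lebesgue_on \<Omega>. G x \<bullet> b = r b x) \<and>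
    integrable lborel (\<lambda>x. (r b x)\<^sup>2) \<and> (LINT x|lborel. (r b x)\<^sup>2) = (LINT x|lebesgue_on \<Omega>. (G x \<bullet> b)\<^sup>2)" ..
  note r = this[rule_format]
  have rm: "r b \<in> borel_measurable borel" and r0: "\<And>z. z \<notin> \<Omega> \<Longrightarrow> r b z = 0" and rae: "AE x in lebesgue_on \<Omega>. G x \<bullet> b = r b x"
    and r2: "integrable lborel (\<lambda>x. (r b x)\<^sup>2)" and rI: "(LINT x|lborel. (r b x)\<^sup>2) = (LINT x|lebesgue_on \<Omega>. (G x \<bullet> b)\<^sup>2)" if "b \<in> Basis" for b
    using r[OF that] by blast+
  have ri: "integrable lborel (r b)" if "b \<in> Basis" for b
    by (rule integrable_if_square_integrable_bounded_support[OF rm[OF that] r2[OF that] bounded_\<Omega> r0[OF that]])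
  have rneg: "r b (x, y) = 0" if "b \<in> Basis" "y \<ge> 0" for b x y
    using r0[OF that(1), of "(x, y)"] snd_neg[of "(x, y)"] that(2) by force
  define c where "c b \<xi> y = cos_transform (\<lambda>x. r b (x, y)) \<xi>" for b \<xi> y
  define s where "s b \<xi> y = sin_transform (\<lambda>x. r b (x, y)) \<xi>" for b \<xi> y
  have cs0: "c b \<xi> y = 0" "s b \<xi> y = 0" if "b \<in> Basis" "y \<ge> 0" for b \<xi> y
    using rneg[OF that] by (simp_all add: c_def s_def cos_transform_def sin_transform_def)
  have cm2: "(\<lambda>z. c b (fst z) (snd z)) \<in> borel_measurable (borel \<Otimes>\<^sub>M borel)" and sm2: "(\<lambda>z. s b (fst z) (snd z)) \<in> borel_measurable (borel \<Otimes>\<^sub>M borel)" if "b \<in> Basis" for b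
    using slice_transform_measurable[OF rm[OF that]] by (simp_all add: c_def s_def)
  have cm: "c b \<xi> \<in> borel_measurable borel" and sm: "s b \<xi> \<in> borel_measurable borel" if "b \<in> Basis" for b \<xi>
    using measurable_compose[OF _ cm2[OF that], of "\<lambda>y. (\<xi>, y)" borel] measurable_compose[OF _ sm2[OF that], of "\<lambda>y. (\<xi>, y)" borel] by simp_all
  have bn: "(0, 1) \<in> (Basis :: ('a \<times> real) set)" and bi: "i \<in> Basis \<Longrightarrow> (i, 0) \<in> (Basis :: ('a \<times> real) set)" for i :: 'a
    by (auto simp: Basis_prod_def)
  \<comment> \<open>At \<xi> = 0 the left side is 0, so the unit vector \<xi> / |\<xi>| is needed
    only elsewhere.\<close>
  have pt: "ennreal (norm \<xi> * ((cos_transform h0 \<xi>)\<^sup>2 + (sin_transform h0 \<xi>)\<^sup>2)) \<le> (\<integral>\<^sup>+y. ennreal (\<Sum>b\<in>Basis. (c b \<xi> y)\<^sup>2 + (s b \<xi> y)\<^sup>2) \<partial>lborel)" for \<xi>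
  proof (cases "\<xi> = 0")
    case False
    then have l: "norm \<xi> > 0" by simp
    let ?l = "norm \<xi>" and ?\<nu> = "\<lambda>i. (\<xi> \<bullet> i) / norm \<xi>"
    have expm: "(\<lambda>z::'a \<times> real. cos (\<xi> \<bullet> fst z) * exp (?l * snd z)) \<in> borel_measurable borel" "(\<lambda>z::'a \<times> real. sin (\<xi> \<bullet> fst z) * exp (?l * snd z)) \<in> borel_measurable borel"
      by (intro borel_measurable_continuous_onI continuous_intros)+
    have Gm: "(\<lambda>z. G z \<bullet> b) \<in> borel_measurable (lebesgue_on \<Omega>)" if "b \<in> Basis" for b
      using sqb[OF that] by (simp add: square_integrable_def)
    have Pb: "(LINT z|lebesgue_on \<Omega>. (G z \<bullet> b) * (cos (\<xi> \<bullet> fst z) * exp (?l * snd z))) = (LINT y|lborel. c b \<xi> y * exp (?l * y))"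
      and Qb: "(LINT z|lebesgue_on \<Omega>. (G z \<bullet> b) * (sin (\<xi> \<bullet> fst z) * exp (?l * snd z))) = (LINT y|lborel. s b \<xi> y * exp (?l * y))"
      and ci: "integrable lborel (\<lambda>y. c b \<xi> y * exp (?l * y))" and si: "integrable lborel (\<lambda>y. s b \<xi> y * exp (?l * y))"
      if b: "b \<in> Basis" for b
      using lint_representative[OF borel_\<Omega> Gm[OF b] rm[OF b] r0[OF b] rae[OF b] expm(1)]
        lint_representative[OF borel_\<Omega> Gm[OF b] rm[OF b] r0[OF b] rae[OF b] expm(2)]
        slice_transform_integral[OF rm[OF b] ri[OF b] rneg[OF b] l, of \<xi>]
      by (simp_all add: c_def s_def)
    have hm: "h \<in> borel_measurable (lebesgue_on (flat F))" using sqh by (simp add: square_integrable_def)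
    have trig: "(\<lambda>x. cos (\<xi> \<bullet> x)) \<in> borel_measurable borel" "(\<lambda>x. sin (\<xi> \<bullet> x)) \<in> borel_measurable borel"
      by (intro borel_measurable_continuous_onI continuous_intros)+
    have C: "(LINT x|lebesgue_on (flat F). h x * cos (\<xi> \<bullet> x)) = cos_transform h0 \<xi>"
      unfolding cos_transform_def by (rule lint_representative[OF borel_flat hm h0 trig(1)])
    have S: "(LINT x|lebesgue_on (flat F). h x * sin (\<xi> \<bullet> x)) = sin_transform h0 \<xi>"
      unfolding sin_transform_def by (rule lint_representative[OF borel_flat hm h0 trig(2)])
    \<comment> \<open>a and d are the real and imaginary part, at depth y, of the transformed
      gradient contracted with the vector (i \<xi> / |\<xi>|, 1).\<close>
    define a where "a y = c (0, 1) \<xi> y + (- (\<Sum>i\<in>Basis. ?\<nu> i * s (i, 0) \<xi> y))" for y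
    define d where "d y = s (0, 1) \<xi> y + (\<Sum>i\<in>Basis. ?\<nu> i * c (i, 0) \<xi> y)" for y
    have am: "a \<in> borel_measurable borel" and dm: "d \<in> borel_measurable borel"
      unfolding a_def[abs_def] d_def[abs_def] using cm[OF bn] sm[OF bn] cm[OF bi] sm[OF bi] by auto
    have ad0: "a y = 0" "d y = 0" if "y \<ge> 0" for y
      using cs0[OF bn that] cs0[OF bi that] by (simp_all add: a_def d_def)
    have Ca: "cos_transform h0 \<xi> = (LINT y|lborel. a y * exp (?l * y))"
    proof -
      have "a y * exp (?l * y) = c (0, 1) \<xi> y * exp (?l * y) - (\<Sum>i\<in>Basis. ?\<nu> i * (s (i, 0) \<xi> y * exp (?l * y)))" for y
        by (simp add: a_def left_diff_distrib sum_distrib_right mult.assoc)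
      then have "(LINT y|lborel. a y * exp (?l * y)) = (LINT y|lborel. c (0, 1) \<xi> y * exp (?l * y)) - (\<Sum>i\<in>Basis. ?\<nu> i * (LINT y|lborel. s (i, 0) \<xi> y * exp (?l * y)))"
        using ci[OF bn] si[OF bi] by (simp add: Bochner_Integration.integral_sum)
      then show ?thesis
        using boundary_transform_identity(1)[OF g False] unfolding C by (simp add: Pb[OF bn] Qb[OF bi])
    qed
    have Sd: "sin_transform h0 \<xi> = (LINT y|lborel. d y * exp (?l * y))"
    proof -
      have "d y * exp (?l * y) = s (0, 1) \<xi> y * exp (?l * y) + (\<Sum>i\<in>Basis. ?\<nu> i * (c (i, 0) \<xi> y * exp (?l * y)))" for y
        by (simp add: d_def distrib_right sum_distrib_right mult.assoc)
      then have "(LINT y|lborel. d y * exp (?l * y)) = (LINT y|lborel. s (0, 1) \<xi> y * exp (?l * y)) + (\<Sum>i\<in>Basis. ?\<nu> i * (LINT y|lborel. c (i, 0) \<xi> y * exp (?l * y)))"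
        using si[OF bn] ci[OF bi] by (simp add: Bochner_Integration.integral_sum)
      then show ?thesis
        using boundary_transform_identity(2)[OF g False] unfolding S by (simp add: Pb[OF bi] Qb[OF bn])
    qed
    \<comment> \<open>Applying the depth estimate to p / sqrt 2 moves its factor 2 into the
      integrand.\<close>
    have half: "ennreal (?l * (LINT y|lborel. p y * exp (?l * y))\<^sup>2) \<le> (\<integral>\<^sup>+y. ennreal ((p y)\<^sup>2 / 2) \<partial>lborel)"
      if p: "p \<in> borel_measurable borel" "\<And>y. y \<ge> 0 \<Longrightarrow> p y = 0" for p
    proof -
      have "(LINT y|lborel. p y / sqrt 2 * exp (?l * y)) = (LINT y|lborel. p y * exp (?l * y)) / sqrt 2" by simp
      then show ?thesis
        using exp_weighted_integral_square_le[of "\<lambda>y. p y / sqrt 2" ?l] p l by (simp add: power_divide)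
    qed
    have \<nu>: "(\<Sum>i\<in>Basis. (?\<nu> i)\<^sup>2) \<le> 1"
    proof -
      have "(\<Sum>i\<in>Basis. (?\<nu> i)\<^sup>2) = (\<Sum>i\<in>Basis. (\<xi> \<bullet> i) * (\<xi> \<bullet> i)) / (?l * ?l)"
        by (simp add: power_divide sum_divide_distrib power2_eq_square)
      also have "(\<Sum>i\<in>Basis. (\<xi> \<bullet> i) * (\<xi> \<bullet> i)) = ?l * ?l"
        unfolding euclidean_inner[of \<xi> \<xi>, symmetric] by (simp add: power2_norm_eq_inner[symmetric] power2_eq_square)
      finally show ?thesis using l by simp
    qed
    \<comment> \<open>The factor 2 just gained is used up by (p + q)^2 / 2 \<le> p^2 + q^2; the
      horizontal sums are then bounded by Cauchy-Schwarz with the unit vector \<xi> /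
      |\<xi>|.\<close>
    have adle: "(a y)\<^sup>2 / 2 + (d y)\<^sup>2 / 2 \<le> (\<Sum>b\<in>Basis. (c b \<xi> y)\<^sup>2 + (s b \<xi> y)\<^sup>2)" for y
    proof -
      have "(a y)\<^sup>2 / 2 \<le> (c (0, 1) \<xi> y)\<^sup>2 + (\<Sum>i\<in>Basis. ?\<nu> i * s (i, 0) \<xi> y)\<^sup>2"
        unfolding a_def using half_square_add_le[of "c (0, 1) \<xi> y" "- (\<Sum>i\<in>Basis. ?\<nu> i * s (i, 0) \<xi> y)"] by simp
      moreover have "(d y)\<^sup>2 / 2 \<le> (s (0, 1) \<xi> y)\<^sup>2 + (\<Sum>i\<in>Basis. ?\<nu> i * c (i, 0) \<xi> y)\<^sup>2"
        unfolding d_def by (rule half_square_add_le)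
      moreover note inner_sum_square_le[OF \<nu>, of "\<lambda>i. s (i, 0) \<xi> y"] inner_sum_square_le[OF \<nu>, of "\<lambda>i. c (i, 0) \<xi> y"]
      moreover have "(\<Sum>b\<in>Basis. (c b \<xi> y)\<^sup>2 + (s b \<xi> y)\<^sup>2) = (\<Sum>i\<in>Basis. (c (i, 0) \<xi> y)\<^sup>2) + (\<Sum>i\<in>Basis. (s (i, 0) \<xi> y)\<^sup>2) + ((c (0, 1) \<xi> y)\<^sup>2 + (s (0, 1) \<xi> y)\<^sup>2)"
        unfolding sum_Basis_times_real by (simp add: sum.distrib)
      ultimately show ?thesis by linarith
    qed
    have "ennreal (?l * ((cos_transform h0 \<xi>)\<^sup>2 + (sin_transform h0 \<xi>)\<^sup>2)) = ennreal (?l * (LINT y|lborel. a y * exp (?l * y))\<^sup>2) + ennreal (?l * (LINT y|lborel. d y * exp (?l * y))\<^sup>2)"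
      unfolding Ca Sd using l by (simp add: distrib_left)
    also have "\<dots> \<le> (\<integral>\<^sup>+y. ennreal ((a y)\<^sup>2 / 2) \<partial>lborel) + (\<integral>\<^sup>+y. ennreal ((d y)\<^sup>2 / 2) \<partial>lborel)"
      by (intro add_mono half am dm ad0)
    also have "\<dots> = (\<integral>\<^sup>+y. ennreal ((a y)\<^sup>2 / 2) + ennreal ((d y)\<^sup>2 / 2) \<partial>lborel)"
      using am dm by (intro nn_integral_add[symmetric]) auto
    also have "\<dots> \<le> (\<integral>\<^sup>+y. ennreal (\<Sum>b\<in>Basis. (c b \<xi> y)\<^sup>2 + (s b \<xi> y)\<^sup>2) \<partial>lborel)"
      using adle by (intro nn_integral_mono) (simp add: ennreal_plus[symmetric] ennreal_leI del: ennreal_plus)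
    finally show ?thesis .
  qed simp
  have "(\<integral>\<^sup>+\<xi>. ennreal (gauss (t *\<^sub>R \<xi>) * (norm \<xi> * ((cos_transform h0 \<xi>)\<^sup>2 + (sin_transform h0 \<xi>)\<^sup>2))) \<partial>lborel)
    \<le> (\<integral>\<^sup>+\<xi>. (\<Sum>b\<in>Basis. (\<integral>\<^sup>+y. ennreal (gauss (t *\<^sub>R \<xi>) * ((c b \<xi> y)\<^sup>2 + (s b \<xi> y)\<^sup>2)) \<partial>lborel)) \<partial>lborel)"
  proof (rule nn_integral_mono)
    fix \<xi> :: 'a
    let ?\<gamma> = "gauss (t *\<^sub>R \<xi>)"
    have \<gamma>: "0 \<le> ?\<gamma>" using gauss_pos[of "t *\<^sub>R \<xi>"] by simp
    have "ennreal (?\<gamma> * (norm \<xi> * ((cos_transform h0 \<xi>)\<^sup>2 + (sin_transform h0 \<xi>)\<^sup>2))) = ennreal ?\<gamma> * ennreal (norm \<xi> * ((cos_transform h0 \<xi>)\<^sup>2 + (sin_transform h0 \<xi>)\<^sup>2))"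
      using \<gamma> by (simp add: ennreal_mult')
    also have "\<dots> \<le> ennreal ?\<gamma> * (\<integral>\<^sup>+y. ennreal (\<Sum>b\<in>Basis. (c b \<xi> y)\<^sup>2 + (s b \<xi> y)\<^sup>2) \<partial>lborel)"
      by (intro mult_left_mono pt) simp
    also have "\<dots> = (\<integral>\<^sup>+y. ennreal ?\<gamma> * ennreal (\<Sum>b\<in>Basis. (c b \<xi> y)\<^sup>2 + (s b \<xi> y)\<^sup>2) \<partial>lborel)"
      using cm sm by (intro nn_integral_cmult[symmetric]) auto
    also have "\<dots> = (\<integral>\<^sup>+y. (\<Sum>b\<in>Basis. ennreal (?\<gamma> * ((c b \<xi> y)\<^sup>2 + (s b \<xi> y)\<^sup>2))) \<partial>lborel)"
    proof (rule nn_integral_cong)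
      fix y
      have "ennreal ?\<gamma> * ennreal (\<Sum>b\<in>Basis. (c b \<xi> y)\<^sup>2 + (s b \<xi> y)\<^sup>2) = ennreal (\<Sum>b\<in>Basis. ?\<gamma> * ((c b \<xi> y)\<^sup>2 + (s b \<xi> y)\<^sup>2))"
        using \<gamma> by (simp add: ennreal_mult'[symmetric] sum_distrib_left)
      also have "\<dots> = (\<Sum>b\<in>Basis. ennreal (?\<gamma> * ((c b \<xi> y)\<^sup>2 + (s b \<xi> y)\<^sup>2)))"
        using \<gamma> by (intro sum_ennreal[symmetric]) auto
      finally show "ennreal ?\<gamma> * ennreal (\<Sum>b\<in>Basis. (c b \<xi> y)\<^sup>2 + (s b \<xi> y)\<^sup>2) = (\<Sum>b\<in>Basis. ennreal (?\<gamma> * ((c b \<xi> y)\<^sup>2 + (s b \<xi> y)\<^sup>2)))" .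
    qed
    also have "\<dots> = (\<Sum>b\<in>Basis. (\<integral>\<^sup>+y. ennreal (?\<gamma> * ((c b \<xi> y)\<^sup>2 + (s b \<xi> y)\<^sup>2)) \<partial>lborel))"
      using cm sm by (intro nn_integral_sum) auto
    finally show "ennreal (?\<gamma> * (norm \<xi> * ((cos_transform h0 \<xi>)\<^sup>2 + (sin_transform h0 \<xi>)\<^sup>2))) \<le> (\<Sum>b\<in>Basis. (\<integral>\<^sup>+y. ennreal (?\<gamma> * ((c b \<xi> y)\<^sup>2 + (s b \<xi> y)\<^sup>2)) \<partial>lborel))" .
  qed
  also have "\<dots> = (\<Sum>b\<in>Basis. (\<integral>\<^sup>+\<xi>. (\<integral>\<^sup>+y. ennreal (gauss (t *\<^sub>R \<xi>) * ((c b \<xi> y)\<^sup>2 + (s b \<xi> y)\<^sup>2)) \<partial>lborel) \<partial>lborel))"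
  proof (rule nn_integral_sum)
    fix b :: "'a \<times> real" assume b: "b \<in> Basis"
    note [measurable] = cm2[OF b] sm2[OF b]
    have "(\<lambda>z. ennreal (gauss (t *\<^sub>R fst z) * ((c b (fst z) (snd z))\<^sup>2 + (s b (fst z) (snd z))\<^sup>2))) \<in> borel_measurable (borel \<Otimes>\<^sub>M borel)" by measurable
    then have "(\<lambda>(\<xi>, y). ennreal (gauss (t *\<^sub>R \<xi>) * ((c b \<xi> y)\<^sup>2 + (s b \<xi> y)\<^sup>2))) \<in> borel_measurable (borel \<Otimes>\<^sub>M lborel)"
      by (simp add: case_prod_beta')
    from lborel.borel_measurable_nn_integral[OF this]
    show "(\<lambda>\<xi>. \<integral>\<^sup>+y. ennreal (gauss (t *\<^sub>R \<xi>) * ((c b \<xi> y)\<^sup>2 + (s b \<xi> y)\<^sup>2)) \<partial>lborel) \<in> borel_measurable lborel" by simp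
  qed
  also have "\<dots> \<le> (\<Sum>b\<in>Basis. ennreal ((2 * pi) ^ DIM('a) * (LINT x|lebesgue_on \<Omega>. (G x \<bullet> b)\<^sup>2)))"
  proof (rule sum_mono)
    fix b :: "'a \<times> real" assume b: "b \<in> Basis"
    have "(\<integral>\<^sup>+\<xi>. \<integral>\<^sup>+y. ennreal (gauss (t *\<^sub>R \<xi>) * ((c b \<xi> y)\<^sup>2 + (s b \<xi> y)\<^sup>2)) \<partial>lborel \<partial>lborel) \<le> ennreal ((2 * pi) ^ DIM('a)) * (\<integral>\<^sup>+z. ennreal ((r b z)\<^sup>2) \<partial>lborel)"
      unfolding c_def s_def by (rule slice_plancherel[OF rm[OF b] bounded_\<Omega> r0[OF b] t])
    also have "(\<integral>\<^sup>+z. ennreal ((r b z)\<^sup>2) \<partial>lborel) = ennreal (LINT x|lebesgue_on \<Omega>. (G x \<bullet> b)\<^sup>2)"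
      unfolding rI[OF b, symmetric] by (rule nn_integral_eq_integral[OF r2[OF b]]) simp
    finally show "(\<integral>\<^sup>+\<xi>. \<integral>\<^sup>+y. ennreal (gauss (t *\<^sub>R \<xi>) * ((c b \<xi> y)\<^sup>2 + (s b \<xi> y)\<^sup>2)) \<partial>lborel \<partial>lborel) \<le> ennreal ((2 * pi) ^ DIM('a) * (LINT x|lebesgue_on \<Omega>. (G x \<bullet> b)\<^sup>2))"
      by (simp add: ennreal_mult)
  qed
  also have "\<dots> = ennreal (\<Sum>b\<in>Basis. (2 * pi) ^ DIM('a) * (LINT x|lebesgue_on \<Omega>. (G x \<bullet> b)\<^sup>2))"
    by (intro sum_ennreal) auto
  also have "(\<Sum>b\<in>Basis. (2 * pi) ^ DIM('a) * (LINT x|lebesgue_on \<Omega>. (G x \<bullet> b)\<^sup>2)) = (2 * pi) ^ DIM('a) * (LINT x|lebesgue_on \<Omega>. (norm (G x))\<^sup>2)"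
  proof -
    have "(LINT x|lebesgue_on \<Omega>. (norm (G x))\<^sup>2) = (LINT x|lebesgue_on \<Omega>. (\<Sum>b\<in>Basis. (G x \<bullet> b)\<^sup>2))"
      unfolding power2_norm_eq_inner by (subst euclidean_inner) (simp add: power2_eq_square)
    also have "\<dots> = (\<Sum>b\<in>Basis. LINT x|lebesgue_on \<Omega>. (G x \<bullet> b)\<^sup>2)"
      using sqb by (intro Bochner_Integration.integral_sum) (simp add: square_integrable_def)
    finally show ?thesis by (simp add: sum_distrib_left)
  qed
  finally show ?thesis .
qed

end

section \<open>Orthonormalisation and the bathtub argument\<close>

text \<open>The bilinear form of a Gram matrix M on coefficient vectors, so that orthogonalisation
  acts on coefficients and never on functions or on chosen gradients and traces. Indices start at 1
  like the eigenvalues.\<close>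

definition gram_form :: "nat \<Rightarrow> (nat \<Rightarrow> nat \<Rightarrow> real) \<Rightarrow> (nat \<Rightarrow> real) \<Rightarrow> (nat \<Rightarrow> real) \<Rightarrow> real" where
  "gram_form k M x y = (\<Sum>a=1..k. \<Sum>b=1..k. x a * y b * M a b)"

lemma gram_form_sym: "(\<And>i j. M i j = M j i) \<Longrightarrow> gram_form k M x y = gram_form k M y x"
  unfolding gram_form_def by (subst sum.swap) (simp add: mult.commute mult.left_commute)

lemma gram_form_diff: "gram_form k M (\<lambda>a. x a - z a) y = gram_form k M x y - gram_form k M z y"
  by (simp add: gram_form_def left_diff_distrib sum_subtractf)

lemma gram_form_sum: "gram_form k M (\<lambda>a. \<Sum>j\<in>J. c j * x j a) y = (\<Sum>j\<in>J. c j * gram_form k M (x j) y)"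
proof -
  have "gram_form k M (\<lambda>a. \<Sum>j\<in>J. c j * x j a) y = (\<Sum>a=1..k. \<Sum>b=1..k. \<Sum>j\<in>J. c j * (x j a * y b * M a b))"
    unfolding gram_form_def by (simp add: sum_distrib_right mult.assoc)
  also have "\<dots> = (\<Sum>a=1..k. \<Sum>j\<in>J. \<Sum>b=1..k. c j * (x j a * y b * M a b))"
    by (intro sum.cong refl sum.swap)
  also have "\<dots> = (\<Sum>j\<in>J. \<Sum>a=1..k. \<Sum>b=1..k. c j * (x j a * y b * M a b))" by (rule sum.swap)
  finally show ?thesis unfolding gram_form_def by (simp add: sum_distrib_left)
qed

lemma gram_form_scale: "gram_form k M (\<lambda>a. c * x a) (\<lambda>a. d * y a) = c * d * gram_form k M x y"
  unfolding gram_form_def sum_distrib_left by (intro sum.cong) auto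

lemma gram_form_block:
  assumes "\<And>i j. \<eta> i \<noteq> \<eta> j \<Longrightarrow> M i j = 0" "\<And>i. x i \<noteq> 0 \<Longrightarrow> \<eta> i = \<mu>" "\<And>i. y i \<noteq> 0 \<Longrightarrow> \<eta> i = \<nu>" "\<mu> \<noteq> \<nu>"
  shows "gram_form k M x y = 0"
  unfolding gram_form_def
proof (intro sum.neutral ballI)
  fix a b
  show "x a * y b * M a b = 0" using assms(1)[of a b] assms(2)[of a] assms(3)[of b] assms(4) by auto
qed

text \<open>Vectors belonging to different values of \<eta> are orthogonal already, so the
  projections subtracted from a new vector come only from its own block, and each result stays in
  one eigenspace. Positivity is demanded only within a block, where the energy is a multiple of the
  Gram form.\<close>

lemma gram_schmidt_blocks:
  fixes \<eta> :: "nat \<Rightarrow> real"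
  assumes sym: "\<And>i j. M i j = M j i" and orth: "\<And>i j. \<eta> i \<noteq> \<eta> j \<Longrightarrow> M i j = 0"
    and pos: "\<And>\<mu> c. (\<exists>i\<in>{1..k}. c i \<noteq> 0) \<Longrightarrow> (\<And>i. c i \<noteq> 0 \<Longrightarrow> i \<in> {1..k} \<and> \<eta> i = \<mu>) \<Longrightarrow> gram_form k M c c > 0"
  shows "m \<le> k \<Longrightarrow> \<exists>v. (\<forall>j\<in>{1..m}. \<forall>i. v j i \<noteq> 0 \<longrightarrow> i \<in> {1..j} \<and> \<eta> i = \<eta> j) \<and>
    (\<forall>i\<in>{1..m}. \<forall>j\<in>{1..m}. gram_form k M (v i) (v j) = (if i = j then 1 else 0))"
proof (induction m)
  case 0
  show ?case by simp
next
  case (Suc m)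
  have "m \<le> k" using Suc.prems by simp
  from Suc.IH[OF this] obtain v where
    V: "(\<forall>j\<in>{1..m}. \<forall>i. v j i \<noteq> 0 \<longrightarrow> i \<in> {1..j} \<and> \<eta> i = \<eta> j) \<and>
      (\<forall>i\<in>{1..m}. \<forall>j\<in>{1..m}. gram_form k M (v i) (v j) = (if i = j then 1 else 0))"
    ..
  have v: "i \<in> {1..j} \<and> \<eta> i = \<eta> j" if "j \<in> {1..m}" "v j i \<noteq> 0" for j i
    using V that by blast
  have on: "gram_form k M (v i) (v j) = (if i = j then 1 else 0)" if "i \<in> {1..m}" "j \<in> {1..m}" for i j
    using V that by blast
  \<comment> \<open>w is the new coordinate vector minus its projections. Its entry at
    \<open>Suc m\<close> is 1 because the earlier vectors are supported in {1..m}, and so w is not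
    zero.\<close>
  define \<delta> where "\<delta> a = (if a = Suc m then 1 else 0 :: real)" for a
  define w where "w a = \<delta> a - (\<Sum>j\<in>{1..m}. gram_form k M \<delta> (v j) * v j a)" for a
  have P0: "gram_form k M \<delta> (v j) = 0" if "j \<in> {1..m}" "\<eta> j \<noteq> \<eta> (Suc m)" for j
  proof (rule gram_form_block[where \<eta> = \<eta> and \<mu> = "\<eta> (Suc m)" and \<nu> = "\<eta> j"])
    show "M a b = 0" if "\<eta> a \<noteq> \<eta> b" for a b using that by (rule orth)
    show "\<eta> a = \<eta> (Suc m)" if "\<delta> a \<noteq> 0" for a using that by (simp add: \<delta>_def split: if_splits)
    show "\<eta> a = \<eta> j" if "v j a \<noteq> 0" for a using v[OF \<open>j \<in> {1..m}\<close> that] by simp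
    show "\<eta> (Suc m) \<noteq> \<eta> j" using that(2) by simp
  qed
  have wv: "gram_form k M w (v i) = 0" if i: "i \<in> {1..m}" for i
  proof -
    have "gram_form k M w (v i) = gram_form k M \<delta> (v i) - (\<Sum>j\<in>{1..m}. gram_form k M \<delta> (v j) * gram_form k M (v j) (v i))"
      unfolding w_def[abs_def] gram_form_diff gram_form_sum ..
    also have "(\<Sum>j\<in>{1..m}. gram_form k M \<delta> (v j) * gram_form k M (v j) (v i)) = (\<Sum>j\<in>{1..m}. if j = i then gram_form k M \<delta> (v i) else 0)"
    proof (rule sum.cong)
      fix j assume "j \<in> {1..m}"
      then show "gram_form k M \<delta> (v j) * gram_form k M (v j) (v i) = (if j = i then gram_form k M \<delta> (v i) else 0)"
        by (simp only: on i) simp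
    qed simp
    also have "\<dots> = gram_form k M \<delta> (v i)" using i by simp
    finally show ?thesis by simp
  qed
  have supp: "i \<in> {1..Suc m} \<and> \<eta> i = \<eta> (Suc m)" if "w i \<noteq> 0" for i
  proof (cases "i = Suc m")
    case False
    then have "(\<Sum>j\<in>{1..m}. gram_form k M \<delta> (v j) * v j i) \<noteq> 0" using that by (auto simp: w_def \<delta>_def)
    then obtain j where "j \<in> {1..m}" "gram_form k M \<delta> (v j) * v j i \<noteq> 0" by (meson sum.neutral)
    then have "v j i \<noteq> 0" "gram_form k M \<delta> (v j) \<noteq> 0" by auto
    then have "i \<in> {1..j} \<and> \<eta> i = \<eta> j" "\<eta> j = \<eta> (Suc m)" using v \<open>j \<in> {1..m}\<close> P0 by blast+
    then show ?thesis using \<open>j \<in> {1..m}\<close> by auto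
  qed simp
  have "w (Suc m) = 1"
  proof -
    have "(\<Sum>j\<in>{1..m}. gram_form k M \<delta> (v j) * v j (Suc m)) = 0"
    proof (intro sum.neutral ballI)
      fix j assume j: "j \<in> {1..m}"
      then show "gram_form k M \<delta> (v j) * v j (Suc m) = 0" using v[OF j, of "Suc m"] by (cases "v j (Suc m) = 0") auto
    qed
    then show ?thesis by (simp add: w_def \<delta>_def)
  qed
  then have ex: "\<exists>i\<in>{1..k}. w i \<noteq> 0" using Suc.prems by (intro bexI[of _ "Suc m"]) auto
  have W: "gram_form k M w w > 0" (is "?N > 0")
  proof (rule pos[OF ex, of "\<eta> (Suc m)"])
    fix i assume "w i \<noteq> 0"
    then show "i \<in> {1..k} \<and> \<eta> i = \<eta> (Suc m)" using supp[of i] Suc.prems by auto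
  qed
  define v' where "v' j = (if j = Suc m then (\<lambda>a. (1 / sqrt ?N) * w a) else v j)" for j
  have ww: "gram_form k M (v' (Suc m)) (v' (Suc m)) = 1"
  proof -
    have s: "sqrt ?N * sqrt ?N = ?N" using W by simp
    have "gram_form k M (v' (Suc m)) (v' (Suc m)) = 1 / sqrt ?N * (1 / sqrt ?N) * ?N"
      unfolding v'_def if_True simp_thms by (rule gram_form_scale)
    also have "\<dots> = ?N / (sqrt ?N * sqrt ?N)" by simp
    also have "\<dots> = 1" unfolding s using W by simp
    finally show ?thesis .
  qed
  have wv': "gram_form k M (v' (Suc m)) (v i) = 0" if "i \<in> {1..m}" for i
    using gram_form_scale[of k M "1 / sqrt ?N" w 1 "v i"] wv[OF that] by (simp add: v'_def)
  show ?case
  proof (intro exI[of _ v'] conjI ballI allI impI)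
    fix j i assume j: "j \<in> {1..Suc m}" and nz: "v' j i \<noteq> 0"
    show "i \<in> {1..j}" "\<eta> i = \<eta> j"
    proof -
      have "i \<in> {1..j} \<and> \<eta> i = \<eta> j"
      proof (cases "j = Suc m")
        case True
        then have "w i \<noteq> 0" using nz by (simp add: v'_def)
        then show ?thesis using supp True by simp
      next
        case False
        then show ?thesis using v[of j i] j nz by (auto simp: v'_def)
      qed
      then show "i \<in> {1..j}" "\<eta> i = \<eta> j" by simp_all
    qed
  next
    fix i j assume ij: "i \<in> {1..Suc m}" "j \<in> {1..Suc m}"
    consider "i = Suc m" "j = Suc m" | "i = Suc m" "j \<in> {1..m}" | "i \<in> {1..m}" "j = Suc m" | "i \<in> {1..m}" "j \<in> {1..m}"
      using ij by fastforce
    then show "gram_form k M (v' i) (v' j) = (if i = j then 1 else 0)"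
    proof cases
      case 1 then show ?thesis using ww by simp
    next
      case 2 then show ?thesis using wv'[OF 2(2)] by (auto simp: v'_def)
    next
      case 3 then show ?thesis using wv'[OF 3(1)] gram_form_sym[of M k "v i" "v' (Suc m)", OF sym] by (auto simp: v'_def)
    next
      case 4 then show ?thesis using on[OF 4] by (auto simp: v'_def)
    qed
  qed
qed

lemma bessel_inequality:
  fixes v :: "nat \<Rightarrow> 'e \<Rightarrow> real"
  assumes J: "finite J" and v2: "\<And>i j. i \<in> J \<Longrightarrow> j \<in> J \<Longrightarrow> integrable L (\<lambda>x. v i x * v j x)"
    and on: "\<And>i j. i \<in> J \<Longrightarrow> j \<in> J \<Longrightarrow> (LINT x|L. v i x * v j x) = (if i = j then 1 else 0)"
    and \<phi>2: "integrable L (\<lambda>x. (\<phi> x)\<^sup>2)" and \<phi>v: "\<And>j. j \<in> J \<Longrightarrow> integrable L (\<lambda>x. v j x * \<phi> x)"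
  shows "(\<Sum>j\<in>J. (LINT x|L. v j x * \<phi> x)\<^sup>2) \<le> (LINT x|L. (\<phi> x)\<^sup>2)"
proof -
  define c where "c j = (LINT x|L. v j x * \<phi> x)" for j
  have e: "(\<phi> x - (\<Sum>j\<in>J. c j * v j x))\<^sup>2 = (\<phi> x)\<^sup>2 - 2 * (\<Sum>j\<in>J. c j * (v j x * \<phi> x)) + (\<Sum>i\<in>J. \<Sum>j\<in>J. c i * c j * (v i x * v j x))" for x
  proof -
    have "(\<Sum>j\<in>J. c j * v j x)\<^sup>2 = (\<Sum>i\<in>J. \<Sum>j\<in>J. c i * c j * (v i x * v j x))"
      unfolding power2_eq_square sum_product by (intro sum.cong) auto
    moreover have "\<phi> x * (\<Sum>j\<in>J. c j * v j x) = (\<Sum>j\<in>J. c j * (v j x * \<phi> x))"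
      unfolding sum_distrib_left by (intro sum.cong) auto
    ultimately show ?thesis by (simp add: power2_diff mult.assoc)
  qed
  have "0 \<le> (LINT x|L. (\<phi> x - (\<Sum>j\<in>J. c j * v j x))\<^sup>2)" by simp
  also have "\<dots> = (LINT x|L. (\<phi> x)\<^sup>2) - 2 * (\<Sum>j\<in>J. c j * c j) + (\<Sum>i\<in>J. \<Sum>j\<in>J. c i * c j * (LINT x|L. v i x * v j x))"
    unfolding e using \<phi>2 \<phi>v v2 by (simp add: Bochner_Integration.integral_sum c_def)
  also have "(\<Sum>i\<in>J. \<Sum>j\<in>J. c i * c j * (LINT x|L. v i x * v j x)) = (\<Sum>i\<in>J. \<Sum>j\<in>J. if i = j then c i * c i else 0)"
    using on by (intro sum.cong) auto
  also have "\<dots> = (\<Sum>j\<in>J. c j * c j)" using J by simp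
  finally show ?thesis by (simp add: c_def power2_eq_square)
qed

text \<open>\<open>ennreal\<close> cuts off negative values, so this integrates the positive part.
  As R - |\<xi>| is the length of the set of r between |\<xi>| and R, Fubini turns the integral into
  that of the ball volumes over 0 < r < R.\<close>

lemma nn_integral_cone:
  assumes R: "R > 0"
  shows "(\<integral>\<^sup>+\<xi>. ennreal (R - norm (\<xi>::'a::euclidean_space)) \<partial>lborel) = ennreal (unit_ball_vol (real DIM('a)) * (R ^ Suc DIM('a) / real (Suc DIM('a))))"
proof -
  let ?w = "unit_ball_vol (real DIM('a))" and ?d = "DIM('a)"
  have meas: "(\<lambda>(\<xi>::'a, r). indicator {norm \<xi><..<R} r :: ennreal) \<in> borel_measurable (lborel \<Otimes>\<^sub>M lborel)"
  proof -
    have "Measurable.pred ((lborel :: 'a measure) \<Otimes>\<^sub>M (lborel :: real measure)) (\<lambda>z. norm (fst z) < snd z \<and> snd z < R)" by measurable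
    then have "(\<lambda>z. if norm (fst z) < snd z \<and> snd z < R then 1 else 0 :: ennreal) \<in> borel_measurable ((lborel :: 'a measure) \<Otimes>\<^sub>M (lborel :: real measure))" by measurable
    then show ?thesis by (simp add: indicator_def case_prod_beta')
  qed
  have "(\<integral>\<^sup>+\<xi>. ennreal (R - norm (\<xi>::'a)) \<partial>lborel) = (\<integral>\<^sup>+\<xi>. \<integral>\<^sup>+r. indicator {norm (\<xi>::'a)<..<R} r \<partial>lborel \<partial>lborel)"
  proof (rule nn_integral_cong)
    fix \<xi> :: 'a
    show "ennreal (R - norm \<xi>) = (\<integral>\<^sup>+r. indicator {norm \<xi><..<R} r \<partial>lborel)"
      by (cases "norm \<xi> \<le> R") (auto simp: ennreal_neg)
  qed
  also have "\<dots> = (\<integral>\<^sup>+r. \<integral>\<^sup>+\<xi>. indicator {norm (\<xi>::'a)<..<R} r \<partial>lborel \<partial>lborel)"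
    by (rule lborel_pair.Fubini'[symmetric, OF meas])
  also have "\<dots> = (\<integral>\<^sup>+r. ennreal (?w * r ^ ?d) * indicator {0..R} r \<partial>lborel)"
  proof (rule nn_integral_cong_AE)
    \<comment> \<open>The interval on the left is open at R while the one on the right is closed;
      the single point is discarded.\<close>
    have "AE r in lborel. r \<noteq> R" by (rule AE_lborel_singleton)
    then show "AE r in lborel. (\<integral>\<^sup>+\<xi>. indicator {norm (\<xi>::'a)<..<R} r \<partial>lborel) = ennreal (?w * r ^ ?d) * indicator {0..R} r"
    proof eventually_elim
      case (elim r)
      have "(\<integral>\<^sup>+\<xi>. indicator {norm (\<xi>::'a)<..<R} r \<partial>lborel) = (\<integral>\<^sup>+\<xi>. (if r < R then 1 else 0) * indicator (ball (0::'a) r) \<xi> \<partial>lborel)"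
        by (intro nn_integral_cong) (auto simp: indicator_def)
      also have "\<dots> = (if r < R then 1 else 0) * emeasure lborel (ball (0::'a) r)" by (simp add: nn_integral_cmult_indicator)
      also have "\<dots> = ennreal (?w * r ^ ?d) * indicator {0..R} r"
      proof (cases "r \<ge> 0")
        case True
        then show ?thesis using elim by (auto simp: emeasure_ball indicator_def)
      next
        case False
        then have "emeasure lborel (ball (0::'a) r) = 0" by (simp add: ball_empty)
        then show ?thesis using False by simp
      qed
      finally show ?case .
    qed
  qed
  also have "\<dots> = ennreal (?w * (R ^ Suc ?d / real (Suc ?d)) - ?w * (0 ^ Suc ?d / real (Suc ?d)))"
  proof (rule nn_integral_FTC_Icc[where F = "\<lambda>r. ?w * (r ^ Suc ?d / real (Suc ?d))"])
    show "((\<lambda>r. ?w * (r ^ Suc ?d / real (Suc ?d))) has_real_derivative ?w * x ^ ?d) (at x)" for x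
      by (auto intro!: derivative_eq_intros simp del: of_nat_Suc power_Suc)
  qed (use R in auto)
  finally show ?thesis by simp
qed

text \<open>Pointwise R \<Phi> \<le> |\<xi>| \<Phi> + V (R - |\<xi>|), the last bracket cut off at
  0: inside the ball of radius R because \<Phi> \<le> V, outside because R \<le> |\<xi>|.
  Integration gives an inequality for every R without any minimiser being constructed. A sequence is
  used because the mass K is reached only in the limit of the Gaussian weights, while the other
  bounds hold for every n.\<close>

lemma bathtub:
  fixes \<Phi> \<gamma> :: "nat \<Rightarrow> 'a::euclidean_space \<Rightarrow> real"
  assumes \<Phi>: "\<And>n. integrable lborel (\<Phi> n)" "\<And>n \<xi>. 0 \<le> \<Phi> n \<xi>" "\<And>n \<xi>. \<Phi> n \<xi> \<le> V"
    and lim: "(\<lambda>n. LINT \<xi>|lborel. \<Phi> n \<xi>) \<longlonglongrightarrow> K"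
    and E: "\<And>n. (\<integral>\<^sup>+\<xi>. ennreal (norm \<xi> * \<Phi> n \<xi>) \<partial>lborel) \<le> ennreal E" and E0: "E \<ge> 0"
    and R: "R > 0" and V: "V \<ge> 0"
  shows "R * K - V * (unit_ball_vol (real DIM('a)) * (R ^ Suc DIM('a) / real (Suc DIM('a)))) \<le> E"
proof -
  define c where "c = unit_ball_vol (real DIM('a)) * (R ^ Suc DIM('a) / real (Suc DIM('a)))"
  have c0: "c \<ge> 0" using R by (simp add: c_def)
  have "R * (LINT \<xi>|lborel. \<Phi> n \<xi>) \<le> E + V * c" for n
  proof -
    have m: "\<Phi> n \<in> borel_measurable borel" using \<Phi>(1)[of n] by simp
    have pt: "ennreal (R * \<Phi> n \<xi>) \<le> ennreal (norm \<xi> * \<Phi> n \<xi>) + ennreal V * ennreal (R - norm \<xi>)" for \<xi>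
    proof (cases "norm \<xi> \<le> R")
      case True
      have "(R - norm \<xi>) * \<Phi> n \<xi> \<le> (R - norm \<xi>) * V" using True \<Phi>(3) by (intro mult_left_mono) auto
      then have "R * \<Phi> n \<xi> \<le> norm \<xi> * \<Phi> n \<xi> + V * (R - norm \<xi>)" by (simp add: algebra_simps)
      then have "ennreal (R * \<Phi> n \<xi>) \<le> ennreal (norm \<xi> * \<Phi> n \<xi> + V * (R - norm \<xi>))" by (rule ennreal_leI)
      then show ?thesis using True V \<Phi>(2)[of n \<xi>] by (simp add: ennreal_mult)
    next
      case False
      then have "R * \<Phi> n \<xi> \<le> norm \<xi> * \<Phi> n \<xi>" using \<Phi>(2) by (intro mult_right_mono) auto
      then have "ennreal (R * \<Phi> n \<xi>) \<le> ennreal (norm \<xi> * \<Phi> n \<xi>)" by (rule ennreal_leI)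
      then show ?thesis by (rule order_trans) simp
    qed
    have "ennreal (R * (LINT \<xi>|lborel. \<Phi> n \<xi>)) = (\<integral>\<^sup>+\<xi>. ennreal (R * \<Phi> n \<xi>) \<partial>lborel)"
      using \<Phi> R by (subst nn_integral_eq_integral) auto
    also have "\<dots> \<le> (\<integral>\<^sup>+\<xi>. ennreal (norm \<xi> * \<Phi> n \<xi>) + ennreal V * ennreal (R - norm \<xi>) \<partial>lborel)"
      by (intro nn_integral_mono pt)
    also have "\<dots> = (\<integral>\<^sup>+\<xi>. ennreal (norm (\<xi>::'a) * \<Phi> n \<xi>) \<partial>lborel) + ennreal V * (\<integral>\<^sup>+\<xi>. ennreal (R - norm (\<xi>::'a)) \<partial>lborel)"
      using m by (subst nn_integral_add) (auto simp: nn_integral_cmult)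
    also have "\<dots> \<le> ennreal E + ennreal V * ennreal c"
      unfolding nn_integral_cone[OF R] c_def[symmetric] by (intro add_right_mono E)
    also have "\<dots> = ennreal (E + V * c)" using E0 V c0 by (simp add: ennreal_mult)
    finally show ?thesis using E0 V c0 by (subst (asm) ennreal_le_iff) (auto intro!: add_nonneg_nonneg mult_nonneg_nonneg)
  qed
  moreover have "(\<lambda>n. R * (LINT \<xi>|lborel. \<Phi> n \<xi>)) \<longlonglongrightarrow> R * K" by (intro tendsto_intros lim)
  ultimately have "R * K \<le> E + V * c" by (intro LIMSEQ_le_const2) auto
  then show ?thesis unfolding c_def by simp
qed

section \<open>The bound for sums of eigenvalues\<close>

lemma integral_double_sum:
  fixes f :: "'i \<Rightarrow> 'j \<Rightarrow> 'a \<Rightarrow> real"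
  assumes "\<And>a b. a \<in> A \<Longrightarrow> b \<in> B \<Longrightarrow> integrable M (f a b)"
  shows "(LINT x|M. (\<Sum>a\<in>A. \<Sum>b\<in>B. c a b * f a b x)) = (\<Sum>a\<in>A. \<Sum>b\<in>B. c a b * (LINT x|M. f a b x))"
proof -
  have i: "integrable M (\<lambda>x. c a b * f a b x)" if "a \<in> A" "b \<in> B" for a b
    by (intro integrable_mult_right assms that)
  have "(LINT x|M. (\<Sum>a\<in>A. \<Sum>b\<in>B. c a b * f a b x)) = (\<Sum>a\<in>A. LINT x|M. (\<Sum>b\<in>B. c a b * f a b x))"
    by (rule Bochner_Integration.integral_sum, rule Bochner_Integration.integrable_sum, rule i)
  also have "\<dots> = (\<Sum>a\<in>A. \<Sum>b\<in>B. LINT x|M. c a b * f a b x)"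
    by (rule sum.cong[OF refl], rule Bochner_Integration.integral_sum, rule i)
  finally show ?thesis by simp
qed

text \<open>Here \<open>bathtub\<close> receives as \<Phi> the damped sum of the power spectra of
  orthonormal boundary values, as V the measure of F from Bessel's inequality, and as E the sum of
  the energies from \<open>mode_inequality\<close>. R stays free and is optimised in the final
  theorem.\<close>

lemma (in cylindrical_domain) eigenvalue_sum_bathtub:
  assumes ev: "steklov_dirichlet_eigenvalues \<Omega> F B \<eta>" and R: "R > 0"
  shows "R * ((2 * pi) ^ DIM('a) * real k) - measure lebesgue (flat F) * (unit_ball_vol (real DIM('a)) * (R ^ Suc DIM('a) / real (Suc DIM('a))))
    \<le> (2 * pi) ^ DIM('a) * (\<Sum>j=1..k. \<eta> j)"
proof -
  let ?E = "\<lambda>\<mu>. steklov_dirichlet_eigenspace \<Omega> F B \<mu>"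
  let ?F = "lebesgue_on (flat F)"
  define S where "S \<mu> = {j. 1 \<le> j \<and> \<eta> j = \<mu>}" for \<mu>
  have fS: "finite (S \<mu>)" and dS: "has_dim_AE (lebesgue_on \<Omega>) (?E \<mu>) (card (S \<mu>))" for \<mu>
    using ev by (auto simp: steklov_dirichlet_eigenvalues_def S_def)
  have "\<exists>U. (\<forall>i<card (S \<mu>). U i \<in> ?E \<mu>) \<and> (\<forall>c :: nat \<Rightarrow> real. (AE x in lebesgue_on \<Omega>. (\<Sum>i<card (S \<mu>). c i * U i x) = 0) \<longrightarrow> (\<forall>i<card (S \<mu>). c i = 0))" for \<mu>
    using dS[of \<mu>] unfolding has_dim_AE_def by blast
  from choice[OF allI[OF this]] obtain U where
    U: "\<forall>\<mu>. (\<forall>i<card (S \<mu>). U \<mu> i \<in> ?E \<mu>) \<and> (\<forall>c :: nat \<Rightarrow> real. (AE x in lebesgue_on \<Omega>. (\<Sum>i<card (S \<mu>). c i * U \<mu> i x) = 0) \<longrightarrow> (\<forall>i<card (S \<mu>). c i = 0))" ..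
  have "\<exists>e. bij_betw e (S \<mu>) {0..<card (S \<mu>)}" for \<mu> by (rule ex_bij_betw_finite_nat[OF fS])
  from choice[OF allI[OF this]] obtain e where e: "\<forall>\<mu>. bij_betw (e \<mu>) (S \<mu>) {0..<card (S \<mu>)}" ..
  \<comment> \<open>The indices carrying one eigenvalue are matched bijectively with a basis of its
    eigenspace, so that every index owns an eigenfunction and those in a block are
    independent.\<close>
  define u where "u j = U (\<eta> j) (e (\<eta> j) j)" for j
  have uE: "u j \<in> ?E (\<eta> j)" if "j \<ge> 1" for j
  proof -
    have "j \<in> S (\<eta> j)" using that by (simp add: S_def)
    then have "e (\<eta> j) j < card (S (\<eta> j))" using bij_betwE[OF e[rule_format, of "\<eta> j"]] by auto
    then show ?thesis using U by (simp add: u_def)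
  qed
  have indep: "c j = 0" if c: "AE x in lebesgue_on \<Omega>. (\<Sum>j\<in>S \<mu>. c j * u j x) = 0" and j: "j \<in> S \<mu>" for c :: "nat \<Rightarrow> real" and \<mu> j
  proof -
    have b: "bij_betw (e \<mu>) (S \<mu>) {..<card (S \<mu>)}" using e by (simp add: atLeast0LessThan)
    have inv: "the_inv_into (S \<mu>) (e \<mu>) (e \<mu> i) = i" if "i \<in> S \<mu>" for i
      using b that by (auto simp: bij_betw_def the_inv_into_f_f)
    have "(\<Sum>j\<in>S \<mu>. c j * u j x) = (\<Sum>i<card (S \<mu>). c (the_inv_into (S \<mu>) (e \<mu>) i) * U \<mu> i x)" for x
    proof -
      have "(\<Sum>j\<in>S \<mu>. c j * u j x) = (\<Sum>j\<in>S \<mu>. c (the_inv_into (S \<mu>) (e \<mu>) (e \<mu> j)) * U \<mu> (e \<mu> j) x)"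
      proof (rule sum.cong[OF refl])
        fix i assume i: "i \<in> S \<mu>"
        then have "\<eta> i = \<mu>" by (simp add: S_def)
        then show "c i * u i x = c (the_inv_into (S \<mu>) (e \<mu>) (e \<mu> i)) * U \<mu> (e \<mu> i) x"
          unfolding inv[OF i] u_def by simp
      qed
      also have "\<dots> = (\<Sum>i<card (S \<mu>). c (the_inv_into (S \<mu>) (e \<mu>) i) * U \<mu> i x)"
        by (rule sum.reindex_bij_betw[OF b, of "\<lambda>i. c (the_inv_into (S \<mu>) (e \<mu>) i) * U \<mu> i x"])
      finally show ?thesis .
    qed
    with c have ae: "AE x in lebesgue_on \<Omega>. (\<Sum>i<card (S \<mu>). c (the_inv_into (S \<mu>) (e \<mu>) i) * U \<mu> i x) = 0" by simp
    have lt: "e \<mu> j < card (S \<mu>)" using bij_betwE[OF b] j by auto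
    have "c (the_inv_into (S \<mu>) (e \<mu>) (e \<mu> j)) = 0"
      using U[THEN spec, THEN conjunct2, THEN spec, THEN mp, OF ae, THEN spec, THEN mp, OF lt] .
    then show ?thesis using inv[OF j] by simp
  qed
  define T where "T i x = boundary_trace \<Omega> (u i) (x, 0)" for i x
  define G where "G i = weak_gradient \<Omega> (u i)" for i
  have gt: "green_triple (u i) (G i) (T i)" if "i \<ge> 1" for i
    unfolding G_def T_def by (rule eigenfunction_green_triple[OF uE[OF that]])
  have sqT: "square_integrable ?F (T i)" and sqG: "square_integrable (lebesgue_on \<Omega>) (G i)" if "i \<ge> 1" for i
    using gt[OF that] by (auto simp: green_triple_def)
  have TT: "integrable ?F (\<lambda>x. T i x * T j x)" if "i \<ge> 1" "j \<ge> 1" for i j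
    using integrable_inner_square_integrable[OF sqT[OF that(1)] sqT[OF that(2)]] by simp
  have GG: "integrable (lebesgue_on \<Omega>) (\<lambda>x. G i x \<bullet> G j x)" if "i \<ge> 1" "j \<ge> 1" for i j
    by (rule integrable_inner_square_integrable[OF sqG[OF that(1)] sqG[OF that(2)]])
  \<comment> \<open>Index 0 carries no eigenfunction; setting its entries to 0 keeps symmetry and
    block orthogonality valid for all indices.\<close>
  define M where "M i j = (if 1 \<le> i \<and> 1 \<le> j then LINT x|?F. T i x * T j x else 0)" for i j
  have eig: "(LINT x|lebesgue_on \<Omega>. G i x \<bullet> G j x) = \<eta> i * M i j" if "i \<ge> 1" "j \<ge> 1" for i j
  proof -
    have "u j \<in> H1_vanishing \<Omega> B" using uE[OF that(2)] by (simp add: steklov_dirichlet_eigenspace_def)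
    then show ?thesis using uE[OF that(1)] that by (simp add: steklov_dirichlet_eigenspace_def G_def M_def T_def)
  qed
  have sym: "M i j = M j i" for i j by (simp add: M_def mult.commute)
  \<comment> \<open>Testing the equation of u i with u j, and conversely, evaluates the same
    symmetric gradient form as \<eta> i and as \<eta> j times the same entry.\<close>
  have orth: "M i j = 0" if "\<eta> i \<noteq> \<eta> j" for i j
  proof (cases "1 \<le> i \<and> 1 \<le> j")
    case True
    have "\<eta> i * M i j = \<eta> j * M j i" using eig[of i j] eig[of j i] True by (simp add: inner_commute)
    then have "(\<eta> i - \<eta> j) * M i j = 0" by (simp add: sym[of j i] left_diff_distrib)
    then show ?thesis using that by simp
  qed (simp only: M_def if_False)
  define hv where "hv v x = (\<Sum>i=1..k. v i * T i x)" for v x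
  define Gv where "Gv v x = (\<Sum>i=1..k. v i *\<^sub>R G i x)" for v x
  define fv where "fv v x = (\<Sum>i=1..k. v i * u i x)" for v x
  have gtv: "green_triple (fv v) (Gv v) (hv v)" for v
    unfolding fv_def[abs_def] Gv_def[abs_def] hv_def[abs_def] by (rule green_triple_sum) (auto intro: gt)
  have sqh: "square_integrable ?F (hv v)" and sqGv: "square_integrable (lebesgue_on \<Omega>) (Gv v)" for v
    using gtv[of v] by (auto simp: green_triple_def)
  have hh: "(LINT x|?F. hv v x * hv w x) = gram_form k M v w" for v w
  proof -
    have "(LINT x|?F. hv v x * hv w x) = (LINT x|?F. (\<Sum>a=1..k. \<Sum>b=1..k. v a * w b * (T a x * T b x)))"
      unfolding hv_def sum_product by (intro Bochner_Integration.integral_cong sum.cong) auto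
    also have "\<dots> = (\<Sum>a=1..k. \<Sum>b=1..k. v a * w b * (LINT x|?F. T a x * T b x))"
      by (rule integral_double_sum) (auto intro: TT)
    also have "\<dots> = gram_form k M v w" unfolding gram_form_def by (intro sum.cong) (auto simp: M_def)
    finally show ?thesis .
  qed
  have gg: "(LINT x|lebesgue_on \<Omega>. (norm (Gv v x))\<^sup>2) = \<mu> * gram_form k M v v" if v: "\<And>i. v i \<noteq> 0 \<Longrightarrow> \<eta> i = \<mu>" for v \<mu>
  proof -
    have "(LINT x|lebesgue_on \<Omega>. (norm (Gv v x))\<^sup>2) = (LINT x|lebesgue_on \<Omega>. (\<Sum>a=1..k. \<Sum>b=1..k. v a * v b * (G a x \<bullet> G b x)))"
      unfolding power2_norm_eq_inner Gv_def inner_sum_left inner_sum_right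
      by (intro Bochner_Integration.integral_cong refl, subst sum.swap, intro sum.cong) (auto simp: inner_commute)
    also have "\<dots> = (\<Sum>a=1..k. \<Sum>b=1..k. v a * v b * (LINT x|lebesgue_on \<Omega>. G a x \<bullet> G b x))"
      by (rule integral_double_sum) (auto intro: GG)
    also have "\<dots> = (\<Sum>a=1..k. \<Sum>b=1..k. \<mu> * (v a * v b * M a b))"
    proof (intro sum.cong refl)
      fix a b assume "a \<in> {1..k}" "b \<in> {1..k}"
      then show "v a * v b * (LINT x|lebesgue_on \<Omega>. G a x \<bullet> G b x) = \<mu> * (v a * v b * M a b)"
        using eig[of a b] v[of a] by (cases "v a = 0") auto
    qed
    finally show ?thesis by (simp add: gram_form_def sum_distrib_left)
  qed
  \<comment> \<open>Eigenfunctions independent in \<Omega> might a priori have dependent values on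
    F. But if the form vanished at c, so would the energy, which is \<mu> times the form; the
    combination would then be zero in \<Omega>, against independence in the block.\<close>
  have pos: "gram_form k M c c > 0" if ex: "\<exists>i\<in>{1..k}. c i \<noteq> 0" and supp: "\<And>i. c i \<noteq> 0 \<Longrightarrow> i \<in> {1..k} \<and> \<eta> i = \<mu>" for \<mu> c
  proof (rule ccontr)
    assume "\<not> ?thesis"
    moreover have "gram_form k M c c \<ge> 0" unfolding hh[symmetric] by simp
    ultimately have "(LINT x|lebesgue_on \<Omega>. (norm (Gv c x))\<^sup>2) = 0" using gg[of c \<mu>] supp by simp
    then have "AE x in lebesgue_on \<Omega>. (norm (Gv c x))\<^sup>2 = 0"
      using sqGv[of c] by (subst (asm) integral_nonneg_eq_0_iff_AE) (auto simp: square_integrable_def)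
    then have "AE x in lebesgue_on \<Omega>. Gv c x = 0" by simp
    from green_triple_gradient_zero[OF gtv this] have f0: "AE x in lebesgue_on \<Omega>. fv c x = 0" .
    have "fv c x = (\<Sum>i\<in>S \<mu>. c i * u i x)" for x
    proof -
      have "fv c x = (\<Sum>i\<in>{i. c i \<noteq> 0}. c i * u i x)"
        unfolding fv_def using supp by (intro sum.mono_neutral_right) auto
      also have "\<dots> = (\<Sum>i\<in>S \<mu>. c i * u i x)"
        using supp fS by (intro sum.mono_neutral_left) (auto simp: S_def)
      finally show ?thesis .
    qed
    with f0 have "AE x in lebesgue_on \<Omega>. (\<Sum>i\<in>S \<mu>. c i * u i x) = 0" by simp
    note c0 = indep[OF this]
    from ex obtain i where i: "c i \<noteq> 0" by blast
    with supp[OF i] have "i \<in> S \<mu>" by (simp add: S_def)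
    with c0 i show False by blast
  qed
  from gram_schmidt_blocks[of M \<eta> k k, OF sym orth pos order_refl] obtain v where
    V: "(\<forall>j\<in>{1..k}. \<forall>i. v j i \<noteq> 0 \<longrightarrow> i \<in> {1..j} \<and> \<eta> i = \<eta> j) \<and>
      (\<forall>i\<in>{1..k}. \<forall>j\<in>{1..k}. gram_form k M (v i) (v j) = (if i = j then 1 else 0))" ..
  have on: "gram_form k M (v i) (v j) = (if i = j then 1 else 0)" if "i \<in> {1..k}" "j \<in> {1..k}" for i j
    using V that by blast
  \<comment> \<open>All coefficients of \<open>v j\<close> belong to the eigenvalue
    \<open>\<eta> j\<close>, so the energy is that value times the squared norm 1 on F.\<close>
  have energy: "(LINT x|lebesgue_on \<Omega>. (norm (Gv (v j) x))\<^sup>2) = \<eta> j" if j: "j \<in> {1..k}" for j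
  proof -
    have "\<eta> i = \<eta> j" if "v j i \<noteq> 0" for i using V j that by blast
    from gg[of "v j", OF this] show ?thesis using on[OF j j] by simp
  qed
  have "\<forall>j\<in>{1..k}. \<exists>g. g \<in> borel_measurable borel \<and> (\<forall>x. x \<notin> flat F \<longrightarrow> g x = 0) \<and> (AE x in ?F. hv (v j) x = g x) \<and> integrable lborel (\<lambda>x. (g x)\<^sup>2)"
    by (rule ballI, rule borel_representative[OF borel_flat sqh]) blast
  from bchoice[OF this] obtain g where
    "\<forall>j\<in>{1..k}. g j \<in> borel_measurable borel \<and> (\<forall>x. x \<notin> flat F \<longrightarrow> g j x = 0) \<and> (AE x in ?F. hv (v j) x = g j x) \<and> integrable lborel (\<lambda>x. (g j x)\<^sup>2)" ..
  then have gm: "g j \<in> borel_measurable borel" and g0: "\<And>x. x \<notin> flat F \<Longrightarrow> g j x = 0" and gae: "AE x in ?F. hv (v j) x = g j x"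
    and g2: "integrable lborel (\<lambda>x. (g j x)\<^sup>2)" if "j \<in> {1..k}" for j using that by blast+
  have gi: "integrable lborel (g j)" if "j \<in> {1..k}" for j
    by (rule integrable_if_square_integrable_bounded_support[OF gm[OF that] g2[OF that] bounded_flat g0[OF that]])
  have hm: "hv w \<in> borel_measurable ?F" for w using sqh by (simp add: square_integrable_def)
  have gon: "(LINT x|lborel. g i x * g j x) = (if i = j then 1 else 0)" if i: "i \<in> {1..k}" and j: "j \<in> {1..k}" for i j
  proof -
    have gml: "g j \<in> borel_measurable ?F" using gm[OF j] by (intro measurable_restrict_space1 measurable_completion) simp
    have "(LINT x|lborel. g i x * g j x) = (LINT x|?F. hv (v i) x * g j x)"
      by (rule lint_representative[OF borel_flat hm gm[OF i] g0[OF i] gae[OF i] gm[OF j], symmetric])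
    also have "\<dots> = (LINT x|?F. hv (v i) x * hv (v j) x)"
      by (rule integral_cong_AE) (use gae[OF j] hm gml in \<open>auto elim!: eventually_mono\<close>)
    finally show ?thesis using hh on[OF i j] by simp
  qed
  have gg2: "integrable lborel (\<lambda>x. g i x * g j x)" if "i \<in> {1..k}" "j \<in> {1..k}" for i j
    using integrable_inner_square_integrable[of lborel "g i" "g j"] gm g2 that by (simp add: square_integrable_def)
  let ?C = "\<lambda>j. cos_transform (g j)" and ?S = "\<lambda>j. sin_transform (g j)" and ?V = "measure lebesgue (flat F)"
  \<comment> \<open>Bessel's inequality is applied separately to cos and sin of \<xi> \<bullet> x
    restricted to F; their squares add up to the indicator of F.\<close>
  have bessel: "(\<Sum>j=1..k. (?C j \<xi>)\<^sup>2 + (?S j \<xi>)\<^sup>2) \<le> ?V" for \<xi>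
  proof -
    let ?c = "\<lambda>x. indicator (flat F) x * cos (\<xi> \<bullet> x)" and ?s = "\<lambda>x. indicator (flat F) x * sin (\<xi> \<bullet> x)"
    have gT: "g j x * (indicator (flat F) x * t) = g j x * t" if "j \<in> {1..k}" for j x t
      using g0[OF that, of x] by (cases "x \<in> flat F") auto
    have sq: "(indicator (flat F) x * t)\<^sup>2 = indicator (flat F) x * t\<^sup>2" for x and t :: real by (simp add: power_mult_distrib indicator_def)
    have i1: "integrable lborel (\<lambda>x. (?c x)\<^sup>2)" and i2: "integrable lborel (\<lambda>x. (?s x)\<^sup>2)"
      unfolding sq by (intro integrable_indicator_continuous borel_flat bounded_flat continuous_intros)+
    have trig: "(\<lambda>x. cos (\<xi> \<bullet> x)) \<in> borel_measurable lborel" "(\<lambda>x. sin (\<xi> \<bullet> x)) \<in> borel_measurable lborel" by measurable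
    have c: "(\<Sum>j=1..k. (LINT x|lborel. g j x * ?c x)\<^sup>2) \<le> (LINT x|lborel. (?c x)\<^sup>2)"
    proof (rule bessel_inequality[OF _ gg2 gon i1])
      show "integrable lborel (\<lambda>x. g j x * ?c x)" if "j \<in> {1..k}" for j
        unfolding gT[OF that] by (rule integrable_mult_bounded[OF gi[OF that] trig(1)]) simp
    qed auto
    have s: "(\<Sum>j=1..k. (LINT x|lborel. g j x * ?s x)\<^sup>2) \<le> (LINT x|lborel. (?s x)\<^sup>2)"
    proof (rule bessel_inequality[OF _ gg2 gon i2])
      show "integrable lborel (\<lambda>x. g j x * ?s x)" if "j \<in> {1..k}" for j
        unfolding gT[OF that] by (rule integrable_mult_bounded[OF gi[OF that] trig(2)]) simp
    qed auto
    have "(\<Sum>j=1..k. (?C j \<xi>)\<^sup>2 + (?S j \<xi>)\<^sup>2) = (\<Sum>j=1..k. (LINT x|lborel. g j x * ?c x)\<^sup>2) + (\<Sum>j=1..k. (LINT x|lborel. g j x * ?s x)\<^sup>2)"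
      unfolding sum.distrib[symmetric] by (intro sum.cong) (auto simp: gT cos_transform_def sin_transform_def)
    also have "\<dots> \<le> (LINT x|lborel. (?c x)\<^sup>2) + (LINT x|lborel. (?s x)\<^sup>2)" by (intro add_mono c s)
    also have "\<dots> = (LINT x|lborel. (?c x)\<^sup>2 + (?s x)\<^sup>2)" by (rule Bochner_Integration.integral_add[OF i1 i2, symmetric])
    also have "\<dots> = (LINT x|lborel. indicator (flat F) x)"
      unfolding sq by (intro Bochner_Integration.integral_cong refl) (simp add: distrib_left[symmetric] add.commute)
    also have "\<dots> = ?V" using borel_flat by simp
    finally show ?thesis .
  qed
  define s where "s n = inverse (real (Suc n))" for n
  have s: "s n > 0" for n by (simp add: s_def)
  define \<Phi> where "\<Phi> n \<xi> = (\<Sum>j=1..k. gauss (s n *\<^sub>R \<xi>) * ((?C j \<xi>)\<^sup>2 + (?S j \<xi>)\<^sup>2))" for n \<xi>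
  \<comment> \<open>Nonnegativity of the eigenvalues is not built into their definition; it is read
    off from the energies.\<close>
  have \<eta>0: "\<eta> j \<ge> 0" if "j \<in> {1..k}" for j unfolding energy[OF that, symmetric] by simp
  let ?p = "(2 * pi) ^ DIM('a) :: real"
  show ?thesis
  proof (rule bathtub[where \<Phi> = \<Phi> and V = ?V and K = "?p * real k" and E = "?p * (\<Sum>j=1..k. \<eta> j)"])
    show "integrable lborel (\<Phi> n)" for n
      unfolding \<Phi>_def[abs_def] by (intro Bochner_Integration.integrable_sum gaussian_power_spectrum(1) gm gi s)
    show "0 \<le> \<Phi> n \<xi>" for n \<xi>
      unfolding \<Phi>_def by (intro sum_nonneg mult_nonneg_nonneg less_imp_le[OF gauss_pos]) auto
    show "\<Phi> n \<xi> \<le> ?V" for n \<xi>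
    proof -
      have "\<Phi> n \<xi> = gauss (s n *\<^sub>R \<xi>) * (\<Sum>j=1..k. (?C j \<xi>)\<^sup>2 + (?S j \<xi>)\<^sup>2)" by (simp add: \<Phi>_def sum_distrib_left)
      also have "\<dots> \<le> 1 * (\<Sum>j=1..k. (?C j \<xi>)\<^sup>2 + (?S j \<xi>)\<^sup>2)" by (intro mult_right_mono gauss_le_1 sum_nonneg) auto
      finally show ?thesis using bessel[of \<xi>] by simp
    qed
    have "(\<lambda>n. \<Sum>j=1..k. LINT \<xi>|lborel. gauss (s n *\<^sub>R \<xi>) * ((?C j \<xi>)\<^sup>2 + (?S j \<xi>)\<^sup>2)) \<longlonglongrightarrow> (\<Sum>j=1..k. ?p * (LINT x|lborel. (g j x)\<^sup>2))"
      unfolding s_def by (intro tendsto_sum gaussian_plancherel(2) gm gi g2)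
    also have "(\<Sum>j=1..k. ?p * (LINT x|lborel. (g j x)\<^sup>2)) = (\<Sum>j=1..k. ?p * 1)"
      using gon by (intro sum.cong) (auto simp: power2_eq_square)
    also have "\<dots> = ?p * real k" by simp
    also have "(\<lambda>n. \<Sum>j=1..k. LINT \<xi>|lborel. gauss (s n *\<^sub>R \<xi>) * ((?C j \<xi>)\<^sup>2 + (?S j \<xi>)\<^sup>2)) = (\<lambda>n. LINT \<xi>|lborel. \<Phi> n \<xi>)"
      unfolding \<Phi>_def by (intro ext Bochner_Integration.integral_sum[symmetric] gaussian_power_spectrum(1) gm gi s)
    finally show "(\<lambda>n. LINT \<xi>|lborel. \<Phi> n \<xi>) \<longlonglongrightarrow> ?p * real k" .
    show "(\<integral>\<^sup>+\<xi>. ennreal (norm \<xi> * \<Phi> n \<xi>) \<partial>lborel) \<le> ennreal (?p * (\<Sum>j=1..k. \<eta> j))" for n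
    proof -
      have "(\<integral>\<^sup>+\<xi>. ennreal (norm \<xi> * \<Phi> n \<xi>) \<partial>lborel) = (\<integral>\<^sup>+\<xi>. (\<Sum>j=1..k. ennreal (gauss (s n *\<^sub>R \<xi>) * (norm \<xi> * ((?C j \<xi>)\<^sup>2 + (?S j \<xi>)\<^sup>2)))) \<partial>lborel)"
      proof (rule nn_integral_cong)
        fix \<xi>
        have "norm \<xi> * \<Phi> n \<xi> = (\<Sum>j=1..k. gauss (s n *\<^sub>R \<xi>) * (norm \<xi> * ((?C j \<xi>)\<^sup>2 + (?S j \<xi>)\<^sup>2)))"
          unfolding \<Phi>_def sum_distrib_left by (intro sum.cong) auto
        moreover have "0 \<le> gauss (s n *\<^sub>R \<xi>) * (norm \<xi> * ((?C j \<xi>)\<^sup>2 + (?S j \<xi>)\<^sup>2))" for j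
          by (intro mult_nonneg_nonneg less_imp_le[OF gauss_pos]) auto
        ultimately show "ennreal (norm \<xi> * \<Phi> n \<xi>) = (\<Sum>j=1..k. ennreal (gauss (s n *\<^sub>R \<xi>) * (norm \<xi> * ((?C j \<xi>)\<^sup>2 + (?S j \<xi>)\<^sup>2))))"
          by (simp add: sum_ennreal)
      qed
      also have "\<dots> = (\<Sum>j=1..k. (\<integral>\<^sup>+\<xi>. ennreal (gauss (s n *\<^sub>R \<xi>) * (norm \<xi> * ((?C j \<xi>)\<^sup>2 + (?S j \<xi>)\<^sup>2))) \<partial>lborel))"
      proof (rule nn_integral_sum)
        fix j assume "j \<in> {1..k}"
        note [measurable] = gm[OF this]
        show "(\<lambda>\<xi>. ennreal (gauss (s n *\<^sub>R \<xi>) * (norm \<xi> * ((?C j \<xi>)\<^sup>2 + (?S j \<xi>)\<^sup>2)))) \<in> borel_measurable lborel" by measurable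
      qed
      also have "\<dots> \<le> (\<Sum>j=1..k. ennreal (?p * \<eta> j))"
      proof (rule sum_mono)
        fix j assume j: "j \<in> {1..k}"
        show "(\<integral>\<^sup>+\<xi>. ennreal (gauss (s n *\<^sub>R \<xi>) * (norm \<xi> * ((?C j \<xi>)\<^sup>2 + (?S j \<xi>)\<^sup>2))) \<partial>lborel) \<le> ennreal (?p * \<eta> j)"
          using mode_inequality[OF gtv gm[OF j] g0[OF j] gae[OF j] s] unfolding energy[OF j] .
      qed
      also have "\<dots> = ennreal (\<Sum>j=1..k. ?p * \<eta> j)" using \<eta>0 by (intro sum_ennreal) auto
      finally show ?thesis by (simp add: sum_distrib_left)
    qed
    show "0 \<le> ?p * (\<Sum>j=1..k. \<eta> j)" using \<eta>0 by (intro mult_nonneg_nonneg sum_nonneg) auto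
  qed (use R in auto)
qed

theorem corollary1p6:
  fixes \<Omega> F B :: "((real ^ 'm) \<times> real) set"
    and \<eta> :: "nat \<Rightarrow> real"
    and n k :: nat
  assumes "n = DIM((real ^ 'm) \<times> real)"
    and "admissible_domain \<Omega> F B"
    and "\<Omega> \<subseteq> flat F \<times> {..0}"
    and "steklov_dirichlet_eigenvalues \<Omega> F B \<eta>"
    and "k \<ge> 1"
  shows "1 / real k * (\<Sum>j = 1..k. \<eta> j) \<ge> (real n - 1) / real n * weyl_const n (measure lebesgue (flat F)) k \<and>
         (real n - 1) / real n * weyl_const n (measure lebesgue (flat F)) k =
         2 * pi * ((real n - 1) / real n) * unit_ball_vol (real n - 1) powr (- 1 / (real n - 1)) *
           (real k / measure lebesgue (flat F)) powr (1 / (real n - 1))"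
proof
  interpret cylindrical_domain \<Omega> F B by unfold_locales (use assms in auto)
  define d where "d = DIM(real ^ 'm)"
  have d1: "d \<ge> 1" unfolding d_def by (rule DIM_ge_Suc0[unfolded One_nat_def[symmetric]])
  have n: "n = Suc d" using assms(1) by (simp add: d_def)
  have rn: "real n - 1 = real d" using n by simp
  define V where "V = measure lebesgue (flat F)"
  define w where "w = unit_ball_vol (real d)"
  \<comment> \<open>The maximiser of the left side of \<open>eigenvalue_sum_bathtub\<close>: there V
    w R^d = (2 pi)^d k, so the ball of this radius with density V has exactly the total spectral
    mass.\<close>
  define R where "R = weyl_const n V k"
  have V: "V > 0" using flat_pos by (simp add: V_def)
  have w: "w > 0" by (simp add: w_def)
  have k: "real k > 0" using assms(5) by simp
  have Req: "R = 2 * pi * (w powr (- 1 / real d) * (real k / V) powr (1 / real d))"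
    by (simp add: R_def weyl_const_def rn w_def)
  have R: "R > 0" unfolding Req using w V k by simp
  have root: "(x powr (1 / real d)) ^ d = x" if "x > 0" for x
    using that d1 by (simp add: powr_realpow[symmetric] powr_powr)
  have inv: "w powr (- 1 / real d) = inverse (w powr (1 / real d))" by (simp add: powr_minus)
  have Rd: "R ^ d = (2 * pi) ^ d * (inverse w * (real k / V))"
    unfolding Req inv power_mult_distrib power_inverse using root[of w] root[of "real k / V"] w V k by simp
  have "R * ((2 * pi) ^ d * real k) - V * (w * (R ^ Suc d / real (Suc d))) \<le> (2 * pi) ^ d * (\<Sum>j=1..k. \<eta> j)"
    using eigenvalue_sum_bathtub[OF assms(4) R, of k] unfolding d_def[symmetric] V_def[symmetric] w_def[symmetric] .
  \<comment> \<open>At this R the subtracted term is the fraction 1 / (d + 1) of the first one,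
    which leaves the factor d / (d + 1) = (n - 1) / n.\<close>
  also have "V * (w * (R ^ Suc d / real (Suc d))) = (2 * pi) ^ d * (real k * R / real (Suc d))"
  proof -
    have "V * (w * (R * (P * (inverse w * (c / V))) / D)) = P * (c * R / D)" if "D > 0" for P c D :: real
      using w V that by (simp add: field_simps)
    then show ?thesis unfolding power_Suc Rd by simp
  qed
  also have "R * ((2 * pi) ^ d * real k) - (2 * pi) ^ d * (real k * R / real (Suc d)) = (2 * pi) ^ d * (real k * (real d / real (Suc d) * R))"
    by (simp add: field_simps)
  finally have "real k * (real d / real (Suc d) * R) \<le> (\<Sum>j=1..k. \<eta> j)"
    by (subst (asm) mult_le_cancel_left_pos) auto
  then have "real d / real (Suc d) * R \<le> (\<Sum>j=1..k. \<eta> j) / real k"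
    using k by (simp only: pos_le_divide_eq mult.commute)
  then show "1 / real k * (\<Sum>j = 1..k. \<eta> j) \<ge> (real n - 1) / real n * weyl_const n (measure lebesgue (flat F)) k"
    unfolding R_def V_def rn n by simp
qed (simp add: weyl_const_def)

end
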